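(* Let $B_n$ be a homogeneous G-algebra and let $\mathcal{T}=\operatorname{Ker}D^b(\psi)=\{X^\circ\in D^b(\mathrm{Qgr}_{B_n})\mid D^b(\psi)(X^\circ)\text{ is acyclic}\}$. Then (up to isomorphism of objects) $$\mathcal{T}=\{\pi M^\circ\mid M^\circ\in D^b(\mathrm{gr}_{B_n})\text{ such that for all } i,\ H^i(M^\circ)\text{ is of } Z\text{-torsion}\}.$$
   Context: Let $\Bbbk$ be a field of characteristic zero and $n\ge 1$. A G-algebra is an algebra $A_n=\Bbbk\langle X_1,\dots,X_n\rangle/\langle X_iX_j-b_{ij}X_jX_i+\sum_{k=1}^n c_{ij}^kX_k+d_{ij}\mid i>j\rangle$ with $b_{ij}\in\Bbbk\setminus\{0\}$, $c_{ij}^k,d_{ij}\in\Bbbk$, having a Poincaré–Birkhoff–Witt basis (the monomials $X_1^{a_1}\cdots X_n^{a_n}$ form a $\Bbbk$-basis). The associated homogeneous G-algebra is the graded algebra (all generators in degree one) $B_n=\Bbbk\langle X_1,\dots,X_n,Z\rangle/\langle X_iX_j-b_{ij}X_jX_i+\sum_k c_{ij}^kZX_k+d_{ij}Z^2\ (i>j),\ X_iZ-ZX_i\rangle$. It is noetherian with a PBW basis and $Z$ is central. $\mathrm{gr}_{R}$ denotes the category of finitely generated graded left $R$-modules with degree-zero maps. $(B_n)_Z$ is the graded localization of $B_n$ at the powers of $Z$, and $Q=(B_n)_Z\otimes_{B_n}-:\mathrm{gr}_{B_n}\to\mathrm{gr}_{(B_n)_Z}$. $\mathrm{Qgr}_{B_n}$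 is the quotient abelian category of $\mathrm{gr}_{B_n}$ by the Serre subcategory of modules of finite dimension over $\Bbbk$, with quotient functor $\pi$ (also applied termwise to complexes). There is a unique functor $\psi:\mathrm{Qgr}_{B_n}\to\mathrm{gr}_{(B_n)_Z}$ with $\psi\pi=Q$; it is exact and induces $D^b(\psi):D^b(\mathrm{Qgr}_{B_n})\to D^b(\mathrm{gr}_{(B_n)_Z})$. A $B_n$-module $M$ is of $Z$-torsion if every $m\in M$ is annihilated by some power of $Z$. *)

theory Defs
  imports
    "HOL-Algebra.Algebraic_Closure_Type"
    "HOL-Algebra.Free_Abelian_Groups"
begin

section \<open>Categories\<close>

record ('o, 'a) category =
  objs :: "'o set"
  arrs :: "'a set"
  src :: "'a \<Rightarrow> 'o"
  tgt :: "'a \<Rightarrow> 'o"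
  idm :: "'o \<Rightarrow> 'a"
  cmp :: "'a \<Rightarrow> 'a \<Rightarrow> 'a"  \<comment> \<open>\<open>cmp C g f\<close> is \<open>g\<close> after \<open>f\<close>\<close>

definition hom_set :: "('o, 'a) category \<Rightarrow> 'o \<Rightarrow> 'o \<Rightarrow> 'a set" where
  "hom_set C x y = {f \<in> arrs C. src C f = x \<and> tgt C f = y}"

definition is_iso :: "('o, 'a) category \<Rightarrow> 'a \<Rightarrow> bool" where
  "is_iso C f \<longleftrightarrow> f \<in> arrs C \<and>
     (\<exists>g \<in> hom_set C (tgt C f) (src C f).
        cmp C g f = idm C (src C f) \<and> cmp C f g = idm C (tgt C f))"

definition isomorphic :: "('o, 'a) category \<Rightarrow> 'o \<Rightarrow> 'o \<Rightarrow> bool" where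
  "isomorphic C x y \<longleftrightarrow> (\<exists>f \<in> hom_set C x y. is_iso C f)"

record ('o, 'a, 'p, 'b) func =
  fob :: "'o \<Rightarrow> 'p"
  far :: "'a \<Rightarrow> 'b"

definition is_functor ::
  "('o, 'a) category \<Rightarrow> ('p, 'b) category \<Rightarrow> ('o, 'a, 'p, 'b) func \<Rightarrow> bool" where
  "is_functor C D F \<longleftrightarrow>
     (\<forall>x \<in> objs C. fob F x \<in> objs D \<and> far F (idm C x) = idm D (fob F x)) \<and>
     (\<forall>f \<in> arrs C. far F f \<in> hom_set D (fob F (src C f)) (fob F (tgt C f))) \<and>
     (\<forall>f \<in> arrs C. \<forall>g \<in> arrs C. src C g = tgt C f \<longrightarrow>
        far F (cmp C g f) = cmp D (far F g) (far F f))"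

definition zero_object :: "('o, 'a) category \<Rightarrow> 'o \<Rightarrow> bool" where
  "zero_object C z \<longleftrightarrow> z \<in> objs C \<and>
     (\<forall>x \<in> objs C. (\<exists>!f. f \<in> hom_set C x z) \<and> (\<exists>!f. f \<in> hom_set C z x))"

definition zero_arrow :: "('o, 'a) category \<Rightarrow> 'a \<Rightarrow> bool" where
  "zero_arrow C f \<longleftrightarrow> (\<exists>z g h. zero_object C z \<and> g \<in> hom_set C (src C f) z \<and>
     h \<in> hom_set C z (tgt C f) \<and> f = cmp C h g)"

definition is_kernel :: "('o, 'a) category \<Rightarrow> 'a \<Rightarrow> 'a \<Rightarrow> bool" where
  "is_kernel C f k \<longleftrightarrow> f \<in> arrs C \<and> k \<in> arrs C \<and> tgt C k = src C f \<and> zero_arrow C (cmp C f k) \<and>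
     (\<forall>g \<in> arrs C. tgt C g = src C f \<and> zero_arrow C (cmp C f g) \<longrightarrow>
        (\<exists>!u. u \<in> hom_set C (src C g) (src C k) \<and> cmp C k u = g))"

definition is_cokernel :: "('o, 'a) category \<Rightarrow> 'a \<Rightarrow> 'a \<Rightarrow> bool" where
  "is_cokernel C f q \<longleftrightarrow> f \<in> arrs C \<and> q \<in> arrs C \<and> src C q = tgt C f \<and> zero_arrow C (cmp C q f) \<and>
     (\<forall>g \<in> arrs C. src C g = tgt C f \<and> zero_arrow C (cmp C g f) \<longrightarrow>
        (\<exists>!u. u \<in> hom_set C (tgt C q) (tgt C g) \<and> cmp C u q = g))"


subsection \<open>Localization at a class of arrows\<close>

text \<open>
  The Gabriel--Zisman localization: same objects; an arrow is a zigzag, written in the order in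
  which it is traversed, of arrows of \<open>C\<close> and of formal inverses of arrows in \<open>W\<close>, modulo the
  congruence that makes the embedding of \<open>C\<close> a functor and the formal inverses inverses.
\<close>

datatype 'a step = Fwd 'a | Bwd 'a

fun zigzag :: "('o, 'a) category \<Rightarrow> 'a set \<Rightarrow> 'o \<Rightarrow> 'a step list \<Rightarrow> 'o \<Rightarrow> bool" where
  "zigzag C W x [] y \<longleftrightarrow> x \<in> objs C \<and> x = y"
| "zigzag C W x (Fwd f # p) y \<longleftrightarrow> f \<in> arrs C \<and> src C f = x \<and> zigzag C W (tgt C f) p y"
| "zigzag C W x (Bwd s # p) y \<longleftrightarrow> s \<in> W \<and> tgt C s = x \<and> zigzag C W (src C s) p y"

inductive zstep :: "('o, 'a) category \<Rightarrow> 'a set \<Rightarrow> 'a step list \<Rightarrow> 'a step list \<Rightarrow> bool"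
  for C W where
  "zstep C W (p @ [Fwd f, Fwd g] @ q) (p @ [Fwd (cmp C g f)] @ q)"
| "zstep C W (p @ [Fwd (idm C x)] @ q) (p @ q)"
| "s \<in> W \<Longrightarrow> zstep C W (p @ [Fwd s, Bwd s] @ q) (p @ q)"
| "s \<in> W \<Longrightarrow> zstep C W (p @ [Bwd s, Fwd s] @ q) (p @ q)"

definition zclass ::
  "('o, 'a) category \<Rightarrow> 'a set \<Rightarrow> 'o \<Rightarrow> 'o \<Rightarrow> 'a step list \<Rightarrow> 'a step list set" where
  "zclass C W x y p =
     {q. equivclp (\<lambda>r s. zigzag C W x r y \<and> zigzag C W x s y \<and> zstep C W r s) p q}"

definition localization ::
  "('o, 'a) category \<Rightarrow> 'a set \<Rightarrow> ('o, 'o \<times> 'o \<times> 'a step list set) category" where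
  "localization C W =
     \<lparr>objs = objs C,
      arrs = {(x, y, zclass C W x y p) | x y p. zigzag C W x p y},
      src = (\<lambda>(x, y, u). x),
      tgt = (\<lambda>(x, y, u). y),
      idm = (\<lambda>x. (x, x, zclass C W x x [])),
      cmp = (\<lambda>(_, z, v) (x, _, u). (x, z, \<Union>p \<in> u. \<Union>q \<in> v. zclass C W x z (p @ q)))\<rparr>"

definition localization_functor ::
  "('o, 'a) category \<Rightarrow> 'a set \<Rightarrow> ('o, 'a, 'o, 'o \<times> 'o \<times> 'a step list set) func" where
  "localization_functor C W =
     \<lparr>fob = (\<lambda>x. x),
      far = (\<lambda>f. (src C f, tgt C f, zclass C W (src C f) (tgt C f) [Fwd f]))\<rparr>"

text \<open>
  The quotient of an abelian category by a Serre subcategory (given by its objects \<open>S\<close>) is the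
  localization at the arrows whose kernel and cokernel lie in \<open>S\<close>.
\<close>

definition serre_arrows :: "('o, 'a) category \<Rightarrow> 'o set \<Rightarrow> 'a set" where
  "serre_arrows C S = {f \<in> arrs C.
     (\<exists>k. is_kernel C f k \<and> src C k \<in> S) \<and> (\<exists>q. is_cokernel C f q \<and> tgt C q \<in> S)}"


subsection \<open>Bounded complexes and the bounded derived category\<close>

record ('o, 'a) cochain =
  cob :: "int \<Rightarrow> 'o"
  cdiff :: "int \<Rightarrow> 'a"

definition bounded_complex :: "('o, 'a) category \<Rightarrow> ('o, 'a) cochain \<Rightarrow> bool" where
  "bounded_complex C K \<longleftrightarrow>
     (\<forall>i. cob K i \<in> objs C) \<and>
     (\<forall>i. cdiff K i \<in> hom_set C (cob K i) (cob K (i + 1))) \<and>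
     (\<forall>i. zero_arrow C (cmp C (cdiff K (i + 1)) (cdiff K i))) \<and>
     (\<exists>N. \<forall>i. \<bar>i\<bar> > N \<longrightarrow> zero_object C (cob K i))"

text \<open>
  \<open>cohomology_data C K i k q\<close>: \<open>k\<close> is a kernel of the differential leaving degree \<open>i\<close>, and \<open>q\<close> is
  a cokernel of the factorization through \<open>k\<close> of the differential entering degree \<open>i\<close>.
\<close>

definition cohomology_data ::
  "('o, 'a) category \<Rightarrow> ('o, 'a) cochain \<Rightarrow> int \<Rightarrow> 'a \<Rightarrow> 'a \<Rightarrow> bool" where
  "cohomology_data C K i k q \<longleftrightarrow> is_kernel C (cdiff K i) k \<and>
     (\<exists>u \<in> hom_set C (cob K (i - 1)) (src C k).
        cmp C k u = cdiff K (i - 1) \<and> is_cokernel C u q)"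

definition is_cohomology ::
  "('o, 'a) category \<Rightarrow> ('o, 'a) cochain \<Rightarrow> int \<Rightarrow> 'o \<Rightarrow> bool" where
  "is_cohomology C K i H \<longleftrightarrow> (\<exists>k q. cohomology_data C K i k q \<and> tgt C q = H)"

definition acyclic_complex :: "('o, 'a) category \<Rightarrow> ('o, 'a) cochain \<Rightarrow> bool" where
  "acyclic_complex C K \<longleftrightarrow> (\<forall>i. \<exists>H. is_cohomology C K i H \<and> zero_object C H)"

definition is_cohomology_map ::
  "('o, 'a) category \<Rightarrow> ('o, 'a) cochain \<Rightarrow> ('o, 'a) cochain \<Rightarrow> (int \<Rightarrow> 'a) \<Rightarrow> int \<Rightarrow> 'a \<Rightarrow> bool"
where
  "is_cohomology_map C K L f i h \<longleftrightarrow>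
     (\<exists>k q k' q' a. cohomology_data C K i k q \<and> cohomology_data C L i k' q' \<and>
        a \<in> hom_set C (src C k) (src C k') \<and> cmp C k' a = cmp C (f i) k \<and>
        h \<in> hom_set C (tgt C q) (tgt C q') \<and> cmp C h q = cmp C q' a)"

definition complex_category ::
  "('o, 'a) category \<Rightarrow>
   (('o, 'a) cochain, ('o, 'a) cochain \<times> ('o, 'a) cochain \<times> (int \<Rightarrow> 'a)) category" where
  "complex_category C =
     \<lparr>objs = {K. bounded_complex C K},
      arrs = {(K, L, f). bounded_complex C K \<and> bounded_complex C L \<and>
                (\<forall>i. f i \<in> hom_set C (cob K i) (cob L i)) \<and>
                (\<forall>i. cmp C (f (i + 1)) (cdiff K i) = cmp C (cdiff L i) (f i))},
      src = (\<lambda>(K, L, f). K),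
      tgt = (\<lambda>(K, L, f). L),
      idm = (\<lambda>K. (K, K, \<lambda>i. idm C (cob K i))),
      cmp = (\<lambda>(_, P, g) (K, _, f). (K, P, \<lambda>i. cmp C (g i) (f i)))\<rparr>"

definition quasi_isos ::
  "('o, 'a) category \<Rightarrow> (('o, 'a) cochain \<times> ('o, 'a) cochain \<times> (int \<Rightarrow> 'a)) set" where
  "quasi_isos C = {(K, L, f) \<in> arrs (complex_category C).
     \<forall>i. \<exists>h. is_cohomology_map C K L f i h \<and> is_iso C h}"

definition derived_category where
  "derived_category C = localization (complex_category C) (quasi_isos C)"

text \<open>
  Termwise application of a functor to a complex; for an exact functor \<open>F\<close> this is the
  action of \<open>D\<^sup>b(F)\<close> on objects.
\<close>

definition map_cochain ::
  "('o, 'a, 'p, 'b) func \<Rightarrow> ('o, 'a) cochain \<Rightarrow> ('p, 'b) cochain" where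
  "map_cochain F K = \<lparr>cob = (\<lambda>i. fob F (cob K i)), cdiff = (\<lambda>i. far F (cdiff K i))\<rparr>"


section \<open>Graded modules\<close>

record 'a graded_ring = "'a ring" +
  rcomp :: "int \<Rightarrow> 'a set"

record ('a, 'b) graded_module = "('a, 'b) module" +
  mcomp :: "int \<Rightarrow> 'b set"

text \<open>
  Left modules over a noncommutative ring (the library's locale \<open>module\<close> wants a commutative
  one).  As there, the multiplication and the unit of the record \<open>M\<close> play no role.
\<close>

locale left_module = R?: ring R + M?: abelian_group M
  for R :: "('a, 'r) ring_scheme" (structure) and M :: "('a, 'b, 'm) module_scheme" (structure) +
  assumes smult_closed: "\<lbrakk>a \<in> carrier R; x \<in> carrier M\<rbrakk> \<Longrightarrow> a \<odot>\<^bsub>M\<^esub> x \<in> carrier M"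
    and smult_l_distr: "\<lbrakk>a \<in> carrier R; b \<in> carrier R; x \<in> carrier M\<rbrakk> \<Longrightarrow>
      (a \<oplus>\<^bsub>R\<^esub> b) \<odot>\<^bsub>M\<^esub> x = a \<odot>\<^bsub>M\<^esub> x \<oplus>\<^bsub>M\<^esub> b \<odot>\<^bsub>M\<^esub> x"
    and smult_r_distr: "\<lbrakk>a \<in> carrier R; x \<in> carrier M; y \<in> carrier M\<rbrakk> \<Longrightarrow>
      a \<odot>\<^bsub>M\<^esub> (x \<oplus>\<^bsub>M\<^esub> y) = a \<odot>\<^bsub>M\<^esub> x \<oplus>\<^bsub>M\<^esub> a \<odot>\<^bsub>M\<^esub> y"
    and smult_assoc: "\<lbrakk>a \<in> carrier R; b \<in> carrier R; x \<in> carrier M\<rbrakk> \<Longrightarrow>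
      (a \<otimes>\<^bsub>R\<^esub> b) \<odot>\<^bsub>M\<^esub> x = a \<odot>\<^bsub>M\<^esub> (b \<odot>\<^bsub>M\<^esub> x)"
    and smult_one: "x \<in> carrier M \<Longrightarrow> \<one>\<^bsub>R\<^esub> \<odot>\<^bsub>M\<^esub> x = x"

locale graded_left_module = left_module R M
  for R :: "('a, 'r) graded_ring_scheme" (structure)
    and M :: "('a, 'b, 'm) graded_module_scheme" (structure) +
  assumes mcomp_subgroup: "subgroup (mcomp M i) (add_monoid M)"
    and mcomp_smult: "\<lbrakk>a \<in> rcomp R i; x \<in> mcomp M j\<rbrakk> \<Longrightarrow> a \<odot>\<^bsub>M\<^esub> x \<in> mcomp M (i + j)"
    and mcomp_direct_sum: "x \<in> carrier M \<Longrightarrow>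
      \<exists>!f. (\<forall>i. f i \<in> mcomp M i) \<and> finite {i. f i \<noteq> \<zero>\<^bsub>M\<^esub>} \<and>
           x = (\<Oplus>\<^bsub>M\<^esub> i \<in> {i. f i \<noteq> \<zero>\<^bsub>M\<^esub>}. f i)"

definition finitely_generated ::
  "('a, 'r) ring_scheme \<Rightarrow> ('a, 'b, 'm) module_scheme \<Rightarrow> bool" where
  "finitely_generated R M \<longleftrightarrow> (\<exists>S. finite S \<and> S \<subseteq> carrier M \<and>
     (\<forall>x \<in> carrier M. \<exists>f \<in> S \<rightarrow> carrier R. x = (\<Oplus>\<^bsub>M\<^esub> s \<in> S. f s \<odot>\<^bsub>M\<^esub> s)))"

definition fg_graded_modules :: "'a graded_ring \<Rightarrow> ('a, 'b) graded_module set" where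
  "fg_graded_modules R = {M. graded_left_module R M \<and> finitely_generated R M}"

definition graded_homs ::
  "'a graded_ring \<Rightarrow> ('a, 'b) graded_module \<Rightarrow> ('a, 'b) graded_module \<Rightarrow> ('b \<Rightarrow> 'b) set" where
  "graded_homs R M N = {f \<in> carrier M \<rightarrow>\<^sub>E carrier N.
     (\<forall>x \<in> carrier M. \<forall>y \<in> carrier M. f (x \<oplus>\<^bsub>M\<^esub> y) = f x \<oplus>\<^bsub>N\<^esub> f y) \<and>
     (\<forall>a \<in> carrier R. \<forall>x \<in> carrier M. f (a \<odot>\<^bsub>M\<^esub> x) = a \<odot>\<^bsub>N\<^esub> f x) \<and>
     (\<forall>i. f ` mcomp M i \<subseteq> mcomp N i)}"

type_synonym ('a, 'b) gr_arrow =
  "('a, 'b) graded_module \<times> ('a, 'b) graded_module \<times> ('b \<Rightarrow> 'b)"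

text \<open>
  The type \<open>'b\<close> is the universe that the elements of the modules are taken from.  If it is at
  least as large as an infinite ring \<open>R\<close>, every finitely generated graded \<open>R\<close>-module has an
  isomorphic copy in it.
\<close>

definition gr :: "'a graded_ring \<Rightarrow> (('a, 'b) graded_module, ('a, 'b) gr_arrow) category" where
  "gr R =
     \<lparr>objs = fg_graded_modules R,
      arrs = {(M, N, f). M \<in> fg_graded_modules R \<and> N \<in> fg_graded_modules R \<and>
                f \<in> graded_homs R M N},
      src = (\<lambda>(M, N, f). M),
      tgt = (\<lambda>(M, N, f). N),
      idm = (\<lambda>M. (M, M, \<lambda>x \<in> carrier M. x)),
      cmp = (\<lambda>(_, P, g) (M, _, f). (M, P, compose (carrier M) g f))\<rparr>"

definition torsion_module ::
  "('a, 'r) ring_scheme \<Rightarrow> 'a \<Rightarrow> ('a, 'b, 'm) module_scheme \<Rightarrow> bool" where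
  "torsion_module R z M \<longleftrightarrow>
     (\<forall>x \<in> carrier M. \<exists>j::nat. (z [^]\<^bsub>R\<^esub> j) \<odot>\<^bsub>M\<^esub> x = \<zero>\<^bsub>M\<^esub>)"


subsection \<open>Graded localization at a central element of degree one\<close>

text \<open>\<open>fraction R z (x, k)\<close> is the fraction \<open>x / z\<^sup>k\<close>, an equivalence class of pairs.\<close>

definition fraction :: "('a, 'r) ring_scheme \<Rightarrow> 'a \<Rightarrow> 'a \<times> nat \<Rightarrow> ('a \<times> nat) set" where
  "fraction R z = (\<lambda>(x, k). {(y, l). y \<in> carrier R \<and>
     (\<exists>j::nat. z [^]\<^bsub>R\<^esub> j \<otimes>\<^bsub>R\<^esub> (z [^]\<^bsub>R\<^esub> l \<otimes>\<^bsub>R\<^esub> x) = z [^]\<^bsub>R\<^esub> j \<otimes>\<^bsub>R\<^esub> (z [^]\<^bsub>R\<^esub> k \<otimes>\<^bsub>R\<^esub> y))})"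

definition fraction_ring :: "'a graded_ring \<Rightarrow> 'a \<Rightarrow> ('a \<times> nat) set graded_ring" where
  "fraction_ring R z =
     \<lparr>carrier = {fraction R z (x, k) | x k. x \<in> carrier R},
      monoid.mult = (\<lambda>s t. \<Union>(x, k) \<in> s. \<Union>(y, l) \<in> t. fraction R z (x \<otimes>\<^bsub>R\<^esub> y, k + l)),
      monoid.one = fraction R z (\<one>\<^bsub>R\<^esub>, 0),
      ring.zero = fraction R z (\<zero>\<^bsub>R\<^esub>, 0),
      ring.add = (\<lambda>s t. \<Union>(x, k) \<in> s. \<Union>(y, l) \<in> t.
               fraction R z (z [^]\<^bsub>R\<^esub> l \<otimes>\<^bsub>R\<^esub> x \<oplus>\<^bsub>R\<^esub> z [^]\<^bsub>R\<^esub> k \<otimes>\<^bsub>R\<^esub> y, k + l)),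
      rcomp = (\<lambda>d. {fraction R z (x, k) | x k. x \<in> rcomp R (d + int k)})\<rparr>"


subsection \<open>Extension of scalars\<close>

text \<open>
  The tensor product of \<open>S\<close> and \<open>M\<close> over \<open>R\<close>, where \<open>S\<close> is a right \<open>R\<close>-module through
  \<open>\<phi> : R \<rightarrow> S\<close>: the free abelian group on the pairs modulo the biadditivity and balancing relations.
\<close>

definition tensor_rels ::
  "'s graded_ring \<Rightarrow> ('a \<Rightarrow> 's) \<Rightarrow> 'a graded_ring \<Rightarrow> ('a, 'b) graded_module \<Rightarrow>
   (('s \<times> 'b) \<Rightarrow>\<^sub>0 int) set" where
  "tensor_rels S \<phi> R M =
     {frag_of (s \<oplus>\<^bsub>S\<^esub> s', x) - frag_of (s, x) - frag_of (s', x) | s s' x.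
        s \<in> carrier S \<and> s' \<in> carrier S \<and> x \<in> carrier M} \<union>
     {frag_of (s, x \<oplus>\<^bsub>M\<^esub> x') - frag_of (s, x) - frag_of (s, x') | s x x'.
        s \<in> carrier S \<and> x \<in> carrier M \<and> x' \<in> carrier M} \<union>
     {frag_of (s \<otimes>\<^bsub>S\<^esub> \<phi> a, x) - frag_of (s, a \<odot>\<^bsub>M\<^esub> x) | s a x.
        s \<in> carrier S \<and> a \<in> carrier R \<and> x \<in> carrier M}"

definition tensor_free ::
  "'s graded_ring \<Rightarrow> ('a, 'b) graded_module \<Rightarrow> (('s \<times> 'b) \<Rightarrow>\<^sub>0 int) monoid" where
  "tensor_free S M = free_Abelian_group (carrier S \<times> carrier M)"

definition tensor_sub ::
  "'s graded_ring \<Rightarrow> ('a \<Rightarrow> 's) \<Rightarrow> 'a graded_ring \<Rightarrow> ('a, 'b) graded_module \<Rightarrow>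
   (('s \<times> 'b) \<Rightarrow>\<^sub>0 int) set" where
  "tensor_sub S \<phi> R M = generate (tensor_free S M) (tensor_rels S \<phi> R M)"

definition tensor_class ::
  "'s graded_ring \<Rightarrow> ('a \<Rightarrow> 's) \<Rightarrow> 'a graded_ring \<Rightarrow> ('a, 'b) graded_module \<Rightarrow>
   (('s \<times> 'b) \<Rightarrow>\<^sub>0 int) \<Rightarrow> (('s \<times> 'b) \<Rightarrow>\<^sub>0 int) set" where
  "tensor_class S \<phi> R M c = tensor_sub S \<phi> R M #>\<^bsub>tensor_free S M\<^esub> c"

definition tensor_obj ::
  "'s graded_ring \<Rightarrow> ('a \<Rightarrow> 's) \<Rightarrow> 'a graded_ring \<Rightarrow> ('a, 'b) graded_module \<Rightarrow>
   ('s, (('s \<times> 'b) \<Rightarrow>\<^sub>0 int) set) graded_module" where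
  "tensor_obj S \<phi> R M =
     (let T = tensor_free S M Mod tensor_sub S \<phi> R M in
      \<lparr>carrier = carrier T, monoid.mult = undefined, monoid.one = undefined,
       ring.zero = \<one>\<^bsub>T\<^esub>, ring.add = (\<lambda>t u. t \<otimes>\<^bsub>T\<^esub> u),
       module.smult = (\<lambda>s t. \<Union>c \<in> t.
         tensor_class S \<phi> R M (frag_extend (\<lambda>(s', x). frag_of (s \<otimes>\<^bsub>S\<^esub> s', x)) c)),
       mcomp = (\<lambda>d. tensor_class S \<phi> R M `
         {c. Poly_Mapping.keys c \<subseteq> (\<Union>i. rcomp S i \<times> mcomp M (d - i))})\<rparr>)"

definition tensor_arr ::
  "'s graded_ring \<Rightarrow> ('a \<Rightarrow> 's) \<Rightarrow> 'a graded_ring \<Rightarrow> ('a, 'b) gr_arrow \<Rightarrow>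
   ('s, (('s \<times> 'b) \<Rightarrow>\<^sub>0 int) set) gr_arrow" where
  "tensor_arr S \<phi> R = (\<lambda>(M, N, f).
     (tensor_obj S \<phi> R M, tensor_obj S \<phi> R N,
      \<lambda>t \<in> carrier (tensor_obj S \<phi> R M). \<Union>c \<in> t.
        tensor_class S \<phi> R N (frag_extend (\<lambda>(s, x). frag_of (s, f x)) c)))"

definition tensor_functor ::
  "'s graded_ring \<Rightarrow> ('a \<Rightarrow> 's) \<Rightarrow> 'a graded_ring \<Rightarrow>
   (('a, 'b) graded_module, ('a, 'b) gr_arrow,
    ('s, (('s \<times> 'b) \<Rightarrow>\<^sub>0 int) set) graded_module, ('s, (('s \<times> 'b) \<Rightarrow>\<^sub>0 int) set) gr_arrow) func"
where
  "tensor_functor S \<phi> R = \<lparr>fob = tensor_obj S \<phi> R, far = tensor_arr S \<phi> R\<rparr>"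


section \<open>G-algebras\<close>

text \<open>
  The free algebra on a set of letters is the monoid algebra of the free monoid, as an instance
  of the convolution product on finitely supported functions.
\<close>

datatype 'x fmon = FMon (letters: "'x list")

instantiation fmon :: (type) monoid_add
begin

definition zero_fmon :: "'a fmon" where
  "0 = FMon []"

definition plus_fmon :: "'a fmon \<Rightarrow> 'a fmon \<Rightarrow> 'a fmon" where
  "u + v = FMon (letters u @ letters v)"

instance
  by standard (simp_all add: zero_fmon_def plus_fmon_def)

end

type_synonym ('x, 'k) free_alg = "'x fmon \<Rightarrow>\<^sub>0 'k"

abbreviation free_ring :: "('x, 'k::field) free_alg ring" where
  "free_ring \<equiv> ring_of_type_algebra"

definition gen :: "'x \<Rightarrow> ('x, 'k::field) free_alg" where
  "gen x = Poly_Mapping.single (FMon [x]) 1"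

definition scalar :: "'k \<Rightarrow> ('x, 'k::field) free_alg" where
  "scalar a = Poly_Mapping.single 0 a"

definition std_monomial :: "('n::{finite, linorder} \<Rightarrow> nat) \<Rightarrow> 'n fmon" where
  "std_monomial a = FMon (concat (map (\<lambda>i. replicate (a i) i) (sorted_list_of_set UNIV)))"

text \<open>
  The generators are indexed by a finite linearly ordered type \<open>'n\<close>, and the parameters are
  \<open>b i j\<close>, \<open>c i j k\<close>, \<open>d i j\<close>, of which only those with \<open>i > j\<close> matter.
\<close>

definition G_ideal ::
  "('n::{finite, linorder} \<Rightarrow> 'n \<Rightarrow> 'k::field) \<Rightarrow> ('n \<Rightarrow> 'n \<Rightarrow> 'n \<Rightarrow> 'k) \<Rightarrow> ('n \<Rightarrow> 'n \<Rightarrow> 'k) \<Rightarrow>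
   ('n, 'k) free_alg set" where
  "G_ideal b c d = genideal free_ring
     {gen i * gen j - scalar (b i j) * gen j * gen i
        + (\<Sum>k \<in> UNIV. scalar (c i j k) * gen k) + scalar (d i j) | i j. i > j}"

text \<open>
  \<open>G_algebra b c d\<close>: the parameters define a G-algebra, that is, the standard monomials form
  a basis of the quotient of the free algebra by \<open>G_ideal b c d\<close>.
\<close>

definition G_algebra ::
  "('n::{finite, linorder} \<Rightarrow> 'n \<Rightarrow> 'k::field) \<Rightarrow> ('n \<Rightarrow> 'n \<Rightarrow> 'n \<Rightarrow> 'k) \<Rightarrow> ('n \<Rightarrow> 'n \<Rightarrow> 'k) \<Rightarrow> bool"
where
  "G_algebra b c d \<longleftrightarrow>
     (\<forall>i j. i > j \<longrightarrow> b i j \<noteq> 0) \<and>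
     (\<forall>x \<in> carrier (free_ring Quot G_ideal b c d).
        \<exists>!u :: ('n \<Rightarrow> nat) \<Rightarrow>\<^sub>0 'k.
          x = G_ideal b c d +>\<^bsub>free_ring\<^esub>
                (\<Sum>a \<in> Poly_Mapping.keys u.
                   Poly_Mapping.single (std_monomial a) (Poly_Mapping.lookup u a)))"

text \<open>For the homogenization, \<open>Some i\<close> is the generator with index \<open>i\<close> and \<open>None\<close> is \<open>Z\<close>.\<close>

definition homog_ideal ::
  "('n::{finite, linorder} \<Rightarrow> 'n \<Rightarrow> 'k::field) \<Rightarrow> ('n \<Rightarrow> 'n \<Rightarrow> 'n \<Rightarrow> 'k) \<Rightarrow> ('n \<Rightarrow> 'n \<Rightarrow> 'k) \<Rightarrow>
   ('n option, 'k) free_alg set" where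
  "homog_ideal b c d = genideal free_ring
     ({gen (Some i) * gen (Some j) - scalar (b i j) * gen (Some j) * gen (Some i)
        + (\<Sum>k \<in> UNIV. scalar (c i j k) * gen None * gen (Some k))
        + scalar (d i j) * gen None * gen None | i j. i > j} \<union>
      {gen (Some i) * gen None - gen None * gen (Some i) | i. True})"

definition homog_class where
  "homog_class b c d p = homog_ideal b c d +>\<^bsub>free_ring\<^esub> p"

type_synonym ('n, 'k) homog_elt = "('n option, 'k) free_alg set"

definition homog_G_algebra ::
  "('n::{finite, linorder} \<Rightarrow> 'n \<Rightarrow> 'k::field) \<Rightarrow> ('n \<Rightarrow> 'n \<Rightarrow> 'n \<Rightarrow> 'k) \<Rightarrow> ('n \<Rightarrow> 'n \<Rightarrow> 'k) \<Rightarrow>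
   ('n, 'k) homog_elt graded_ring" where
  "homog_G_algebra b c d =
     ring.extend (free_ring Quot homog_ideal b c d)
       \<lparr>rcomp = (\<lambda>m. homog_class b c d `
          {p. \<forall>w \<in> Poly_Mapping.keys p. int (length (letters w)) = m})\<rparr>"

definition Zel where
  "Zel b c d = homog_class b c d (gen None)"

definition homog_localized ::
  "('n::{finite, linorder} \<Rightarrow> 'n \<Rightarrow> 'k::field) \<Rightarrow> ('n \<Rightarrow> 'n \<Rightarrow> 'n \<Rightarrow> 'k) \<Rightarrow> ('n \<Rightarrow> 'n \<Rightarrow> 'k) \<Rightarrow>
   (('n, 'k) homog_elt \<times> nat) set graded_ring" where
  "homog_localized b c d = fraction_ring (homog_G_algebra b c d) (Zel b c d)"

definition finite_dimensional_objs ::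
  "('n::{finite, linorder} \<Rightarrow> 'n \<Rightarrow> 'k::field) \<Rightarrow> ('n \<Rightarrow> 'n \<Rightarrow> 'n \<Rightarrow> 'k) \<Rightarrow> ('n \<Rightarrow> 'n \<Rightarrow> 'k) \<Rightarrow>
   (('n, 'k) homog_elt, 'm) graded_module set" where
  "finite_dimensional_objs b c d = {M \<in> fg_graded_modules (homog_G_algebra b c d).
     \<exists>S. finite S \<and> S \<subseteq> carrier M \<and>
       (\<forall>x \<in> carrier M. \<exists>f :: 'm \<Rightarrow> 'k.
          x = (\<Oplus>\<^bsub>M\<^esub> s \<in> S. homog_class b c d (scalar (f s)) \<odot>\<^bsub>M\<^esub> s))}"


subsection \<open>The categories and functors\<close>

definition Qgr_arrows ::
  "('n::{finite, linorder} \<Rightarrow> 'n \<Rightarrow> 'k::field) \<Rightarrow> ('n \<Rightarrow> 'n \<Rightarrow> 'n \<Rightarrow> 'k) \<Rightarrow> ('n \<Rightarrow> 'n \<Rightarrow> 'k) \<Rightarrow>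
   (('n, 'k) homog_elt, 'm) gr_arrow set" where
  "Qgr_arrows b c d = serre_arrows (gr (homog_G_algebra b c d)) (finite_dimensional_objs b c d)"

definition Qgr where
  "Qgr b c d = localization (gr (homog_G_algebra b c d)) (Qgr_arrows b c d)"

definition pi_functor where
  "pi_functor b c d = localization_functor (gr (homog_G_algebra b c d)) (Qgr_arrows b c d)"

definition Q_functor where
  "Q_functor b c d =
     tensor_functor (homog_localized b c d)
       (\<lambda>x. fraction (homog_G_algebra b c d) (Zel b c d) (x, 0)) (homog_G_algebra b c d)"

text \<open>The functor \<open>\<psi>\<close> determined by \<open>\<psi>\<pi> = Q\<close>.\<close>

definition psi_functor where
  "psi_functor b c d = (SOME F.
     is_functor (Qgr b c d) (gr (homog_localized b c d)) F \<and>
     (\<forall>M \<in> objs (gr (homog_G_algebra b c d)).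
        fob F (fob (pi_functor b c d) M) = fob (Q_functor b c d) M) \<and>
     (\<forall>f \<in> arrs (gr (homog_G_algebra b c d)).
        far F (far (pi_functor b c d) f) = far (Q_functor b c d) f))"

definition kernel_Db_psi where
  "kernel_Db_psi b c d = {K \<in> objs (derived_category (Qgr b c d)).
     acyclic_complex (gr (homog_localized b c d)) (map_cochain (psi_functor b c d) K)}"

end

theory Submission
  imports Defs
begin

text \<open>
  Let \<open>A\<close> be the homogeneous G-algebra and \<open>\<pi>\<close> the functor from graded \<open>A\<close>-modules to the quotient
  category.  The functors \<open>\<pi>\<close>, \<open>Q\<close> and \<open>\<psi>\<close> are exact, so for a complex \<open>K\<close> isomorphic to \<open>\<pi> M\<close> the
  cohomology of \<open>\<psi> K\<close> is \<open>Q\<close> of the cohomology of \<open>M\<close>; and \<open>Q H\<close>, whose elements are the fractions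
  \<open>x / Z\<^sup>k\<close>, vanishes exactly if every element of \<open>H\<close> is killed by a power of \<open>Z\<close> (lemma
  \<open>acyclic_iff_torsion\<close>).  What remains is to see that every bounded complex in the quotient category is
  isomorphic to some \<open>\<pi> M\<close> (lemma \<open>bounded_complex_lifts\<close>).

  All the facts on the quotient category come from one description of its arrows.  A finitely generated
  graded module is finite-dimensional if and only if it vanishes in large degrees.  Hence the inclusion
  of the truncation \<open>M\<^sub>\<ge>\<^sub>n\<close> into \<open>M\<close> becomes invertible in the quotient category, while an arrow that is
  to be inverted is already an isomorphism in large degrees.  An arrow from \<open>\<pi> M\<close> to \<open>\<pi> N\<close> is therefore a
  germ of homomorphisms from \<open>M\<^sub>\<ge>\<^sub>n\<close> to \<open>N\<close> for large \<open>n\<close> (lemmas \<open>represent\<close> and \<open>eventually_equal\<close>).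
  This gives exactness of \<open>\<pi>\<close>, kernels and cokernels in the quotient category, and exactness of \<open>\<psi>\<close>.  It
  also lifts a bounded complex: its finitely many nonzero differentials are homomorphisms on one common
  truncation, and their composites vanish after a further one.  The argument only uses some formal
  properties of truncation, which are collected in the locale \<open>truncated_category\<close>.

  Cohomology in the category of finitely generated modules presupposes that \<open>A\<close> is noetherian.  This
  follows from Dickson's lemma as for commutative polynomials (theorem
  \<open>stable_subspace_finitely_generated\<close>): when the letters other than \<open>Z\<close> are counted first, two words
  with the same letters are proportional up to smaller words, as the coefficients \<open>b i j\<close> are nonzero.
\<close>

section \<open>Kernels and cokernels in a category\<close>

locale cat =
  fixes C :: "('o, 'a) category"
  assumes src_objs: "f \<in> arrs C \<Longrightarrow> src C f \<in> objs C"
    and tgt_objs: "f \<in> arrs C \<Longrightarrow> tgt C f \<in> objs C"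
    and idm_objs: "idm C x \<in> arrs C \<Longrightarrow> x \<in> objs C"
    and idm_hom: "x \<in> objs C \<Longrightarrow> idm C x \<in> hom_set C x x"
    and cmp_hom: "\<lbrakk>f \<in> hom_set C x y; g \<in> hom_set C y z\<rbrakk> \<Longrightarrow> cmp C g f \<in> hom_set C x z"
    and cmp_idm_left: "f \<in> hom_set C x y \<Longrightarrow> cmp C (idm C y) f = f"
    and cmp_idm_right: "f \<in> hom_set C x y \<Longrightarrow> cmp C f (idm C x) = f"
    and cmp_assoc: "\<lbrakk>f \<in> hom_set C x y; g \<in> hom_set C y z; h \<in> hom_set C z w\<rbrakk> \<Longrightarrow>
      cmp C (cmp C h g) f = cmp C h (cmp C g f)"

lemma hom_setD:
  assumes "f \<in> hom_set C x y"
  shows "f \<in> arrs C" "src C f = x" "tgt C f = y"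
  using assms by (auto simp: hom_set_def)

lemma arr_hom_set: "f \<in> arrs C \<Longrightarrow> f \<in> hom_set C (src C f) (tgt C f)"
  by (simp add: hom_set_def)

definition inverse_arrows :: "('o, 'a) category \<Rightarrow> 'o \<Rightarrow> 'o \<Rightarrow> 'a \<Rightarrow> 'a \<Rightarrow> bool" where
  "inverse_arrows C x y f g \<longleftrightarrow> f \<in> hom_set C x y \<and> g \<in> hom_set C y x \<and>
     cmp C g f = idm C x \<and> cmp C f g = idm C y"

lemma inverse_arrowsD:
  assumes "inverse_arrows C x y f g"
  shows "f \<in> hom_set C x y" "g \<in> hom_set C y x" "cmp C g f = idm C x" "cmp C f g = idm C y"
  using assms by (auto simp: inverse_arrows_def)

lemma inverse_arrows_sym: "inverse_arrows C x y f g \<Longrightarrow> inverse_arrows C y x g f"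
  by (auto simp: inverse_arrows_def)

lemma is_iso_iff: "is_iso C f \<longleftrightarrow> (\<exists>g. inverse_arrows C (src C f) (tgt C f) f g)"
  by (auto simp: is_iso_def inverse_arrows_def hom_set_def)

lemma is_iso_hom: "f \<in> hom_set C x y \<Longrightarrow> is_iso C f \<longleftrightarrow> (\<exists>g. inverse_arrows C x y f g)"
  by (auto simp: is_iso_iff dest: hom_setD)

lemma isomorphic_iff: "isomorphic C x y \<longleftrightarrow> (\<exists>f g. inverse_arrows C x y f g)"
  unfolding isomorphic_def by (metis inverse_arrowsD(1) is_iso_hom)

lemma isomorphic_sym: "isomorphic C x y \<Longrightarrow> isomorphic C y x"
  by (auto simp: isomorphic_iff intro: inverse_arrows_sym)

text \<open>
  Cokernels are kernels in the opposite category, so what holds for kernels in every category also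
  holds for cokernels.
\<close>

definition opposite :: "('o, 'a) category \<Rightarrow> ('o, 'a) category" where
  "opposite C = \<lparr>objs = objs C, arrs = arrs C, src = tgt C, tgt = src C, idm = idm C,
     cmp = (\<lambda>g f. cmp C f g)\<rparr>"

lemma opposite_simps [simp]:
  "objs (opposite C) = objs C" "arrs (opposite C) = arrs C"
  "src (opposite C) = tgt C" "tgt (opposite C) = src C"
  "idm (opposite C) = idm C" "cmp (opposite C) g f = cmp C f g"
  by (simp_all add: opposite_def)

lemma hom_set_opposite [simp]: "hom_set (opposite C) x y = hom_set C y x"
  by (auto simp: hom_set_def)

lemma inverse_arrows_opposite [simp]:
  "inverse_arrows (opposite C) x y f g \<longleftrightarrow> inverse_arrows C x y g f"
  by (auto simp: inverse_arrows_def)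

lemma zero_object_opposite [simp]: "zero_object (opposite C) z = zero_object C z"
  by (auto simp: zero_object_def)

lemma zero_arrow_opposite [simp]: "zero_arrow (opposite C) f = zero_arrow C f"
  by (auto simp: zero_arrow_def)

lemma is_kernel_opposite [simp]: "is_kernel (opposite C) f q \<longleftrightarrow> is_cokernel C f q"
  by (auto simp: is_kernel_def is_cokernel_def)

lemma is_cokernel_opposite [simp]: "is_cokernel (opposite C) f q \<longleftrightarrow> is_kernel C f q"
  by (auto simp: is_kernel_def is_cokernel_def)

lemma cat_opposite:
  assumes "cat C"
  shows "cat (opposite C)"
proof -
  interpret cat C by fact
  show ?thesis
    by standard (use src_objs tgt_objs idm_objs idm_hom cmp_hom cmp_idm_left cmp_idm_right cmp_assoc in \<open>simp_all, blast?, metis?\<close>)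
qed

context cat
begin

lemma hom_objs:
  assumes "f \<in> hom_set C x y"
  shows "x \<in> objs C" "y \<in> objs C"
  using assms src_objs tgt_objs by (auto simp: hom_set_def)

lemma cat_simps:
  assumes "f \<in> arrs C" "g \<in> arrs C" "src C g = tgt C f"
  shows "cmp C g f \<in> arrs C" "src C (cmp C g f) = src C f" "tgt C (cmp C g f) = tgt C g"
    "h \<in> arrs C \<Longrightarrow> src C h = tgt C g \<Longrightarrow> cmp C (cmp C h g) f = cmp C h (cmp C g f)"
  using cmp_hom[of f _ _ g] cmp_assoc[of f _ _ g _ h] assms by (auto simp: hom_set_def)

lemma idm_simps:
  "f \<in> arrs C \<Longrightarrow> tgt C f = y \<Longrightarrow> cmp C (idm C y) f = f"
  "f \<in> arrs C \<Longrightarrow> src C f = x \<Longrightarrow> cmp C f (idm C x) = f"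
  using cmp_idm_left cmp_idm_right by (auto simp: hom_set_def)

lemma inverse_arrows_cancel:
  assumes "inverse_arrows C x y f g"
  shows "h \<in> arrs C \<Longrightarrow> tgt C h = x \<Longrightarrow> cmp C g (cmp C f h) = h"
    and "h \<in> arrs C \<Longrightarrow> tgt C h = y \<Longrightarrow> cmp C f (cmp C g h) = h"
    and "h \<in> arrs C \<Longrightarrow> src C h = x \<Longrightarrow> cmp C (cmp C h g) f = h"
    and "h \<in> arrs C \<Longrightarrow> src C h = y \<Longrightarrow> cmp C (cmp C h f) g = h"
proof -
  have i: "f \<in> arrs C" "src C f = x" "tgt C f = y" "g \<in> arrs C" "src C g = y" "tgt C g = x"
    "cmp C g f = idm C x" "cmp C f g = idm C y"
    using assms by (auto simp: inverse_arrows_def hom_set_def)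
  show "h \<in> arrs C \<Longrightarrow> tgt C h = x \<Longrightarrow> cmp C g (cmp C f h) = h"
    using i cat_simps(4)[of h f g] by (simp add: idm_simps)
  show "h \<in> arrs C \<Longrightarrow> tgt C h = y \<Longrightarrow> cmp C f (cmp C g h) = h"
    using i cat_simps(4)[of h g f] by (simp add: idm_simps)
  show "h \<in> arrs C \<Longrightarrow> src C h = x \<Longrightarrow> cmp C (cmp C h g) f = h"
    using i cat_simps(4)[of f g h] by (simp add: idm_simps)
  show "h \<in> arrs C \<Longrightarrow> src C h = y \<Longrightarrow> cmp C (cmp C h f) g = h"
    using i cat_simps(4)[of g f h] by (simp add: idm_simps)
qed

lemma inverse_arrows_idm: "x \<in> objs C \<Longrightarrow> inverse_arrows C x x (idm C x) (idm C x)"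
  by (metis cmp_idm_left idm_hom inverse_arrows_def)

lemma inverse_arrows_cmp:
  assumes "inverse_arrows C x y f f'" "inverse_arrows C y z g g'"
  shows "inverse_arrows C x z (cmp C g f) (cmp C f' g')"
proof -
  note f = inverse_arrowsD[OF assms(1)] and g = inverse_arrowsD[OF assms(2)]
  show ?thesis
    using f g inverse_arrows_cancel(1)[OF assms(2), of f] inverse_arrows_cancel(2)[OF assms(1), of g']
    by (auto simp: inverse_arrows_def hom_set_def cat_simps)
qed

lemma isomorphic_trans: "isomorphic C x y \<Longrightarrow> isomorphic C y z \<Longrightarrow> isomorphic C x z"
  by (meson inverse_arrows_cmp isomorphic_iff)

lemma cancel_iso_right:
  assumes "inverse_arrows C x y f g" "u \<in> hom_set C y z" "v \<in> hom_set C y z" "cmp C u f = cmp C v f"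
  shows "u = v"
proof -
  have "cmp C (cmp C u f) g = u" "cmp C (cmp C v f) g = v"
    using inverse_arrows_cancel(4)[OF assms(1)] hom_setD[OF assms(2)] hom_setD[OF assms(3)] by blast+
  then show ?thesis using assms(4) by metis
qed

lemma cancel_iso_left:
  assumes "inverse_arrows C y z f g" "u \<in> hom_set C x y" "v \<in> hom_set C x y" "cmp C f u = cmp C f v"
  shows "u = v"
proof -
  have "cmp C g (cmp C f u) = u" "cmp C g (cmp C f v) = v"
    using inverse_arrows_cancel(1)[OF assms(1)] hom_setD[OF assms(2)] hom_setD[OF assms(3)] by blast+
  then show ?thesis using assms(4) by metis
qed

lemma zero_object_homs:
  assumes "zero_object C z" "x \<in> objs C"
  obtains f g where "f \<in> hom_set C x z" "g \<in> hom_set C z x"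
  using assms unfolding zero_object_def by blast

lemma zero_object_hom_unique:
  assumes "zero_object C z"
  shows "f \<in> hom_set C x z \<Longrightarrow> g \<in> hom_set C x z \<Longrightarrow> f = g"
    and "f \<in> hom_set C z x \<Longrightarrow> g \<in> hom_set C z x \<Longrightarrow> f = g"
  using assms hom_objs unfolding zero_object_def by metis+

lemma zero_object_isomorphic:
  assumes "zero_object C z" "isomorphic C z w"
  shows "zero_object C w"
proof -
  obtain f g where fg: "inverse_arrows C z w f g" using assms(2) by (auto simp: isomorphic_iff)
  note i = inverse_arrowsD[OF fg]
  have "\<exists>!h. h \<in> hom_set C x w" if x: "x \<in> objs C" for x
  proof -
    obtain h where "h \<in> hom_set C x z" using zero_object_homs[OF assms(1) x] by blast
    then have "cmp C f h \<in> hom_set C x w" using cmp_hom i(1) by blast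
    moreover have "h' = h''" if "h' \<in> hom_set C x w" "h'' \<in> hom_set C x w" for h' h''
      using cancel_iso_left[OF inverse_arrows_sym[OF fg] that]
        zero_object_hom_unique(1)[OF assms(1)] cmp_hom[OF that(1) i(2)] cmp_hom[OF that(2) i(2)] by blast
    ultimately show ?thesis by blast
  qed
  moreover have "\<exists>!h. h \<in> hom_set C w x" if x: "x \<in> objs C" for x
  proof -
    obtain h where "h \<in> hom_set C z x" using zero_object_homs[OF assms(1) x] by blast
    then have "cmp C h g \<in> hom_set C w x" using cmp_hom i(2) by blast
    moreover have "h' = h''" if "h' \<in> hom_set C w x" "h'' \<in> hom_set C w x" for h' h''
      using cancel_iso_right[OF fg that]
        zero_object_hom_unique(2)[OF assms(1)] cmp_hom[OF i(1) that(1)] cmp_hom[OF i(1) that(2)] by blast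
    ultimately show ?thesis by blast
  qed
  ultimately show ?thesis using hom_objs(2)[OF i(1)] by (auto simp: zero_object_def)
qed

lemma zero_object_unique:
  assumes "zero_object C z" "zero_object C w"
  shows "isomorphic C z w"
proof -
  have zw: "z \<in> objs C" "w \<in> objs C" using assms by (auto simp: zero_object_def)
  obtain f g where f: "f \<in> hom_set C z w" and g: "g \<in> hom_set C w z"
    using zero_object_homs[OF assms(2) zw(1)] zero_object_homs[OF assms(1) zw(2)] by metis
  have "cmp C g f = idm C z"
    using zero_object_hom_unique(1)[OF assms(1) cmp_hom[OF f g] idm_hom[OF zw(1)]] .
  moreover have "cmp C f g = idm C w"
    using zero_object_hom_unique(1)[OF assms(2) cmp_hom[OF g f] idm_hom[OF zw(2)]] .
  ultimately show ?thesis using f g by (auto simp: isomorphic_iff inverse_arrows_def)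
qed

lemma zero_arrowI:
  assumes "zero_object C z" "p \<in> hom_set C x z" "q \<in> hom_set C z y"
  shows "zero_arrow C (cmp C q p)"
  unfolding zero_arrow_def hom_setD(2,3)[OF cmp_hom[OF assms(2,3)]] using assms by blast

lemma zero_arrow_unique:
  assumes "zero_arrow C f" "zero_arrow C g" "f \<in> hom_set C x y" "g \<in> hom_set C x y"
  shows "f = g"
proof -
  obtain z p q where z: "zero_object C z" "p \<in> hom_set C x z" "q \<in> hom_set C z y" "f = cmp C q p"
    using assms(1,3) by (auto simp: zero_arrow_def hom_set_def)
  obtain w r s where w: "zero_object C w" "r \<in> hom_set C x w" "s \<in> hom_set C w y" "g = cmp C s r"
    using assms(2,4) by (auto simp: zero_arrow_def hom_set_def)
  obtain t where t: "t \<in> hom_set C z w" 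
    using zero_object_homs[OF z(1)] hom_objs(2)[OF w(2)] by blast
  have "cmp C t p = r"
    using zero_object_hom_unique(1)[OF w(1) cmp_hom[OF z(2) t] w(2)] .
  moreover have "cmp C s t = q"
    using zero_object_hom_unique(2)[OF z(1) cmp_hom[OF t w(3)] z(3)] .
  ultimately show ?thesis using z w t cmp_assoc[OF z(2) t w(3)] by simp
qed

lemma zero_arrow_cmp_right:
  assumes "zero_arrow C f" "f \<in> hom_set C x y" "g \<in> hom_set C w x"
  shows "zero_arrow C (cmp C f g)"
proof -
  obtain z p q where z: "zero_object C z" "p \<in> hom_set C x z" "q \<in> hom_set C z y" "f = cmp C q p"
    using assms(1,2) by (auto simp: zero_arrow_def hom_set_def)
  show ?thesis
    using zero_arrowI[OF z(1) cmp_hom[OF assms(3) z(2)] z(3)] cmp_assoc[OF assms(3) z(2,3)] z(4) by simp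
qed

lemma zero_arrow_exists:
  assumes "zero_object C z" "x \<in> objs C" "y \<in> objs C"
  shows "\<exists>f \<in> hom_set C x y. zero_arrow C f"
proof -
  obtain p q where "p \<in> hom_set C x z" "q \<in> hom_set C z y"
    using zero_object_homs[OF assms(1,2)] zero_object_homs[OF assms(1,3)] by metis
  then show ?thesis using zero_arrowI[OF assms(1)] cmp_hom by blast
qed

lemma is_kernelD:
  assumes "is_kernel C f k"
  shows "f \<in> hom_set C (src C f) (tgt C f)" "k \<in> hom_set C (src C k) (src C f)"
    "zero_arrow C (cmp C f k)"
    "\<lbrakk>g \<in> hom_set C v (src C f); zero_arrow C (cmp C f g)\<rbrakk> \<Longrightarrow>
       \<exists>u. u \<in> hom_set C v (src C k) \<and> cmp C k u = g"
proof -
  have k: "f \<in> arrs C" "k \<in> arrs C" "tgt C k = src C f" "zero_arrow C (cmp C f k)"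
    and u: "\<And>g. \<lbrakk>g \<in> arrs C; tgt C g = src C f; zero_arrow C (cmp C f g)\<rbrakk> \<Longrightarrow>
        \<exists>!u. u \<in> hom_set C (src C g) (src C k) \<and> cmp C k u = g"
    using assms unfolding is_kernel_def by blast+
  show "f \<in> hom_set C (src C f) (tgt C f)" "k \<in> hom_set C (src C k) (src C f)"
    "zero_arrow C (cmp C f k)"
    using k by (simp_all add: hom_set_def)
  show "\<exists>u. u \<in> hom_set C v (src C k) \<and> cmp C k u = g"
    if "g \<in> hom_set C v (src C f)" "zero_arrow C (cmp C f g)"
    using u[OF hom_setD(1,3)[OF that(1)] that(2)] hom_setD(2)[OF that(1)] by blast
qed

lemma kernel_mono:
  assumes "is_kernel C f k" "u \<in> hom_set C v (src C k)" "u' \<in> hom_set C v (src C k)"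
    "cmp C k u = cmp C k u'"
  shows "u = u'"
proof -
  note k = is_kernelD[OF assms(1)]
  have ku: "cmp C k u \<in> hom_set C v (src C f)" by (rule cmp_hom[OF assms(2) k(2)])
  have "zero_arrow C (cmp C f (cmp C k u))"
    using zero_arrow_cmp_right[OF k(3) cmp_hom[OF k(2) k(1)] assms(2)]
    by (simp add: cmp_assoc[OF assms(2) k(2) k(1)])
  then have "\<exists>!w. w \<in> hom_set C v (src C k) \<and> cmp C k w = cmp C k u"
    using assms(1) hom_setD[OF ku] unfolding is_kernel_def by blast
  then obtain w where "\<And>y. y \<in> hom_set C v (src C k) \<Longrightarrow> cmp C k y = cmp C k u \<Longrightarrow> y = w"
    by (elim ex1E) blast
  from this[OF assms(2) refl] this[OF assms(3) assms(4)[symmetric]] show ?thesis by (rule trans[OF _ sym])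
qed

lemma is_kernelI:
  assumes "f \<in> hom_set C x y" "k \<in> hom_set C w x" "zero_arrow C (cmp C f k)"
    and "\<And>v g. g \<in> hom_set C v x \<Longrightarrow> zero_arrow C (cmp C f g) \<Longrightarrow> \<exists>u. u \<in> hom_set C v w \<and> cmp C k u = g"
    and "\<And>v u u'. u \<in> hom_set C v w \<Longrightarrow> u' \<in> hom_set C v w \<Longrightarrow> cmp C k u = cmp C k u' \<Longrightarrow> u = u'"
  shows "is_kernel C f k"
proof -
  have "\<exists>!u. u \<in> hom_set C (src C g) w \<and> cmp C k u = g"
    if "g \<in> arrs C" "tgt C g = x" "zero_arrow C (cmp C f g)" for g
  proof -
    have g: "g \<in> hom_set C (src C g) x" using that by (simp add: hom_set_def)
    show ?thesis using assms(4)[OF g that(3)] assms(5)[of _ "src C g"] by blast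
  qed
  then show ?thesis
    using assms(3) hom_setD[OF assms(1)] hom_setD[OF assms(2)] by (simp add: is_kernel_def)
qed

lemma kernel_unique:
  assumes "is_kernel C f k" "is_kernel C f k'"
  shows "\<exists>u v. inverse_arrows C (src C k') (src C k) u v \<and> cmp C k u = k'"
proof -
  note k = is_kernelD[OF assms(1)] and k' = is_kernelD[OF assms(2)]
  obtain u where u: "u \<in> hom_set C (src C k') (src C k)" "cmp C k u = k'" using k(4)[OF _ k'(3)] k'(2) by blast
  obtain v where v: "v \<in> hom_set C (src C k) (src C k')" "cmp C k' v = k" using k'(4)[OF _ k(3)] k(2) by blast
  have "cmp C k (cmp C u v) = k" using u v cmp_assoc[OF v(1) u(1) k(2)] by simp
  then have 1: "cmp C u v = idm C (src C k)"
    using kernel_mono[OF assms(1) cmp_hom[OF v(1) u(1)] idm_hom] hom_objs(1)[OF k(2)] k(2)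
    by (simp add: cmp_idm_right)
  have "cmp C k' (cmp C v u) = k'"
    using u v cmp_assoc[OF u(1) v(1), of k'] k'(2) by simp
  then have 2: "cmp C v u = idm C (src C k')"
    using kernel_mono[OF assms(2) cmp_hom[OF u(1) v(1)] idm_hom] hom_objs(1)[OF k'(2)] k'(2)
    by (simp add: cmp_idm_right)
  show ?thesis using 1 2 u v by (auto simp: inverse_arrows_def)
qed

lemma zero_arrow_iso_left:
  assumes "inverse_arrows C y z g g'" "f \<in> hom_set C x y"
  shows "zero_arrow C (cmp C g f) \<longleftrightarrow> zero_arrow C f"
proof -
  note g = inverse_arrowsD[OF assms(1)]
  interpret op: cat "opposite C" by (rule cat_opposite) (rule cat_axioms)
  have *: "zero_arrow C (cmp C h p)" if "zero_arrow C p" "p \<in> hom_set C u v" "h \<in> hom_set C v w" for h p u v w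
    using op.zero_arrow_cmp_right[of p v u h w] that by simp
  have "f = cmp C g' (cmp C g f)"
    using inverse_arrows_cancel(1)[OF assms(1), of f] assms(2) by (simp add: hom_set_def)
  then show ?thesis using *[OF _ assms(2) g(1)] *[OF _ cmp_hom[OF assms(2) g(1)] g(2)] by auto
qed

text \<open>
  Isomorphisms transport the universal property of a kernel.
\<close>

lemma kernel_conjugate:
  assumes "is_kernel C (cmp C c (cmp C f a)) k" "f \<in> hom_set C x y"
    and a: "inverse_arrows C x' x a a'" and c: "inverse_arrows C y y' c c'"
    and e: "inverse_arrows C w (src C k) e e'"
  shows "is_kernel C f (cmp C a (cmp C k e))"
proof (rule is_kernelI)
  note a = inverse_arrowsD[OF a] and e = inverse_arrowsD[OF e]
  let ?g = "cmp C c (cmp C f a)"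
  have fa: "cmp C f a \<in> hom_set C x' y" by (rule cmp_hom[OF a(1) assms(2)])
  have g: "?g \<in> hom_set C x' y'" by (rule cmp_hom[OF fa inverse_arrowsD(1)[OF c]])
  have k: "k \<in> hom_set C (src C k) x'" using is_kernelD(2)[OF assms(1)] hom_setD(2)[OF g] by simp
  have ke: "cmp C k e \<in> hom_set C w x'" by (rule cmp_hom[OF e(1) k])
  show "f \<in> hom_set C x y" by fact
  show "cmp C a (cmp C k e) \<in> hom_set C w x" by (rule cmp_hom[OF ke a(1)])
  have z: "zero_arrow C (cmp C ?g p) \<longleftrightarrow> zero_arrow C (cmp C f (cmp C a p))" if "p \<in> hom_set C v x'" for v p
    using zero_arrow_iso_left[OF c cmp_hom[OF that fa]]
    by (simp add: cmp_assoc[OF that fa inverse_arrowsD(1)[OF c]] cmp_assoc[OF that a(1) assms(2)])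
  have "zero_arrow C (cmp C ?g (cmp C k e))"
    using zero_arrow_cmp_right[OF is_kernelD(3)[OF assms(1)] cmp_hom[OF k g] e(1)]
    by (simp add: cmp_assoc[OF e(1) k g])
  then show "zero_arrow C (cmp C f (cmp C a (cmp C k e)))" using z[OF ke] by simp
  {
    fix v p assume p: "p \<in> hom_set C v x" "zero_arrow C (cmp C f p)"
    have ap: "cmp C a' p \<in> hom_set C v x'" by (rule cmp_hom[OF p(1) a(2)])
    have aap: "cmp C a (cmp C a' p) = p" using inverse_arrows_cancel(2)[OF assms(3)] p(1) by (simp add: hom_set_def)
    then have "zero_arrow C (cmp C ?g (cmp C a' p))" using z[OF ap] p by simp
    then obtain u where u: "u \<in> hom_set C v (src C k)" "cmp C k u = cmp C a' p"
      using is_kernelD(4)[OF assms(1), of "cmp C a' p" v] hom_setD(2)[OF g] ap by auto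
    have "cmp C (cmp C a (cmp C k e)) (cmp C e' u) = cmp C a (cmp C k (cmp C e (cmp C e' u)))"
      using e u a k by (simp add: hom_set_def cat_simps)
    also have "\<dots> = p"
      using inverse_arrows_cancel(2)[OF assms(5), of u] u aap by (simp add: hom_set_def)
    finally show "\<exists>u. u \<in> hom_set C v w \<and> cmp C (cmp C a (cmp C k e)) u = p"
      using cmp_hom[OF u(1) e(2)] by blast
  next
    fix v u u' assume u: "u \<in> hom_set C v w" "u' \<in> hom_set C v w"
      "cmp C (cmp C a (cmp C k e)) u = cmp C (cmp C a (cmp C k e)) u'"
    have "cmp C a (cmp C (cmp C k e) u) = cmp C a (cmp C (cmp C k e) u')"
      using u(3) cmp_assoc[OF u(1) ke a(1)] cmp_assoc[OF u(2) ke a(1)] by simp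
    then have "cmp C (cmp C k e) u = cmp C (cmp C k e) u'"
      by (rule cancel_iso_left[OF assms(3) cmp_hom[OF u(1) ke] cmp_hom[OF u(2) ke]])
    then have "cmp C e u = cmp C e u'"
      using kernel_mono[OF assms(1) cmp_hom[OF u(1) e(1)] cmp_hom[OF u(2) e(1)]]
        cmp_assoc[OF u(1) e(1) k] cmp_assoc[OF u(2) e(1) k] by simp
    then show "u = u'" using cancel_iso_left[OF assms(5)] u by blast
  }
qed

end

definition preserves_kernels ::
  "('o, 'a) category \<Rightarrow> ('p, 'b) category \<Rightarrow> ('o, 'a, 'p, 'b) func \<Rightarrow> bool" where
  "preserves_kernels C D F \<longleftrightarrow> (\<forall>f k. is_kernel C f k \<longrightarrow> is_kernel D (far F f) (far F k))"

definition preserves_cokernels ::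
  "('o, 'a) category \<Rightarrow> ('p, 'b) category \<Rightarrow> ('o, 'a, 'p, 'b) func \<Rightarrow> bool" where
  "preserves_cokernels C D F \<longleftrightarrow> (\<forall>f q. is_cokernel C f q \<longrightarrow> is_cokernel D (far F f) (far F q))"

lemma is_functor_hom:
  "is_functor C D F \<Longrightarrow> f \<in> hom_set C x y \<Longrightarrow> far F f \<in> hom_set D (fob F x) (fob F y)"
  by (auto simp: is_functor_def hom_set_def)

lemma is_functor_obj: "is_functor C D F \<Longrightarrow> x \<in> objs C \<Longrightarrow> fob F x \<in> objs D"
  by (auto simp: is_functor_def)

lemma is_functor_idm: "is_functor C D F \<Longrightarrow> x \<in> objs C \<Longrightarrow> far F (idm C x) = idm D (fob F x)"
  by (auto simp: is_functor_def)

lemma is_functor_cmp: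
  "is_functor C D F \<Longrightarrow> f \<in> hom_set C x y \<Longrightarrow> g \<in> hom_set C y z \<Longrightarrow>
    far F (cmp C g f) = cmp D (far F g) (far F f)"
  by (auto simp: is_functor_def hom_set_def)

lemma is_functor_opposite: "is_functor C D F \<Longrightarrow> is_functor (opposite C) (opposite D) F"
  by (auto simp: is_functor_def hom_set_def)

lemma functor_inverse_arrows:
  assumes "cat C" "is_functor C D F" "inverse_arrows C x y f g"
  shows "inverse_arrows D (fob F x) (fob F y) (far F f) (far F g)"
proof -
  note i = inverse_arrowsD[OF assms(3)]
  have "x \<in> objs C" "y \<in> objs C" using cat.hom_objs[OF assms(1) i(1)] by auto
  then show ?thesis
    using is_functor_hom[OF assms(2) i(1)] is_functor_hom[OF assms(2) i(2)]
      is_functor_cmp[OF assms(2) i(1,2)] is_functor_cmp[OF assms(2) i(2,1)] i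
      is_functor_idm[OF assms(2)] by (simp add: inverse_arrows_def)
qed

lemma functor_isomorphic:
  assumes "cat C" "is_functor C D F" "isomorphic C x y"
  shows "isomorphic D (fob F x) (fob F y)"
  using assms functor_inverse_arrows unfolding isomorphic_iff by meson

text \<open>
  Exactness passes from \<open>P\<close> and \<open>T P\<close> to \<open>T\<close> when \<open>P\<close> hits every arrow up to isomorphism: a
  kernel of an arrow \<open>g\<close> is, up to isomorphisms, the image under \<open>P\<close> of a kernel in the domain of \<open>P\<close>.
\<close>

lemma kernel_preservation_descends:
  assumes C: "cat C" and E: "cat E" and D: "cat D"
    and P: "is_functor C E P" "preserves_kernels C E P"
    and T: "is_functor E D T"
    and TP: "\<And>f k. is_kernel C f k \<Longrightarrow> is_kernel D (far T (far P f)) (far T (far P k))"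
    and ker: "\<And>f. f \<in> arrs C \<Longrightarrow> \<exists>k. is_kernel C f k"
    and dense: "\<And>g. g \<in> arrs E \<Longrightarrow> \<exists>f \<in> arrs C. \<exists>a a' c c'.
      inverse_arrows E (fob P (src C f)) (src E g) a a' \<and>
      inverse_arrows E (tgt E g) (fob P (tgt C f)) c c' \<and>
      far P f = cmp E c (cmp E g a)"
  shows "preserves_kernels E D T"
  unfolding preserves_kernels_def
proof (intro allI impI)
  fix g \<kappa> assume \<kappa>: "is_kernel E g \<kappa>"
  interpret E: cat E by fact
  interpret D: cat D by fact
  have g: "g \<in> hom_set E (src E g) (tgt E g)" using E.is_kernelD(1)[OF \<kappa>] .
  obtain f a a' c c' where f: "f \<in> arrs C"
    and a: "inverse_arrows E (fob P (src C f)) (src E g) a a'"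
    and c: "inverse_arrows E (tgt E g) (fob P (tgt C f)) c c'"
    and Pf: "far P f = cmp E c (cmp E g a)"
    using dense[OF hom_setD(1)[OF g]] by blast
  obtain k where k: "is_kernel C f k" using ker[OF f] by blast
  note khom = cat.is_kernelD(2)[OF C k]
  have Pk: "is_kernel E (cmp E c (cmp E g a)) (far P k)"
    using P(2) k Pf unfolding preserves_kernels_def by metis
  note Pkhom = is_functor_hom[OF P(1) khom]
  have s: "src E (far P k) = fob P (src C k)" using hom_setD(2)[OF Pkhom] .
  have ker1: "is_kernel E g (cmp E a (far P k))"
    using E.kernel_conjugate[OF Pk g a c E.inverse_arrows_idm] E.hom_objs(1)[OF Pkhom] s
      E.cmp_idm_right[OF Pkhom] by simp
  have s1: "src E (cmp E a (far P k)) = fob P (src C k)"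
    using hom_setD(2)[OF E.cmp_hom[OF Pkhom inverse_arrowsD(1)[OF a]]] .
  obtain u v where uv: "inverse_arrows E (src E \<kappa>) (fob P (src C k)) u v"
    and \<kappa>u: "\<kappa> = cmp E (cmp E a (far P k)) u"
    using E.kernel_unique[OF ker1 \<kappa>] s1 by auto
  note u = inverse_arrowsD(1)[OF uv] and a1 = inverse_arrowsD(1)[OF a] and c1 = inverse_arrowsD(1)[OF c]
  have Tf: "far T (far P f) = cmp D (far T c) (cmp D (far T g) (far T a))"
    unfolding Pf using is_functor_cmp[OF T E.cmp_hom[OF a1 g] c1] is_functor_cmp[OF T a1 g] by simp
  have T\<kappa>: "far T \<kappa> = cmp D (far T a) (cmp D (far T (far P k)) (far T u))"
    unfolding \<kappa>u using is_functor_cmp[OF T u E.cmp_hom[OF Pkhom a1]] is_functor_cmp[OF T Pkhom a1]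
      D.cmp_assoc[OF is_functor_hom[OF T u] is_functor_hom[OF T Pkhom] is_functor_hom[OF T a1]] by simp
  have "src D (far T (far P k)) = fob T (fob P (src C k))"
    using hom_setD(2)[OF is_functor_hom[OF T Pkhom]] .
  then show "is_kernel D (far T g) (far T \<kappa>)"
    unfolding T\<kappa> using D.kernel_conjugate[OF TP[OF k, unfolded Tf] is_functor_hom[OF T g]
        functor_inverse_arrows[OF E T a] functor_inverse_arrows[OF E T c]]
      functor_inverse_arrows[OF E T uv] by simp
qed

lemma cokernel_preservation_descends:
  assumes C: "cat C" and E: "cat E" and D: "cat D"
    and P: "is_functor C E P" "preserves_cokernels C E P"
    and T: "is_functor E D T"
    and TP: "\<And>f k. is_cokernel C f k \<Longrightarrow> is_cokernel D (far T (far P f)) (far T (far P k))"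
    and coker: "\<And>f. f \<in> arrs C \<Longrightarrow> \<exists>q. is_cokernel C f q"
    and dense: "\<And>g. g \<in> arrs E \<Longrightarrow> \<exists>f \<in> arrs C. \<exists>a a' c c'.
      inverse_arrows E (fob P (src C f)) (src E g) a a' \<and>
      inverse_arrows E (tgt E g) (fob P (tgt C f)) c c' \<and>
      far P f = cmp E c (cmp E g a)"
  shows "preserves_cokernels E D T"
proof -
  have "preserves_kernels (opposite E) (opposite D) T"
  proof (rule kernel_preservation_descends[OF cat_opposite[OF C] cat_opposite[OF E] cat_opposite[OF D]
        is_functor_opposite[OF P(1)] _ is_functor_opposite[OF T]])
    show "preserves_kernels (opposite C) (opposite E) P"
      using P(2) by (simp add: preserves_kernels_def preserves_cokernels_def)
    show "\<exists>k. is_kernel (opposite C) f k" if "f \<in> arrs (opposite C)" for f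
      using coker that by simp
    show "is_kernel (opposite D) (far T (far P f)) (far T (far P k))" if "is_kernel (opposite C) f k" for f k
      using TP that by simp
    fix g assume "g \<in> arrs (opposite E)"
    then have g: "g \<in> arrs E" by simp
    obtain f a a' c c' where f: "f \<in> arrs C" and i: "inverse_arrows E (fob P (src C f)) (src E g) a a'"
      "inverse_arrows E (tgt E g) (fob P (tgt C f)) c c'" "far P f = cmp E c (cmp E g a)"
      using dense[OF g] by blast
    have "cmp E c (cmp E g a) = cmp E (cmp E c g) a"
      using cat.cmp_assoc[OF E inverse_arrowsD(1)[OF i(1)] arr_hom_set[OF g] inverse_arrowsD(1)[OF i(2)]] by simp
    then show "\<exists>f\<in>arrs (opposite C). \<exists>a a' c c'.
      inverse_arrows (opposite E) (fob P (src (opposite C) f)) (src (opposite E) g) a a' \<and>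
      inverse_arrows (opposite E) (tgt (opposite E) g) (fob P (tgt (opposite C) f)) c c' \<and>
      far P f = cmp (opposite E) c (cmp (opposite E) g a)"
      using f inverse_arrows_sym[OF i(1)] inverse_arrows_sym[OF i(2)] i(3)
      by (intro bexI[of _ f] exI[of _ c] exI[of _ c'] exI[of _ a] exI[of _ a']) simp_all
  qed
  then show ?thesis by (simp add: preserves_kernels_def preserves_cokernels_def)
qed

section \<open>Localization at a class of arrows\<close>

lemma zstep_context:
  assumes "zstep C W r s"
  shows "zstep C W (p @ r @ q) (p @ s @ q)"
  using assms
proof cases
  case (1 p' f g q')
  then show ?thesis using zstep.intros(1)[of C W "p @ p'" f g "q' @ q"] by simp
next
  case (2 p' x q')
  then show ?thesis using zstep.intros(2)[of C W "p @ p'" x "q' @ q"] by simp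
next
  case (3 t p' q')
  then show ?thesis using zstep.intros(3)[of t W C "p @ p'" "q' @ q"] by simp
next
  case (4 t p' q')
  then show ?thesis using zstep.intros(4)[of t W C "p @ p'" "q' @ q"] by simp
qed

lemma zigzag_end_unique: "zigzag C W x p y \<Longrightarrow> zigzag C W x p z \<Longrightarrow> y = z"
proof (induction p arbitrary: x)
  case (Cons s p)
  then show ?case by (cases s) auto
qed simp

definition zigzag_equiv ::
  "('o, 'a) category \<Rightarrow> 'a set \<Rightarrow> 'o \<Rightarrow> 'o \<Rightarrow> 'a step list \<Rightarrow> 'a step list \<Rightarrow> bool" where
  "zigzag_equiv C W x y = equivclp (\<lambda>r s. zigzag C W x r y \<and> zigzag C W x s y \<and> zstep C W r s)"

lemma zclass_eq: "zclass C W x y p = zclass C W x y q \<longleftrightarrow> zigzag_equiv C W x y p q"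
proof -
  have "zclass C W x y r = {s. zigzag_equiv C W x y r s}" for r
    by (simp add: zclass_def zigzag_equiv_def)
  moreover have "zigzag_equiv C W x y r r" for r by (simp add: zigzag_equiv_def)
  moreover have "zigzag_equiv C W x y r s \<Longrightarrow> zigzag_equiv C W x y s t \<Longrightarrow> zigzag_equiv C W x y r t" for r s t
    unfolding zigzag_equiv_def by (rule equivclp_trans)
  moreover have "zigzag_equiv C W x y r s \<Longrightarrow> zigzag_equiv C W x y s r" for r s
    unfolding zigzag_equiv_def by (rule equivclp_sym)
  ultimately show ?thesis by blast
qed

lemma mem_zclass: "q \<in> zclass C W x y p \<longleftrightarrow> zigzag_equiv C W x y p q"
  by (simp add: zclass_def zigzag_equiv_def)

lemma zigzag_equiv_refl: "zigzag_equiv C W x y p p"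
  by (simp add: zigzag_equiv_def)

lemma zigzag_equiv_trans:
  "zigzag_equiv C W x y p q \<Longrightarrow> zigzag_equiv C W x y q r \<Longrightarrow> zigzag_equiv C W x y p r"
  unfolding zigzag_equiv_def by (rule equivclp_trans)

lemma zstep_equiv:
  "zstep C W p q \<Longrightarrow> zigzag C W x p y \<Longrightarrow> zigzag C W x q y \<Longrightarrow> zigzag_equiv C W x y p q"
  unfolding zigzag_equiv_def by (rule r_into_equivclp) simp

lemma zigzag_equiv_invariant:
  assumes "zigzag_equiv C W x y p q"
    and "\<And>r s. zigzag C W x r y \<Longrightarrow> zigzag C W x s y \<Longrightarrow> zstep C W r s \<Longrightarrow> I r = I s"
  shows "I p = I q"
  using assms(1) unfolding zigzag_equiv_def
proof (induction rule: equivclp_induct)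
  case (step r s)
  then show ?case using assms(2)[of r s] assms(2)[of s r] by auto
qed simp

lemma zigzag_equiv_map:
  assumes "zigzag_equiv C W x y p q"
    and "\<And>r s. zigzag C W x r y \<Longrightarrow> zigzag C W x s y \<Longrightarrow> zstep C W r s \<Longrightarrow> zigzag_equiv C W x' y' (I r) (I s)"
  shows "zigzag_equiv C W x' y' (I p) (I q)"
  using zigzag_equiv_invariant[OF assms(1), of "\<lambda>r. zclass C W x' y' (I r)"] assms(2)
  by (simp add: zclass_eq)

lemma zigzag_equiv_zigzag: "zigzag_equiv C W x y p q \<Longrightarrow> zigzag C W x p y \<Longrightarrow> zigzag C W x q y"
  using zigzag_equiv_invariant[of C W x y p q "\<lambda>p. zigzag C W x p y"] by blast

context cat
begin

lemma zigzag_objs: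
  assumes "W \<subseteq> arrs C" "zigzag C W x p y"
  shows "x \<in> objs C" "y \<in> objs C"
proof -
  have "x \<in> objs C \<and> y \<in> objs C" using assms(2)
  proof (induction p arbitrary: x)
    case (Cons s p)
    then show ?case using assms(1) src_objs tgt_objs by (cases s) auto
  qed simp
  then show "x \<in> objs C" "y \<in> objs C" by auto
qed

lemma zigzag_append:
  assumes "W \<subseteq> arrs C"
  shows "zigzag C W x (p @ q) z \<longleftrightarrow> (\<exists>y. zigzag C W x p y \<and> zigzag C W y q z)"
proof (induction p arbitrary: x)
  case Nil
  then show ?case using zigzag_objs[OF assms] by auto
next
  case (Cons s p)
  then show ?case by (cases s) auto
qed

text \<open>
  Composition in the localization does not depend on the zigzags that represent the arrows.
\<close>

lemma zigzag_equiv_append: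
  assumes W: "W \<subseteq> arrs C" and p: "zigzag C W x p y" "zigzag_equiv C W x y p p'"
    and q: "zigzag C W y q z" "zigzag_equiv C W y z q q'"
  shows "zigzag_equiv C W x z (p @ q) (p' @ q')"
proof -
  have "zigzag_equiv C W x z (p @ q) (p' @ q)"
    using p(2)
  proof (rule zigzag_equiv_map)
    fix r s assume "zigzag C W x r y" "zigzag C W x s y" "zstep C W r s"
    then show "zigzag_equiv C W x z (r @ q) (s @ q)"
      using zstep_context[of C W r s "[]" q] q(1) zigzag_append[OF W] by (intro zstep_equiv) auto
  qed
  moreover have "zigzag_equiv C W x z (p' @ q) (p' @ q')"
    using q(2)
  proof (rule zigzag_equiv_map)
    fix r s assume "zigzag C W y r z" "zigzag C W y s z" "zstep C W r s"
    then show "zigzag_equiv C W x z (p' @ r) (p' @ s)"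
      using zstep_context[of C W r s p' "[]"] zigzag_equiv_zigzag[OF p(2,1)] zigzag_append[OF W]
      by (intro zstep_equiv) auto
  qed
  ultimately show ?thesis by (rule zigzag_equiv_trans)
qed

end

definition zigzag_arrow ::
  "('o, 'a) category \<Rightarrow> 'a set \<Rightarrow> 'o \<Rightarrow> 'o \<Rightarrow> 'a step list \<Rightarrow> 'o \<times> 'o \<times> 'a step list set" where
  "zigzag_arrow C W x y p = (x, y, zclass C W x y p)"

lemma objs_localization [simp]: "objs (localization C W) = objs C"
  by (simp add: localization_def)

lemma idm_localization: "idm (localization C W) x = zigzag_arrow C W x x []"
  by (simp add: localization_def zigzag_arrow_def)

lemma hom_localization:
  "hom_set (localization C W) x y = {zigzag_arrow C W x y p | p. zigzag C W x p y}"
  by (auto simp: hom_set_def localization_def zigzag_arrow_def)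

lemma zigzag_arrow_hom:
  "zigzag C W x p y \<Longrightarrow> zigzag_arrow C W x y p \<in> hom_set (localization C W) x y"
  by (auto simp: hom_localization)

lemma zigzag_arrow_eq: "zigzag_arrow C W x y p = zigzag_arrow C W x y q \<longleftrightarrow> zigzag_equiv C W x y p q"
  by (simp add: zigzag_arrow_def zclass_eq)

lemma fob_localization_functor [simp]: "fob (localization_functor C W) x = x"
  by (simp add: localization_functor_def)

lemma far_localization_functor:
  "far (localization_functor C W) f = zigzag_arrow C W (src C f) (tgt C f) [Fwd f]"
  by (simp add: localization_functor_def zigzag_arrow_def)

locale cat_with_weq = cat C for C :: "('o, 'a) category" +
  fixes W :: "'a set"
  assumes W_arrs: "W \<subseteq> arrs C"
begin

abbreviation "CW \<equiv> localization C W"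
abbreviation "L \<equiv> localization_functor C W"

lemma cmp_zigzag_arrow:
  assumes "zigzag C W x p y" "zigzag C W y q z"
  shows "cmp CW (zigzag_arrow C W y z q) (zigzag_arrow C W x y p) = zigzag_arrow C W x z (p @ q)"
proof -
  have "zclass C W x z (p' @ q') = zclass C W x z (p @ q)"
    if "p' \<in> zclass C W x y p" "q' \<in> zclass C W y z q" for p' q'
    using zigzag_equiv_append[OF W_arrs assms(1) _ assms(2)] that by (metis mem_zclass zclass_eq)
  moreover have "p \<in> zclass C W x y p" "q \<in> zclass C W y z q"
    by (simp_all add: mem_zclass zigzag_equiv_refl)
  ultimately have "(\<Union>p \<in> zclass C W x y p. \<Union>q \<in> zclass C W y z q. zclass C W x z (p @ q)) =
      zclass C W x z (p @ q)"
    by blast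
  then show ?thesis by (simp add: localization_def zigzag_arrow_def)
qed

lemma cat_localization: "cat CW"
proof
  fix f assume f: "f \<in> arrs CW"
  then obtain x y p where "f = zigzag_arrow C W x y p" "zigzag C W x p y"
    by (auto simp: localization_def zigzag_arrow_def)
  then show "src CW f \<in> objs CW" "tgt CW f \<in> objs CW"
    using zigzag_objs[OF W_arrs] by (auto simp: localization_def zigzag_arrow_def)
next
  fix x assume "idm CW x \<in> arrs CW"
  then show "x \<in> objs CW"
    using zigzag_objs[OF W_arrs] by (auto simp: localization_def)
next
  fix x assume "x \<in> objs CW"
  then show "idm CW x \<in> hom_set CW x x"
    by (auto simp: idm_localization hom_localization intro!: exI[of _ "[]"])
next
  fix f x y g z assume fg: "f \<in> hom_set CW x y" "g \<in> hom_set CW y z"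
  then obtain p q where "f = zigzag_arrow C W x y p" "zigzag C W x p y" 
    "g = zigzag_arrow C W y z q" "zigzag C W y q z" by (auto simp: hom_localization)
  then show "cmp CW g f \<in> hom_set CW x z"
    using zigzag_append[OF W_arrs, of x p q z] by (auto simp: cmp_zigzag_arrow hom_localization)
next
  fix f x y assume "f \<in> hom_set CW x y"
  then obtain p where p: "f = zigzag_arrow C W x y p" "zigzag C W x p y"
    by (auto simp: hom_localization)
  note o = zigzag_objs[OF W_arrs p(2)]
  show "cmp CW (idm CW y) f = f" "cmp CW f (idm CW x) = f"
    using cmp_zigzag_arrow[of x p y "[]" y] cmp_zigzag_arrow[of x "[]" x p y] p o
    by (simp_all add: idm_localization)
next
  fix f x y g z h w
  assume "f \<in> hom_set CW x y" "g \<in> hom_set CW y z" "h \<in> hom_set CW z w"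
  then obtain p q r where p: "f = zigzag_arrow C W x y p" "zigzag C W x p y" 
    and q: "g = zigzag_arrow C W y z q" "zigzag C W y q z"
    and r: "h = zigzag_arrow C W z w r" "zigzag C W z r w" by (auto simp: hom_localization)
  have "zigzag C W y (q @ r) w" "zigzag C W x (p @ q) z"
    using p q r zigzag_append[OF W_arrs] by auto
  then show "cmp CW (cmp CW h g) f = cmp CW h (cmp CW g f)"
    using p q r cmp_zigzag_arrow[of x p y "q @ r" w] cmp_zigzag_arrow[of x "p @ q" z r w]
    by (simp add: cmp_zigzag_arrow)
qed

lemma zigzag_Fwd: "f \<in> hom_set C x y \<Longrightarrow> zigzag C W x [Fwd f] y"
  using hom_objs by (auto simp: hom_set_def)

lemma L_hom: "f \<in> hom_set C x y \<Longrightarrow> far L f \<in> hom_set CW x y"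
  using zigzag_Fwd by (auto simp: far_localization_functor hom_localization hom_setD)

lemma is_functor_L: "is_functor C CW L"
  unfolding is_functor_def
proof (intro conjI ballI impI)
  fix x assume x: "x \<in> objs C"
  then show "fob L x \<in> objs CW" by simp
  have i: "idm C x \<in> hom_set C x x" by (rule idm_hom[OF x])
  have "zigzag_equiv C W x x [Fwd (idm C x)] []"
    using zstep.intros(2)[of C W "[]" x "[]"] zigzag_Fwd[OF i] x by (intro zstep_equiv) auto
  then show "far L (idm C x) = idm CW (fob L x)"
    using hom_setD[OF i] by (simp add: far_localization_functor idm_localization zigzag_arrow_eq)
next
  fix f assume "f \<in> arrs C"
  then show "far L f \<in> hom_set CW (fob L (src C f)) (fob L (tgt C f))"
    using L_hom[OF arr_hom_set] by simp
next
  fix f g assume "f \<in> arrs C" "g \<in> arrs C" "src C g = tgt C f"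
  then have f: "f \<in> hom_set C (src C f) (tgt C f)" and g: "g \<in> hom_set C (tgt C f) (tgt C g)"
    by (auto simp: hom_set_def)
  note gf = cmp_hom[OF f g]
  have "zigzag_equiv C W (src C f) (tgt C g) [Fwd f, Fwd g] [Fwd (cmp C g f)]"
    using zstep.intros(1)[of C W "[]" f g "[]"] zigzag_append[OF W_arrs, of "src C f" "[Fwd f]" "[Fwd g]" "tgt C g"]
      zigzag_Fwd[OF f] zigzag_Fwd[OF g] zigzag_Fwd[OF gf] by (intro zstep_equiv) auto
  then show "far L (cmp C g f) = cmp CW (far L g) (far L f)"
    using cmp_zigzag_arrow[OF zigzag_Fwd[OF f] zigzag_Fwd[OF g]] hom_setD[OF gf] \<open>src C g = tgt C f\<close>
    by (metis append_Cons append_Nil far_localization_functor zigzag_arrow_eq)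
qed

lemma L_inverse:
  assumes "s \<in> W"
  shows "inverse_arrows CW (src C s) (tgt C s) (far L s) (zigzag_arrow C W (tgt C s) (src C s) [Bwd s])"
proof -
  have s: "s \<in> hom_set C (src C s) (tgt C s)" using assms W_arrs by (auto simp: hom_set_def)
  have F: "zigzag C W (src C s) [Fwd s] (tgt C s)" by (rule zigzag_Fwd[OF s])
  have B: "zigzag C W (tgt C s) [Bwd s] (src C s)" using assms hom_objs[OF s] by simp
  have "zigzag_equiv C W (src C s) (src C s) ([Fwd s] @ [Bwd s]) []"
    using zstep.intros(3)[OF assms, of C "[]" "[]"] zigzag_append[OF W_arrs] F B hom_objs[OF s]
    by (intro zstep_equiv) auto
  moreover have "zigzag_equiv C W (tgt C s) (tgt C s) ([Bwd s] @ [Fwd s]) []"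
    using zstep.intros(4)[OF assms, of C "[]" "[]"] zigzag_append[OF W_arrs] F B hom_objs[OF s]
    by (intro zstep_equiv) auto
  ultimately show ?thesis
    using L_hom[OF s] cmp_zigzag_arrow[OF F B] cmp_zigzag_arrow[OF B F] zigzag_arrow_hom[OF B]
    by (simp add: inverse_arrows_def far_localization_functor idm_localization zigzag_arrow_eq)
qed

text \<open>
  A zigzag is traversed step by step, so an arrow of the localization is a composite of arrows of
  \<open>C\<close> and inverses of arrows in \<open>W\<close>.
\<close>

lemma localization_induct:
  assumes "u \<in> hom_set CW x y"
    and "\<And>x. x \<in> objs C \<Longrightarrow> P x x (idm CW x)"
    and "\<And>x y z f u. f \<in> hom_set C x y \<Longrightarrow> u \<in> hom_set CW y z \<Longrightarrow> P y z u \<Longrightarrow> P x z (cmp CW u (far L f))"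
    and "\<And>x y z s t u. s \<in> W \<Longrightarrow> inverse_arrows CW y x (far L s) t \<Longrightarrow> s \<in> hom_set C y x \<Longrightarrow>
      u \<in> hom_set CW y z \<Longrightarrow> P y z u \<Longrightarrow> P x z (cmp CW u t)"
  shows "P x y u"
proof -
  have "P x y (zigzag_arrow C W x y p)" if "zigzag C W x p y" for p
    using that
  proof (induction p arbitrary: x)
    case Nil
    then show ?case using assms(2) by (auto simp: idm_localization)
  next
    case (Cons s p)
    show ?case
    proof (cases s)
      case (Fwd f)
      then have f: "f \<in> hom_set C x (tgt C f)" and p: "zigzag C W (tgt C f) p y"
        using Cons.prems by (auto simp: hom_set_def)
      show ?thesis
        using assms(3)[OF f _ Cons.IH[OF p]] cmp_zigzag_arrow[OF zigzag_Fwd[OF f] p] p hom_setD[OF f] Fwd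
        by (auto simp: hom_localization far_localization_functor)
    next
      case (Bwd t)
      then have t: "t \<in> W" "t \<in> hom_set C (src C t) x" and p: "zigzag C W (src C t) p y"
        using Cons.prems W_arrs by (auto simp: hom_set_def)
      have x: "tgt C t = x" using t(2) by (rule hom_setD)
      have "zigzag C W x [Bwd t] (src C t)" using t hom_objs[OF t(2)] x by simp
      then show ?thesis
        using assms(4)[OF t(1) L_inverse[OF t(1), unfolded x] t(2) _ Cons.IH[OF p]]
          cmp_zigzag_arrow[of x "[Bwd t]" "src C t" p y] p Bwd
        by (auto simp: hom_localization)
    qed
  qed
  then show ?thesis using assms(1) by (auto simp: hom_localization)
qed

end

fun zigzag_eval ::
  "('o, 'a) category \<Rightarrow> ('p, 'b) category \<Rightarrow> ('o, 'a, 'p, 'b) func \<Rightarrow> ('a \<Rightarrow> 'b) \<Rightarrow> 'o \<Rightarrow> 'a step list \<Rightarrow> 'b"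
where
  "zigzag_eval C D F i x [] = idm D (fob F x)"
| "zigzag_eval C D F i x (Fwd f # p) = cmp D (zigzag_eval C D F i (tgt C f) p) (far F f)"
| "zigzag_eval C D F i x (Bwd s # p) = cmp D (zigzag_eval C D F i (src C s) p) (i s)"

context cat_with_weq
begin

text \<open>The universal property: a functor that inverts \<open>W\<close> extends to the localization.\<close>

lemma localization_universal:
  assumes D: "cat D" and F: "is_functor C D F" and iso: "\<And>s. s \<in> W \<Longrightarrow> is_iso D (far F s)"
  shows "\<exists>G. is_functor CW D G \<and> (\<forall>x. fob G x = fob F x) \<and> (\<forall>f \<in> arrs C. far G (far L f) = far F f)"
proof -
  interpret D: cat D by fact
  have Fhom: "far F s \<in> hom_set D (fob F (src C s)) (fob F (tgt C s))" if "s \<in> arrs C" for s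
    using is_functor_hom[OF F arr_hom_set[OF that]] .
  have "\<exists>t. inverse_arrows D (fob F (src C s)) (fob F (tgt C s)) (far F s) t" if "s \<in> W" for s
    using iso[OF that] is_iso_hom[OF Fhom[of s]] that W_arrs by auto
  then obtain i where i: "\<And>s. s \<in> W \<Longrightarrow> inverse_arrows D (fob F (src C s)) (fob F (tgt C s)) (far F s) (i s)"
    by metis
  define ev where "ev = zigzag_eval C D F i"
  have ev_simps: "ev x [] = idm D (fob F x)" "ev x (Fwd f # p) = cmp D (ev (tgt C f) p) (far F f)"
    "ev x (Bwd s # p) = cmp D (ev (src C s) p) (i s)" for x f s p
    by (simp_all add: ev_def)
  have ev_hom: "ev x p \<in> hom_set D (fob F x) (fob F y)" if "zigzag C W x p y" for x p y
    using that
  proof (induction p arbitrary: x)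
    case Nil
    then show ?case using D.idm_hom is_functor_obj[OF F] by (auto simp: ev_simps)
  next
    case (Cons s p)
    show ?case
    proof (cases s)
      case (Fwd f)
      then show ?thesis using Cons D.cmp_hom[OF Fhom[of f] Cons.IH[of "tgt C f"]] by (auto simp: ev_simps)
    next
      case (Bwd t)
      then show ?thesis
        using Cons D.cmp_hom[OF inverse_arrowsD(2)[OF i[of t]] Cons.IH[of "src C t"]] by (auto simp: ev_simps)
    qed
  qed
  have ev_append: "ev x (p @ q) = cmp D (ev y q) (ev x p)" if "zigzag C W x p y" "zigzag C W y q z" for x p y q z
    using that(1)
  proof (induction p arbitrary: x)
    case Nil
    then show ?case using ev_hom[OF that(2)] D.cmp_idm_right by (simp add: ev_simps)
  next
    case (Cons s p)
    show ?case
    proof (cases s)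
      case (Fwd f)
      then have p: "zigzag C W (tgt C f) p y" and f: "far F f \<in> hom_set D (fob F x) (fob F (tgt C f))"
        using Cons.prems Fhom[of f] by auto
      show ?thesis using Fwd Cons.IH[OF p] D.cmp_assoc[OF f ev_hom[OF p] ev_hom[OF that(2)]]
        by (simp add: ev_simps)
    next
      case (Bwd t)
      then have p: "zigzag C W (src C t) p y" and f: "i t \<in> hom_set D (fob F x) (fob F (src C t))"
        using Cons.prems inverse_arrowsD(2)[OF i[of t]] by auto
      show ?thesis using Bwd Cons.IH[OF p] D.cmp_assoc[OF f ev_hom[OF p] ev_hom[OF that(2)]]
        by (simp add: ev_simps)
    qed
  qed
  have ev_middle: "ev x (p @ m @ q) = ev x (p @ m' @ q)"
    if z: "zigzag C W x (p @ m @ q) y" "zigzag C W x (p @ m' @ q) y"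
      and m: "\<And>a b b'. zigzag C W a m b \<Longrightarrow> zigzag C W a m' b' \<Longrightarrow> zigzag C W b q y \<Longrightarrow> b' = b \<and> ev a m = ev a m'"
    for x p m q m' y
  proof -
    obtain a where a: "zigzag C W x p a" "zigzag C W a (m @ q) y" using z(1) zigzag_append[OF W_arrs] by blast
    obtain a' where a': "zigzag C W x p a'" "zigzag C W a' (m' @ q) y" using z(2) zigzag_append[OF W_arrs] by blast
    have [simp]: "a' = a" by (rule zigzag_end_unique[OF a'(1) a(1)])
    obtain b where b: "zigzag C W a m b" "zigzag C W b q y" using a(2) zigzag_append[OF W_arrs] by blast
    obtain b' where b': "zigzag C W a m' b'" "zigzag C W b' q y" using a'(2) zigzag_append[OF W_arrs] by auto
    have [simp]: "b' = b" "ev a m = ev a m'" using m[OF b(1) b'(1) b(2)] by auto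
    have "ev a (m @ q) = ev a (m' @ q)"
      using ev_append[OF b] ev_append[OF b'] by simp
    then show ?thesis using ev_append[OF a] ev_append[OF a'] by simp
  qed
  have ev_step: "ev x r = ev x s" if "zigzag C W x r y" "zigzag C W x s y" "zstep C W r s" for x y r s
    using that(3)
  proof cases
    case (1 p f g q)
    show ?thesis
      unfolding 1
    proof (rule ev_middle)
      show "zigzag C W x (p @ [Fwd f, Fwd g] @ q) y" "zigzag C W x (p @ [Fwd (cmp C g f)] @ q) y"
        using that 1 by auto
      fix a b b' assume z: "zigzag C W a [Fwd f, Fwd g] b" "zigzag C W a [Fwd (cmp C g f)] b'"
      then have f: "f \<in> hom_set C a (tgt C f)" and g: "g \<in> hom_set C (tgt C f) b" by (auto simp: hom_set_def)
      note gf = cmp_hom[OF f g]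
      have "b' = b" using zigzag_end_unique[OF z(2) zigzag_Fwd[OF gf]] .
      moreover have "ev a [Fwd f, Fwd g] = ev a [Fwd (cmp C g f)]"
        using hom_setD[OF gf] hom_setD[OF f] hom_setD[OF g] is_functor_cmp[OF F f g] is_functor_hom[OF F f]
          is_functor_hom[OF F g] is_functor_hom[OF F gf] D.cmp_idm_left
        by (auto simp: ev_simps)
      ultimately show "b' = b \<and> ev a [Fwd f, Fwd g] = ev a [Fwd (cmp C g f)]" by simp
    qed
  next
    case (2 p w q)
    have "ev x (p @ [Fwd (idm C w)] @ q) = ev x (p @ [] @ q)"
    proof (rule ev_middle)
      show "zigzag C W x (p @ [Fwd (idm C w)] @ q) y" "zigzag C W x (p @ [] @ q) y"
        using that 2 by auto
      fix a b b' assume z: "zigzag C W a [Fwd (idm C w)] b" "zigzag C W a [] b'" "zigzag C W b q y"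
      have "w \<in> objs C" using z(1) idm_objs by auto
      then have "idm C w \<in> hom_set C w w" by (rule idm_hom)
      then show "b' = b \<and> ev a [Fwd (idm C w)] = ev a []"
        using z(1,2) is_functor_idm[OF F \<open>w \<in> objs C\<close>] D.cmp_idm_left[OF D.idm_hom] is_functor_obj[OF F]
        by (auto simp: ev_simps hom_setD)
    qed
    then show ?thesis using 2 by simp
  next
    case (3 t p q)
    have "ev x (p @ [Fwd t, Bwd t] @ q) = ev x (p @ [] @ q)"
    proof (rule ev_middle)
      show "zigzag C W x (p @ [Fwd t, Bwd t] @ q) y" "zigzag C W x (p @ [] @ q) y"
        using that 3 by auto
      fix a b b' assume z: "zigzag C W a [Fwd t, Bwd t] b" "zigzag C W a [] b'"
      then show "b' = b \<and> ev a [Fwd t, Bwd t] = ev a []"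
        using inverse_arrowsD[OF i[OF 3(3)]] D.cmp_idm_left by (auto simp: ev_simps)
    qed
    then show ?thesis using 3 by simp
  next
    case (4 t p q)
    have "ev x (p @ [Bwd t, Fwd t] @ q) = ev x (p @ [] @ q)"
    proof (rule ev_middle)
      show "zigzag C W x (p @ [Bwd t, Fwd t] @ q) y" "zigzag C W x (p @ [] @ q) y"
        using that 4 by auto
      fix a b b' assume z: "zigzag C W a [Bwd t, Fwd t] b" "zigzag C W a [] b'"
      then show "b' = b \<and> ev a [Bwd t, Fwd t] = ev a []"
        using inverse_arrowsD[OF i[OF 4(3)]] D.cmp_idm_left by (auto simp: ev_simps)
    qed
    then show ?thesis using 4 by simp
  qed
  have ev_some: "ev x (SOME q. q \<in> zclass C W x y p) = ev x p" for x y p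
  proof -
    have "(SOME q. q \<in> zclass C W x y p) \<in> zclass C W x y p"
      by (rule someI[of _ p]) (simp add: mem_zclass zigzag_equiv_refl)
    then show ?thesis using zigzag_equiv_invariant[of C W x y p _ "ev x"] ev_step by (metis mem_zclass)
  qed
  define G where "G = \<lparr>fob = fob F, far = (\<lambda>(x, y :: 'o, u). ev x (SOME p. p \<in> u))\<rparr>"
  have G: "far G (zigzag_arrow C W x y p) = ev x p" "fob G x = fob F x" for x y p
    by (simp_all add: G_def zigzag_arrow_def ev_some)
  have "is_functor CW D G"
    unfolding is_functor_def
  proof (intro conjI ballI impI)
    fix x assume "x \<in> objs CW"
    then show "fob G x \<in> objs D" "far G (idm CW x) = idm D (fob G x)"
      using is_functor_obj[OF F] by (simp_all add: G idm_localization ev_simps)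
  next
    fix u assume "u \<in> arrs CW"
    then obtain x y p where u: "u = zigzag_arrow C W x y p" "zigzag C W x p y"
      by (auto simp: localization_def zigzag_arrow_def)
    then show "far G u \<in> hom_set D (fob G (src CW u)) (fob G (tgt CW u))"
      using ev_hom[OF u(2)] G by (simp add: localization_def zigzag_arrow_def)
  next
    fix u v assume "u \<in> arrs CW" "v \<in> arrs CW" "src CW v = tgt CW u"
    then obtain x y z p q where u: "u = zigzag_arrow C W x y p" "zigzag C W x p y"
      and v: "v = zigzag_arrow C W y z q" "zigzag C W y q z"
      by (auto simp: localization_def zigzag_arrow_def)
    show "far G (cmp CW v u) = cmp D (far G v) (far G u)"
      using cmp_zigzag_arrow[OF u(2) v(2)] ev_append[OF u(2) v(2)] u v G by simp
  qed
  moreover have "far G (far L f) = far F f" if "f \<in> arrs C" for f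
    using Fhom[OF that] D.cmp_idm_left by (simp add: far_localization_functor G ev_simps)
  ultimately show ?thesis using G(2) by blast
qed

end

section \<open>Cohomology and the derived category\<close>

context cat
begin

lemma zero_arrow_cmp_left:
  assumes "zero_arrow C f" "f \<in> hom_set C x y" "g \<in> hom_set C y z"
  shows "zero_arrow C (cmp C g f)"
proof -
  interpret op: cat "opposite C" by (rule cat_opposite) (rule cat_axioms)
  show ?thesis using op.zero_arrow_cmp_right[of f y x g z] assms by simp
qed

lemma is_cokernelD:
  assumes "is_cokernel C f q"
  shows "f \<in> hom_set C (src C f) (tgt C f)" "q \<in> hom_set C (tgt C f) (tgt C q)"
    "zero_arrow C (cmp C q f)"
    "\<lbrakk>g \<in> hom_set C (tgt C f) v; zero_arrow C (cmp C g f)\<rbrakk> \<Longrightarrow>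
       \<exists>u. u \<in> hom_set C (tgt C q) v \<and> cmp C u q = g"
proof -
  interpret op: cat "opposite C" by (rule cat_opposite) (rule cat_axioms)
  note k = op.is_kernelD[of f q]
  show "f \<in> hom_set C (src C f) (tgt C f)" "q \<in> hom_set C (tgt C f) (tgt C q)"
    "zero_arrow C (cmp C q f)"
    using k(1-3) assms by simp_all
  show "\<lbrakk>g \<in> hom_set C (tgt C f) v; zero_arrow C (cmp C g f)\<rbrakk> \<Longrightarrow>
       \<exists>u. u \<in> hom_set C (tgt C q) v \<and> cmp C u q = g"
    using k(4)[of g v] assms by simp
qed

lemma cokernel_epi:
  assumes "is_cokernel C f q" "u \<in> hom_set C (tgt C q) v" "u' \<in> hom_set C (tgt C q) v"
    "cmp C u q = cmp C u' q"
  shows "u = u'"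
proof -
  interpret op: cat "opposite C" by (rule cat_opposite) (rule cat_axioms)
  show ?thesis using op.kernel_mono[of f q u v u'] assms by simp
qed

end

definition cohomology_map_between ::
  "('o, 'a) category \<Rightarrow> 'a \<Rightarrow> 'a \<Rightarrow> 'a \<Rightarrow> 'a \<Rightarrow> 'a \<Rightarrow> 'a \<Rightarrow> bool" where
  "cohomology_map_between C k q k' q' g h \<longleftrightarrow>
     (\<exists>a. a \<in> hom_set C (src C k) (src C k') \<and> cmp C k' a = cmp C g k \<and>
        h \<in> hom_set C (tgt C q) (tgt C q') \<and> cmp C h q = cmp C q' a)"

lemma is_cohomology_map_iff:
  "is_cohomology_map C K L f i h \<longleftrightarrow>
     (\<exists>k q k' q'. cohomology_data C K i k q \<and> cohomology_data C L i k' q' \<and>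
        cohomology_map_between C k q k' q' (f i) h)"
  unfolding is_cohomology_map_def cohomology_map_between_def by blast

lemma objs_complex_category [simp]: "objs (complex_category C) = {K. bounded_complex C K}"
  by (simp add: complex_category_def)

lemma hom_complex_category:
  "hom_set (complex_category C) K L = {(K, L, f) | f. bounded_complex C K \<and> bounded_complex C L \<and>
     (\<forall>i. f i \<in> hom_set C (cob K i) (cob L i)) \<and>
     (\<forall>i. cmp C (f (i + 1)) (cdiff K i) = cmp C (cdiff L i) (f i))}"
  by (auto simp: hom_set_def complex_category_def)

lemma idm_complex_category: "idm (complex_category C) K = (K, K, \<lambda>i. idm C (cob K i))"
  by (simp add: complex_category_def)

lemma cmp_complex_category:
  "cmp (complex_category C) (L, P, g) (K, L', f) = (K, P, \<lambda>i. cmp C (g i) (f i))"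
  by (simp add: complex_category_def)

lemma bounded_complexD:
  assumes "bounded_complex C K"
  shows "cob K i \<in> objs C" "cdiff K i \<in> hom_set C (cob K i) (cob K (i + 1))"
    "zero_arrow C (cmp C (cdiff K (i + 1)) (cdiff K i))"
  using assms by (auto simp: bounded_complex_def)

lemma cat_complex_category:
  assumes "cat C"
  shows "cat (complex_category C)"
proof -
  interpret cat C by fact
  let ?D = "complex_category C"
  show ?thesis
  proof
    fix F assume "F \<in> arrs ?D"
    then show "src ?D F \<in> objs ?D" "tgt ?D F \<in> objs ?D" by (auto simp: complex_category_def)
  next
    fix K assume "idm ?D K \<in> arrs ?D"
    then show "K \<in> objs ?D" by (auto simp: complex_category_def)
  next
    fix K assume "K \<in> objs ?D"
    then show "idm ?D K \<in> hom_set ?D K K"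
      using idm_hom bounded_complexD(1)[of C K] cmp_idm_left[OF bounded_complexD(2), of K]
        cmp_idm_right[OF bounded_complexD(2), of K]
      by (simp add: hom_complex_category idm_complex_category)
  next
    fix F G K L P assume "F \<in> hom_set ?D K L" "G \<in> hom_set ?D L P"
    then obtain f g where f: "F = (K, L, f)" "bounded_complex C K" "bounded_complex C L"
      "\<And>i. f i \<in> hom_set C (cob K i) (cob L i)"
      "\<And>i. cmp C (f (i + 1)) (cdiff K i) = cmp C (cdiff L i) (f i)"
      and g: "G = (L, P, g)" "bounded_complex C P" "\<And>i. g i \<in> hom_set C (cob L i) (cob P i)"
      "\<And>i. cmp C (g (i + 1)) (cdiff L i) = cmp C (cdiff P i) (g i)"
      by (auto simp: hom_complex_category)
    have "cmp C (cmp C (g (i + 1)) (f (i + 1))) (cdiff K i) = cmp C (cdiff P i) (cmp C (g i) (f i))" for i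
      using cmp_assoc[OF bounded_complexD(2)[OF f(2)] f(4) g(3), of i] f(5)[of i] g(4)[of i]
        cmp_assoc[OF f(4) bounded_complexD(2)[OF f(3)] g(3), of i]
        cmp_assoc[OF f(4) g(3) bounded_complexD(2)[OF g(2)], of i] by simp
    then show "cmp ?D G F \<in> hom_set ?D K P"
      using f g cmp_hom[OF f(4) g(3)] by (simp add: hom_complex_category cmp_complex_category)
  next
    fix F K L assume "F \<in> hom_set ?D K L"
    then obtain f where f: "F = (K, L, f)" "\<And>i. f i \<in> hom_set C (cob K i) (cob L i)"
      by (auto simp: hom_complex_category)
    show "cmp ?D (idm ?D L) F = F" "cmp ?D F (idm ?D K) = F"
      using cmp_idm_left[OF f(2)] cmp_idm_right[OF f(2)] f(1)
      by (simp_all add: idm_complex_category cmp_complex_category)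
  next
    fix F K L G P H R assume "F \<in> hom_set ?D K L" "G \<in> hom_set ?D L P" "H \<in> hom_set ?D P R"
    then obtain f g h where eq: "F = (K, L, f)" "G = (L, P, g)" "H = (P, R, h)"
      and hom: "\<And>i. f i \<in> hom_set C (cob K i) (cob L i)" "\<And>i. g i \<in> hom_set C (cob L i) (cob P i)"
      "\<And>i. h i \<in> hom_set C (cob P i) (cob R i)"
      by (auto simp: hom_complex_category)
    show "cmp ?D (cmp ?D H G) F = cmp ?D H (cmp ?D G F)"
      using cmp_assoc[OF hom] eq by (simp add: cmp_complex_category)
  qed
qed

text \<open>
  Kernels and cokernels are all that the definition of cohomology uses.
\<close>

lemma cohomology_data_preserved:
  assumes "is_functor C D F" "preserves_kernels C D F" "preserves_cokernels C D F"
    and "cat C" "bounded_complex C K" "cohomology_data C K i k q"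
  shows "cohomology_data D (map_cochain F K) i (far F k) (far F q)"
proof -
  interpret cat C by fact
  have d: "cdiff K i \<in> hom_set C (cob K i) (cob K (i + 1))" by (rule bounded_complexD[OF assms(5)])
  obtain u where k: "is_kernel C (cdiff K i) k" and u: "u \<in> hom_set C (cob K (i - 1)) (src C k)"
    "cmp C k u = cdiff K (i - 1)" "is_cokernel C u q"
    using assms(6) by (auto simp: cohomology_data_def)
  have khom: "k \<in> hom_set C (src C k) (cob K i)" using is_kernelD(2)[OF k] hom_setD(2)[OF d] by simp
  have "src D (far F k) = fob F (src C k)"
    using is_functor_hom[OF assms(1) khom] by (simp add: hom_set_def)
  then show ?thesis
    unfolding cohomology_data_def
    using k u assms(2,3) is_functor_hom[OF assms(1) u(1)] is_functor_cmp[OF assms(1) u(1) khom]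
    by (auto simp: map_cochain_def preserves_kernels_def preserves_cokernels_def)
qed

context cat
begin

lemma cohomology_dataD:
  assumes "bounded_complex C K" "cohomology_data C K i k q"
  obtains u where "is_kernel C (cdiff K i) k" "k \<in> hom_set C (src C k) (cob K i)"
    "u \<in> hom_set C (cob K (i - 1)) (src C k)" "cmp C k u = cdiff K (i - 1)"
    "is_cokernel C u q" "q \<in> hom_set C (src C k) (tgt C q)"
proof -
  have d: "cdiff K i \<in> hom_set C (cob K i) (cob K (i + 1))" by (rule bounded_complexD[OF assms(1)])
  obtain u where k: "is_kernel C (cdiff K i) k" and u: "u \<in> hom_set C (cob K (i - 1)) (src C k)"
    "cmp C k u = cdiff K (i - 1)" "is_cokernel C u q"
    using assms(2) by (auto simp: cohomology_data_def)
  show thesis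
    using that[OF k _ u] is_kernelD(2)[OF k] hom_setD(2)[OF d] is_cokernelD(2)[OF u(3)] hom_setD(3)[OF u(1)]
    by simp
qed

lemma cohomology_data_exists:
  assumes ker: "\<And>f. f \<in> arrs C \<Longrightarrow> \<exists>k. is_kernel C f k"
    and coker: "\<And>f. f \<in> arrs C \<Longrightarrow> \<exists>q. is_cokernel C f q"
    and K: "bounded_complex C K"
  shows "\<exists>k q. cohomology_data C K i k q"
proof -
  have d: "cdiff K i \<in> hom_set C (cob K i) (cob K (i + 1))"
    "cdiff K (i - 1) \<in> hom_set C (cob K (i - 1)) (cob K i)"
    using bounded_complexD(2)[OF K, of i] bounded_complexD(2)[OF K, of "i - 1"] by simp_all
  obtain k where k: "is_kernel C (cdiff K i) k" using ker hom_setD(1)[OF d(1)] by blast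
  have "zero_arrow C (cmp C (cdiff K i) (cdiff K (i - 1)))"
    using bounded_complexD(3)[OF K, of "i - 1"] by simp
  then obtain u where u: "u \<in> hom_set C (cob K (i - 1)) (src C k)" "cmp C k u = cdiff K (i - 1)"
    using is_kernelD(4)[OF k, of "cdiff K (i - 1)" "cob K (i - 1)"] d(2) hom_setD(2)[OF d(1)] by auto
  obtain q where "is_cokernel C u q" using coker hom_setD(1)[OF u(1)] by blast
  then show ?thesis using k u by (auto simp: cohomology_data_def)
qed

lemma cohomology_map_exists:
  assumes f: "(K, L, f) \<in> hom_set (complex_category C) K L"
    and kq: "cohomology_data C K i k q" and kq': "cohomology_data C L i k' q'"
  shows "\<exists>h. cohomology_map_between C k q k' q' (f i) h"
proof -
  have K: "bounded_complex C K" and L: "bounded_complex C L"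
    and fh: "\<And>i. f i \<in> hom_set C (cob K i) (cob L i)"
    and fd: "\<And>i. cmp C (f (i + 1)) (cdiff K i) = cmp C (cdiff L i) (f i)"
    using f by (auto simp: hom_complex_category)
  obtain u where k: "is_kernel C (cdiff K i) k" "k \<in> hom_set C (src C k) (cob K i)"
    and u: "u \<in> hom_set C (cob K (i - 1)) (src C k)" "cmp C k u = cdiff K (i - 1)"
    and q: "is_cokernel C u q" "q \<in> hom_set C (src C k) (tgt C q)"
    by (rule cohomology_dataD[OF K kq])
  obtain u' where k': "is_kernel C (cdiff L i) k'" "k' \<in> hom_set C (src C k') (cob L i)"
    and u': "u' \<in> hom_set C (cob L (i - 1)) (src C k')" "cmp C k' u' = cdiff L (i - 1)"
    and q': "is_cokernel C u' q'" "q' \<in> hom_set C (src C k') (tgt C q')"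
    by (rule cohomology_dataD[OF L kq'])
  note dK = bounded_complexD(2)[OF K, of i] and dL = bounded_complexD(2)[OF L, of i]
  have fk: "cmp C (f i) k \<in> hom_set C (src C k) (cob L i)" by (rule cmp_hom[OF k(2) fh])
  have "cmp C (cdiff L i) (cmp C (f i) k) = cmp C (f (i + 1)) (cmp C (cdiff K i) k)"
    using cmp_assoc[OF k(2) fh dL] cmp_assoc[OF k(2) dK fh] fd[of i] by simp
  moreover have "zero_arrow C (cmp C (f (i + 1)) (cmp C (cdiff K i) k))"
    by (rule zero_arrow_cmp_left[OF is_kernelD(3)[OF k(1)] cmp_hom[OF k(2) dK] fh])
  ultimately obtain a where a: "a \<in> hom_set C (src C k) (src C k')" "cmp C k' a = cmp C (f i) k"
    using is_kernelD(4)[OF k'(1), of "cmp C (f i) k" "src C k"] fk hom_setD(2)[OF dL] by auto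
  have f': "f (i - 1) \<in> hom_set C (cob K (i - 1)) (cob L (i - 1))" by (rule fh)
  have "cmp C k' (cmp C a u) = cmp C (cmp C (f i) k) u"
    using cmp_assoc[OF u(1) a(1) k'(2)] a(2) by simp
  also have "\<dots> = cmp C (f i) (cdiff K (i - 1))" using cmp_assoc[OF u(1) k(2) fh] u(2) by simp
  also have "\<dots> = cmp C (cdiff L (i - 1)) (f (i - 1))" using fd[of "i - 1"] by simp
  also have "\<dots> = cmp C k' (cmp C u' (f (i - 1)))" using cmp_assoc[OF f' u'(1) k'(2)] u'(2) by simp
  finally have au: "cmp C a u = cmp C u' (f (i - 1))"
    by (rule kernel_mono[OF k'(1) cmp_hom[OF u(1) a(1)] cmp_hom[OF f' u'(1)]])
  have "cmp C (cmp C q' a) u = cmp C (cmp C q' u') (f (i - 1))"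
    using cmp_assoc[OF u(1) a(1) q'(2)] cmp_assoc[OF f' u'(1) q'(2)] au by simp
  moreover have "zero_arrow C (cmp C (cmp C q' u') (f (i - 1)))"
    by (rule zero_arrow_cmp_right[OF is_cokernelD(3)[OF q'(1)] cmp_hom[OF u'(1) q'(2)] f'])
  ultimately obtain h where "h \<in> hom_set C (tgt C q) (tgt C q')" "cmp C h q = cmp C q' a"
    using is_cokernelD(4)[OF q(1), of "cmp C q' a" "tgt C q'"] cmp_hom[OF a(1) q'(2)] hom_setD(3)[OF u(1)] by auto
  then show ?thesis using a by (auto simp: cohomology_map_between_def)
qed

lemma cohomology_map_unique:
  assumes K: "bounded_complex C K" "cohomology_data C K i k q"
    and L: "bounded_complex C L" "cohomology_data C L i k' q'"
    and h: "cohomology_map_between C k q k' q' g h" "cohomology_map_between C k q k' q' g h'"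
  shows "h = h'"
proof -
  obtain u where q: "is_cokernel C u q" by (rule cohomology_dataD[OF K])
  obtain d where k': "is_kernel C d k'" by (rule cohomology_dataD[OF L])
  obtain a where a: "a \<in> hom_set C (src C k) (src C k')" "cmp C k' a = cmp C g k"
    "h \<in> hom_set C (tgt C q) (tgt C q')" "cmp C h q = cmp C q' a"
    using h(1) by (auto simp: cohomology_map_between_def)
  obtain a' where a': "a' \<in> hom_set C (src C k) (src C k')" "cmp C k' a' = cmp C g k"
    "h' \<in> hom_set C (tgt C q) (tgt C q')" "cmp C h' q = cmp C q' a'"
    using h(2) by (auto simp: cohomology_map_between_def)
  have "a = a'" using kernel_mono[OF k' a(1) a'(1)] a(2) a'(2) by simp
  then show ?thesis using cokernel_epi[OF q a(3) a'(3)] a(4) a'(4) by simp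
qed

lemma cohomology_map_idm:
  assumes K: "bounded_complex C K" "cohomology_data C K i k q"
  shows "cohomology_map_between C k q k q (idm C (cob K i)) (idm C (tgt C q))"
proof -
  obtain u where k: "k \<in> hom_set C (src C k) (cob K i)" and q: "q \<in> hom_set C (src C k) (tgt C q)"
    by (rule cohomology_dataD[OF K])
  show ?thesis
    unfolding cohomology_map_between_def
    using cmp_idm_left[OF k] cmp_idm_right[OF k] cmp_idm_left[OF q] cmp_idm_right[OF q]
      idm_hom[OF hom_objs(1)[OF k]] idm_hom[OF hom_objs(2)[OF q]]
    by (intro exI[of _ "idm C (src C k)"]) simp
qed

lemma cohomology_map_cmp:
  assumes K: "bounded_complex C K" "cohomology_data C K i k q"
    and L: "bounded_complex C L" "cohomology_data C L i k' q'"
    and P: "bounded_complex C P" "cohomology_data C P i k'' q''"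
    and g: "g \<in> hom_set C (cob K i) (cob L i)" "g' \<in> hom_set C (cob L i) (cob P i)"
    and h: "cohomology_map_between C k q k' q' g h" "cohomology_map_between C k' q' k'' q'' g' h'"
  shows "cohomology_map_between C k q k'' q'' (cmp C g' g) (cmp C h' h)"
proof -
  obtain u where k: "k \<in> hom_set C (src C k) (cob K i)" and q: "q \<in> hom_set C (src C k) (tgt C q)"
    by (rule cohomology_dataD[OF K])
  obtain u' where k': "k' \<in> hom_set C (src C k') (cob L i)" and q': "q' \<in> hom_set C (src C k') (tgt C q')"
    by (rule cohomology_dataD[OF L])
  obtain u'' where k'': "k'' \<in> hom_set C (src C k'') (cob P i)" and q'': "q'' \<in> hom_set C (src C k'') (tgt C q'')"
    by (rule cohomology_dataD[OF P])
  obtain a where a: "a \<in> hom_set C (src C k) (src C k')" "cmp C k' a = cmp C g k"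
    "h \<in> hom_set C (tgt C q) (tgt C q')" "cmp C h q = cmp C q' a"
    using h(1) by (auto simp: cohomology_map_between_def)
  obtain a' where a': "a' \<in> hom_set C (src C k') (src C k'')" "cmp C k'' a' = cmp C g' k'"
    "h' \<in> hom_set C (tgt C q') (tgt C q'')" "cmp C h' q' = cmp C q'' a'"
    using h(2) by (auto simp: cohomology_map_between_def)
  have "cmp C k'' (cmp C a' a) = cmp C (cmp C g' g) k"
    using cmp_assoc[OF a(1) a'(1) k''] cmp_assoc[OF a(1) k' g(2)] cmp_assoc[OF k g(1) g(2)] a(2) a'(2) by simp
  moreover have "cmp C (cmp C h' h) q = cmp C q'' (cmp C a' a)"
    using cmp_assoc[OF q a(3) a'(3)] cmp_assoc[OF a(1) q' a'(3)] cmp_assoc[OF a(1) a'(1) q''] a(4) a'(4) by simp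
  ultimately show ?thesis
    using cmp_hom[OF a(1) a'(1)] cmp_hom[OF a(3) a'(3)] by (auto simp: cohomology_map_between_def)
qed

text \<open>Two choices of kernel and cokernel for the same complex have canonically isomorphic cohomology.\<close>

lemma cohomology_comparison:
  assumes K: "bounded_complex C K" and kq: "cohomology_data C K i k q" and kq': "cohomology_data C K i k' q'"
  shows "\<exists>j j'. inverse_arrows C (tgt C q) (tgt C q') j j' \<and>
    cohomology_map_between C k q k' q' (idm C (cob K i)) j"
proof -
  interpret cc: cat "complex_category C" by (rule cat_complex_category) (rule cat_axioms)
  let ?id = "idm C (cob K i)"
  have I: "(K, K, \<lambda>i. idm C (cob K i)) \<in> hom_set (complex_category C) K K"
    using cc.idm_hom[of K] K by (simp add: idm_complex_category)
  have id: "?id \<in> hom_set C (cob K i) (cob K i)" "cmp C ?id ?id = ?id"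
    using idm_hom[OF bounded_complexD(1)[OF K]] cmp_idm_left by auto
  obtain j where j: "cohomology_map_between C k q k' q' ?id j"
    using cohomology_map_exists[OF I kq kq'] by blast
  obtain j' where j': "cohomology_map_between C k' q' k q ?id j'"
    using cohomology_map_exists[OF I kq' kq] by blast
  have "cmp C j' j = idm C (tgt C q)"
    using cohomology_map_unique[OF K kq K kq _ cohomology_map_idm[OF K kq]]
      cohomology_map_cmp[OF K kq K kq' K kq id(1,1) j j'] id(2) by simp
  moreover have "cmp C j j' = idm C (tgt C q')"
    using cohomology_map_unique[OF K kq' K kq' _ cohomology_map_idm[OF K kq']]
      cohomology_map_cmp[OF K kq' K kq K kq' id(1,1) j' j] id(2) by simp
  moreover have "j \<in> hom_set C (tgt C q) (tgt C q')" "j' \<in> hom_set C (tgt C q') (tgt C q)"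
    using j j' by (auto simp: cohomology_map_between_def)
  ultimately show ?thesis using j by (auto simp: inverse_arrows_def)
qed

lemma is_cohomology_unique:
  assumes "bounded_complex C K" "is_cohomology C K i H" "is_cohomology C K i H'"
  shows "isomorphic C H H'"
proof -
  obtain k q k' q' where "cohomology_data C K i k q" "tgt C q = H" "cohomology_data C K i k' q'" "tgt C q' = H'"
    using assms(2,3) by (auto simp: is_cohomology_def)
  then show ?thesis
    using cohomology_comparison[OF assms(1), of i k q k' q'] unfolding isomorphic_iff by blast
qed

lemma quasi_isos_arrs: "quasi_isos C \<subseteq> arrs (complex_category C)"
  by (auto simp: quasi_isos_def)

text \<open>
  Cohomology is a functor on complexes that inverts quasi-isomorphisms, so it is defined on the
  derived category, and isomorphic objects there have isomorphic cohomology.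
\<close>

lemma derived_isomorphic_cohomology:
  assumes ker: "\<And>f. f \<in> arrs C \<Longrightarrow> \<exists>k. is_kernel C f k"
    and coker: "\<And>f. f \<in> arrs C \<Longrightarrow> \<exists>q. is_cokernel C f q"
    and iso: "isomorphic (derived_category C) K L"
    and H: "is_cohomology C K i H" "is_cohomology C L i H'"
  shows "isomorphic C H H'"
proof -
  let ?D = "complex_category C"
  interpret cc: cat ?D by (rule cat_complex_category) (rule cat_axioms)
  interpret dc: cat_with_weq ?D "quasi_isos C"
    by (intro cat_with_weq.intro cat_with_weq_axioms.intro cc.cat_axioms quasi_isos_arrs)
  have "\<exists>k q. bounded_complex C K \<longrightarrow> cohomology_data C K i k q" for K
    using cohomology_data_exists[OF ker coker] by blast
  then obtain k q where kq: "\<And>K. bounded_complex C K \<Longrightarrow> cohomology_data C K i (k K) (q K)"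
    by metis
  define \<H> where "\<H> = \<lparr>fob = (\<lambda>K. tgt C (q K)),
    far = (\<lambda>(K, L, f). THE h. cohomology_map_between C (k K) (q K) (k L) (q L) (f i) h)\<rparr>"
  have far_eq: "far \<H> (K, L, f) = h"
    if "bounded_complex C K" "bounded_complex C L" "cohomology_map_between C (k K) (q K) (k L) (q L) (f i) h"
    for K L f h
  proof -
    have "(THE h. cohomology_map_between C (k K) (q K) (k L) (q L) (f i) h) = h"
      using that(3) by (rule the_equality)
        (rule cohomology_map_unique[OF that(1) kq[OF that(1)] that(2) kq[OF that(2)] _ that(3)])
    then show ?thesis by (simp add: \<H>_def)
  qed
  have far_map: "cohomology_map_between C (k K) (q K) (k L) (q L) (f i) (far \<H> (K, L, f))"
    if KLf: "(K, L, f) \<in> hom_set ?D K L" for K L f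
  proof -
    have "bounded_complex C K" "bounded_complex C L" using that by (auto simp: hom_complex_category)
    then obtain h where "cohomology_map_between C (k K) (q K) (k L) (q L) (f i) h"
      using cohomology_map_exists[OF KLf kq kq] by blast
    then show ?thesis using far_eq[OF \<open>bounded_complex C K\<close> \<open>bounded_complex C L\<close>] by simp
  qed
  have "is_functor ?D C \<H>"
    unfolding is_functor_def
  proof (intro conjI ballI impI)
    fix K assume "K \<in> objs ?D"
    then have K: "bounded_complex C K" by simp
    note id = cohomology_map_idm[OF K kq[OF K]]
    show "fob \<H> K \<in> objs C"
      using id hom_objs(1)[of "idm C (tgt C (q K))"] by (auto simp: \<H>_def cohomology_map_between_def)
    show "far \<H> (idm ?D K) = idm C (fob \<H> K)"
      using far_eq[OF K K, of "\<lambda>i. idm C (cob K i)"] id by (simp add: idm_complex_category \<H>_def)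
  next
    fix F assume "F \<in> arrs ?D"
    then obtain K L f where F: "F = (K, L, f)" "F \<in> hom_set ?D K L"
      by (auto simp: complex_category_def hom_set_def)
    then show "far \<H> F \<in> hom_set C (fob \<H> (src ?D F)) (fob \<H> (tgt ?D F))"
      using far_map[of K L f] hom_setD[OF F(2)]
      by (auto simp: cohomology_map_between_def \<H>_def)
  next
    fix F G assume "F \<in> arrs ?D" "G \<in> arrs ?D" "src ?D G = tgt ?D F"
    then obtain K L P f g where F: "F = (K, L, f)" "(K, L, f) \<in> hom_set ?D K L"
      and G: "G = (L, P, g)" "(L, P, g) \<in> hom_set ?D L P"
      by (auto simp: complex_category_def hom_set_def)
    have b: "bounded_complex C K" "bounded_complex C L" "bounded_complex C P"
      and fg: "f i \<in> hom_set C (cob K i) (cob L i)" "g i \<in> hom_set C (cob L i) (cob P i)"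
      using F G by (auto simp: hom_complex_category)
    show "far \<H> (cmp ?D G F) = cmp C (far \<H> G) (far \<H> F)"
      using far_eq[OF b(1,3)] cohomology_map_cmp[OF b(1) kq[OF b(1)] b(2) kq[OF b(2)] b(3) kq[OF b(3)] fg
          far_map[OF F(2)] far_map[OF G(2)]] F(1) G(1)
      by (simp add: cmp_complex_category)
  qed
  moreover have "is_iso C (far \<H> s)" if s: "s \<in> quasi_isos C" for s
  proof -
    obtain K L f h where f: "s = (K, L, f)" "(K, L, f) \<in> arrs ?D" and h: "is_cohomology_map C K L f i h" "is_iso C h"
      using s by (force simp: quasi_isos_def)
    have fh: "(K, L, f) \<in> hom_set ?D K L" using f by (auto simp: complex_category_def hom_set_def)
    have K: "bounded_complex C K" and L: "bounded_complex C L" and fi: "f i \<in> hom_set C (cob K i) (cob L i)"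
      using fh by (auto simp: hom_complex_category)
    obtain k1 q1 k2 q2 where 1: "cohomology_data C K i k1 q1" and 2: "cohomology_data C L i k2 q2"
      and hm: "cohomology_map_between C k1 q1 k2 q2 (f i) h"
      using h(1) by (auto simp: is_cohomology_map_iff)
    have hh: "h \<in> hom_set C (tgt C q1) (tgt C q2)" using hm by (auto simp: cohomology_map_between_def)
    obtain h' where h': "inverse_arrows C (tgt C q1) (tgt C q2) h h'"
      using h(2) is_iso_hom[OF hh] by blast
    obtain j j' where j: "inverse_arrows C (tgt C (q K)) (tgt C q1) j j'"
      "cohomology_map_between C (k K) (q K) k1 q1 (idm C (cob K i)) j"
      using cohomology_comparison[OF K kq[OF K] 1] by blast
    obtain l l' where l: "inverse_arrows C (tgt C q2) (tgt C (q L)) l l'"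
      "cohomology_map_between C k2 q2 (k L) (q L) (idm C (cob L i)) l"
      using cohomology_comparison[OF L 2 kq[OF L]] by blast
    have idK: "idm C (cob K i) \<in> hom_set C (cob K i) (cob K i)" using idm_hom bounded_complexD(1)[OF K] by blast
    have idL: "idm C (cob L i) \<in> hom_set C (cob L i) (cob L i)" using idm_hom bounded_complexD(1)[OF L] by blast
    have "cohomology_map_between C (k K) (q K) k2 q2 (f i) (cmp C h j)"
      using cohomology_map_cmp[OF K kq[OF K] K 1 L 2 idK fi j(2) hm] cmp_idm_right[OF fi] by simp
    then have "cohomology_map_between C (k K) (q K) (k L) (q L) (f i) (cmp C l (cmp C h j))"
      using cohomology_map_cmp[OF K kq[OF K] L 2 L kq[OF L] fi idL _ l(2)] cmp_idm_left[OF fi] by simp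
    then have "far \<H> s = cmp C l (cmp C h j)" using far_eq[OF K L] f(1) by simp
    then show ?thesis
      using inverse_arrows_cmp[OF inverse_arrows_cmp[OF j(1) h'] l(1)] is_iso_hom[OF inverse_arrowsD(1)]
      by metis
  qed
  ultimately obtain G where G: "is_functor (localization ?D (quasi_isos C)) C G" "\<And>K. fob G K = fob \<H> K"
    using dc.localization_universal[OF cat_axioms] by blast
  have b: "bounded_complex C K" "bounded_complex C L"
    using cat.hom_objs[OF dc.cat_localization] iso unfolding isomorphic_def derived_category_def by fastforce+
  have "isomorphic C (tgt C (q K)) (tgt C (q L))"
    using functor_isomorphic[OF dc.cat_localization G(1)] iso G(2)
    by (simp add: derived_category_def \<H>_def)
  moreover have "isomorphic C H (tgt C (q K))" "isomorphic C (tgt C (q L)) H'"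
    using is_cohomology_unique[OF b(1) H(1)] is_cohomology_unique[OF b(2) _ H(2)] kq[OF b(1)] kq[OF b(2)]
    by (auto simp: is_cohomology_def)
  ultimately show ?thesis using isomorphic_trans by blast
qed

text \<open>
  Isomorphic complexes have isomorphic cohomology, so such an isomorphism is a quasi-isomorphism,
  and the derived category inverts it.
\<close>

lemma complex_isomorphic_derived:
  assumes "bounded_complex C K" "bounded_complex C L"
    and a: "\<And>i. inverse_arrows C (cob K i) (cob L i) (a i) (b i)"
    and chain: "\<And>i. cmp C (a (i + 1)) (cdiff K i) = cmp C (cdiff L i) (a i)"
  shows "isomorphic (derived_category C) K L"
proof -
  let ?D = "complex_category C"
  interpret cc: cat ?D by (rule cat_complex_category) (rule cat_axioms)
  interpret dc: cat_with_weq ?D "quasi_isos C"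
    by (intro cat_with_weq.intro cat_with_weq_axioms.intro cc.cat_axioms quasi_isos_arrs)
  note ah = inverse_arrowsD(1)[OF a] and bh = inverse_arrowsD(2)[OF a]
  note dK = bounded_complexD(2)[OF assms(1)] and dL = bounded_complexD(2)[OF assms(2)]
  have "cmp C (b (i + 1)) (cdiff L i) = cmp C (cdiff K i) (b i)" for i
  proof (rule cancel_iso_right[OF a[of i] cmp_hom[OF dL bh] cmp_hom[OF bh dK]])
    have "cmp C (cmp C (b (i + 1)) (cdiff L i)) (a i) = cmp C (b (i + 1)) (cmp C (a (i + 1)) (cdiff K i))"
      using cmp_assoc[OF ah dL bh] chain[of i] by simp
    also have "\<dots> = cdiff K i"
      using inverse_arrows_cancel(1)[OF a] hom_setD[OF dK] by simp
    also have "\<dots> = cmp C (cmp C (cdiff K i) (b i)) (a i)"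
      using inverse_arrows_cancel(3)[OF a] hom_setD[OF dK] by simp
    finally show "cmp C (cmp C (b (i + 1)) (cdiff L i)) (a i) = cmp C (cmp C (cdiff K i) (b i)) (a i)" .
  qed
  then have "inverse_arrows ?D K L (K, L, a) (L, K, b)"
    using assms(1,2) ah bh chain inverse_arrowsD(3,4)[OF a]
    by (simp add: inverse_arrows_def hom_complex_category cmp_complex_category idm_complex_category)
  then have "isomorphic ?D K L" unfolding isomorphic_iff by blast
  from functor_isomorphic[OF cc.cat_axioms dc.is_functor_L this]
  show ?thesis by (simp add: derived_category_def)
qed

end

section \<open>Modules and homogeneous components\<close>

lemma (in abelian_monoid) finsum_superset:
  assumes "finite B" "A \<subseteq> B" "f \<in> A \<rightarrow> carrier G" "\<And>i. i \<in> B - A \<Longrightarrow> f i = \<zero>"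
  shows "finsum G f B = finsum G f A"
proof -
  have "f i \<in> carrier G" if "i \<in> B" for i using assms(3,4) that by (cases "i \<in> A") auto
  then show ?thesis using add.finprod_mono_neutral_cong_left[of B A f f] assms(1,2,4) by auto
qed

text \<open>
  Linear combinations with coefficients in a set \<open>K\<close>: for \<open>K\<close> the whole ring this is the
  submodule generated by \<open>S\<close>, for \<open>K\<close> the scalars of an algebra it is the subspace spanned by \<open>S\<close>.
\<close>

inductive_set lin_span :: "('a, 'b, 'm) module_scheme \<Rightarrow> 'a set \<Rightarrow> 'b set \<Rightarrow> 'b set"
  for M K S where
  zero: "\<zero>\<^bsub>M\<^esub> \<in> lin_span M K S"
| step: "\<lbrakk>a \<in> K; s \<in> S; y \<in> lin_span M K S\<rbrakk> \<Longrightarrow> a \<odot>\<^bsub>M\<^esub> s \<oplus>\<^bsub>M\<^esub> y \<in> lin_span M K S"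

lemma lin_span_mono:
  assumes "K \<subseteq> K'" "S \<subseteq> S'"
  shows "lin_span M K S \<subseteq> lin_span M K' S'"
proof
  fix x assume "x \<in> lin_span M K S"
  then show "x \<in> lin_span M K' S'"
    by induction (use assms in \<open>auto intro: lin_span.intros\<close>)
qed

lemma lin_span_cong:
  fixes M :: "('a, 'b, 'm) module_scheme" and N :: "('a, 'b, 'n) module_scheme"
  assumes "\<zero>\<^bsub>N\<^esub> = \<zero>\<^bsub>M\<^esub>" "add N = add M" "module.smult N = module.smult M"
  shows "lin_span N K S = lin_span M K S"
proof (intro equalityI subsetI)
  show "x \<in> lin_span M K S" if "x \<in> lin_span N K S" for x
    using that by induction (use assms lin_span.intros[where M = M] in auto)
  show "x \<in> lin_span N K S" if "x \<in> lin_span M K S" for x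
    using that by induction (use assms lin_span.intros[where M = N] in auto)
qed

context left_module
begin

lemma smult_zero_left: "x \<in> carrier M \<Longrightarrow> \<zero> \<odot>\<^bsub>M\<^esub> x = \<zero>\<^bsub>M\<^esub>"
  using smult_l_distr[of \<zero> \<zero> x] smult_closed[of \<zero> x] by (simp add: M.l_zero)

lemma smult_zero_right: "a \<in> carrier R \<Longrightarrow> a \<odot>\<^bsub>M\<^esub> \<zero>\<^bsub>M\<^esub> = \<zero>\<^bsub>M\<^esub>"
  using smult_r_distr[of a "\<zero>\<^bsub>M\<^esub>" "\<zero>\<^bsub>M\<^esub>"] smult_closed[of a "\<zero>\<^bsub>M\<^esub>"] by simp

lemma smult_minus_left:
  assumes "a \<in> carrier R" "x \<in> carrier M"
  shows "(\<ominus> a) \<odot>\<^bsub>M\<^esub> x = \<ominus>\<^bsub>M\<^esub> (a \<odot>\<^bsub>M\<^esub> x)"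
  using smult_l_distr[of "\<ominus> a" a x] assms smult_closed smult_zero_left[of x]
  by (simp add: R.l_neg M.minus_equality)

lemma smult_minus_right:
  assumes "a \<in> carrier R" "x \<in> carrier M"
  shows "a \<odot>\<^bsub>M\<^esub> (\<ominus>\<^bsub>M\<^esub> x) = \<ominus>\<^bsub>M\<^esub> (a \<odot>\<^bsub>M\<^esub> x)"
  using smult_r_distr[of a "\<ominus>\<^bsub>M\<^esub> x" x] assms smult_closed smult_zero_right[of a]
  by (simp add: M.l_neg M.minus_equality)

lemma minus_one_smult: "x \<in> carrier M \<Longrightarrow> (\<ominus> \<one>) \<odot>\<^bsub>M\<^esub> x = \<ominus>\<^bsub>M\<^esub> x"
  using smult_minus_left[of \<one> x] smult_one by simp

lemma finsum_smult:
  assumes "a \<in> carrier R" "f \<in> A \<rightarrow> carrier M"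
  shows "a \<odot>\<^bsub>M\<^esub> (\<Oplus>\<^bsub>M\<^esub>i\<in>A. f i) = (\<Oplus>\<^bsub>M\<^esub>i\<in>A. a \<odot>\<^bsub>M\<^esub> f i)"
  using assms(2)
proof (induction A rule: infinite_finite_induct)
  case (insert i A)
  then show ?case
    using assms(1) smult_closed smult_r_distr[of a "f i" "finsum M f A"] by (simp add: Pi_iff)
qed (use assms(1) smult_zero_right in simp_all)

lemma lin_span_carrier:
  assumes "K \<subseteq> carrier R" "S \<subseteq> carrier M"
  shows "lin_span M K S \<subseteq> carrier M"
proof
  fix x assume "x \<in> lin_span M K S"
  then show "x \<in> carrier M"
    by induction (use smult_closed[OF subsetD[OF assms(1)] subsetD[OF assms(2)]] in simp_all)
qed

lemma lin_span_add:
  assumes "K \<subseteq> carrier R" "S \<subseteq> carrier M" "x \<in> lin_span M K S" "y \<in> lin_span M K S"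
  shows "x \<oplus>\<^bsub>M\<^esub> y \<in> lin_span M K S"
  using assms(3)
proof induction
  case zero
  then show ?case using assms lin_span_carrier[OF assms(1,2)] by auto
next
  case (step a s x)
  then have "a \<odot>\<^bsub>M\<^esub> s \<in> carrier M" "x \<in> carrier M" "y \<in> carrier M"
    using assms(4) lin_span_carrier[OF assms(1,2)] smult_closed[OF subsetD[OF assms(1)] subsetD[OF assms(2)]]
    by auto
  then show ?case using lin_span.step[OF step(1,2,4)] by (simp add: M.a_assoc)
qed

lemma lin_span_single:
  assumes "K \<subseteq> carrier R" "S \<subseteq> carrier M" "a \<in> K" "s \<in> S"
  shows "a \<odot>\<^bsub>M\<^esub> s \<in> lin_span M K S"
  using lin_span.step[OF assms(3,4) lin_span.zero, of M] 
    smult_closed[OF subsetD[OF assms(1,3)] subsetD[OF assms(2,4)]] by simp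

lemma lin_span_smult:
  assumes "K \<subseteq> carrier R" "S \<subseteq> carrier M" "c \<in> carrier R" "\<And>a. a \<in> K \<Longrightarrow> c \<otimes> a \<in> K"
    and "x \<in> lin_span M K S"
  shows "c \<odot>\<^bsub>M\<^esub> x \<in> lin_span M K S"
  using assms(5)
proof induction
  case zero
  then show ?case using assms(3) smult_zero_right lin_span.zero[of M] by simp
next
  case (step a s x)
  then have h: "a \<in> carrier R" "s \<in> carrier M" "x \<in> carrier M"
    using assms lin_span_carrier[OF assms(1,2)] by auto
  have "c \<odot>\<^bsub>M\<^esub> (a \<odot>\<^bsub>M\<^esub> s \<oplus>\<^bsub>M\<^esub> x) = (c \<otimes> a) \<odot>\<^bsub>M\<^esub> s \<oplus>\<^bsub>M\<^esub> c \<odot>\<^bsub>M\<^esub> x"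
    using h assms(3) smult_closed by (simp add: smult_r_distr smult_assoc)
  then show ?case using lin_span.step[OF assms(4)[OF step(1)] step(2,4)] by simp
qed

lemma lin_span_finsum:
  assumes "K \<subseteq> carrier R" "S \<subseteq> carrier M" "\<And>i. i \<in> A \<Longrightarrow> g i \<in> lin_span M K S"
  shows "(\<Oplus>\<^bsub>M\<^esub>i\<in>A. g i) \<in> lin_span M K S"
  using assms(3)
proof (induction A rule: infinite_finite_induct)
  case (insert i A)
  then have "g \<in> A \<rightarrow> carrier M" "g i \<in> carrier M" using lin_span_carrier[OF assms(1,2)] by auto
  then show ?case using insert lin_span_add[OF assms(1,2)] by simp
qed (simp_all add: lin_span.zero)

lemma lin_span_finite:
  assumes "finite S" "S \<subseteq> carrier M" "K \<subseteq> carrier R" "\<zero> \<in> K" "\<And>a b. a \<in> K \<Longrightarrow> b \<in> K \<Longrightarrow> a \<oplus> b \<in> K"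
  shows "lin_span M K S = {(\<Oplus>\<^bsub>M\<^esub>s\<in>S. f s \<odot>\<^bsub>M\<^esub> s) | f. f \<in> S \<rightarrow> K}"
proof (intro equalityI subsetI)
  fix x assume "x \<in> lin_span M K S"
  then show "x \<in> {(\<Oplus>\<^bsub>M\<^esub>s\<in>S. f s \<odot>\<^bsub>M\<^esub> s) | f. f \<in> S \<rightarrow> K}"
  proof induction
    case zero
    have "(\<Oplus>\<^bsub>M\<^esub>s\<in>S. \<zero> \<odot>\<^bsub>M\<^esub> s) = (\<Oplus>\<^bsub>M\<^esub>s\<in>S. \<zero>\<^bsub>M\<^esub>)"
      using assms(2) by (intro M.finsum_cong') (auto simp: smult_zero_left)
    then show ?case using assms(4) by (auto intro!: exI[of _ "\<lambda>_. \<zero>"])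
  next
    case (step a t x)
    then obtain f where f: "f \<in> S \<rightarrow> K" "x = (\<Oplus>\<^bsub>M\<^esub>s\<in>S. f s \<odot>\<^bsub>M\<^esub> s)" by blast
    let ?f = "f(t := a \<oplus> f t)"
    have c: "f s \<in> carrier R" "s \<in> carrier M" if "s \<in> S" for s using f(1) assms(2,3) that by auto
    have a: "a \<in> carrier R" using step assms(3) by auto
    have S: "S = insert t (S - {t})" using step by auto
    have fin: "finite (S - {t})" "t \<notin> S - {t}" using assms(1) by auto
    have F: "(\<lambda>s. f s \<odot>\<^bsub>M\<^esub> s) \<in> S - {t} \<rightarrow> carrier M" using c smult_closed by auto
    have ft: "f t \<odot>\<^bsub>M\<^esub> t \<in> carrier M" "a \<odot>\<^bsub>M\<^esub> t \<in> carrier M" using c[OF step(2)] a smult_closed by auto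
    have "(\<Oplus>\<^bsub>M\<^esub>s\<in>S. ?f s \<odot>\<^bsub>M\<^esub> s) = (a \<oplus> f t) \<odot>\<^bsub>M\<^esub> t \<oplus>\<^bsub>M\<^esub> (\<Oplus>\<^bsub>M\<^esub>s\<in>S - {t}. ?f s \<odot>\<^bsub>M\<^esub> s)"
      by (subst S, subst M.finsum_insert[OF fin]) (use c a step(2) smult_closed in \<open>auto\<close>)
    also have "(\<Oplus>\<^bsub>M\<^esub>s\<in>S - {t}. ?f s \<odot>\<^bsub>M\<^esub> s) = (\<Oplus>\<^bsub>M\<^esub>s\<in>S - {t}. f s \<odot>\<^bsub>M\<^esub> s)"
      by (intro M.finsum_cong') (use F in auto)
    also have "(a \<oplus> f t) \<odot>\<^bsub>M\<^esub> t \<oplus>\<^bsub>M\<^esub> \<dots> = a \<odot>\<^bsub>M\<^esub> t \<oplus>\<^bsub>M\<^esub> (f t \<odot>\<^bsub>M\<^esub> t \<oplus>\<^bsub>M\<^esub> \<dots>)"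
      using c[OF step(2)] a ft F by (simp add: smult_l_distr M.a_assoc)
    also have "f t \<odot>\<^bsub>M\<^esub> t \<oplus>\<^bsub>M\<^esub> (\<Oplus>\<^bsub>M\<^esub>s\<in>S - {t}. f s \<odot>\<^bsub>M\<^esub> s) = x"
      unfolding f(2) by (subst (2) S, subst M.finsum_insert[OF fin F ft(1)]) simp
    finally have "a \<odot>\<^bsub>M\<^esub> t \<oplus>\<^bsub>M\<^esub> x = (\<Oplus>\<^bsub>M\<^esub>s\<in>S. ?f s \<odot>\<^bsub>M\<^esub> s)" by simp
    moreover have "?f \<in> S \<rightarrow> K" using f(1) assms(5)[OF step(1)] step(2) by (simp add: Pi_iff)
    ultimately show ?case by blast
  qed
next
  fix x assume "x \<in> {(\<Oplus>\<^bsub>M\<^esub>s\<in>S. f s \<odot>\<^bsub>M\<^esub> s) | f. f \<in> S \<rightarrow> K}"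
  then obtain f where f: "f \<in> S \<rightarrow> K" "x = (\<Oplus>\<^bsub>M\<^esub>s\<in>S. f s \<odot>\<^bsub>M\<^esub> s)" by blast
  have "f s \<odot>\<^bsub>M\<^esub> s \<in> lin_span M K S" if "s \<in> S" for s
    using lin_span_single[OF assms(3,2)] f(1) that by (simp add: Pi_iff)
  then show "x \<in> lin_span M K S" unfolding f(2) by (rule lin_span_finsum[OF assms(3,2)])
qed

lemma finitely_generated_iff:
  "finitely_generated R M \<longleftrightarrow>
     (\<exists>S. finite S \<and> S \<subseteq> carrier M \<and> carrier M \<subseteq> lin_span M (carrier R) S)"
  unfolding finitely_generated_def
proof (intro ex_cong1 conj_cong refl)
  fix S assume "finite S" "S \<subseteq> carrier M"
  then have eq: "lin_span M (carrier R) S = {(\<Oplus>\<^bsub>M\<^esub>s\<in>S. f s \<odot>\<^bsub>M\<^esub> s) | f. f \<in> S \<rightarrow> carrier R}"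
    using lin_span_finite[of S "carrier R"] by simp
  show "(\<forall>x\<in>carrier M. \<exists>f\<in>S \<rightarrow> carrier R. x = (\<Oplus>\<^bsub>M\<^esub>s\<in>S. f s \<odot>\<^bsub>M\<^esub> s)) \<longleftrightarrow>
      carrier M \<subseteq> lin_span M (carrier R) S"
    unfolding eq by (auto simp: Bex_def)
qed

end

definition homogeneous_part :: "('a, 'b, 'm) graded_module_scheme \<Rightarrow> 'b \<Rightarrow> int \<Rightarrow> 'b" where
  "homogeneous_part M x = (THE f. (\<forall>i. f i \<in> mcomp M i) \<and> finite {i. f i \<noteq> \<zero>\<^bsub>M\<^esub>} \<and>
     x = (\<Oplus>\<^bsub>M\<^esub> i \<in> {i. f i \<noteq> \<zero>\<^bsub>M\<^esub>}. f i))"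

context graded_left_module
begin

abbreviation "part \<equiv> homogeneous_part M"

lemma mcomp_carrier: "x \<in> mcomp M i \<Longrightarrow> x \<in> carrier M"
  using subgroup.subset[OF mcomp_subgroup] by auto

lemma mcomp_zero: "\<zero>\<^bsub>M\<^esub> \<in> mcomp M i"
  using subgroup.one_closed[OF mcomp_subgroup] by simp

lemma mcomp_add: "x \<in> mcomp M i \<Longrightarrow> y \<in> mcomp M i \<Longrightarrow> x \<oplus>\<^bsub>M\<^esub> y \<in> mcomp M i"
  using subgroup.m_closed[OF mcomp_subgroup] by simp

lemma homogeneous_part:
  assumes "x \<in> carrier M"
  shows "part x i \<in> mcomp M i" "finite {i. part x i \<noteq> \<zero>\<^bsub>M\<^esub>}"
    "x = (\<Oplus>\<^bsub>M\<^esub> i \<in> {i. part x i \<noteq> \<zero>\<^bsub>M\<^esub>}. part x i)"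
  using theI'[OF mcomp_direct_sum[OF assms]] by (auto simp: homogeneous_part_def)

lemma part_carrier: "x \<in> carrier M \<Longrightarrow> part x i \<in> carrier M"
  using homogeneous_part(1) mcomp_carrier by blast

lemma homogeneous_part_sum:
  assumes "x \<in> carrier M" "finite A" "{i. part x i \<noteq> \<zero>\<^bsub>M\<^esub>} \<subseteq> A"
  shows "x = (\<Oplus>\<^bsub>M\<^esub> i \<in> A. part x i)"
proof -
  have "(\<Oplus>\<^bsub>M\<^esub> i \<in> A. part x i) = (\<Oplus>\<^bsub>M\<^esub> i \<in> {i. part x i \<noteq> \<zero>\<^bsub>M\<^esub>}. part x i)"
    by (rule M.finsum_superset[OF assms(2,3)]) (use part_carrier[OF assms(1)] in auto)
  then show ?thesis by (rule trans[OF homogeneous_part(3)[OF assms(1)] sym])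
qed

lemma homogeneous_part_unique:
  assumes "finite A" "\<And>i. i \<in> A \<Longrightarrow> g i \<in> mcomp M i" "x = (\<Oplus>\<^bsub>M\<^esub> i \<in> A. g i)"
  shows "part x = (\<lambda>i. if i \<in> A then g i else \<zero>\<^bsub>M\<^esub>)"
proof -
  let ?g = "\<lambda>i. if i \<in> A then g i else \<zero>\<^bsub>M\<^esub>"
  have c: "g i \<in> carrier M" if "i \<in> A" for i using assms(2) that mcomp_carrier by blast
  then have x: "x \<in> carrier M" using assms(3) by auto
  have sub: "{i. ?g i \<noteq> \<zero>\<^bsub>M\<^esub>} \<subseteq> A" by auto
  have "x = (\<Oplus>\<^bsub>M\<^esub> i \<in> A. ?g i)" unfolding assms(3) by (intro M.finsum_cong') (use c in auto)
  also have "\<dots> = (\<Oplus>\<^bsub>M\<^esub> i \<in> {i. ?g i \<noteq> \<zero>\<^bsub>M\<^esub>}. ?g i)"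
    by (rule M.finsum_superset[OF assms(1) sub]) (use c in auto)
  finally have "x = \<dots>" .
  moreover have "finite {i. ?g i \<noteq> \<zero>\<^bsub>M\<^esub>}" using finite_subset[OF sub assms(1)] .
  moreover have "\<forall>i. ?g i \<in> mcomp M i" using assms(2) mcomp_zero by auto
  ultimately show ?thesis
    unfolding homogeneous_part_def by (intro the1_equality[OF mcomp_direct_sum[OF x]]) blast
qed

lemma part_homogeneous: "x \<in> mcomp M d \<Longrightarrow> part x = (\<lambda>i. if i = d then x else \<zero>\<^bsub>M\<^esub>)"
  using homogeneous_part_unique[of "{d}" "\<lambda>_. x" x] mcomp_carrier[of x d] by (simp add: M.finsum_insert)

lemma mcomp_iff: "x \<in> carrier M \<Longrightarrow> x \<in> mcomp M d \<longleftrightarrow> part x d = x"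
  using part_homogeneous[of x d] homogeneous_part(1)[of x d] by auto

lemma part_add:
  assumes "x \<in> carrier M" "y \<in> carrier M"
  shows "part (x \<oplus>\<^bsub>M\<^esub> y) i = part x i \<oplus>\<^bsub>M\<^esub> part y i"
proof -
  let ?A = "{i. part x i \<noteq> \<zero>\<^bsub>M\<^esub>} \<union> {i. part y i \<noteq> \<zero>\<^bsub>M\<^esub>}"
  have A: "finite ?A" using homogeneous_part(2)[OF assms(1)] homogeneous_part(2)[OF assms(2)] by simp
  have "x \<oplus>\<^bsub>M\<^esub> y = (\<Oplus>\<^bsub>M\<^esub> i \<in> ?A. part x i) \<oplus>\<^bsub>M\<^esub> (\<Oplus>\<^bsub>M\<^esub> i \<in> ?A. part y i)"
    by (intro arg_cong2[where f = "add M"] homogeneous_part_sum[OF assms(1) A] homogeneous_part_sum[OF assms(2) A])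
      auto
  also have "\<dots> = (\<Oplus>\<^bsub>M\<^esub> i \<in> ?A. part x i \<oplus>\<^bsub>M\<^esub> part y i)"
    by (rule M.finsum_addf[symmetric]) (use part_carrier assms in auto)
  finally have "part (x \<oplus>\<^bsub>M\<^esub> y) = (\<lambda>i. if i \<in> ?A then part x i \<oplus>\<^bsub>M\<^esub> part y i else \<zero>\<^bsub>M\<^esub>)"
    by (intro homogeneous_part_unique[OF A]) (use homogeneous_part(1) assms mcomp_add in auto)
  then show ?thesis by auto
qed

lemma part_smult:
  assumes "a \<in> rcomp R d" "a \<in> carrier R" "x \<in> carrier M"
  shows "part (a \<odot>\<^bsub>M\<^esub> x) i = a \<odot>\<^bsub>M\<^esub> part x (i - d)"
proof -
  let ?B = "{i. part x i \<noteq> \<zero>\<^bsub>M\<^esub>}"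
  let ?A = "(\<lambda>i. d + i) ` ?B"
  have A: "finite ?A" using homogeneous_part(2)[OF assms(3)] by simp
  have h: "a \<odot>\<^bsub>M\<^esub> part x i \<in> mcomp M (d + i)" for i
    using mcomp_smult[OF assms(1)] homogeneous_part(1)[OF assms(3)] by blast
  have h': "a \<odot>\<^bsub>M\<^esub> part x (i - d) \<in> mcomp M i" for i
    using h[of "i - d"] by simp
  have "a \<odot>\<^bsub>M\<^esub> x = (\<Oplus>\<^bsub>M\<^esub> i \<in> ?B. a \<odot>\<^bsub>M\<^esub> part x i)"
    by (rule trans[OF arg_cong[OF homogeneous_part(3)[OF assms(3)], of "\<lambda>y. a \<odot>\<^bsub>M\<^esub> y"] finsum_smult[OF assms(2)]])
      (use part_carrier[OF assms(3)] in auto)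
  also have "\<dots> = (\<Oplus>\<^bsub>M\<^esub> i \<in> ?B. a \<odot>\<^bsub>M\<^esub> part x ((d + i) - d))" by simp
  also have "\<dots> = (\<Oplus>\<^bsub>M\<^esub> i \<in> ?A. a \<odot>\<^bsub>M\<^esub> part x (i - d))"
    by (rule M.finsum_reindex[symmetric]) (use h' mcomp_carrier in \<open>auto simp: inj_on_def\<close>)
  finally have "part (a \<odot>\<^bsub>M\<^esub> x) = (\<lambda>i. if i \<in> ?A then a \<odot>\<^bsub>M\<^esub> part x (i - d) else \<zero>\<^bsub>M\<^esub>)"
    by (intro homogeneous_part_unique[OF A] h') auto
  moreover have "a \<odot>\<^bsub>M\<^esub> part x (i - d) = \<zero>\<^bsub>M\<^esub>" if "i \<notin> ?A"
  proof -
    have "i - d \<notin> ?B" using that by force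
    then show ?thesis using smult_zero_right[OF assms(2)] by simp
  qed
  ultimately show ?thesis by auto
qed

lemma homogeneous_induct:
  assumes "x \<in> carrier M" "P \<zero>\<^bsub>M\<^esub>" "\<And>i x. x \<in> mcomp M i \<Longrightarrow> P x"
    and "\<And>x y. x \<in> carrier M \<Longrightarrow> y \<in> carrier M \<Longrightarrow> P x \<Longrightarrow> P y \<Longrightarrow> P (x \<oplus>\<^bsub>M\<^esub> y)"
  shows "P x"
proof -
  have "P (\<Oplus>\<^bsub>M\<^esub> i \<in> A. part x i)" if "finite A" for A
    using that
  proof induction
    case (insert i A)
    then show ?case
      using assms(3)[OF homogeneous_part(1)[OF assms(1)]] assms(4) part_carrier[OF assms(1)] by simp
  qed (simp add: assms(2))
  from this[OF homogeneous_part(2)[OF assms(1)]] show ?thesis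
    by (subst homogeneous_part(3)[OF assms(1)])
qed

end

text \<open>
  To recognize a grading it is enough to have homogeneous decompositions and to know that
  homogeneous elements of different degrees are independent.
\<close>

lemma graded_left_moduleI:
  fixes R :: "('a, 'r) graded_ring_scheme" (structure) and M :: "('a, 'b, 'm) graded_module_scheme"
  assumes "left_module R M"
    and sub: "\<And>i. subgroup (mcomp M i) (add_monoid M)"
    and smult: "\<And>i j a x. a \<in> rcomp R i \<Longrightarrow> x \<in> mcomp M j \<Longrightarrow> a \<odot>\<^bsub>M\<^esub> x \<in> mcomp M (i + j)"
    and ex: "\<And>x. x \<in> carrier M \<Longrightarrow> \<exists>A g. finite A \<and> (\<forall>i. g i \<in> mcomp M i) \<and> x = (\<Oplus>\<^bsub>M\<^esub>i\<in>A. g i)"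
    and ind: "\<And>A g i. finite A \<Longrightarrow> (\<forall>i. g i \<in> mcomp M i) \<Longrightarrow> (\<Oplus>\<^bsub>M\<^esub>i\<in>A. g i) = \<zero>\<^bsub>M\<^esub> \<Longrightarrow> i \<in> A \<Longrightarrow>
      g i = \<zero>\<^bsub>M\<^esub>"
  shows "graded_left_module R M"
proof -
  interpret left_module R M by fact
  have c: "x \<in> carrier M" if "x \<in> mcomp M i" for x i using subgroup.subset[OF sub] that by auto
  have z: "\<zero>\<^bsub>M\<^esub> \<in> mcomp M i" for i using subgroup.one_closed[OF sub] by simp
  show ?thesis
  proof (intro graded_left_module.intro graded_left_module_axioms.intro assms(1), goal_cases)
    case (1 i) show ?case by (rule sub)
  next
    case (2 a i x j) then show ?case by (rule smult)
  next
    case (3 x)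
    obtain A g where g: "finite A" "\<forall>i. g i \<in> mcomp M i" "x = (\<Oplus>\<^bsub>M\<^esub>i\<in>A. g i)" using ex[OF 3] by blast
    have gc: "g i \<in> carrier M" for i using g(2) c by blast
    let ?g = "\<lambda>i. if i \<in> A then g i else \<zero>\<^bsub>M\<^esub>"
    have sub': "{i. ?g i \<noteq> \<zero>\<^bsub>M\<^esub>} \<subseteq> A" by auto
    have "x = (\<Oplus>\<^bsub>M\<^esub>i\<in>A. ?g i)" unfolding g(3) by (intro M.finsum_cong') (use gc in auto)
    also have "\<dots> = (\<Oplus>\<^bsub>M\<^esub> i \<in> {i. ?g i \<noteq> \<zero>\<^bsub>M\<^esub>}. ?g i)"
      by (rule M.finsum_superset[OF g(1) sub']) (use gc in auto)
    finally have ex1: "x = \<dots>" .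
    have "f = f'" if f: "\<forall>i. f i \<in> mcomp M i" "finite {i. f i \<noteq> \<zero>\<^bsub>M\<^esub>}" "x = (\<Oplus>\<^bsub>M\<^esub> i \<in> {i. f i \<noteq> \<zero>\<^bsub>M\<^esub>}. f i)"
      and f': "\<forall>i. f' i \<in> mcomp M i" "finite {i. f' i \<noteq> \<zero>\<^bsub>M\<^esub>}" "x = (\<Oplus>\<^bsub>M\<^esub> i \<in> {i. f' i \<noteq> \<zero>\<^bsub>M\<^esub>}. f' i)"
      for f f'
    proof
      fix i
      let ?A = "insert i ({i. f i \<noteq> \<zero>\<^bsub>M\<^esub>} \<union> {i. f' i \<noteq> \<zero>\<^bsub>M\<^esub>})"
      have A: "finite ?A" using f f' by simp
      have fc: "f i \<in> carrier M" "f' i \<in> carrier M" for i using f(1) f'(1) c by blast+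
      have x1: "x = (\<Oplus>\<^bsub>M\<^esub> i \<in> ?A. f i)"
        by (rule trans[OF f(3) M.finsum_superset[OF A, symmetric]]) (use fc in auto)
      have x2: "x = (\<Oplus>\<^bsub>M\<^esub> i \<in> ?A. f' i)"
        by (rule trans[OF f'(3) M.finsum_superset[OF A, symmetric]]) (use fc in auto)
      have neg: "(\<ominus> \<one>) \<odot>\<^bsub>M\<^esub> f' i \<in> mcomp M i" for i
        using subgroup.m_inv_closed[OF sub, of "f' i" i] f'(1) minus_one_smult[OF fc(2)] by (simp add: a_inv_def)
      have "(\<Oplus>\<^bsub>M\<^esub> i \<in> ?A. f i \<oplus>\<^bsub>M\<^esub> (\<ominus> \<one>) \<odot>\<^bsub>M\<^esub> f' i) =
          (\<Oplus>\<^bsub>M\<^esub> i \<in> ?A. f i) \<oplus>\<^bsub>M\<^esub> (\<Oplus>\<^bsub>M\<^esub> i \<in> ?A. (\<ominus> \<one>) \<odot>\<^bsub>M\<^esub> f' i)"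
        by (rule M.finsum_addf) (use fc c[OF neg] in auto)
      also have "(\<Oplus>\<^bsub>M\<^esub> i \<in> ?A. (\<ominus> \<one>) \<odot>\<^bsub>M\<^esub> f' i) = (\<ominus> \<one>) \<odot>\<^bsub>M\<^esub> (\<Oplus>\<^bsub>M\<^esub> i \<in> ?A. f' i)"
        by (rule finsum_smult[symmetric]) (use fc in auto)
      also have "(\<Oplus>\<^bsub>M\<^esub> i \<in> ?A. f i) \<oplus>\<^bsub>M\<^esub> (\<ominus> \<one>) \<odot>\<^bsub>M\<^esub> (\<Oplus>\<^bsub>M\<^esub> i \<in> ?A. f' i) = x \<oplus>\<^bsub>M\<^esub> (\<ominus> \<one>) \<odot>\<^bsub>M\<^esub> x"
        by (simp only: x1[symmetric] x2[symmetric])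
      also have "\<dots> = \<zero>\<^bsub>M\<^esub>" using minus_one_smult[OF 3] 3 by (simp add: M.r_neg)
      finally have "f i \<oplus>\<^bsub>M\<^esub> (\<ominus> \<one>) \<odot>\<^bsub>M\<^esub> f' i = \<zero>\<^bsub>M\<^esub>"
        using ind[OF A, of "\<lambda>i. f i \<oplus>\<^bsub>M\<^esub> (\<ominus> \<one>) \<odot>\<^bsub>M\<^esub> f' i" i] f(1) neg subgroup.m_closed[OF sub] by auto
      then show "f i = f' i"
        using minus_one_smult[OF fc(2)] fc M.minus_equality[of "f i" "\<ominus>\<^bsub>M\<^esub> f' i"] by simp
    qed
    moreover have "\<forall>i. ?g i \<in> mcomp M i" using g(2) z by auto
    moreover have "finite {i. ?g i \<noteq> \<zero>\<^bsub>M\<^esub>}" using finite_subset[OF sub' g(1)] .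
    ultimately show ?case using ex1 by (intro ex_ex1I exI[of _ ?g]) blast+
  qed
qed

section \<open>The category of finitely generated graded modules\<close>

lemma (in abelian_group) diff_eq_zero_iff:
  "x \<in> carrier G \<Longrightarrow> y \<in> carrier G \<Longrightarrow> x \<ominus> y = \<zero> \<longleftrightarrow> x = y"
  using minus_equality[of x "\<ominus> y"] by (auto simp: minus_eq r_neg)

lemma (in graded_left_module) mcomp_minus: "x \<in> mcomp M i \<Longrightarrow> \<ominus>\<^bsub>M\<^esub> x \<in> mcomp M i"
  using subgroup.m_inv_closed[OF mcomp_subgroup] by (simp add: a_inv_def)

locale graded_hom = M?: graded_left_module R M + N?: graded_left_module R N
  for R :: "('a, 'r) graded_ring_scheme" (structure) and M :: "('a, 'b) graded_module"
    and N :: "('a, 'b) graded_module" +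
  fixes f :: "'b \<Rightarrow> 'b"
  assumes closed: "x \<in> carrier M \<Longrightarrow> f x \<in> carrier N"
    and add: "\<lbrakk>x \<in> carrier M; y \<in> carrier M\<rbrakk> \<Longrightarrow> f (x \<oplus>\<^bsub>M\<^esub> y) = f x \<oplus>\<^bsub>N\<^esub> f y"
    and smult: "\<lbrakk>a \<in> carrier R; x \<in> carrier M\<rbrakk> \<Longrightarrow> f (a \<odot>\<^bsub>M\<^esub> x) = a \<odot>\<^bsub>N\<^esub> f x"
    and degree: "x \<in> mcomp M i \<Longrightarrow> f x \<in> mcomp N i"
begin

lemma hom_zero: "f \<zero>\<^bsub>M\<^esub> = \<zero>\<^bsub>N\<^esub>"
  using smult[of \<zero> "\<zero>\<^bsub>M\<^esub>"] closed M.smult_zero_left N.smult_zero_left by simp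

lemma minus: "x \<in> carrier M \<Longrightarrow> f (\<ominus>\<^bsub>M\<^esub> x) = \<ominus>\<^bsub>N\<^esub> f x"
  using smult[of "\<ominus> \<one>" x] closed[of x] M.minus_one_smult[of x] N.minus_one_smult[of "f x"] by simp

lemma finsum: "g \<in> A \<rightarrow> carrier M \<Longrightarrow> f (\<Oplus>\<^bsub>M\<^esub>i\<in>A. g i) = (\<Oplus>\<^bsub>N\<^esub>i\<in>A. f (g i))"
proof (induction A rule: infinite_finite_induct)
  case (insert i A)
  then show ?case using closed add[of "g i" "finsum M g A"] by (simp add: Pi_iff)
qed (simp_all add: hom_zero)

lemma homogeneous_part_image:
  assumes "x \<in> carrier M"
  shows "homogeneous_part N (f x) i = f (homogeneous_part M x i)"
proof -
  let ?A = "{i. homogeneous_part M x i \<noteq> \<zero>\<^bsub>M\<^esub>}"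
  have "f x = f (\<Oplus>\<^bsub>M\<^esub>i\<in>?A. homogeneous_part M x i)"
    by (rule arg_cong[OF M.homogeneous_part(3)[OF assms]])
  also have "\<dots> = (\<Oplus>\<^bsub>N\<^esub>i\<in>?A. f (homogeneous_part M x i))"
    by (rule finsum) (use M.part_carrier[OF assms] in auto)
  finally have "homogeneous_part N (f x) = (\<lambda>i. if i \<in> ?A then f (homogeneous_part M x i) else \<zero>\<^bsub>N\<^esub>)"
    by (intro N.homogeneous_part_unique M.homogeneous_part(2)[OF assms] degree M.homogeneous_part(1)[OF assms])
  then show ?thesis by (auto simp: hom_zero)
qed

lemma inj_onI: "(\<And>x. x \<in> carrier M \<Longrightarrow> f x = \<zero>\<^bsub>N\<^esub> \<Longrightarrow> x = \<zero>\<^bsub>M\<^esub>) \<Longrightarrow> inj_on f (carrier M)"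
proof (rule Fun.inj_onI)
  fix x y assume *: "\<And>x. x \<in> carrier M \<Longrightarrow> f x = \<zero>\<^bsub>N\<^esub> \<Longrightarrow> x = \<zero>\<^bsub>M\<^esub>"
    and xy: "x \<in> carrier M" "y \<in> carrier M" "f x = f y"
  then have "x \<ominus>\<^bsub>M\<^esub> y = \<zero>\<^bsub>M\<^esub>"
    using add[of x "\<ominus>\<^bsub>M\<^esub> y"] minus[of y] closed by (intro *) (simp_all add: M.M.minus_eq N.M.r_neg)
  then show "x = y" using M.M.diff_eq_zero_iff xy(1,2) by blast
qed

lemma eq_iff_diff:
  "x \<in> carrier M \<Longrightarrow> y \<in> carrier M \<Longrightarrow> f x = f y \<longleftrightarrow> f (x \<ominus>\<^bsub>M\<^esub> y) = \<zero>\<^bsub>N\<^esub>"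
  using add[of x "\<ominus>\<^bsub>M\<^esub> y"] minus[of y] closed N.M.diff_eq_zero_iff[of "f x" "f y"]
  by (simp add: M.M.minus_eq N.M.minus_eq[symmetric])

lemma reflects_degree:
  assumes "inj_on f (carrier M)" "x \<in> carrier M" "f x \<in> mcomp N i"
  shows "x \<in> mcomp M i"
proof -
  have "f (homogeneous_part M x i) = f x"
    using homogeneous_part_image[OF assms(2)] N.mcomp_iff[OF closed[OF assms(2)]] assms(3) by simp
  then show ?thesis
    using assms(1,2) M.part_carrier[OF assms(2)] M.mcomp_iff[OF assms(2)] by (auto dest: inj_onD)
qed

lemma lifts_degree:
  assumes "y \<in> mcomp N i" "y \<in> f ` carrier M"
  shows "y \<in> f ` mcomp M i"
proof -
  obtain x where x: "x \<in> carrier M" "y = f x" using assms(2) by auto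
  then have "f (homogeneous_part M x i) = y"
    using homogeneous_part_image[OF x(1)] N.mcomp_iff[OF closed[OF x(1)]] assms(1) by simp
  then show ?thesis using M.homogeneous_part(1)[OF x(1)] by blast
qed

lemma lin_span_image:
  assumes "S \<subseteq> carrier M" "K \<subseteq> carrier R" "x \<in> lin_span M K S"
  shows "f x \<in> lin_span N K (f ` S)"
  using assms(3)
proof induction
  case zero
  then show ?case by (simp add: hom_zero lin_span.zero)
next
  case (step a s y)
  then have h: "a \<in> carrier R" "s \<in> carrier M" "y \<in> carrier M"
    using assms M.lin_span_carrier[OF assms(2,1)] by auto
  then have "f (a \<odot>\<^bsub>M\<^esub> s \<oplus>\<^bsub>M\<^esub> y) = a \<odot>\<^bsub>N\<^esub> f s \<oplus>\<^bsub>N\<^esub> f y"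
    using add[of "a \<odot>\<^bsub>M\<^esub> s" y] smult[of a s] M.smult_closed by simp
  then show ?case using lin_span.step[OF step(1) imageI[OF step(2), of f] step(4)] by simp
qed

lemma finitely_generated_image:
  assumes "finitely_generated R M" "f ` carrier M = carrier N"
  shows "finitely_generated R N"
proof -
  obtain S where S: "finite S" "S \<subseteq> carrier M" "carrier M \<subseteq> lin_span M (carrier R) S"
    using assms(1) unfolding M.finitely_generated_iff by (elim exE conjE)
  have "carrier N \<subseteq> lin_span N (carrier R) (f ` S)"
  proof
    fix y assume "y \<in> carrier N"
    then obtain x where "x \<in> carrier M" "y = f x" using assms(2) by (metis imageE)
    then show "y \<in> lin_span N (carrier R) (f ` S)"
      using lin_span_image[OF S(2) subset_refl subsetD[OF S(3)]] by simp
  qed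
  moreover have "f ` S \<subseteq> carrier N" using S(2) closed by auto
  ultimately show ?thesis
    unfolding N.finitely_generated_iff using S(1) by (intro exI[of _ "f ` S"]) simp
qed

end

lemma graded_homs_iff:
  assumes "graded_left_module R M" "graded_left_module R N"
  shows "f \<in> graded_homs R M N \<longleftrightarrow> graded_hom R M N f \<and> f \<in> extensional (carrier M)"
proof -
  interpret M: graded_left_module R M by fact
  interpret N: graded_left_module R N by fact
  show ?thesis
  proof
    assume f: "f \<in> graded_homs R M N"
    then have "graded_hom R M N f"
      using assms unfolding graded_homs_def by (intro graded_hom.intro graded_hom_axioms.intro) (auto simp: image_subset_iff)
    then show "graded_hom R M N f \<and> f \<in> extensional (carrier M)"
      using f by (auto simp: graded_homs_def PiE_def)
  next
    assume f: "graded_hom R M N f \<and> f \<in> extensional (carrier M)"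
    then interpret graded_hom R M N f by simp
    show "f \<in> graded_homs R M N"
      using f closed add smult degree by (auto simp: graded_homs_def extensional_def)
  qed
qed

lemma fg_graded_modulesD:
  assumes "M \<in> fg_graded_modules R"
  shows "graded_left_module R M" "finitely_generated R M"
  using assms by (auto simp: fg_graded_modules_def)

lemma objs_gr [simp]: "objs (gr R) = fg_graded_modules R"
  by (simp add: gr_def)

lemma hom_gr_iff:
  "F \<in> hom_set (gr R) M N \<longleftrightarrow> (\<exists>f. F = (M, N, f) \<and> M \<in> fg_graded_modules R \<and> N \<in> fg_graded_modules R \<and>
     graded_hom R M N f \<and> f \<in> extensional (carrier M))"
proof -
  have "F \<in> hom_set (gr R) M N \<longleftrightarrow> (\<exists>f. F = (M, N, f) \<and> M \<in> fg_graded_modules R \<and> N \<in> fg_graded_modules R \<and>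
     f \<in> graded_homs R M N)"
    by (auto simp: hom_set_def gr_def)
  then show ?thesis using graded_homs_iff fg_graded_modulesD(1) by metis
qed

lemma hom_grE:
  assumes "F \<in> hom_set (gr R) M N"
  obtains f where "F = (M, N, f)" "M \<in> fg_graded_modules R" "N \<in> fg_graded_modules R"
    "graded_hom R M N f" "f \<in> extensional (carrier M)"
  using assms hom_gr_iff by blast

lemma cmp_gr: "cmp (gr R) (N, P, g) (M, N', f) = (M, P, compose (carrier M) g f)"
  by (simp add: gr_def)

lemma idm_gr: "idm (gr R) M = (M, M, \<lambda>x \<in> carrier M. x)"
  by (simp add: gr_def)

lemma graded_hom_restrict:
  assumes "graded_hom R M N f"
  shows "graded_hom R M N (restrict f (carrier M))"
proof -
  interpret graded_hom R M N f by fact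
  show ?thesis
    by unfold_locales
      (use closed add smult degree M.smult_closed M.mcomp_carrier in \<open>auto simp: restrict_def\<close>)
qed

lemma graded_hom_compose:
  assumes "graded_hom R M N f" "graded_hom R N P g"
  shows "graded_hom R M P (compose (carrier M) g f)"
proof -
  interpret f: graded_hom R M N f by fact
  interpret g: graded_hom R N P g by fact
  have "graded_hom R M P (\<lambda>x. g (f x))"
    by unfold_locales (use f.closed f.add f.smult f.degree g.closed g.add g.smult g.degree in auto)
  then show ?thesis unfolding compose_def by (rule graded_hom_restrict)
qed

lemma graded_hom_id:
  assumes "graded_left_module R M"
  shows "graded_hom R M M (\<lambda>x \<in> carrier M. x)"
proof (rule graded_hom_restrict)
  interpret graded_left_module R M by fact
  show "graded_hom R M M (\<lambda>x. x)" by unfold_locales auto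
qed

lemma hom_gr_restrict:
  assumes "graded_hom R M N f" "M \<in> fg_graded_modules R" "N \<in> fg_graded_modules R"
  shows "(M, N, restrict f (carrier M)) \<in> hom_set (gr R) M N"
  using assms graded_hom_restrict by (auto simp: hom_gr_iff)

lemma hom_gr_eqI:
  assumes "(M, N, f) \<in> hom_set (gr R) M N" "(M, N, g) \<in> hom_set (gr R) M N"
    "\<And>x. x \<in> carrier M \<Longrightarrow> f x = g x"
  shows "(M, N, f) = (M, N, g)"
  using assms by (auto simp: hom_gr_iff intro: extensionalityI)

lemma cat_gr: "cat (gr R)"
proof
  fix F assume "F \<in> arrs (gr R)"
  then show "src (gr R) F \<in> objs (gr R)" "tgt (gr R) F \<in> objs (gr R)" by (auto simp: gr_def)
next
  fix M assume "idm (gr R) M \<in> arrs (gr R)"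
  then show "M \<in> objs (gr R)" by (auto simp: gr_def)
next
  fix M assume "M \<in> objs (gr R)"
  then show "idm (gr R) M \<in> hom_set (gr R) M M"
    using graded_hom_id fg_graded_modulesD(1) by (auto simp: hom_gr_iff idm_gr)
next
  fix F M N G P assume "F \<in> hom_set (gr R) M N" "G \<in> hom_set (gr R) N P"
  then show "cmp (gr R) G F \<in> hom_set (gr R) M P"
    using graded_hom_compose by (auto simp: hom_gr_iff cmp_gr)
next
  fix F M N assume "F \<in> hom_set (gr R) M N"
  then obtain f where f: "F = (M, N, f)" "graded_hom R M N f" "f \<in> extensional (carrier M)"
    by (rule hom_grE)
  then have "x \<in> carrier M \<Longrightarrow> f x \<in> carrier N" for x using graded_hom.closed by metis
  then have "compose (carrier M) (\<lambda>x\<in>carrier N. x) f = f" "compose (carrier M) f (\<lambda>x\<in>carrier M. x) = f"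
    using f(3) by (auto simp: compose_def fun_eq_iff extensional_def)
  then show "cmp (gr R) (idm (gr R) N) F = F" "cmp (gr R) F (idm (gr R) M) = F"
    using f(1) by (simp_all add: cmp_gr idm_gr)
next
  fix F M N G P H Q
  assume "F \<in> hom_set (gr R) M N" "G \<in> hom_set (gr R) N P" "H \<in> hom_set (gr R) P Q"
  then obtain f g h where "F = (M, N, f)" "G = (N, P, g)" "H = (P, Q, h)" "graded_hom R M N f"
    by (metis hom_grE)
  then show "cmp (gr R) (cmp (gr R) H G) F = cmp (gr R) H (cmp (gr R) G F)"
    using graded_hom.closed[of R M N f] by (auto simp: cmp_gr compose_def intro!: ext)
qed

subsection \<open>Zero modules\<close>

definition zero_module :: "'b \<Rightarrow> ('a, 'b) graded_module" where
  "zero_module e = \<lparr>carrier = {e}, monoid.mult = undefined, monoid.one = undefined, ring.zero = e,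
     ring.add = (\<lambda>_ _. e), module.smult = (\<lambda>_ _. e), mcomp = (\<lambda>_. {e})\<rparr>"

lemma zero_module_simps [simp]:
  "carrier (zero_module e) = {e}" "\<zero>\<^bsub>zero_module e\<^esub> = e" "x \<oplus>\<^bsub>zero_module e\<^esub> y = e"
  "a \<odot>\<^bsub>zero_module e\<^esub> x = e" "mcomp (zero_module e) i = {e}"
  by (simp_all add: zero_module_def)

lemma zero_module_fg:
  assumes "ring R"
  shows "zero_module e \<in> fg_graded_modules R"
proof -
  interpret R: ring R by fact
  let ?O = "zero_module e :: ('a, 'b) graded_module"
  have ab: "abelian_group ?O" by (rule abelian_groupI) auto
  have lm: "left_module R ?O"
    by (intro left_module.intro left_module_axioms.intro ab assms) auto
  interpret left_module R ?O by fact
  have "graded_left_module R ?O"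
  proof (rule graded_left_moduleI[OF lm])
    show "subgroup (mcomp ?O i) (add_monoid ?O)" for i
      using M.add.subgroup_self by simp
    show "\<exists>A g. finite A \<and> (\<forall>i. g i \<in> mcomp ?O i) \<and> x = (\<Oplus>\<^bsub>?O\<^esub>i\<in>A. g i)" if "x \<in> carrier ?O" for x
      using that M.finsum_empty by (intro exI[of _ "{}"] exI[of _ "\<lambda>_. e"]) auto
  qed auto
  moreover have "finitely_generated R ?O"
    unfolding finitely_generated_iff
    using lin_span.zero[of ?O] by (intro exI[of _ "{}"]) auto
  ultimately show ?thesis by (simp add: fg_graded_modules_def)
qed

text \<open>
  For a zero object the identity and the zero map are the same arrow.
\<close>

lemma zero_object_gr:
  fixes M :: "('a, 'b) graded_module"
  assumes "ring R" "M \<in> fg_graded_modules R"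
  shows "zero_object (gr R) M \<longleftrightarrow> carrier M = {\<zero>\<^bsub>M\<^esub>}"
proof -
  interpret cat "gr R" by (rule cat_gr)
  have if_zero: "zero_object (gr R) M" if M: "carrier M = {\<zero>\<^bsub>M\<^esub>}" "M \<in> fg_graded_modules R"
    for M :: "('a, 'b) graded_module"
    unfolding zero_object_def
  proof (intro conjI ballI)
    interpret M: graded_left_module R M using fg_graded_modulesD(1)[OF M(2)] .
    have mM: "mcomp M i = {\<zero>\<^bsub>M\<^esub>}" for i using M.mcomp_carrier M.mcomp_zero M(1) by blast
    show "M \<in> objs (gr R)" using M by simp
    fix N :: "('a, 'b) graded_module" assume N: "N \<in> objs (gr R)"
    interpret N: graded_left_module R N using fg_graded_modulesD(1) N by simp
    have "graded_hom R N M (\<lambda>_. \<zero>\<^bsub>M\<^esub>)"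
      by unfold_locales (use M.smult_zero_right mM in auto)
    then have h: "(N, M, restrict (\<lambda>_. \<zero>\<^bsub>M\<^esub>) (carrier N)) \<in> hom_set (gr R) N M"
      using hom_gr_restrict M(2) N by simp
    have "F = G" if "F \<in> hom_set (gr R) N M" "G \<in> hom_set (gr R) N M" for F G
    proof -
      obtain f g where fg: "F = (N, M, f)" "G = (N, M, g)" "graded_hom R N M f" "graded_hom R N M g"
        using \<open>F \<in> _\<close> \<open>G \<in> _\<close> by (metis hom_grE)
      then have "f x = g x" if "x \<in> carrier N" for x
        using graded_hom.closed[OF fg(3) that] graded_hom.closed[OF fg(4) that] M(1) by simp
      then show ?thesis using that fg hom_gr_eqI by blast
    qed
    then show "\<exists>!f. f \<in> hom_set (gr R) N M" using h by blast
    have z: "graded_hom R M N (\<lambda>_. \<zero>\<^bsub>N\<^esub>)"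
      by unfold_locales (use N.smult_zero_right N.mcomp_zero in auto)
    then have h: "(M, N, restrict (\<lambda>_. \<zero>\<^bsub>N\<^esub>) (carrier M)) \<in> hom_set (gr R) M N"
      using hom_gr_restrict M(2) N by simp
    have "F = G" if "F \<in> hom_set (gr R) M N" "G \<in> hom_set (gr R) M N" for F G
    proof -
      obtain f g where fg: "F = (M, N, f)" "G = (M, N, g)" "graded_hom R M N f" "graded_hom R M N g"
        using \<open>F \<in> _\<close> \<open>G \<in> _\<close> by (metis hom_grE)
      then have "f x = g x" if "x \<in> carrier M" for x
        using graded_hom.hom_zero[OF fg(3)] graded_hom.hom_zero[OF fg(4)] M(1) that by auto
      then show ?thesis using that fg hom_gr_eqI by blast
    qed
    then show "\<exists>!f. f \<in> hom_set (gr R) M N" using h by blast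
  qed
  show ?thesis
  proof
    assume "zero_object (gr R) M"
    moreover have "zero_object (gr R) (zero_module undefined :: ('a, 'b) graded_module)"
      by (intro if_zero zero_module_fg assms(1)) simp
    ultimately obtain F G where FG: "inverse_arrows (gr R) M (zero_module undefined) F G"
      using zero_object_unique unfolding isomorphic_iff by blast
    obtain f where f: "F = (M, zero_module undefined, f)" "graded_hom R M (zero_module undefined) f"
      by (rule hom_grE[OF inverse_arrowsD(1)[OF FG]])
    obtain g where g: "G = (zero_module undefined, M, g)" "graded_hom R (zero_module undefined) M g"
      by (rule hom_grE[OF inverse_arrowsD(2)[OF FG]])
    have c: "compose (carrier M) g f = (\<lambda>x\<in>carrier M. x)"
      using inverse_arrowsD(3)[OF FG] f g by (simp add: cmp_gr idm_gr)
    have "x = \<zero>\<^bsub>M\<^esub>" if "x \<in> carrier M" for x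
    proof -
      have "x = g (f x)" using fun_cong[OF c, of x] that by (simp add: compose_def)
      also have "f x = undefined" using graded_hom.closed[OF f(2) that] by simp
      also have "g undefined = \<zero>\<^bsub>M\<^esub>" using graded_hom.hom_zero[OF g(2)] by simp
      finally show ?thesis .
    qed
    moreover interpret M: graded_left_module R M using fg_graded_modulesD(1)[OF assms(2)] .
    have "\<zero>\<^bsub>M\<^esub> \<in> carrier M" by simp
    ultimately show "carrier M = {\<zero>\<^bsub>M\<^esub>}" by blast
  qed (rule if_zero[OF _ assms(2)])
qed

lemma zero_arrow_gr:
  assumes "ring R" "(M, N, f) \<in> hom_set (gr R) M N"
  shows "zero_arrow (gr R) (M, N, f) \<longleftrightarrow> (\<forall>x \<in> carrier M. f x = \<zero>\<^bsub>N\<^esub>)"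
proof
  interpret cat "gr R" by (rule cat_gr)
  have M: "M \<in> fg_graded_modules R" and N: "N \<in> fg_graded_modules R" and f: "graded_hom R M N f"
    using assms(2) by (auto simp: hom_gr_iff)
  interpret graded_hom R M N f by fact
  {
    assume "zero_arrow (gr R) (M, N, f)"
    then obtain Z G H where Z: "zero_object (gr R) Z" "G \<in> hom_set (gr R) M Z" "H \<in> hom_set (gr R) Z N"
      "(M, N, f) = cmp (gr R) H G"
      using hom_setD[OF assms(2)] by (auto simp: zero_arrow_def)
    obtain g where g: "G = (M, Z, g)" "graded_hom R M Z g" "Z \<in> fg_graded_modules R"
      by (rule hom_grE[OF Z(2)])
    obtain h where h: "H = (Z, N, h)" "graded_hom R Z N h"
      by (rule hom_grE[OF Z(3)])
    have c: "f = compose (carrier M) h g" using Z(4) g h by (simp add: cmp_gr)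
    show "\<forall>x \<in> carrier M. f x = \<zero>\<^bsub>N\<^esub>"
    proof
      fix x assume x: "x \<in> carrier M"
      have "g x = \<zero>\<^bsub>Z\<^esub>"
        using graded_hom.closed[OF g(2) x] zero_object_gr[OF assms(1) g(3)] Z(1) by simp
      then show "f x = \<zero>\<^bsub>N\<^esub>" using x c graded_hom.hom_zero[OF h(2)] by (simp add: compose_def)
    qed
  next
    assume f0: "\<forall>x \<in> carrier M. f x = \<zero>\<^bsub>N\<^esub>"
    let ?O = "zero_module undefined :: ('a, 'b) graded_module"
    have "?O \<in> fg_graded_modules R" by (rule zero_module_fg[OF assms(1)])
    then have O: "zero_object (gr R) ?O" using zero_object_gr[OF assms(1), of ?O] by simp
    obtain G where G: "G \<in> hom_set (gr R) M N" "zero_arrow (gr R) G"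
      using zero_arrow_exists[OF O, of M N] M N by auto
    obtain H K where HK: "H \<in> hom_set (gr R) M ?O" "K \<in> hom_set (gr R) ?O N"
      using zero_object_homs[OF O, of M] zero_object_homs[OF O, of N] M N by (metis objs_gr)
    obtain h where h: "H = (M, ?O, h)" "graded_hom R M ?O h" by (rule hom_grE[OF HK(1)])
    obtain k where k: "K = (?O, N, k)" "graded_hom R ?O N k" by (rule hom_grE[OF HK(2)])
    have "k (h x) = \<zero>\<^bsub>N\<^esub>" if "x \<in> carrier M" for x
      using graded_hom.closed[OF h(2) that] graded_hom.hom_zero[OF k(2)] by simp
    then have "(M, N, f) = (M, N, compose (carrier M) k h)"
      using cmp_hom[OF HK] h k f0 by (intro hom_gr_eqI[OF assms(2)]) (simp_all add: cmp_gr compose_def)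
    then show "zero_arrow (gr R) (M, N, f)"
      using zero_arrowI[OF O HK] h k by (simp add: cmp_gr)
  }
qed

lemma zero_arrow_cmp_gr:
  assumes "ring R" "(M, N, f) \<in> hom_set (gr R) M N" "(N, P, g) \<in> hom_set (gr R) N P"
  shows "zero_arrow (gr R) (cmp (gr R) (N, P, g) (M, N, f)) \<longleftrightarrow> (\<forall>x \<in> carrier M. g (f x) = \<zero>\<^bsub>P\<^esub>)"
  using zero_arrow_gr[OF assms(1), of M P "compose (carrier M) g f"] cat.cmp_hom[OF cat_gr assms(2,3)]
  by (simp add: cmp_gr compose_def)

subsection \<open>Isomorphisms, kernels and cokernels\<close>

lemma gr_iso_bijective:
  assumes "inverse_arrows (gr R) M N (M, N, f) G"
  shows "inj_on f (carrier M)" "f ` carrier M = carrier N"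
proof -
  obtain g where g: "G = (N, M, g)" "graded_hom R N M g"
    by (rule hom_grE[OF inverse_arrowsD(2)[OF assms]])
  have f: "graded_hom R M N f" using inverse_arrowsD(1)[OF assms] by (auto simp: hom_gr_iff)
  have gf: "g (f x) = x" if "x \<in> carrier M" for x
    using inverse_arrowsD(3)[OF assms] g that by (auto simp: cmp_gr idm_gr compose_def dest: fun_cong[of _ _ x])
  have fg: "f (g x) = x" if "x \<in> carrier N" for x
    using inverse_arrowsD(4)[OF assms] g that by (auto simp: cmp_gr idm_gr compose_def dest: fun_cong[of _ _ x])
  show "inj_on f (carrier M)" using gf by (rule inj_on_inverseI)
  show "f ` carrier M = carrier N"
    using fg graded_hom.closed[OF f] graded_hom.closed[OF g(2)] by (auto simp: image_iff) metis
qed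

lemma gr_bijective_iso:
  assumes "(M, N, f) \<in> hom_set (gr R) M N" "inj_on f (carrier M)" "f ` carrier M = carrier N"
  shows "\<exists>G. inverse_arrows (gr R) M N (M, N, f) G"
proof -
  have M: "M \<in> fg_graded_modules R" and N: "N \<in> fg_graded_modules R" and f: "graded_hom R M N f"
    and fe: "f \<in> extensional (carrier M)"
    using assms(1) by (auto simp: hom_gr_iff)
  interpret graded_hom R M N f by fact
  let ?g = "inv_into (carrier M) f"
  have gc: "?g y \<in> carrier M" and fg: "f (?g y) = y" if "y \<in> carrier N" for y
    using that assms(3) by (metis inv_into_into, metis f_inv_into_f)
  have gf: "?g (f x) = x" if "x \<in> carrier M" for x using assms(2) that by simp
  have g: "graded_hom R N M ?g"
  proof (unfold_locales, goal_cases)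
    case (1 x) then show ?case by (rule gc)
  next
    case (2 x y)
    then have "f (?g x \<oplus>\<^bsub>M\<^esub> ?g y) = x \<oplus>\<^bsub>N\<^esub> y" using add gc fg by simp
    then show ?case using gf[of "?g x \<oplus>\<^bsub>M\<^esub> ?g y"] gc 2 by simp
  next
    case (3 a x)
    then have "f (a \<odot>\<^bsub>M\<^esub> ?g x) = a \<odot>\<^bsub>N\<^esub> x" using smult gc fg by simp
    then show ?case using gf[of "a \<odot>\<^bsub>M\<^esub> ?g x"] gc 3 M.smult_closed by simp
  next
    case (4 x i)
    then have "x \<in> carrier N" using N.mcomp_carrier by blast
    then show ?case using reflects_degree[OF assms(2) gc] fg 4 by simp
  qed
  have "inverse_arrows (gr R) M N (M, N, f) (N, M, restrict ?g (carrier N))"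
    using assms(1) hom_gr_restrict[OF g N M] closed gc fg gf
    by (auto simp: inverse_arrows_def cmp_gr idm_gr compose_def fun_eq_iff)
  then show ?thesis by blast
qed

text \<open>
  An arrow that \<open>f\<close> kills has its values in the image of the injective map \<open>k\<close>; following it by the
  inverse of \<open>k\<close> on this image gives the factorization.
\<close>

lemma is_kernel_grI:
  assumes "ring R" and f: "(M, N, f) \<in> hom_set (gr R) M N" and k: "(K, M, k) \<in> hom_set (gr R) K M"
    and inj: "inj_on k (carrier K)" and img: "k ` carrier K = {x \<in> carrier M. f x = \<zero>\<^bsub>N\<^esub>}"
  shows "is_kernel (gr R) (M, N, f) (K, M, k)"
proof -
  interpret cat "gr R" by (rule cat_gr)
  have f': "graded_hom R M N f" and k': "graded_hom R K M k" and K: "K \<in> fg_graded_modules R"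
    using f k by (auto simp: hom_gr_iff)
  interpret f: graded_hom R M N f by fact
  interpret k: graded_hom R K M k by fact
  show ?thesis
  proof (rule is_kernelI[OF f k])
    show "zero_arrow (gr R) (cmp (gr R) (M, N, f) (K, M, k))"
      using zero_arrow_cmp_gr[OF assms(1) k f] img by blast
  next
    fix P G assume G: "G \<in> hom_set (gr R) P M" "zero_arrow (gr R) (cmp (gr R) (M, N, f) G)"
    obtain g where g: "G = (P, M, g)" "graded_hom R P M g" "P \<in> fg_graded_modules R"
      "g \<in> extensional (carrier P)"
      by (rule hom_grE[OF G(1)])
    interpret g: graded_hom R P M g by fact
    have fg: "f (g x) = \<zero>\<^bsub>N\<^esub>" if "x \<in> carrier P" for x
      using G that zero_arrow_cmp_gr[OF assms(1) _ f] g(1) by blast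
    let ?u = "\<lambda>x. inv_into (carrier K) k (g x)"
    have gi: "g x \<in> k ` carrier K" if "x \<in> carrier P" for x
      using img fg[OF that] g.closed[OF that] by blast
    have uc: "?u x \<in> carrier K" and ku: "k (?u x) = g x" if "x \<in> carrier P" for x
      using gi[OF that] by (simp_all add: inv_into_into f_inv_into_f)
    have uk: "y = ?u x" if "k y = g x" "y \<in> carrier K" for x y using that inv_into_f_f[OF inj, of y] by simp
    have "graded_hom R P K ?u"
    proof (unfold_locales, goal_cases)
      case (1 x) then show ?case by (rule uc)
    next
      case (2 x y)
      then show ?case
        using uk[of "?u x \<oplus>\<^bsub>K\<^esub> ?u y" "x \<oplus>\<^bsub>P\<^esub> y"] uc ku k.add g.add by simp
    next
      case (3 a x)
      then show ?case
        using uk[of "a \<odot>\<^bsub>K\<^esub> ?u x" "a \<odot>\<^bsub>P\<^esub> x"] uc ku k.smult g.smult k.M.smult_closed by simp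
    next
      case (4 x i)
      then have "x \<in> carrier P" using g.M.mcomp_carrier by blast
      then show ?case using k.reflects_degree[OF inj uc] ku 4 g.degree by simp
    qed
    then have u: "(P, K, restrict ?u (carrier P)) \<in> hom_set (gr R) P K"
      using hom_gr_restrict g(3) K by blast
    moreover have "cmp (gr R) (K, M, k) (P, K, restrict ?u (carrier P)) = G"
      using g ku by (auto simp: cmp_gr compose_def fun_eq_iff extensional_def)
    ultimately show "\<exists>U. U \<in> hom_set (gr R) P K \<and> cmp (gr R) (K, M, k) U = G" by blast
  next
    fix P U V assume UV: "U \<in> hom_set (gr R) P K" "V \<in> hom_set (gr R) P K"
      "cmp (gr R) (K, M, k) U = cmp (gr R) (K, M, k) V"
    obtain u where u: "U = (P, K, u)" "graded_hom R P K u" by (rule hom_grE[OF UV(1)])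
    obtain v where v: "V = (P, K, v)" "graded_hom R P K v" by (rule hom_grE[OF UV(2)])
    have "k (u x) = k (v x)" if "x \<in> carrier P" for x
      using UV(3) that u v by (auto simp: cmp_gr compose_def dest: fun_cong[of _ _ x])
    then have "u x = v x" if "x \<in> carrier P" for x
      using inj_onD[OF inj] graded_hom.closed[OF u(2)] graded_hom.closed[OF v(2)] that by blast
    then show "U = V" using UV(1,2) u v hom_gr_eqI by blast
  qed
qed

text \<open>
  A homomorphism that vanishes on the image of \<open>f\<close> is constant on the fibres of \<open>q\<close> and descends
  along the surjection \<open>q\<close>.
\<close>

lemma is_cokernel_grI:
  assumes "ring R" and f: "(M, N, f) \<in> hom_set (gr R) M N" and q: "(N, C, q) \<in> hom_set (gr R) N C"
    and surj: "q ` carrier N = carrier C" and ker: "f ` carrier M = {y \<in> carrier N. q y = \<zero>\<^bsub>C\<^esub>}"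
  shows "is_cokernel (gr R) (M, N, f) (N, C, q)"
proof -
  interpret cat "gr R" by (rule cat_gr)
  interpret op: cat "opposite (gr R)" by (rule cat_opposite) (rule cat_gr)
  have f': "graded_hom R M N f" and q': "graded_hom R N C q" and C: "C \<in> fg_graded_modules R"
    using f q by (auto simp: hom_gr_iff)
  interpret f: graded_hom R M N f by fact
  interpret q: graded_hom R N C q by fact
  have "is_kernel (opposite (gr R)) (M, N, f) (N, C, q)"
  proof (rule op.is_kernelI, unfold hom_set_opposite opposite_simps zero_arrow_opposite)
    show "(M, N, f) \<in> hom_set (gr R) M N" "(N, C, q) \<in> hom_set (gr R) N C" by fact+
    show "zero_arrow (gr R) (cmp (gr R) (N, C, q) (M, N, f))"
      using zero_arrow_cmp_gr[OF assms(1) f q] ker by blast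
  next
    fix P G assume G: "G \<in> hom_set (gr R) N P" "zero_arrow (gr R) (cmp (gr R) G (M, N, f))"
    obtain g where g: "G = (N, P, g)" "graded_hom R N P g" "P \<in> fg_graded_modules R"
      "g \<in> extensional (carrier N)"
      by (rule hom_grE[OF G(1)])
    interpret g: graded_hom R N P g by fact
    have gf: "g (f x) = \<zero>\<^bsub>P\<^esub>" if "x \<in> carrier M" for x
      using G that zero_arrow_cmp_gr[OF assms(1) f] g(1) by blast
    have gq: "g x = g y" if "x \<in> carrier N" "y \<in> carrier N" "q x = q y" for x y
    proof -
      have "x \<ominus>\<^bsub>N\<^esub> y \<in> f ` carrier M"
        using q.eq_iff_diff[OF that(1,2)] that ker by auto
      then have "g (x \<ominus>\<^bsub>N\<^esub> y) = \<zero>\<^bsub>P\<^esub>" using gf by auto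
      then show ?thesis using g.eq_iff_diff[OF that(1,2)] by simp
    qed
    let ?s = "inv_into (carrier N) q"
    let ?u = "\<lambda>x. g (?s x)"
    have sc: "?s x \<in> carrier N" "q (?s x) = x" if "x \<in> carrier C" for x
      using surj that by (metis inv_into_into, metis f_inv_into_f)
    have us: "?u x = g y" if "y \<in> carrier N" "q y = x" for x y
      using gq[OF sc(1) that(1)] sc(2) that q.closed by blast
    have "graded_hom R C P ?u"
    proof (unfold_locales, goal_cases)
      case (1 x) then show ?case using sc g.closed by blast
    next
      case (2 x y)
      then show ?case using us[of "?s x \<oplus>\<^bsub>N\<^esub> ?s y"] sc q.add g.add by simp
    next
      case (3 a x)
      then show ?case using us[of "a \<odot>\<^bsub>N\<^esub> ?s x"] sc q.smult g.smult f.N.smult_closed by simp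
    next
      case (4 x i)
      then have "x \<in> q ` mcomp N i" using q.lifts_degree surj q.N.mcomp_carrier by blast
      then obtain y where y: "y \<in> mcomp N i" "x = q y" by (elim imageE)
      then show ?case using us[OF f.N.mcomp_carrier[OF y(1)]] g.degree[OF y(1)] by simp
    qed
    then have u: "(C, P, restrict ?u (carrier C)) \<in> hom_set (gr R) C P"
      using hom_gr_restrict g(3) C by blast
    moreover have "cmp (gr R) (C, P, restrict ?u (carrier C)) (N, C, q) = G"
      using g us q.closed by (auto simp: cmp_gr compose_def fun_eq_iff extensional_def)
    ultimately show "\<exists>U. U \<in> hom_set (gr R) C P \<and> cmp (gr R) U (N, C, q) = G" by blast
  next
    fix P U V assume UV: "U \<in> hom_set (gr R) C P" "V \<in> hom_set (gr R) C P"
      "cmp (gr R) U (N, C, q) = cmp (gr R) V (N, C, q)"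
    obtain u where u: "U = (C, P, u)" "graded_hom R C P u" by (rule hom_grE[OF UV(1)])
    obtain v where v: "V = (C, P, v)" "graded_hom R C P v" by (rule hom_grE[OF UV(2)])
    have "u (q x) = v (q x)" if "x \<in> carrier N" for x
      using UV(3) that u v by (auto simp: cmp_gr compose_def dest: fun_cong[of _ _ x])
    then have "u x = v x" if "x \<in> carrier C" for x
      using surj that by (metis image_iff)
    then show "U = V" using UV(1,2) u v hom_gr_eqI by blast
  qed
  then show ?thesis by simp
qed

subsection \<open>Graded submodules and quotients\<close>

definition graded_submodule ::
  "('a, 'r) graded_ring_scheme \<Rightarrow> ('a, 'b, 'm) graded_module_scheme \<Rightarrow> 'b set \<Rightarrow> bool" where
  "graded_submodule R M L \<longleftrightarrow> L \<subseteq> carrier M \<and> \<zero>\<^bsub>M\<^esub> \<in> L \<and>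
     (\<forall>x \<in> L. \<forall>y \<in> L. x \<oplus>\<^bsub>M\<^esub> y \<in> L) \<and> (\<forall>a \<in> carrier R. \<forall>x \<in> L. a \<odot>\<^bsub>M\<^esub> x \<in> L) \<and>
     (\<forall>x \<in> L. \<forall>i. homogeneous_part M x i \<in> L)"

lemma graded_submoduleD:
  assumes "graded_submodule R M L"
  shows "x \<in> L \<Longrightarrow> x \<in> carrier M" "\<zero>\<^bsub>M\<^esub> \<in> L" "x \<in> L \<Longrightarrow> y \<in> L \<Longrightarrow> x \<oplus>\<^bsub>M\<^esub> y \<in> L"
    "a \<in> carrier R \<Longrightarrow> x \<in> L \<Longrightarrow> a \<odot>\<^bsub>M\<^esub> x \<in> L" "x \<in> L \<Longrightarrow> homogeneous_part M x i \<in> L"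
  using assms by (auto simp: graded_submodule_def)

definition submodule_obj :: "('a, 'b) graded_module \<Rightarrow> 'b set \<Rightarrow> ('a, 'b) graded_module" where
  "submodule_obj M L = M\<lparr>carrier := L, mcomp := (\<lambda>i. mcomp M i \<inter> L)\<rparr>"

lemma submodule_obj_simps [simp]:
  "carrier (submodule_obj M L) = L" "\<zero>\<^bsub>submodule_obj M L\<^esub> = \<zero>\<^bsub>M\<^esub>"
  "x \<oplus>\<^bsub>submodule_obj M L\<^esub> y = x \<oplus>\<^bsub>M\<^esub> y" "a \<odot>\<^bsub>submodule_obj M L\<^esub> x = a \<odot>\<^bsub>M\<^esub> x"
  "mcomp (submodule_obj M L) i = mcomp M i \<inter> L"
  by (simp_all add: submodule_obj_def)

lemma lin_span_submodule_obj [simp]: "lin_span (submodule_obj M L) K S = lin_span M K S"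
  by (rule lin_span_cong) (auto simp: submodule_obj_def)

context graded_left_module
begin

lemma part_zero [simp]: "part \<zero>\<^bsub>M\<^esub> i = \<zero>\<^bsub>M\<^esub>"
  using part_homogeneous[OF mcomp_zero[of i]] by simp

lemma submodule_minus: "graded_submodule R M L \<Longrightarrow> x \<in> L \<Longrightarrow> \<ominus>\<^bsub>M\<^esub> x \<in> L"
  using graded_submoduleD(4)[of R M L "\<ominus> \<one>" x] graded_submoduleD(1)[of R M L x] minus_one_smult[of x] by simp

end

lemma submodule_obj_graded:
  assumes "graded_left_module R M" and R: "\<And>i. rcomp R i \<subseteq> carrier R" and L: "graded_submodule R M L"
  shows "graded_left_module R (submodule_obj M L)" "graded_hom R (submodule_obj M L) M (\<lambda>x. x)"
proof -
  interpret graded_left_module R M by fact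
  note LD = graded_submoduleD[OF L]
  let ?L = "submodule_obj M L"
  have neg: "\<ominus>\<^bsub>M\<^esub> x \<in> L" if "x \<in> L" for x using submodule_minus[OF L that] .
  have ab: "abelian_group ?L"
  proof (rule abelian_groupI)
    fix x assume "x \<in> carrier ?L"
    then show "\<exists>y\<in>carrier ?L. y \<oplus>\<^bsub>?L\<^esub> x = \<zero>\<^bsub>?L\<^esub>"
      using neg[of x] M.l_neg[OF LD(1)[of x]] by (intro bexI[of _ "\<ominus>\<^bsub>M\<^esub> x"]) auto
  qed (use LD(1) in \<open>auto intro: LD(2,3) M.a_assoc M.a_comm\<close>)
  have lm: "left_module R ?L"
    by (intro left_module.intro left_module_axioms.intro ab)
      (use LD R.ring_axioms smult_l_distr smult_r_distr smult_assoc smult_one in auto)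
  interpret L: left_module R ?L by fact
  have sum: "finsum ?L g A = finsum M g A" if "\<And>i. i \<in> A \<Longrightarrow> g i \<in> L" for g and A :: "int set"
    using that
  proof (induction A rule: infinite_finite_induct)
    case (insert i A)
    then show ?case using LD(1) by simp
  qed simp_all
  show gl: "graded_left_module R ?L"
  proof (rule graded_left_moduleI[OF lm])
    fix i
    have "inv\<^bsub>add_monoid ?L\<^esub> x = \<ominus>\<^bsub>M\<^esub> x" if "x \<in> L" for x
      unfolding a_inv_def[of ?L, symmetric]
      by (rule L.M.minus_equality) (use that neg LD(1) in \<open>simp_all add: M.l_neg\<close>)
    then show "subgroup (mcomp ?L i) (add_monoid ?L)"
      using LD neg mcomp_zero mcomp_add mcomp_minus by (intro subgroup.intro) auto
  next
    fix i j a x assume "a \<in> rcomp R i" "x \<in> mcomp ?L j"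
    then show "a \<odot>\<^bsub>?L\<^esub> x \<in> mcomp ?L (i + j)" using mcomp_smult[of a i x j] LD(4)[of a x] R by auto
  next
    fix x assume "x \<in> carrier ?L"
    then have x: "x \<in> L" "x \<in> carrier M" using LD(1) by auto
    have "x = (\<Oplus>\<^bsub>?L\<^esub>i\<in>{i. homogeneous_part M x i \<noteq> \<zero>\<^bsub>M\<^esub>}. homogeneous_part M x i)"
      by (rule trans[OF homogeneous_part(3)[OF x(2)] sum[symmetric]]) (rule LD(5)[OF x(1)])
    then show "\<exists>A g. finite A \<and> (\<forall>i. g i \<in> mcomp ?L i) \<and> x = (\<Oplus>\<^bsub>?L\<^esub>i\<in>A. g i)"
      using homogeneous_part(1,2)[OF x(2)] LD(5)[OF x(1)] by auto
  next
    fix A g i assume g: "finite A" "\<forall>i. g i \<in> mcomp ?L i" "(\<Oplus>\<^bsub>?L\<^esub>i\<in>A. g i) = \<zero>\<^bsub>?L\<^esub>" "i \<in> A"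
    then have "homogeneous_part M \<zero>\<^bsub>M\<^esub> i = g i"
      using homogeneous_part_unique[of A g "\<zero>\<^bsub>M\<^esub>"] sum[of A g] by auto
    then show "g i = \<zero>\<^bsub>?L\<^esub>" using part_homogeneous[OF mcomp_zero[of i]] by simp
  qed
  interpret L: graded_left_module R ?L by fact
  show "graded_hom R ?L M (\<lambda>x. x)" by unfold_locales (use LD(1) in auto)
qed

definition coset_rep :: "('a, 'b, 'm) graded_module_scheme \<Rightarrow> 'b set \<Rightarrow> 'b \<Rightarrow> 'b" where
  "coset_rep M L x = (SOME y. y \<in> carrier M \<and> x \<ominus>\<^bsub>M\<^esub> y \<in> L)"

text \<open>
  The elements of a quotient are represented by chosen elements of the cosets, so that the
  quotient lives in the same universe as the module.
\<close>

definition quotient_obj :: "('a, 'b) graded_module \<Rightarrow> 'b set \<Rightarrow> ('a, 'b) graded_module" where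
  "quotient_obj M L = \<lparr>carrier = coset_rep M L ` carrier M, monoid.mult = undefined, monoid.one = undefined,
     ring.zero = coset_rep M L \<zero>\<^bsub>M\<^esub>, ring.add = (\<lambda>x y. coset_rep M L (x \<oplus>\<^bsub>M\<^esub> y)),
     module.smult = (\<lambda>a x. coset_rep M L (a \<odot>\<^bsub>M\<^esub> x)), mcomp = (\<lambda>i. coset_rep M L ` mcomp M i)\<rparr>"

lemma quotient_obj_simps [simp]:
  "carrier (quotient_obj M L) = coset_rep M L ` carrier M" "\<zero>\<^bsub>quotient_obj M L\<^esub> = coset_rep M L \<zero>\<^bsub>M\<^esub>"
  "x \<oplus>\<^bsub>quotient_obj M L\<^esub> y = coset_rep M L (x \<oplus>\<^bsub>M\<^esub> y)"
  "a \<odot>\<^bsub>quotient_obj M L\<^esub> x = coset_rep M L (a \<odot>\<^bsub>M\<^esub> x)"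
  "mcomp (quotient_obj M L) i = coset_rep M L ` mcomp M i"
  by (simp_all add: quotient_obj_def)

context graded_left_module
begin

lemma minus_add_minus:
  assumes "x \<in> carrier M" "y \<in> carrier M" "x' \<in> carrier M" "y' \<in> carrier M"
  shows "(x \<oplus>\<^bsub>M\<^esub> y) \<ominus>\<^bsub>M\<^esub> (x' \<oplus>\<^bsub>M\<^esub> y') = (x \<ominus>\<^bsub>M\<^esub> x') \<oplus>\<^bsub>M\<^esub> (y \<ominus>\<^bsub>M\<^esub> y')"
  using assms by (simp add: M.minus_eq M.minus_add M.a_ac)

lemma smult_diff:
  assumes "a \<in> carrier R" "x \<in> carrier M" "y \<in> carrier M"
  shows "a \<odot>\<^bsub>M\<^esub> (x \<ominus>\<^bsub>M\<^esub> y) = a \<odot>\<^bsub>M\<^esub> x \<ominus>\<^bsub>M\<^esub> a \<odot>\<^bsub>M\<^esub> y"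
  using assms by (simp add: M.minus_eq smult_r_distr smult_minus_right)

end

context graded_left_module
begin

context
  fixes L
  assumes L0: "L \<subseteq> carrier M" "\<zero>\<^bsub>M\<^esub> \<in> L" and Ladd: "\<And>x y. x \<in> L \<Longrightarrow> y \<in> L \<Longrightarrow> x \<oplus>\<^bsub>M\<^esub> y \<in> L"
    and Lsmult: "\<And>a x. a \<in> carrier R \<Longrightarrow> x \<in> L \<Longrightarrow> a \<odot>\<^bsub>M\<^esub> x \<in> L"
begin

lemma L_minus: "x \<in> L \<Longrightarrow> \<ominus>\<^bsub>M\<^esub> x \<in> L"
  using Lsmult[of "\<ominus> \<one>" x] L0 minus_one_smult[of x] by auto

lemma diff_sym: "x \<in> carrier M \<Longrightarrow> y \<in> carrier M \<Longrightarrow> x \<ominus>\<^bsub>M\<^esub> y \<in> L \<Longrightarrow> y \<ominus>\<^bsub>M\<^esub> x \<in> L"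
  using L_minus[of "x \<ominus>\<^bsub>M\<^esub> y"] by (simp add: M.minus_eq M.minus_add M.a_comm)

lemma diff_trans:
  assumes "x \<in> carrier M" "y \<in> carrier M" "z \<in> carrier M" "x \<ominus>\<^bsub>M\<^esub> y \<in> L" "y \<ominus>\<^bsub>M\<^esub> z \<in> L"
  shows "x \<ominus>\<^bsub>M\<^esub> z \<in> L"
proof -
  have "(x \<ominus>\<^bsub>M\<^esub> y) \<oplus>\<^bsub>M\<^esub> (y \<ominus>\<^bsub>M\<^esub> z) = (x \<oplus>\<^bsub>M\<^esub> (\<ominus>\<^bsub>M\<^esub> y \<oplus>\<^bsub>M\<^esub> y)) \<oplus>\<^bsub>M\<^esub> \<ominus>\<^bsub>M\<^esub> z"
    using assms(1-3) by (simp only: M.minus_eq M.a_assoc M.a_inv_closed M.a_closed)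
  also have "\<dots> = x \<ominus>\<^bsub>M\<^esub> z" using assms(1-3) by (simp add: M.l_neg M.minus_eq)
  finally show ?thesis using Ladd[OF assms(4,5)] by simp
qed

lemma coset_rep: 
  assumes "x \<in> carrier M"
  shows "coset_rep M L x \<in> carrier M" "x \<ominus>\<^bsub>M\<^esub> coset_rep M L x \<in> L"
proof -
  have "x \<ominus>\<^bsub>M\<^esub> x \<in> L" using assms L0(2) by (simp add: M.minus_eq M.r_neg)
  then have "\<exists>y. y \<in> carrier M \<and> x \<ominus>\<^bsub>M\<^esub> y \<in> L" using assms by blast
  from someI_ex[OF this] show "coset_rep M L x \<in> carrier M" "x \<ominus>\<^bsub>M\<^esub> coset_rep M L x \<in> L"
    by (auto simp: coset_rep_def)
qed

lemma coset_rep_eq: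
  assumes "x \<in> carrier M" "y \<in> carrier M"
  shows "coset_rep M L x = coset_rep M L y \<longleftrightarrow> x \<ominus>\<^bsub>M\<^esub> y \<in> L"
proof
  assume "coset_rep M L x = coset_rep M L y"
  then have "x \<ominus>\<^bsub>M\<^esub> coset_rep M L y \<in> L" using coset_rep(2)[OF assms(1)] by simp
  then show "x \<ominus>\<^bsub>M\<^esub> y \<in> L"
    using diff_trans[OF assms(1) coset_rep(1)[OF assms(2)] assms(2)]
      diff_sym[OF assms(2) coset_rep(1)[OF assms(2)] coset_rep(2)[OF assms(2)]] by simp
next
  assume xy: "x \<ominus>\<^bsub>M\<^esub> y \<in> L"
  have "x \<ominus>\<^bsub>M\<^esub> z \<in> L \<longleftrightarrow> y \<ominus>\<^bsub>M\<^esub> z \<in> L" if "z \<in> carrier M" for z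
    using diff_trans[OF assms that xy] diff_trans[OF assms(2,1) that diff_sym[OF assms xy]] by blast
  then have "(\<lambda>z. z \<in> carrier M \<and> x \<ominus>\<^bsub>M\<^esub> z \<in> L) = (\<lambda>z. z \<in> carrier M \<and> y \<ominus>\<^bsub>M\<^esub> z \<in> L)" by blast
  then show "coset_rep M L x = coset_rep M L y" by (simp add: coset_rep_def)
qed

lemma coset_rep_idem: "x \<in> carrier M \<Longrightarrow> coset_rep M L (coset_rep M L x) = coset_rep M L x"
  using coset_rep_eq[of "coset_rep M L x" x] coset_rep[of x] diff_sym[of x "coset_rep M L x"] by blast

lemma coset_rep_add:
  assumes "x \<in> carrier M" "y \<in> carrier M"
  shows "coset_rep M L (coset_rep M L x \<oplus>\<^bsub>M\<^esub> coset_rep M L y) = coset_rep M L (x \<oplus>\<^bsub>M\<^esub> y)"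
proof (rule sym, subst coset_rep_eq)
  note x = coset_rep[OF assms(1)] and y = coset_rep[OF assms(2)]
  show "x \<oplus>\<^bsub>M\<^esub> y \<in> carrier M" "coset_rep M L x \<oplus>\<^bsub>M\<^esub> coset_rep M L y \<in> carrier M"
    using x y assms by auto
  show "x \<oplus>\<^bsub>M\<^esub> y \<ominus>\<^bsub>M\<^esub> (coset_rep M L x \<oplus>\<^bsub>M\<^esub> coset_rep M L y) \<in> L"
    using minus_add_minus[OF assms x(1) y(1)] Ladd[OF x(2) y(2)] by simp
qed

lemma coset_rep_smult:
  assumes "a \<in> carrier R" "x \<in> carrier M"
  shows "coset_rep M L (a \<odot>\<^bsub>M\<^esub> coset_rep M L x) = coset_rep M L (a \<odot>\<^bsub>M\<^esub> x)"
proof (rule sym, subst coset_rep_eq)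
  note x = coset_rep[OF assms(2)]
  show "a \<odot>\<^bsub>M\<^esub> x \<in> carrier M" "a \<odot>\<^bsub>M\<^esub> coset_rep M L x \<in> carrier M"
    using x assms smult_closed by auto
  show "a \<odot>\<^bsub>M\<^esub> x \<ominus>\<^bsub>M\<^esub> a \<odot>\<^bsub>M\<^esub> coset_rep M L x \<in> L"
    using smult_diff[OF assms x(1)] Lsmult[OF assms(1) x(2)] by simp
qed

end

end

lemma quotient_obj_graded:
  assumes "graded_left_module R M" and R: "\<And>i. rcomp R i \<subseteq> carrier R" and L: "graded_submodule R M L"
  shows "graded_left_module R (quotient_obj M L)" "graded_hom R M (quotient_obj M L) (coset_rep M L)"
    "\<And>x. x \<in> carrier M \<Longrightarrow> coset_rep M L x = \<zero>\<^bsub>quotient_obj M L\<^esub> \<longleftrightarrow> x \<in> L"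
proof -
  interpret graded_left_module R M by fact
  note LD = graded_submoduleD[OF L]
  have Ls: "L \<subseteq> carrier M" using LD(1) by blast
  let ?Q = "quotient_obj M L" and ?r = "coset_rep M L"
  note r_add [simp] = coset_rep_add[OF Ls LD(2,3,4), simplified]
  note r_smult [simp] = coset_rep_smult[OF Ls LD(2,3,4), simplified]
  note r_idem [simp] = coset_rep_idem[OF Ls LD(2,3,4), simplified]
  note r_c [simp] = coset_rep(1)[OF Ls LD(2,3,4), simplified]
  have r_add1: "?r (?r x \<oplus>\<^bsub>M\<^esub> y) = ?r (x \<oplus>\<^bsub>M\<^esub> y)" "?r (y \<oplus>\<^bsub>M\<^esub> ?r x) = ?r (y \<oplus>\<^bsub>M\<^esub> x)"
    if "x \<in> carrier M" "y \<in> carrier M" for x y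
    using r_add[of "?r x" y] r_add[of y "?r x"] r_add[of x y] r_add[of y x] that by simp_all
  have r_lin: "?r (a \<odot>\<^bsub>M\<^esub> ?r x \<oplus>\<^bsub>M\<^esub> b \<odot>\<^bsub>M\<^esub> ?r y) = ?r (a \<odot>\<^bsub>M\<^esub> x \<oplus>\<^bsub>M\<^esub> b \<odot>\<^bsub>M\<^esub> y)"
    "?r (a \<odot>\<^bsub>M\<^esub> (b \<odot>\<^bsub>M\<^esub> ?r x)) = ?r (a \<odot>\<^bsub>M\<^esub> (b \<odot>\<^bsub>M\<^esub> x))"
    if "x \<in> carrier M" "y \<in> carrier M" "a \<in> carrier R" "b \<in> carrier R" for x y a b
    using r_add[of "a \<odot>\<^bsub>M\<^esub> ?r x" "b \<odot>\<^bsub>M\<^esub> ?r y"] r_add[of "a \<odot>\<^bsub>M\<^esub> x" "b \<odot>\<^bsub>M\<^esub> y"]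
      r_smult[of a "b \<odot>\<^bsub>M\<^esub> ?r x"] r_smult[of a "b \<odot>\<^bsub>M\<^esub> x"] that smult_closed by simp_all
  have ab: "abelian_group ?Q"
  proof (rule abelian_groupI)
    fix x assume "x \<in> carrier ?Q"
    then obtain x' where x: "x = ?r x'" "x' \<in> carrier M" by auto
    then show "\<zero>\<^bsub>?Q\<^esub> \<oplus>\<^bsub>?Q\<^esub> x = x" by simp
    show "\<exists>y\<in>carrier ?Q. y \<oplus>\<^bsub>?Q\<^esub> x = \<zero>\<^bsub>?Q\<^esub>"
      using x by (intro bexI[of _ "?r (\<ominus>\<^bsub>M\<^esub> x')"]) (auto simp: M.l_neg)
      fix y assume "y \<in> carrier ?Q"
    then obtain y' where y: "y = ?r y'" "y' \<in> carrier M" by auto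
    show "x \<oplus>\<^bsub>?Q\<^esub> y = y \<oplus>\<^bsub>?Q\<^esub> x" using x y by (simp add: M.a_comm)
    fix z assume "z \<in> carrier ?Q"
    then obtain z' where z: "z = ?r z'" "z' \<in> carrier M" by auto
    show "x \<oplus>\<^bsub>?Q\<^esub> y \<oplus>\<^bsub>?Q\<^esub> z = x \<oplus>\<^bsub>?Q\<^esub> (y \<oplus>\<^bsub>?Q\<^esub> z)"
      using x y z by (simp add: r_add1 M.a_assoc)
  qed auto
  have lm: "left_module R ?Q"
    by (intro left_module.intro left_module_axioms.intro ab)
      (auto simp: R.ring_axioms smult_closed smult_l_distr smult_r_distr smult_assoc smult_one r_lin)
  interpret Q: left_module R ?Q by fact
  have sum: "finsum ?Q (\<lambda>i. ?r (g i)) A = ?r (finsum M g A)" if "\<And>i. i \<in> A \<Longrightarrow> g i \<in> carrier M" for g and A :: "int set"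
    using that
  proof (induction A rule: infinite_finite_induct)
    case (insert i A)
    then show ?case by (subst Q.M.finsum_insert) auto
  qed simp_all
  show ker: "?r x = \<zero>\<^bsub>?Q\<^esub> \<longleftrightarrow> x \<in> L" if "x \<in> carrier M" for x
    using coset_rep_eq[OF Ls LD(2,3,4), simplified, of x "\<zero>\<^bsub>M\<^esub>"] that
      M.minus_equality[of "\<zero>\<^bsub>M\<^esub>" "\<zero>\<^bsub>M\<^esub>"] by (simp add: M.minus_eq)
  show gl: "graded_left_module R ?Q"
  proof (rule graded_left_moduleI[OF lm])
    fix i
    have "inv\<^bsub>add_monoid ?Q\<^esub> ?r x = ?r (\<ominus>\<^bsub>M\<^esub> x)" if "x \<in> carrier M" for x
      unfolding a_inv_def[of ?Q, symmetric]
      by (rule Q.M.minus_equality) (use that in \<open>simp_all add: M.l_neg\<close>)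
    then show "subgroup (mcomp ?Q i) (add_monoid ?Q)"
      using mcomp_carrier mcomp_zero mcomp_add mcomp_minus
      by (intro subgroup.intro) (auto simp: image_iff)
  next
    fix i j a x assume a: "a \<in> rcomp R i" and "x \<in> mcomp ?Q j"
    then obtain x' where x': "x = ?r x'" "x' \<in> mcomp M j" by auto
    have "a \<in> carrier R" using a R by blast
    then show "a \<odot>\<^bsub>?Q\<^esub> x \<in> mcomp ?Q (i + j)"
      using mcomp_smult[OF a x'(2)] mcomp_carrier[OF x'(2)] x'(1) by simp
  next
    fix x assume "x \<in> carrier ?Q"
    then obtain x' where x: "x = ?r x'" "x' \<in> carrier M" by auto
    let ?A = "{i. homogeneous_part M x' i \<noteq> \<zero>\<^bsub>M\<^esub>}"
    have "x = ?r (\<Oplus>\<^bsub>M\<^esub>i\<in>?A. homogeneous_part M x' i)"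
      unfolding x(1) by (rule arg_cong[OF homogeneous_part(3)[OF x(2)]])
    also have "\<dots> = (\<Oplus>\<^bsub>?Q\<^esub>i\<in>?A. ?r (homogeneous_part M x' i))"
      by (rule sum[symmetric]) (rule part_carrier[OF x(2)])
    finally show "\<exists>A g. finite A \<and> (\<forall>i. g i \<in> mcomp ?Q i) \<and> x = (\<Oplus>\<^bsub>?Q\<^esub>i\<in>A. g i)"
      using homogeneous_part(1,2)[OF x(2)]
      by (intro exI[of _ ?A] exI[of _ "\<lambda>i. ?r (homogeneous_part M x' i)"]) auto
  next
    fix A g i assume g: "finite A" "\<forall>i. g i \<in> mcomp ?Q i" "(\<Oplus>\<^bsub>?Q\<^esub>i\<in>A. g i) = \<zero>\<^bsub>?Q\<^esub>" "i \<in> A"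
    then have "\<forall>i. \<exists>h. h \<in> mcomp M i \<and> g i = ?r h" by auto
    then obtain h where h: "\<And>i. h i \<in> mcomp M i" "\<And>i. g i = ?r (h i)" by metis
    have hc: "h i \<in> carrier M" for i using h(1) mcomp_carrier by blast
    have g_eq: "g = (\<lambda>i. ?r (h i))" using h(2) by blast
    let ?x = "\<Oplus>\<^bsub>M\<^esub>i\<in>A. h i"
    have "?r ?x = \<zero>\<^bsub>?Q\<^esub>" using g(3) sum[of A h] hc g_eq by simp
    then have "?x \<in> L" using ker[of ?x] hc by simp
    then have "homogeneous_part M ?x i \<in> L" by (rule LD(5))
    then have "h i \<in> L" using homogeneous_part_unique[OF g(1) h(1) refl] g(4) by simp
    then show "g i = \<zero>\<^bsub>?Q\<^esub>" using ker[OF hc] h(2) by simp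
  qed
  interpret Q: graded_left_module R ?Q by fact
  show "graded_hom R M ?Q ?r"
    by unfold_locales (auto simp: smult_closed)
qed

lemma kernel_graded_submodule:
  assumes "graded_hom R M N f"
  shows "graded_submodule R M {x \<in> carrier M. f x = \<zero>\<^bsub>N\<^esub>}"
proof -
  interpret graded_hom R M N f by fact
  show ?thesis
    unfolding graded_submodule_def
    using M.smult_closed M.part_carrier N.smult_zero_right
    by (auto simp: hom_zero add smult homogeneous_part_image[symmetric])
qed

lemma image_graded_submodule:
  assumes "graded_hom R M N f"
  shows "graded_submodule R N (f ` carrier M)"
proof -
  interpret graded_hom R M N f by fact
  show ?thesis
    unfolding graded_submodule_def
  proof (intro conjI ballI allI)
    show "f ` carrier M \<subseteq> carrier N" using closed by auto
    show "\<zero>\<^bsub>N\<^esub> \<in> f ` carrier M" using hom_zero by (auto intro!: image_eqI[of _ _ "\<zero>\<^bsub>M\<^esub>"])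
    fix y assume "y \<in> f ` carrier M"
    then obtain x where x: "x \<in> carrier M" "y = f x" by auto
    show "y \<oplus>\<^bsub>N\<^esub> y' \<in> f ` carrier M" if y': "y' \<in> f ` carrier M" for y'
    proof -
      obtain x' where x': "x' \<in> carrier M" "y' = f x'" using y' by auto
      show ?thesis using add[OF x(1) x'(1)] x x' imageI[of "x \<oplus>\<^bsub>M\<^esub> x'" "carrier M" f] by simp
    qed
    show "homogeneous_part N y i \<in> f ` carrier M" for i
      using homogeneous_part_image[OF x(1)] M.part_carrier[OF x(1)] x by auto
    show "a \<odot>\<^bsub>N\<^esub> y \<in> f ` carrier M" if "a \<in> carrier R" for a
      using smult[OF that x(1)] M.smult_closed[OF that x(1)] x(2) by (metis imageI)
  qed
qed

text \<open>
  A noetherian graded ring; as the modules take their elements from a fixed universe, so does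
  this property.
\<close>

locale gr_noetherian = R?: ring R for R :: "'a graded_ring" (structure) +
  fixes universe :: "'b itself"
  assumes rcomp_carrier: "rcomp R i \<subseteq> carrier R"
    and fg_submodule: "\<And>(M :: ('a, 'b) graded_module) L. M \<in> fg_graded_modules R \<Longrightarrow>
    graded_submodule R M L \<Longrightarrow> finitely_generated R (submodule_obj M L)"
begin

lemma kernel_gr_exists:
  fixes M :: "('a, 'b) graded_module"
  assumes "(M, N, f) \<in> hom_set (gr R) M N"
  defines "L \<equiv> {x \<in> carrier M. f x = \<zero>\<^bsub>N\<^esub>}"
  shows "is_kernel (gr R) (M, N, f) (submodule_obj M L, M, restrict (\<lambda>x. x) L)"
    "submodule_obj M L \<in> fg_graded_modules R"
proof -
  have M: "M \<in> fg_graded_modules R" and f: "graded_hom R M N f" using assms by (auto simp: hom_gr_iff)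
  have L: "graded_submodule R M L" unfolding L_def by (rule kernel_graded_submodule[OF f])
  note s = submodule_obj_graded[OF fg_graded_modulesD(1)[OF M] rcomp_carrier L]
  show *: "submodule_obj M L \<in> fg_graded_modules R"
    using s(1) fg_submodule[OF M L] by (simp add: fg_graded_modules_def)
  show "is_kernel (gr R) (M, N, f) (submodule_obj M L, M, restrict (\<lambda>x. x) L)"
    using hom_gr_restrict[OF s(2) * M]
    by (intro is_kernel_grI[OF ring_axioms assms(1)]) (auto simp: L_def inj_on_def)
qed

lemma cokernel_gr_exists:
  fixes M :: "('a, 'b) graded_module"
  assumes "(M, N, f) \<in> hom_set (gr R) M N"
  defines "L \<equiv> f ` carrier M"
  shows "is_cokernel (gr R) (M, N, f) (N, quotient_obj N L, restrict (coset_rep N L) (carrier N))"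
    "quotient_obj N L \<in> fg_graded_modules R"
proof -
  have N: "N \<in> fg_graded_modules R" and f: "graded_hom R M N f" using assms by (auto simp: hom_gr_iff)
  have L: "graded_submodule R N L" unfolding L_def by (rule image_graded_submodule[OF f])
  note s = quotient_obj_graded[OF fg_graded_modulesD(1)[OF N] rcomp_carrier L]
  have "finitely_generated R (quotient_obj N L)"
    by (rule graded_hom.finitely_generated_image[OF s(2) fg_graded_modulesD(2)[OF N]]) simp
  then show *: "quotient_obj N L \<in> fg_graded_modules R"
    using s(1) by (simp add: fg_graded_modules_def)
  show "is_cokernel (gr R) (M, N, f) (N, quotient_obj N L, restrict (coset_rep N L) (carrier N))"
    using hom_gr_restrict[OF s(2) N *] s(3) graded_submoduleD(1)[OF L]
    by (intro is_cokernel_grI[OF ring_axioms assms(1)]) (auto simp: L_def)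
qed

text \<open>
  Kernels are unique up to isomorphism, so these properties pass from the submodule of the elements
  killed by \<open>f\<close> to any kernel.
\<close>

lemma kernel_grD:
  fixes M :: "('a, 'b) graded_module"
  assumes "is_kernel (gr R) (M, N, f) (K, M, k)"
  shows "inj_on k (carrier K)" "k ` carrier K = {x \<in> carrier M. f x = \<zero>\<^bsub>N\<^esub>}"
proof -
  interpret cat "gr R" by (rule cat_gr)
  have f: "(M, N, f) \<in> hom_set (gr R) M N" and k: "(K, M, k) \<in> hom_set (gr R) K M"
    using is_kernelD(1,2)[OF assms] by (simp_all add: gr_def)
  let ?L = "{x \<in> carrier M. f x = \<zero>\<^bsub>N\<^esub>}"
  obtain U V where UV: "inverse_arrows (gr R) K (submodule_obj M ?L) U V"
    "cmp (gr R) (submodule_obj M ?L, M, restrict (\<lambda>x. x) ?L) U = (K, M, k)"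
    using kernel_unique[OF kernel_gr_exists(1)[OF f] assms] by (auto simp: gr_def)
  obtain u where u: "U = (K, submodule_obj M ?L, u)" "graded_hom R K (submodule_obj M ?L) u"
    by (rule hom_grE[OF inverse_arrowsD(1)[OF UV(1)]])
  have "u x \<in> ?L" if "x \<in> carrier K" for x using graded_hom.closed[OF u(2) that] by simp
  then have ku: "k x = u x" if "x \<in> carrier K" for x
    using UV(2) u(1) that by (auto simp: cmp_gr compose_def dest!: fun_cong[of _ _ x])
  note b = gr_iso_bijective[OF UV(1)[unfolded u(1)]]
  show "inj_on k (carrier K)" using b(1) ku by (simp add: inj_on_def)
  show "k ` carrier K = ?L" using b(2) ku by (metis (no_types, lifting) image_cong submodule_obj_simps(1))
qed

text \<open>
  Here the properties come from the quotient by the image of \<open>f\<close>.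
\<close>

lemma cokernel_grD:
  fixes M :: "('a, 'b) graded_module"
  assumes "is_cokernel (gr R) (M, N, f) (N, C, q)"
  shows "q ` carrier N = carrier C" "f ` carrier M = {y \<in> carrier N. q y = \<zero>\<^bsub>C\<^esub>}"
proof -
  interpret cat "gr R" by (rule cat_gr)
  interpret op: cat "opposite (gr R)" by (rule cat_opposite) (rule cat_gr)
  have f: "(M, N, f) \<in> hom_set (gr R) M N" and q: "(N, C, q) \<in> hom_set (gr R) N C"
    using is_cokernelD(1,2)[OF assms] by (simp_all add: gr_def)
  let ?L = "f ` carrier M"
  let ?Q = "quotient_obj N ?L" and ?r = "coset_rep N ?L"
  obtain U V where UV: "inverse_arrows (gr R) ?Q C V U"
    "cmp (gr R) V (N, ?Q, restrict ?r (carrier N)) = (N, C, q)"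
    using op.kernel_unique[of "(M, N, f)" "(N, ?Q, restrict ?r (carrier N))" "(N, C, q)"]
      cokernel_gr_exists(1)[OF f] assms by (auto simp: gr_def dest: inverse_arrows_sym)
  obtain v where v: "V = (?Q, C, v)" "graded_hom R ?Q C v"
    by (rule hom_grE[OF inverse_arrowsD(1)[OF UV(1)]])
  have qv: "q x = v (?r x)" if "x \<in> carrier N" for x
    using UV(2) v(1) that by (auto simp: cmp_gr compose_def dest!: fun_cong[of _ _ x])
  note b = gr_iso_bijective[OF UV(1)[unfolded v(1)]]
  have "q ` carrier N = v ` (?r ` carrier N)" using qv by (auto simp: image_image)
  then show "q ` carrier N = carrier C" using b(2) by simp
  have N: "N \<in> fg_graded_modules R" and f': "graded_hom R M N f" using f by (auto simp: hom_gr_iff)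
  have L: "graded_submodule R N ?L" by (rule image_graded_submodule[OF f'])
  note s = quotient_obj_graded[OF fg_graded_modulesD(1)[OF N] rcomp_carrier L]
  have "q x = \<zero>\<^bsub>C\<^esub> \<longleftrightarrow> x \<in> ?L" if x: "x \<in> carrier N" for x
  proof -
    have "q x = \<zero>\<^bsub>C\<^esub> \<longleftrightarrow> v (?r x) = v \<zero>\<^bsub>?Q\<^esub>" using qv[OF x] graded_hom.hom_zero[OF v(2)] by simp
    also have "\<dots> \<longleftrightarrow> ?r x = \<zero>\<^bsub>?Q\<^esub>"
      using inj_on_eq_iff[OF b(1), of "?r x" "\<zero>\<^bsub>?Q\<^esub>"] x
        graded_left_module.mcomp_zero[OF s(1)] graded_left_module.mcomp_carrier[OF s(1)]
        graded_hom.closed[OF s(2)] by blast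
    finally show ?thesis using s(3)[OF x] by simp
  qed
  then show "?L = {y \<in> carrier N. q y = \<zero>\<^bsub>C\<^esub>}" using graded_submoduleD(1)[OF L] by blast
qed

end

section \<open>Localization at a central element\<close>

lemma UN_pair_const:
  assumes "(a, i) \<in> A" "(b, j) \<in> B" "\<And>x k y l. (x, k) \<in> A \<Longrightarrow> (y, l) \<in> B \<Longrightarrow> f x k y l = c"
  shows "(\<Union>(x, k) \<in> A. \<Union>(y, l) \<in> B. f x k y l) = c"
proof (intro equalityI subsetI)
  show "w \<in> c" if "w \<in> (\<Union>(x, k) \<in> A. \<Union>(y, l) \<in> B. f x k y l)" for w
    using that assms(3) by (auto split: prod.splits)
  show "w \<in> (\<Union>(x, k) \<in> A. \<Union>(y, l) \<in> B. f x k y l)" if "w \<in> c" for w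
    using that assms(1,2) assms(3)[OF assms(1,2)] by (intro UN_I[of "(a, i)"] UN_I[of "(b, j)"]) auto
qed

locale central_element = R?: ring R for R :: "'a graded_ring" (structure) +
  fixes z :: 'a
  assumes z_closed: "z \<in> carrier R"
    and z_central: "x \<in> carrier R \<Longrightarrow> x \<otimes> z = z \<otimes> x"
    and rcomp_carrier: "rcomp R i \<subseteq> carrier R"
    and z_degree: "z \<in> rcomp R 1"
    and one_degree: "\<one> \<in> rcomp R 0"
begin

definition scale :: "nat \<Rightarrow> 'a \<Rightarrow> 'a" where
  "scale k x = z [^] k \<otimes> x"

lemma z_pow_closed: "z [^] (k::nat) \<in> carrier R"
  using z_closed by simp

lemma z_pow_central: "x \<in> carrier R \<Longrightarrow> x \<otimes> z [^] (k::nat) = z [^] k \<otimes> x"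
proof (induction k)
  case (Suc k)
  then have "x \<otimes> (z [^] k \<otimes> z) = z [^] k \<otimes> (x \<otimes> z)"
    using z_closed by (simp add: m_assoc[symmetric])
  then show ?case using Suc.prems z_closed z_central[OF Suc.prems] by (simp add: m_assoc)
qed simp

lemma scale_simps [simp]:
  assumes "x \<in> carrier R"
  shows "scale k x \<in> carrier R" "scale k (scale l x) = scale (k + l) x" "scale 0 x = x"
    "y \<in> carrier R \<Longrightarrow> scale k x \<oplus> scale k y = scale k (x \<oplus> y)"
    "y \<in> carrier R \<Longrightarrow> x \<otimes> scale k y = scale k (x \<otimes> y)"
    "y \<in> carrier R \<Longrightarrow> scale k x \<otimes> y = scale k (x \<otimes> y)"
    "\<ominus> scale k x = scale k (\<ominus> x)"
proof -
  show "scale k x \<in> carrier R" "scale 0 x = x" using assms z_closed by (simp_all add: scale_def)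
  show "scale k (scale l x) = scale (k + l) x"
    using assms z_closed by (simp add: scale_def m_assoc[symmetric] nat_pow_mult)
  show "y \<in> carrier R \<Longrightarrow> scale k x \<oplus> scale k y = scale k (x \<oplus> y)"
    using assms z_closed by (simp add: scale_def r_distr)
  show "y \<in> carrier R \<Longrightarrow> x \<otimes> scale k y = scale k (x \<otimes> y)"
    using assms z_closed by (simp add: scale_def m_assoc[symmetric] z_pow_central)
  show "y \<in> carrier R \<Longrightarrow> scale k x \<otimes> y = scale k (x \<otimes> y)"
    using assms z_closed by (simp add: scale_def m_assoc)
  show "\<ominus> scale k x = scale k (\<ominus> x)"
    using assms z_closed by (simp add: scale_def r_minus)
qed

abbreviation fr :: "'a \<Rightarrow> nat \<Rightarrow> ('a \<times> nat) set" where
  "fr x k \<equiv> fraction R z (x, k)"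

lemma mem_fr:
  "x \<in> carrier R \<Longrightarrow> (y, l) \<in> fr x k \<longleftrightarrow> y \<in> carrier R \<and> (\<exists>j. scale (j + l) x = scale (j + k) y)"
proof -
  assume x: "x \<in> carrier R"
  have "z [^] j \<otimes> (z [^] m \<otimes> w) = scale (j + m) w" if "w \<in> carrier R" for j m w
    using scale_simps(2)[OF that] by (simp add: scale_def)
  then show ?thesis using x by (auto simp: fraction_def)
qed

lemma fr_refl: "x \<in> carrier R \<Longrightarrow> (x, k) \<in> fr x k"
  using mem_fr by auto

lemma fr_eq_iff:
  assumes "x \<in> carrier R" "y \<in> carrier R"
  shows "fr x k = fr y l \<longleftrightarrow> (\<exists>j. scale (j + l) x = scale (j + k) y)"
proof
  have "(y, l) \<in> fr y l" using mem_fr[OF assms(2)] assms(2) by auto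
  then show "fr x k = fr y l \<Longrightarrow> \<exists>j. scale (j + l) x = scale (j + k) y"
    using mem_fr[OF assms(1)] by blast
  have trans: "\<exists>j. scale (j + m) x = scale (j + k) w"
    if xyw: "x \<in> carrier R" "y \<in> carrier R" "w \<in> carrier R" and 1: "scale (j + l) x = scale (j + k) y"
      and 2: "scale (i + m) y = scale (i + l) w" for i j k l m x y w
  proof -
    have "scale (j + i + l + m) x = scale (i + m) (scale (j + l) x)" using xyw by (simp add: add_ac)
    also have "\<dots> = scale (j + k) (scale (i + m) y)" using xyw 1 by (simp add: add_ac)
    also have "\<dots> = scale (j + i + l + k) w" using xyw 2 by (simp add: add_ac)
    finally show ?thesis by blast
  qed
  assume *: "\<exists>j. scale (j + l) x = scale (j + k) y"
  then have **: "\<exists>j. scale (j + k) y = scale (j + l) x" by metis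
  have "(w, m) \<in> fr x k \<longleftrightarrow> (w, m) \<in> fr y l" for w m
  proof
    assume "(w, m) \<in> fr x k"
    then obtain i where w: "w \<in> carrier R" and i: "scale (i + m) x = scale (i + k) w"
      using mem_fr[OF assms(1)] by blast
    obtain j where "scale (j + k) y = scale (j + l) x" using ** by blast
    from trans[OF assms(2,1) w this i] show "(w, m) \<in> fr y l" using mem_fr[OF assms(2)] w by simp
  next
    assume "(w, m) \<in> fr y l"
    then obtain i where w: "w \<in> carrier R" and i: "scale (i + m) y = scale (i + l) w"
      using mem_fr[OF assms(2)] by blast
    obtain j where "scale (j + l) x = scale (j + k) y" using * by blast
    from trans[OF assms w this i] show "(w, m) \<in> fr x k" using mem_fr[OF assms(1)] w by simp
  qed
  then show "fr x k = fr y l" by auto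
qed

lemma fr_scale: "x \<in> carrier R \<Longrightarrow> fr (scale m x) (m + k) = fr x k"
  by (subst fr_eq_iff) (auto simp: add_ac)

abbreviation "S \<equiv> fraction_ring R z"

lemma fraction_ring_simps [simp]:
  "carrier S = {fr x k | x k. x \<in> carrier R}" "\<one>\<^bsub>S\<^esub> = fr \<one> 0" "\<zero>\<^bsub>S\<^esub> = fr \<zero> 0"
  "rcomp S d = {fr x k | x k. x \<in> rcomp R (d + int k)}"
  by (simp_all add: fraction_ring_def)

lemma fr_closed: "x \<in> carrier R \<Longrightarrow> fr x k \<in> carrier S"
  by auto

lemma fr_mult:
  assumes x: "x \<in> carrier R" and y: "y \<in> carrier R"
  shows "fr x k \<otimes>\<^bsub>S\<^esub> fr y l = fr (x \<otimes> y) (k + l)"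
proof -
  have "fr (x' \<otimes> y') (k' + l') = fr (x \<otimes> y) (k + l)"
    if xk: "(x', k') \<in> fr x k" and yl: "(y', l') \<in> fr y l" for x' k' y' l'
  proof -
    obtain j where x': "x' \<in> carrier R" and j: "scale (j + k') x = scale (j + k) x'" using mem_fr[OF x] xk by blast
    obtain i where y': "y' \<in> carrier R" and i: "scale (i + l') y = scale (i + l) y'" using mem_fr[OF y] yl by blast
    have "scale (j + i + (k' + l')) (x \<otimes> y) = scale (j + k') x \<otimes> scale (i + l') y"
      using x y by (simp add: add_ac)
    also have "\<dots> = scale (j + i + (k + l)) (x' \<otimes> y')" unfolding i j using x' y' by (simp add: add_ac)
    finally show ?thesis using x x' y y' fr_eq_iff[of "x' \<otimes> y'" "x \<otimes> y"] by (metis m_closed)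
  qed
  then have "(\<Union>(x', k') \<in> fr x k. \<Union>(y', l') \<in> fr y l. fr (x' \<otimes> y') (k' + l')) = fr (x \<otimes> y) (k + l)"
    by (rule UN_pair_const[OF fr_refl[OF x] fr_refl[OF y]])
  then show ?thesis by (simp add: fraction_ring_def)
qed

lemma fr_add_general:
  assumes x: "x \<in> carrier R" and y: "y \<in> carrier R"
  shows "fr x k \<oplus>\<^bsub>S\<^esub> fr y l = fr (scale l x \<oplus> scale k y) (k + l)"
proof -
  have "fr (scale l' x' \<oplus> scale k' y') (k' + l') = fr (scale l x \<oplus> scale k y) (k + l)"
    if xk: "(x', k') \<in> fr x k" and yl: "(y', l') \<in> fr y l" for x' k' y' l'
  proof -
    obtain j where x': "x' \<in> carrier R" and j: "scale (j + k') x = scale (j + k) x'" using mem_fr[OF x] xk by blast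
    obtain i where y': "y' \<in> carrier R" and i: "scale (i + l') y = scale (i + l) y'" using mem_fr[OF y] yl by blast
    have "scale (j + i + (k' + l')) (scale l x \<oplus> scale k y) =
        scale (i + l' + l) (scale (j + k') x) \<oplus> scale (j + k' + k) (scale (i + l') y)"
      using x y by (simp add: add_ac scale_simps(4)[symmetric] del: scale_simps(4))
    also have "\<dots> = scale (j + i + (k + l)) (scale l' x' \<oplus> scale k' y')"
      unfolding i j using x' y' by (simp add: add_ac scale_simps(4)[symmetric] del: scale_simps(4))
    finally show ?thesis
      using x x' y y' fr_eq_iff[of "scale l' x' \<oplus> scale k' y'" "scale l x \<oplus> scale k y"]
      by (metis a_closed scale_simps(1))
  qed
  then have "(\<Union>(x', k') \<in> fr x k. \<Union>(y', l') \<in> fr y l. fr (scale l' x' \<oplus> scale k' y') (k' + l')) =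
      fr (scale l x \<oplus> scale k y) (k + l)"
    by (rule UN_pair_const[OF fr_refl[OF x] fr_refl[OF y]])
  then show ?thesis by (simp add: fraction_ring_def scale_def)
qed

lemma fr_add: 
  assumes "x \<in> carrier R" "y \<in> carrier R"
  shows "fr x k \<oplus>\<^bsub>S\<^esub> fr y k = fr (x \<oplus> y) k"
  using fr_scale[of "x \<oplus> y" k k] assms by (simp add: fr_add_general)

text \<open>
  With common denominators the ring axioms for fractions reduce to those of \<open>R\<close>.
\<close>

lemma common_denominator2:
  assumes "s \<in> carrier S" "t \<in> carrier S"
  obtains x y k where "x \<in> carrier R" "y \<in> carrier R" "s = fr x k" "t = fr y k"
proof -
  obtain x k y l where h: "x \<in> carrier R" "y \<in> carrier R" "s = fr x k" "t = fr y l" using assms by auto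
  then show thesis
    using that[of "scale l x" "scale k y" "k + l"] fr_scale[of x l k] fr_scale[of y k l] by (simp add: add_ac)
qed

lemma common_denominator3:
  assumes "s \<in> carrier S" "t \<in> carrier S" "u \<in> carrier S"
  obtains x y w k where "x \<in> carrier R" "y \<in> carrier R" "w \<in> carrier R" "s = fr x k" "t = fr y k" "u = fr w k"
proof -
  obtain x y k where h: "x \<in> carrier R" "y \<in> carrier R" "s = fr x k" "t = fr y k"
    by (rule common_denominator2[OF assms(1,2)])
  obtain w l where w: "w \<in> carrier R" "u = fr w l" using assms(3) by auto
  show thesis
    using that[of "scale l x" "scale l y" "scale k w" "k + l"] h w fr_scale[of x l k] fr_scale[of y l k]
      fr_scale[of w k l] by (simp add: add_ac)
qed

lemma fr_zero: "fr \<zero> k = \<zero>\<^bsub>S\<^esub>"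
  using fr_scale[of \<zero> k 0] z_closed by (simp add: scale_def)

lemma ring_S: "ring S"
proof (rule ringI)
  show "abelian_group S"
  proof (rule abelian_groupI)
    show "s \<oplus>\<^bsub>S\<^esub> t \<in> carrier S" if st: "s \<in> carrier S" "t \<in> carrier S" for s t
      by (rule common_denominator2[OF st]) (simp add: fr_add, blast)
    show "\<zero>\<^bsub>S\<^esub> \<in> carrier S" by auto
    show "s \<oplus>\<^bsub>S\<^esub> t \<oplus>\<^bsub>S\<^esub> u = s \<oplus>\<^bsub>S\<^esub> (t \<oplus>\<^bsub>S\<^esub> u)"
      if stu: "s \<in> carrier S" "t \<in> carrier S" "u \<in> carrier S" for s t u
      by (rule common_denominator3[OF stu]) (simp add: fr_add a_assoc)
    show "s \<oplus>\<^bsub>S\<^esub> t = t \<oplus>\<^bsub>S\<^esub> s" if st: "s \<in> carrier S" "t \<in> carrier S" for s t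
      by (rule common_denominator2[OF st]) (simp add: fr_add a_comm)
    fix s assume s: "s \<in> carrier S"
    then obtain x k where x: "x \<in> carrier R" "s = fr x k" by auto
    show "\<zero>\<^bsub>S\<^esub> \<oplus>\<^bsub>S\<^esub> s = s" using fr_add[of \<zero> x k] x fr_zero[of k] by simp
    show "\<exists>t\<in>carrier S. t \<oplus>\<^bsub>S\<^esub> s = \<zero>\<^bsub>S\<^esub>"
    proof (rule bexI)
      show "fr (\<ominus> x) k \<oplus>\<^bsub>S\<^esub> s = \<zero>\<^bsub>S\<^esub>"
        using fr_add[of "\<ominus> x" x k] x fr_zero[of k] by (simp add: l_neg)
      show "fr (\<ominus> x) k \<in> carrier S" by (rule fr_closed) (simp add: x)
    qed
  qed
  show "Group.monoid S"
  proof (rule monoidI)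
    show "s \<otimes>\<^bsub>S\<^esub> t \<in> carrier S" if st: "s \<in> carrier S" "t \<in> carrier S" for s t
      by (rule common_denominator2[OF st]) (simp add: fr_mult, blast)
    show "\<one>\<^bsub>S\<^esub> \<in> carrier S" by auto
    show "s \<otimes>\<^bsub>S\<^esub> t \<otimes>\<^bsub>S\<^esub> u = s \<otimes>\<^bsub>S\<^esub> (t \<otimes>\<^bsub>S\<^esub> u)"
      if stu: "s \<in> carrier S" "t \<in> carrier S" "u \<in> carrier S" for s t u
      by (rule common_denominator3[OF stu]) (simp add: fr_mult m_assoc add_ac)
  qed (auto simp: fr_mult)
  show "(s \<oplus>\<^bsub>S\<^esub> t) \<otimes>\<^bsub>S\<^esub> u = s \<otimes>\<^bsub>S\<^esub> u \<oplus>\<^bsub>S\<^esub> t \<otimes>\<^bsub>S\<^esub> u"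
    if stu: "s \<in> carrier S" "t \<in> carrier S" "u \<in> carrier S" for s t u
    by (rule common_denominator3[OF stu]) (simp add: fr_mult fr_add l_distr)
  show "u \<otimes>\<^bsub>S\<^esub> (s \<oplus>\<^bsub>S\<^esub> t) = u \<otimes>\<^bsub>S\<^esub> s \<oplus>\<^bsub>S\<^esub> u \<otimes>\<^bsub>S\<^esub> t"
    if stu: "s \<in> carrier S" "t \<in> carrier S" "u \<in> carrier S" for s t u
    by (rule common_denominator3[OF stu]) (simp add: fr_mult fr_add r_distr)
qed

abbreviation "to_S \<equiv> \<lambda>x. fr x 0"

end

locale central_module = central_element R z + M?: graded_left_module R M
  for R :: "'a graded_ring" (structure) and z and M :: "('a, 'b) graded_module"
begin

definition torsion :: "'b \<Rightarrow> bool" where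
  "torsion x \<longleftrightarrow> (\<exists>j::nat. z [^] j \<odot>\<^bsub>M\<^esub> x = \<zero>\<^bsub>M\<^esub>)"

lemma z_pow_smult:
  "x \<in> carrier M \<Longrightarrow> z [^] (j::nat) \<odot>\<^bsub>M\<^esub> (z [^] (i::nat) \<odot>\<^bsub>M\<^esub> x) = z [^] (j + i) \<odot>\<^bsub>M\<^esub> x"
  using z_pow_closed z_closed by (simp add: smult_assoc[symmetric] nat_pow_mult)

lemma scale_smult: "a \<in> carrier R \<Longrightarrow> x \<in> carrier M \<Longrightarrow> scale j a \<odot>\<^bsub>M\<^esub> x = z [^] j \<odot>\<^bsub>M\<^esub> (a \<odot>\<^bsub>M\<^esub> x)"
  using z_pow_closed by (simp add: scale_def smult_assoc)

lemma z_pow_degree: "x \<in> mcomp M i \<Longrightarrow> z [^] (j::nat) \<odot>\<^bsub>M\<^esub> x \<in> mcomp M (i + int j)"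
proof (induction j arbitrary: i x)
  case 0
  then show ?case using M.mcomp_carrier smult_one by simp
next
  case (Suc j)
  have "z \<odot>\<^bsub>M\<^esub> x \<in> mcomp M (1 + i)" using mcomp_smult[OF z_degree Suc.prems] .
  from Suc.IH[OF this] show ?case
    using M.mcomp_carrier[OF Suc.prems] z_closed z_pow_closed by (simp add: smult_assoc add_ac)
qed

lemma torsion_zero: "torsion \<zero>\<^bsub>M\<^esub>"
  unfolding torsion_def using smult_one[of "\<zero>\<^bsub>M\<^esub>"] by (intro exI[of _ 0]) simp

lemma torsion_add:
  assumes "x \<in> carrier M" "y \<in> carrier M" "torsion x" "torsion y"
  shows "torsion (x \<oplus>\<^bsub>M\<^esub> y)"
proof -
  obtain i j :: nat where "z [^] i \<odot>\<^bsub>M\<^esub> x = \<zero>\<^bsub>M\<^esub>" "z [^] j \<odot>\<^bsub>M\<^esub> y = \<zero>\<^bsub>M\<^esub>"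
    using assms(3,4) by (auto simp: torsion_def)
  then have "z [^] (i + j) \<odot>\<^bsub>M\<^esub> x = \<zero>\<^bsub>M\<^esub>" "z [^] (i + j) \<odot>\<^bsub>M\<^esub> y = \<zero>\<^bsub>M\<^esub>"
    using z_pow_smult[OF assms(1), of j i] z_pow_smult[OF assms(2), of i j] smult_zero_right[OF z_pow_closed]
    by (simp_all add: add_ac)
  then have "z [^] (i + j) \<odot>\<^bsub>M\<^esub> (x \<oplus>\<^bsub>M\<^esub> y) = \<zero>\<^bsub>M\<^esub>"
    using smult_r_distr[OF z_pow_closed assms(1,2)] by simp
  then show ?thesis unfolding torsion_def by blast
qed

lemma torsion_minus: "x \<in> carrier M \<Longrightarrow> torsion x \<Longrightarrow> torsion (\<ominus>\<^bsub>M\<^esub> x)"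
proof -
  assume x: "x \<in> carrier M" and "torsion x"
  then obtain j :: nat where "z [^] j \<odot>\<^bsub>M\<^esub> x = \<zero>\<^bsub>M\<^esub>" by (auto simp: torsion_def)
  then have "z [^] j \<odot>\<^bsub>M\<^esub> (\<ominus>\<^bsub>M\<^esub> x) = \<zero>\<^bsub>M\<^esub>"
    using smult_minus_right[OF z_pow_closed x, of j] M.minus_equality[of "\<zero>\<^bsub>M\<^esub>" "\<zero>\<^bsub>M\<^esub>"] by simp
  then show ?thesis unfolding torsion_def by blast
qed

lemma torsion_z_pow: "x \<in> carrier M \<Longrightarrow> torsion (z [^] (i::nat) \<odot>\<^bsub>M\<^esub> x) \<longleftrightarrow> torsion x"
proof
  assume x: "x \<in> carrier M"
  show "torsion (z [^] i \<odot>\<^bsub>M\<^esub> x) \<Longrightarrow> torsion x"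
    using z_pow_smult[OF x, of _ i] by (auto simp: torsion_def)
  assume "torsion x"
  then obtain j :: nat where "z [^] j \<odot>\<^bsub>M\<^esub> x = \<zero>\<^bsub>M\<^esub>" by (auto simp: torsion_def)
  then have "z [^] j \<odot>\<^bsub>M\<^esub> (z [^] i \<odot>\<^bsub>M\<^esub> x) = \<zero>\<^bsub>M\<^esub>"
    using z_pow_smult[OF x, of j i] z_pow_smult[OF x, of i j] smult_zero_right[OF z_pow_closed]
    by (simp add: add_ac)
  then show "torsion (z [^] i \<odot>\<^bsub>M\<^esub> x)" unfolding torsion_def by blast
qed

lemma fr_eq_torsion:
  assumes "a \<in> carrier R" "b \<in> carrier R" "x \<in> carrier M" "fr a k = fr b k"
  shows "torsion (a \<odot>\<^bsub>M\<^esub> x \<ominus>\<^bsub>M\<^esub> b \<odot>\<^bsub>M\<^esub> x)"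
proof -
  obtain j where "scale (j + k) a = scale (j + k) b" using fr_eq_iff[OF assms(1,2)] assms(4) by blast
  then have "z [^] (j + k) \<odot>\<^bsub>M\<^esub> (a \<odot>\<^bsub>M\<^esub> x) = z [^] (j + k) \<odot>\<^bsub>M\<^esub> (b \<odot>\<^bsub>M\<^esub> x)"
    using scale_smult assms by metis
  then have "z [^] (j + k) \<odot>\<^bsub>M\<^esub> (a \<odot>\<^bsub>M\<^esub> x \<ominus>\<^bsub>M\<^esub> b \<odot>\<^bsub>M\<^esub> x) = \<zero>\<^bsub>M\<^esub>"
    using smult_diff[OF z_pow_closed] smult_closed[OF z_pow_closed] smult_closed assms(1-3)
    by (simp add: M.minus_eq M.r_neg)
  then show ?thesis unfolding torsion_def by blast
qed

end

subsection \<open>Extension of scalars to the localization\<close>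

context central_module
begin

abbreviation "pairs \<equiv> carrier S \<times> carrier M"
abbreviation "tsub \<equiv> tensor_sub S to_S R M"
abbreviation "cl \<equiv> tensor_class S to_S R M"
abbreviation "TM \<equiv> tensor_obj S to_S R M"

declare fraction_ring_simps(1) [simp del]

interpretation S: ring S by (rule ring_S)

lemma tensor_rels_keys: "c \<in> tensor_rels S to_S R M \<Longrightarrow> Poly_Mapping.keys c \<subseteq> pairs"
proof -
  have k: "Poly_Mapping.keys (a - b) \<subseteq> pairs"
    if "Poly_Mapping.keys a \<subseteq> pairs" "Poly_Mapping.keys b \<subseteq> pairs" for a b :: "(_ \<times> 'b) \<Rightarrow>\<^sub>0 int"
    using keys_diff[of a b] that by blast
  show "c \<in> tensor_rels S to_S R M \<Longrightarrow> Poly_Mapping.keys c \<subseteq> pairs"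
    unfolding tensor_rels_def
    by (elim UnE CollectE exE conjE; hypsubst; intro k)
      (use S.a_closed S.m_closed M.a_closed smult_closed fr_closed in \<open>auto\<close>)
qed

lemma tsub_keys: "c \<in> tsub \<Longrightarrow> Poly_Mapping.keys c \<subseteq> pairs"
  unfolding tensor_sub_def
proof (induction rule: generate.induct)
  case (eng h1 h2)
  then show ?case using keys_add[of h1 h2] by (auto simp: tensor_free_def)
next
  case (inv h)
  then show ?case using tensor_rels_keys[OF inv] by (simp add: tensor_free_def)
qed (simp_all add: tensor_free_def tensor_rels_keys)

lemma tsub_zero: "0 \<in> tsub"
  using generate.one[of "tensor_free S M"] by (simp add: tensor_sub_def tensor_free_def)

lemma tsub_add: "a \<in> tsub \<Longrightarrow> b \<in> tsub \<Longrightarrow> a + b \<in> tsub"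
  using generate.eng[of a "tensor_free S M"] by (simp add: tensor_sub_def tensor_free_def)

lemma tsub_minus: "a \<in> tsub \<Longrightarrow> - a \<in> tsub"
proof -
  assume a: "a \<in> tsub"
  have "subgroup tsub (tensor_free S M)"
    unfolding tensor_sub_def tensor_free_def
    by (rule group.generate_is_subgroup[OF group_free_Abelian_group]) (auto dest: tensor_rels_keys)
  then show "- a \<in> tsub" using subgroup.m_inv_closed[of tsub _ a] a tsub_keys[OF a]
    by (metis inv_free_Abelian_group tensor_free_def)
qed

lemma tsub_rel: "c \<in> tensor_rels S to_S R M \<Longrightarrow> c \<in> tsub"
  unfolding tensor_sub_def by (rule generate.incl)

lemma cl_def': "cl c = (\<lambda>h. h + c) ` tsub"
  by (auto simp: tensor_class_def r_coset_def tensor_free_def)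

lemma cl_self: "c \<in> cl c"
  using tsub_zero by (force simp: cl_def')

lemma cl_eq_iff: "cl c = cl c' \<longleftrightarrow> c - c' \<in> tsub"
proof
  assume "cl c = cl c'"
  then have "c \<in> cl c'" using cl_self by blast
  then show "c - c' \<in> tsub" by (auto simp: cl_def')
next
  assume *: "c - c' \<in> tsub"
  have "h + c \<in> cl c'" if "h \<in> tsub" for h
    using tsub_add[OF that *] by (auto simp: cl_def' image_iff intro!: bexI[of _ "h + (c - c')"])
  moreover have "h + c' \<in> cl c" if "h \<in> tsub" for h
    using tsub_add[OF that tsub_minus[OF *]] by (auto simp: cl_def' image_iff intro!: bexI[of _ "h + - (c - c')"])
  ultimately show "cl c = cl c'" by (auto simp: cl_def'[of c] cl_def'[of c'])
qed

lemma carrier_TM: "carrier TM = cl ` {c. Poly_Mapping.keys c \<subseteq> pairs}"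
  by (auto simp: tensor_obj_def Let_def FactGroup_def RCOSETS_def tensor_class_def tensor_free_def)

lemma zero_TM: "\<zero>\<^bsub>TM\<^esub> = cl 0"
  by (simp add: tensor_obj_def Let_def FactGroup_def cl_def')

lemma add_TM: "cl a \<oplus>\<^bsub>TM\<^esub> cl b = cl (a + b)"
proof -
  have "cl a \<oplus>\<^bsub>TM\<^esub> cl b = {x + y | x y. x \<in> cl a \<and> y \<in> cl b}"
    by (auto simp: tensor_obj_def Let_def FactGroup_def set_mult_def tensor_free_def)
  also have "\<dots> = cl (a + b)"
  proof (intro equalityI subsetI)
    fix w assume "w \<in> {x + y | x y. x \<in> cl a \<and> y \<in> cl b}"
    then obtain h h' where h: "h \<in> tsub" "h' \<in> tsub" "w = (h + a) + (h' + b)" by (auto simp: cl_def')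
    then have "w = (h + h') + (a + b)" by (simp add: add_ac)
    then show "w \<in> cl (a + b)" using tsub_add[OF h(1,2)] by (auto simp: cl_def')
  next
    fix w assume "w \<in> cl (a + b)"
    then obtain h where h: "h \<in> tsub" "w = h + (a + b)" by (auto simp: cl_def')
    then have "w = (h + a) + b" "h + a \<in> cl a" by (auto simp: cl_def' add_ac)
    then show "w \<in> {x + y | x y. x \<in> cl a \<and> y \<in> cl b}" using cl_self by blast
  qed
  finally show ?thesis .
qed

text \<open>\<open>\<tau> x k\<close> is \<open>x / z\<^sup>k\<close>, that is, \<open>1 / z\<^sup>k \<otimes> x\<close>; every element of the tensor product has this form.\<close>

definition \<tau> :: "'b \<Rightarrow> nat \<Rightarrow> ((('a \<times> nat) set \<times> 'b) \<Rightarrow>\<^sub>0 int) set" where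
  "\<tau> x k = cl (frag_of (fr \<one> k, x))"

lemma cl_bilinear:
  assumes "s \<in> carrier S" "s' \<in> carrier S" "x \<in> carrier M" "x' \<in> carrier M"
  shows "cl (frag_of (s \<oplus>\<^bsub>S\<^esub> s', x)) = cl (frag_of (s, x)) \<oplus>\<^bsub>TM\<^esub> cl (frag_of (s', x))"
    "cl (frag_of (s, x \<oplus>\<^bsub>M\<^esub> x')) = cl (frag_of (s, x)) \<oplus>\<^bsub>TM\<^esub> cl (frag_of (s, x'))"
    "a \<in> carrier R \<Longrightarrow> cl (frag_of (s \<otimes>\<^bsub>S\<^esub> to_S a, x)) = cl (frag_of (s, a \<odot>\<^bsub>M\<^esub> x))"
proof -
  show "cl (frag_of (s \<oplus>\<^bsub>S\<^esub> s', x)) = cl (frag_of (s, x)) \<oplus>\<^bsub>TM\<^esub> cl (frag_of (s', x))"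
    unfolding add_TM cl_eq_iff diff_diff_eq[symmetric]
    by (rule tsub_rel, unfold tensor_rels_def, intro UnI1 CollectI exI conjI, rule refl) (fact assms)+
  show "cl (frag_of (s, x \<oplus>\<^bsub>M\<^esub> x')) = cl (frag_of (s, x)) \<oplus>\<^bsub>TM\<^esub> cl (frag_of (s, x'))"
    unfolding add_TM cl_eq_iff diff_diff_eq[symmetric]
    by (rule tsub_rel, unfold tensor_rels_def, rule UnI1, rule UnI2, intro CollectI exI conjI, rule refl)
      (fact assms)+
  assume a: "a \<in> carrier R"
  show "cl (frag_of (s \<otimes>\<^bsub>S\<^esub> to_S a, x)) = cl (frag_of (s, a \<odot>\<^bsub>M\<^esub> x))"
    unfolding cl_eq_iff
    by (rule tsub_rel, unfold tensor_rels_def, rule UnI2, intro CollectI exI conjI, rule refl)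
      (fact assms a)+
qed

lemma cl_fr: "a \<in> carrier R \<Longrightarrow> x \<in> carrier M \<Longrightarrow> cl (frag_of (fr a k, x)) = \<tau> (a \<odot>\<^bsub>M\<^esub> x) k"
  using cl_bilinear(3)[of "fr \<one> k" "fr \<one> k" x x a] fr_closed[of \<one> k]
  by (simp add: \<tau>_def fr_mult)

lemma \<tau>_closed: "x \<in> carrier M \<Longrightarrow> \<tau> x k \<in> carrier TM"
  using fr_closed[of \<one> k] by (auto simp: carrier_TM \<tau>_def)

lemma \<tau>_add: "x \<in> carrier M \<Longrightarrow> y \<in> carrier M \<Longrightarrow> \<tau> x k \<oplus>\<^bsub>TM\<^esub> \<tau> y k = \<tau> (x \<oplus>\<^bsub>M\<^esub> y) k"
  unfolding \<tau>_def by (rule cl_bilinear(2)[symmetric]) (use fr_closed[of \<one> k] in auto)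

lemma \<tau>_expand: "x \<in> carrier M \<Longrightarrow> \<tau> (z [^] (m::nat) \<odot>\<^bsub>M\<^esub> x) (m + k) = \<tau> x k"
  using cl_fr[OF z_pow_closed, of x m "m + k"] fr_scale[of \<one> m k] z_pow_closed by (simp add: \<tau>_def scale_def)

lemma \<tau>_zero: "\<tau> \<zero>\<^bsub>M\<^esub> k = \<zero>\<^bsub>TM\<^esub>"
proof -
  have "\<tau> \<zero>\<^bsub>M\<^esub> k \<oplus>\<^bsub>TM\<^esub> \<tau> \<zero>\<^bsub>M\<^esub> k = \<tau> \<zero>\<^bsub>M\<^esub> k" by (simp add: \<tau>_add)
  then have "frag_of (fr \<one> k, \<zero>\<^bsub>M\<^esub>) + frag_of (fr \<one> k, \<zero>\<^bsub>M\<^esub>) - frag_of (fr \<one> k, \<zero>\<^bsub>M\<^esub>) \<in> tsub"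
    by (simp add: \<tau>_def add_TM cl_eq_iff)
  then show ?thesis by (simp add: \<tau>_def zero_TM cl_eq_iff)
qed

lemma \<tau>_diff:
  assumes "cl a = \<tau> x k" "cl b = \<tau> y k" "x \<in> carrier M" "y \<in> carrier M"
  shows "cl (a - b) = \<tau> (x \<ominus>\<^bsub>M\<^esub> y) k"
proof -
  have "cl (frag_of (fr \<one> k, x \<ominus>\<^bsub>M\<^esub> y) + frag_of (fr \<one> k, y)) = cl (frag_of (fr \<one> k, x))"
    using \<tau>_add[of "x \<ominus>\<^bsub>M\<^esub> y" y k] assms(3,4) by (simp add: \<tau>_def add_TM M.minus_eq M.a_assoc M.l_neg)
  then have 1: "frag_of (fr \<one> k, x \<ominus>\<^bsub>M\<^esub> y) + frag_of (fr \<one> k, y) - frag_of (fr \<one> k, x) \<in> tsub"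
    by (simp add: cl_eq_iff)
  have 2: "a - frag_of (fr \<one> k, x) \<in> tsub" "b - frag_of (fr \<one> k, y) \<in> tsub"
    using assms(1,2) by (simp_all add: \<tau>_def cl_eq_iff)
  have "a - b - frag_of (fr \<one> k, x \<ominus>\<^bsub>M\<^esub> y) =
      (a - frag_of (fr \<one> k, x)) + (- (b - frag_of (fr \<one> k, y)) +
      - (frag_of (fr \<one> k, x \<ominus>\<^bsub>M\<^esub> y) + frag_of (fr \<one> k, y) - frag_of (fr \<one> k, x)))"
    by (simp add: algebra_simps)
  also have "\<dots> \<in> tsub" by (intro tsub_add tsub_minus 1 2)
  finally show ?thesis by (simp add: \<tau>_def cl_eq_iff)
qed

lemma \<tau>_exists_homogeneous:
  assumes P: "\<And>k. P k \<zero>\<^bsub>M\<^esub>" "\<And>k x y. P k x \<Longrightarrow> P k y \<Longrightarrow> P k (x \<ominus>\<^bsub>M\<^esub> y)"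
    "\<And>k x m. P k x \<Longrightarrow> P (m + k) (z [^] (m::nat) \<odot>\<^bsub>M\<^esub> x)" "\<And>k x. P k x \<Longrightarrow> x \<in> carrier M"
    and gen: "\<And>s x. (s, x) \<in> A \<Longrightarrow> \<exists>a k. a \<in> carrier R \<and> s = fr a k \<and> x \<in> carrier M \<and> P k (a \<odot>\<^bsub>M\<^esub> x)"
    and c: "Poly_Mapping.keys c \<subseteq> A"
  shows "\<exists>x k. P k x \<and> cl c = \<tau> x k"
  using c
proof (rule free_Abelian_group_induct)
  show "\<exists>x k. P k x \<and> cl 0 = \<tau> x k" using P(1) \<tau>_zero[of 0] zero_TM by auto
  fix p assume "p \<in> A"
  then obtain s x where p: "p = (s, x)" "(s, x) \<in> A" by (cases p) auto
  then obtain a k where "a \<in> carrier R" "s = fr a k" "x \<in> carrier M" "P k (a \<odot>\<^bsub>M\<^esub> x)" using gen by blast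
  then show "\<exists>x k. P k x \<and> cl (frag_of p) = \<tau> x k" using cl_fr p by blast
next
  fix a b assume "\<exists>x k. P k x \<and> cl a = \<tau> x k" "\<exists>x k. P k x \<and> cl b = \<tau> x k"
  then obtain x k y l where h: "P k x" "cl a = \<tau> x k" "P l y" "cl b = \<tau> y l" by blast
  have 1: "cl a = \<tau> (z [^] l \<odot>\<^bsub>M\<^esub> x) (l + k)" "cl b = \<tau> (z [^] k \<odot>\<^bsub>M\<^esub> y) (l + k)"
    using \<tau>_expand[of x l k] \<tau>_expand[of y k l] h P(4) by (simp_all add: add_ac)
  have 2: "P (l + k) (z [^] l \<odot>\<^bsub>M\<^esub> x)" "P (l + k) (z [^] k \<odot>\<^bsub>M\<^esub> y)"
    using P(3)[OF h(1), of l] P(3)[OF h(3), of k] by (simp_all add: add_ac)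
  show "\<exists>x k. P k x \<and> cl (a - b) = \<tau> x k"
    using \<tau>_diff[OF 1 P(4)[OF 2(1)] P(4)[OF 2(2)]] P(2)[OF 2] by blast
qed

lemma \<tau>_exists:
  assumes "t \<in> carrier TM"
  obtains x k where "x \<in> carrier M" "t = \<tau> x k"
proof -
  obtain c where c: "t = cl c" "Poly_Mapping.keys c \<subseteq> pairs" using assms by (auto simp: carrier_TM)
  have "\<exists>x k. x \<in> carrier M \<and> cl c = \<tau> x k"
  proof (rule \<tau>_exists_homogeneous[OF _ _ _ _ _ c(2), where P = "\<lambda>k x. x \<in> carrier M"])
    show "\<exists>a k. a \<in> carrier R \<and> s = fr a k \<and> x \<in> carrier M \<and> a \<odot>\<^bsub>M\<^esub> x \<in> carrier M"
      if "(s, x) \<in> pairs" for s x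
      using that smult_closed by (auto simp: fraction_ring_simps(1))
  qed (use smult_closed[OF z_pow_closed] in auto)
  then show thesis using that c(1) by blast
qed

lemma mcomp_TM: "mcomp TM d = {\<tau> x k | x k. x \<in> mcomp M (d + int k)}"
proof (intro equalityI subsetI)
  let ?A = "\<Union>i. rcomp S i \<times> mcomp M (d - i)"
  have m: "mcomp TM d = cl ` {c. Poly_Mapping.keys c \<subseteq> ?A}"
    by (simp add: tensor_obj_def Let_def)
  fix t
  {
    assume "t \<in> mcomp TM d"
    then obtain c where c: "t = cl c" "Poly_Mapping.keys c \<subseteq> ?A" using m by auto
    have "\<exists>x k. x \<in> mcomp M (d + int k) \<and> cl c = \<tau> x k"
    proof (rule \<tau>_exists_homogeneous[OF _ _ _ _ _ c(2), where P = "\<lambda>k x. x \<in> mcomp M (d + int k)"])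
      show "\<zero>\<^bsub>M\<^esub> \<in> mcomp M (d + int k)" for k by (rule mcomp_zero)
      show "x \<ominus>\<^bsub>M\<^esub> y \<in> mcomp M (d + int k)" if "x \<in> mcomp M (d + int k)" "y \<in> mcomp M (d + int k)" for k x y
        using mcomp_add[OF that(1) mcomp_minus[OF that(2)]] by (simp add: a_minus_def)
      show "z [^] m \<odot>\<^bsub>M\<^esub> x \<in> mcomp M (d + int (m + k))" if "x \<in> mcomp M (d + int k)" for k x and m :: nat
        using z_pow_degree[OF that, of m] by (simp add: add_ac)
      show "x \<in> carrier M" if "x \<in> mcomp M (d + int k)" for k x using that by (rule mcomp_carrier)
      fix s x assume "(s, x) \<in> ?A"
      then obtain i where "s \<in> rcomp S i" and x: "x \<in> mcomp M (d - i)" by blast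
      then obtain a k where a: "s = fr a k" "a \<in> rcomp R (i + int k)" by auto
      have "a \<odot>\<^bsub>M\<^esub> x \<in> mcomp M (i + int k + (d - i))" by (rule mcomp_smult[OF a(2) x])
      then have "a \<odot>\<^bsub>M\<^esub> x \<in> mcomp M (d + int k)" by (simp add: add_ac)
      then show "\<exists>a k. a \<in> carrier R \<and> s = fr a k \<and> x \<in> carrier M \<and> a \<odot>\<^bsub>M\<^esub> x \<in> mcomp M (d + int k)"
        using a x rcomp_carrier mcomp_carrier by blast
    qed
    then show "t \<in> {\<tau> x k | x k. x \<in> mcomp M (d + int k)}" using c(1) by blast
  next
    assume "t \<in> {\<tau> x k | x k. x \<in> mcomp M (d + int k)}"
    then obtain x k where x: "t = \<tau> x k" "x \<in> mcomp M (d + int k)" by blast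
    have "fr \<one> k \<in> rcomp S (- int k)"
      unfolding fraction_ring_simps using one_degree by (intro CollectI exI[of _ \<one>] exI[of _ k]) simp
    then have "(fr \<one> k, x) \<in> ?A" using x(2) by (intro UN_I[of "- int k"]) auto
    then show "t \<in> mcomp TM d" unfolding m x(1) \<tau>_def by (intro imageI) auto
  }
qed

text \<open>
  An element of the tensor product is zero only for a reason seen in \<open>M\<close>: sending \<open>(s, x)\<close> to
  \<open>(z\<^sup>K s) x\<close>, for \<open>K\<close> large enough to clear the denominators, takes all the relations of the tensor
  product to \<open>z\<close>-torsion elements.
\<close>

lemma \<tau>_eq_zero_iff:
  assumes x: "x \<in> carrier M"
  shows "\<tau> x k = \<zero>\<^bsub>TM\<^esub> \<longleftrightarrow> torsion x"
proof
  assume "torsion x"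
  then obtain j :: nat where j: "z [^] j \<odot>\<^bsub>M\<^esub> x = \<zero>\<^bsub>M\<^esub>" by (auto simp: torsion_def)
  show "\<tau> x k = \<zero>\<^bsub>TM\<^esub>" using \<tau>_expand[OF x, of j k] \<tau>_zero[of "j + k"] j by simp
next
  assume z0: "\<tau> x k = \<zero>\<^bsub>TM\<^esub>"
  have "\<exists>a d. a \<in> carrier R \<and> s = fr a d" if "s \<in> carrier S" for s
    using that by (auto simp: fraction_ring_simps(1))
  then obtain num den where nd: "\<And>s. s \<in> carrier S \<Longrightarrow> num s \<in> carrier R"
    "\<And>s. s \<in> carrier S \<Longrightarrow> s = fr (num s) (den s)" by metis
  define rep where "rep K s = scale (K - den s) (num s)" for K s
  have rep_closed: "rep K s \<in> carrier R" if "s \<in> carrier S" for K s using nd(1)[OF that] by (simp add: rep_def)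
  have rep_fr: "fr (rep K s) K = s" if "s \<in> carrier S" "den s \<le> K" for K s
    using fr_scale[OF nd(1)[OF that(1)], of "K - den s" "den s"] nd(2)[OF that(1)] that(2) by (simp add: rep_def)
  have "\<exists>v. v \<in> hom (free_Abelian_group pairs) (add_monoid M) \<and>
      (\<forall>p \<in> pairs. v (frag_of p) = rep K (fst p) \<odot>\<^bsub>M\<^esub> snd p)" for K
  proof -
    have "(\<lambda>p. rep K (fst p) \<odot>\<^bsub>M\<^esub> snd p) ` pairs \<subseteq> carrier M"
      using rep_closed smult_closed by auto
    then obtain h where h: "h \<in> hom (free_Abelian_group pairs) (add_monoid M)"
      "\<And>p. p \<in> pairs \<Longrightarrow> h (frag_of p) = rep K (fst p) \<odot>\<^bsub>M\<^esub> snd p"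
      by (rule M.add.free_Abelian_group_universal) blast
    then show ?thesis by blast
  qed
  then have "\<exists>v. \<forall>K. v K \<in> hom (free_Abelian_group pairs) (add_monoid M) \<and>
      (\<forall>p \<in> pairs. v K (frag_of p) = rep K (fst p) \<odot>\<^bsub>M\<^esub> snd p)"
    by (intro choice allI)
  then obtain v where "\<forall>K. v K \<in> hom (free_Abelian_group pairs) (add_monoid M) \<and>
      (\<forall>p \<in> pairs. v K (frag_of p) = rep K (fst p) \<odot>\<^bsub>M\<^esub> snd p)"
    by (elim exE)
  then have v: "\<And>K. v K \<in> hom (free_Abelian_group pairs) (add_monoid M)"
    and v_of: "\<And>K s x. s \<in> carrier S \<Longrightarrow> x \<in> carrier M \<Longrightarrow> v K (frag_of (s, x)) = rep K s \<odot>\<^bsub>M\<^esub> x"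
    by simp_all
  have vc: "v K c \<in> carrier M" if "Poly_Mapping.keys c \<subseteq> pairs" for K c
    using hom_in_carrier[OF v] that by simp
  have v_add: "v K (c + c') = v K c \<oplus>\<^bsub>M\<^esub> v K c'"
    if "Poly_Mapping.keys c \<subseteq> pairs" "Poly_Mapping.keys c' \<subseteq> pairs" for K c c'
    using hom_mult[OF v, of c c' K] that by simp
  have keys_minus: "Poly_Mapping.keys (- c) = Poly_Mapping.keys c" for c :: "(_ \<times> 'b) \<Rightarrow>\<^sub>0 int" by simp
  have v_zero: "v K 0 = \<zero>\<^bsub>M\<^esub>" for K
    using v_add[of 0 0 K] vc[of 0 K] M.add.r_cancel_one[of "v K 0" "v K 0"] by simp
  have v_minus: "v K (- c) = \<ominus>\<^bsub>M\<^esub> v K c" if "Poly_Mapping.keys c \<subseteq> pairs" for K c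
    using v_add[of "- c" c K] that v_zero[of K] vc[OF that] vc[of "- c"] M.minus_equality[of "v K (- c)" "v K c"]
    by (simp add: keys_minus)
  have v_diff: "v K (c - c') = v K c \<ominus>\<^bsub>M\<^esub> v K c'"
    if "Poly_Mapping.keys c \<subseteq> pairs" "Poly_Mapping.keys c' \<subseteq> pairs" for K c c'
    using v_add[of c "- c'" K] v_minus[of c' K] that by (simp add: keys_minus M.minus_eq)
  define good where "good c \<longleftrightarrow> (\<exists>K0. \<forall>K \<ge> K0. torsion (v K c))" for c
  have rel: "good c" if "c \<in> tensor_rels S to_S R M" for c
    using that unfolding tensor_rels_def
  proof (elim UnE CollectE exE conjE)
    fix s s' y assume c: "c = frag_of (s \<oplus>\<^bsub>S\<^esub> s', y) - frag_of (s, y) - frag_of (s', y)"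
      and h: "s \<in> carrier S" "s' \<in> carrier S" "y \<in> carrier M"
    have ss: "s \<oplus>\<^bsub>S\<^esub> s' \<in> carrier S" using h by blast
    have "torsion (v K c)" if K: "den (s \<oplus>\<^bsub>S\<^esub> s') \<le> K" "den s \<le> K" "den s' \<le> K" for K
    proof -
      let ?a = "rep K (s \<oplus>\<^bsub>S\<^esub> s')" and ?b = "rep K s" and ?c = "rep K s'"
      have rc: "?a \<in> carrier R" "?b \<in> carrier R" "?c \<in> carrier R" using rep_closed h ss by auto
      have "fr ?a K = fr (?b \<oplus> ?c) K"
        using rep_fr[OF ss K(1)] rep_fr[OF h(1) K(2)] rep_fr[OF h(2) K(3)] fr_add[OF rc(2,3), of K] by simp
      then have "torsion (?a \<odot>\<^bsub>M\<^esub> y \<ominus>\<^bsub>M\<^esub> (?b \<oplus> ?c) \<odot>\<^bsub>M\<^esub> y)"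
        using fr_eq_torsion rc h(3) by simp
      moreover have "v K c = ?a \<odot>\<^bsub>M\<^esub> y \<ominus>\<^bsub>M\<^esub> ?b \<odot>\<^bsub>M\<^esub> y \<ominus>\<^bsub>M\<^esub> ?c \<odot>\<^bsub>M\<^esub> y"
      proof -
        have "Poly_Mapping.keys (frag_of (s \<oplus>\<^bsub>S\<^esub> s', y) - frag_of (s, y)) \<subseteq> pairs"
          using keys_diff[of "frag_of (s \<oplus>\<^bsub>S\<^esub> s', y)" "frag_of (s, y)"] ss h
          by auto
        then show ?thesis unfolding c using v_diff v_of ss h by simp
      qed
      moreover have "?a \<odot>\<^bsub>M\<^esub> y \<ominus>\<^bsub>M\<^esub> (?b \<oplus> ?c) \<odot>\<^bsub>M\<^esub> y = ?a \<odot>\<^bsub>M\<^esub> y \<ominus>\<^bsub>M\<^esub> ?b \<odot>\<^bsub>M\<^esub> y \<ominus>\<^bsub>M\<^esub> ?c \<odot>\<^bsub>M\<^esub> y"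
        using smult_closed rc h(3) by (simp add: smult_l_distr M.minus_eq M.minus_add M.a_assoc)
      ultimately show ?thesis by simp
    qed
    then show "good c" unfolding good_def
      by (intro exI[of _ "max (den (s \<oplus>\<^bsub>S\<^esub> s')) (max (den s) (den s'))"]) simp
  next
    fix s y y' assume c: "c = frag_of (s, y \<oplus>\<^bsub>M\<^esub> y') - frag_of (s, y) - frag_of (s, y')"
      and h: "s \<in> carrier S" "y \<in> carrier M" "y' \<in> carrier M"
    have "v K c = \<zero>\<^bsub>M\<^esub>" for K
    proof -
      have "Poly_Mapping.keys (frag_of (s, y \<oplus>\<^bsub>M\<^esub> y') - frag_of (s, y)) \<subseteq> pairs"
        using keys_diff[of "frag_of (s, y \<oplus>\<^bsub>M\<^esub> y')" "frag_of (s, y)"] h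
        by auto
      then have "v K c = rep K s \<odot>\<^bsub>M\<^esub> (y \<oplus>\<^bsub>M\<^esub> y') \<ominus>\<^bsub>M\<^esub> rep K s \<odot>\<^bsub>M\<^esub> y \<ominus>\<^bsub>M\<^esub> rep K s \<odot>\<^bsub>M\<^esub> y'"
        unfolding c using v_diff v_of h by simp
      also have "\<dots> = (rep K s \<odot>\<^bsub>M\<^esub> y \<oplus>\<^bsub>M\<^esub> rep K s \<odot>\<^bsub>M\<^esub> y') \<ominus>\<^bsub>M\<^esub> (rep K s \<odot>\<^bsub>M\<^esub> y \<oplus>\<^bsub>M\<^esub> rep K s \<odot>\<^bsub>M\<^esub> y')"
        using rep_closed[OF h(1)] h smult_closed by (simp add: smult_r_distr M.minus_eq M.minus_add M.a_assoc)
      also have "\<dots> = \<zero>\<^bsub>M\<^esub>"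
        using rep_closed[OF h(1)] h smult_closed by (simp add: M.minus_eq M.r_neg)
      finally show ?thesis .
    qed
    then show "good c" unfolding good_def using torsion_zero by simp
  next
    fix s a y assume c: "c = frag_of (s \<otimes>\<^bsub>S\<^esub> to_S a, y) - frag_of (s, a \<odot>\<^bsub>M\<^esub> y)"
      and h: "s \<in> carrier S" "a \<in> carrier R" "y \<in> carrier M"
    have sa: "s \<otimes>\<^bsub>S\<^esub> to_S a \<in> carrier S" using h fr_closed[OF h(2)] by blast
    have "torsion (v K c)" if K: "den (s \<otimes>\<^bsub>S\<^esub> to_S a) \<le> K" "den s \<le> K" for K
    proof -
      let ?a = "rep K (s \<otimes>\<^bsub>S\<^esub> to_S a)" and ?b = "rep K s"
      have rc: "?a \<in> carrier R" "?b \<in> carrier R" using rep_closed h sa by auto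
      have "fr ?a K = fr (?b \<otimes> a) K"
        using rep_fr[OF sa K(1)] rep_fr[OF h(1) K(2)] fr_mult[OF rc(2) h(2), of K 0] by simp
      then have "torsion (?a \<odot>\<^bsub>M\<^esub> y \<ominus>\<^bsub>M\<^esub> (?b \<otimes> a) \<odot>\<^bsub>M\<^esub> y)"
        using fr_eq_torsion rc h by simp
      moreover have "v K c = ?a \<odot>\<^bsub>M\<^esub> y \<ominus>\<^bsub>M\<^esub> ?b \<odot>\<^bsub>M\<^esub> (a \<odot>\<^bsub>M\<^esub> y)"
        unfolding c using v_diff v_of sa h smult_closed by simp
      ultimately show ?thesis using rc h by (simp add: smult_assoc)
    qed
    then show "good c" unfolding good_def
      by (intro exI[of _ "max (den (s \<otimes>\<^bsub>S\<^esub> to_S a)) (den s)"]) simp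
  qed
  have good_sub: "good c \<and> Poly_Mapping.keys c \<subseteq> pairs" if "c \<in> tsub" for c
    using that unfolding tensor_sub_def
  proof (induction rule: generate.induct)
    case one
    then show ?case using v_zero torsion_zero by (simp add: good_def tensor_free_def)
  next
    case (incl h)
    then show ?case using rel tensor_rels_keys by blast
  next
    case (inv h)
    have k: "Poly_Mapping.keys h \<subseteq> pairs" using tensor_rels_keys[OF inv] .
    have i: "inv\<^bsub>tensor_free S M\<^esub> h = - h" using k by (simp add: tensor_free_def)
    obtain K0 where "\<And>K. K \<ge> K0 \<Longrightarrow> torsion (v K h)" using rel[OF inv] by (auto simp: good_def)
    then show ?case unfolding i good_def keys_minus
      using k v_minus[OF k] torsion_minus[OF vc[OF k]] by (intro conjI exI[of _ K0]) auto
  next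
    case (eng h h')
    then have k: "Poly_Mapping.keys h \<subseteq> pairs" "Poly_Mapping.keys h' \<subseteq> pairs" by auto
    have e: "h \<otimes>\<^bsub>tensor_free S M\<^esub> h' = h + h'" by (simp add: tensor_free_def)
    obtain K0 K1 where K: "\<And>K. K \<ge> K0 \<Longrightarrow> torsion (v K h)" "\<And>K. K \<ge> K1 \<Longrightarrow> torsion (v K h')"
      using eng by (auto simp: good_def)
    have "torsion (v K (h + h'))" if "max K0 K1 \<le> K" for K
      using torsion_add[OF vc[OF k(1)] vc[OF k(2)] K(1) K(2)] v_add[OF k] that by simp
    then show ?case unfolding e good_def using k keys_add[of h h'] by blast
  qed
  have o: "fr \<one> k \<in> carrier S" by (rule fr_closed) simp
  have "frag_of (fr \<one> k, x) \<in> tsub" using z0 by (simp add: \<tau>_def zero_TM cl_eq_iff)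
  then obtain K0 where "\<And>K. K \<ge> K0 \<Longrightarrow> torsion (v K (frag_of (fr \<one> k, x)))"
    using good_sub unfolding good_def by blast
  then have t: "torsion (rep K (fr \<one> k) \<odot>\<^bsub>M\<^esub> x)" if "K \<ge> K0" for K using that v_of[OF o x] by simp
  define K where "K = max K0 (max k (den (fr \<one> k)))"
  have rc: "rep K (fr \<one> k) \<in> carrier R" by (rule rep_closed[OF o])
  have "fr (rep K (fr \<one> k)) K = fr (scale (K - k) \<one>) K"
    using rep_fr[OF o, of K] fr_scale[of \<one> "K - k" k] by (simp add: K_def)
  then have "torsion (scale (K - k) \<one> \<odot>\<^bsub>M\<^esub> x \<ominus>\<^bsub>M\<^esub> rep K (fr \<one> k) \<odot>\<^bsub>M\<^esub> x)"
    using fr_eq_torsion[of "scale (K - k) \<one>" "rep K (fr \<one> k)" x K] rc x by simp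
  moreover have "torsion (rep K (fr \<one> k) \<odot>\<^bsub>M\<^esub> x)" by (rule t) (simp add: K_def)
  ultimately have "torsion ((scale (K - k) \<one> \<odot>\<^bsub>M\<^esub> x \<ominus>\<^bsub>M\<^esub> rep K (fr \<one> k) \<odot>\<^bsub>M\<^esub> x) \<oplus>\<^bsub>M\<^esub> rep K (fr \<one> k) \<odot>\<^bsub>M\<^esub> x)"
    using torsion_add smult_closed rc x by simp
  then have "torsion (scale (K - k) \<one> \<odot>\<^bsub>M\<^esub> x)"
    using smult_closed rc x by (simp add: M.minus_eq M.a_assoc M.l_neg)
  then show "torsion x" using torsion_z_pow[OF x] scale_smult[of \<one> x] x smult_one[OF x] by simp
qed

end

context central_module
begin

interpretation S: ring S by (rule ring_S)

text \<open>
  An additive map that respects the relations descends to tensor products; this evaluates the unions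
  over representatives in their definition.
\<close>

lemma cl_map:
  assumes "central_module R z N" and add: "\<And>a b. h (a + b) = h a + h b"
    and rels: "\<And>c. c \<in> tensor_rels S to_S R M \<Longrightarrow> h c \<in> tensor_sub S to_S R N"
  shows "(\<Union>c' \<in> cl c. tensor_class S to_S R N (h c')) = tensor_class S to_S R N (h c)"
proof -
  interpret N: central_module R z N by fact
  have h0: "h 0 = 0" using add[of 0 0] by simp
  have hm: "h (- a) = - h a" for a using add[of a "- a"] h0 by (simp add: eq_neg_iff_add_eq_0 add.commute)
  have sub: "h a \<in> N.tsub" if "a \<in> tsub" for a
    using that unfolding tensor_sub_def[of S to_S R M]
  proof (induction rule: generate.induct)
    case one
    then show ?case using N.tsub_zero h0 by (simp add: tensor_free_def)
  next
    case (incl a)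
    then show ?case by (rule rels)
  next
    case (inv a)
    then show ?case using N.tsub_minus[OF rels[OF inv]] tensor_rels_keys[OF inv] hm by (simp add: tensor_free_def)
  next
    case (eng a b)
    then show ?case using N.tsub_add add by (simp add: tensor_free_def)
  qed
  have "N.cl (h c') = N.cl (h c)" if "c' \<in> cl c" for c'
    using that sub add by (auto simp: cl_def' N.cl_eq_iff)
  then show ?thesis using cl_self[of c] by blast
qed

lemma smult_TM:
  assumes s: "s \<in> carrier S"
  shows "s \<odot>\<^bsub>TM\<^esub> cl c = cl (frag_extend (\<lambda>(s', x). frag_of (s \<otimes>\<^bsub>S\<^esub> s', x)) c)"
proof -
  have "s \<odot>\<^bsub>TM\<^esub> cl c = (\<Union>c' \<in> cl c. cl (frag_extend (\<lambda>(s', x). frag_of (s \<otimes>\<^bsub>S\<^esub> s', x)) c'))"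
    by (simp add: tensor_obj_def Let_def)
  also have "\<dots> = cl (frag_extend (\<lambda>(s', x). frag_of (s \<otimes>\<^bsub>S\<^esub> s', x)) c)"
  proof (rule cl_map[OF central_module_axioms frag_extend_add])
    fix c assume "c \<in> tensor_rels S to_S R M"
    then have "frag_extend (\<lambda>(s', x). frag_of (s \<otimes>\<^bsub>S\<^esub> s', x)) c \<in> tensor_rels S to_S R M"
      unfolding tensor_rels_def
    proof (elim UnE CollectE exE conjE, goal_cases)
      case (1 s1 s2 x)
      then show ?case
        by (intro UnI1 CollectI exI[of _ "s \<otimes>\<^bsub>S\<^esub> s1"] exI[of _ "s \<otimes>\<^bsub>S\<^esub> s2"] exI[of _ x])
          (simp add: s frag_extend_diff S.r_distr)
    next
      case (2 s1 x x')
      then show ?case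
        by (intro UnI1 UnI2 CollectI exI[of _ "s \<otimes>\<^bsub>S\<^esub> s1"] exI[of _ x] exI[of _ x'])
          (simp add: s frag_extend_diff)
    next
      case (3 s1 a x)
      then show ?case
        by (intro UnI2 CollectI exI[of _ "s \<otimes>\<^bsub>S\<^esub> s1"] exI[of _ a] exI[of _ x])
          (simp add: s frag_extend_diff S.m_assoc fr_closed)
    qed
    then show "frag_extend (\<lambda>(s', x). frag_of (s \<otimes>\<^bsub>S\<^esub> s', x)) c \<in> tsub" by (rule tsub_rel)
  qed
  finally show ?thesis .
qed

lemma smult_\<tau>:
  assumes "a \<in> carrier R" "x \<in> carrier M"
  shows "fr a l \<odot>\<^bsub>TM\<^esub> \<tau> x k = \<tau> (a \<odot>\<^bsub>M\<^esub> x) (l + k)"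
  using smult_TM[OF fr_closed[OF assms(1)], of l "frag_of (fr \<one> k, x)"] assms cl_fr[OF assms, of "l + k"]
  by (simp add: \<tau>_def fr_mult)

lemma \<tau>_common2:
  assumes "s \<in> carrier TM" "t \<in> carrier TM"
  obtains x y k where "x \<in> carrier M" "y \<in> carrier M" "s = \<tau> x k" "t = \<tau> y k"
proof -
  obtain x k where x: "x \<in> carrier M" "s = \<tau> x k" by (rule \<tau>_exists[OF assms(1)])
  obtain y l where y: "y \<in> carrier M" "t = \<tau> y l" by (rule \<tau>_exists[OF assms(2)])
  show thesis
    using that[of "z [^] l \<odot>\<^bsub>M\<^esub> x" "z [^] k \<odot>\<^bsub>M\<^esub> y" "k + l"] x y \<tau>_expand[OF x(1), of l k]
      \<tau>_expand[OF y(1), of k l] smult_closed[OF z_pow_closed] by (simp add: add_ac)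
qed

lemma \<tau>_common3:
  assumes "s \<in> carrier TM" "t \<in> carrier TM" "u \<in> carrier TM"
  obtains x y w k where "x \<in> carrier M" "y \<in> carrier M" "w \<in> carrier M" "s = \<tau> x k" "t = \<tau> y k" "u = \<tau> w k"
proof -
  obtain x y k where h: "x \<in> carrier M" "y \<in> carrier M" "s = \<tau> x k" "t = \<tau> y k"
    by (rule \<tau>_common2[OF assms(1,2)])
  obtain w l where w: "w \<in> carrier M" "u = \<tau> w l" by (rule \<tau>_exists[OF assms(3)])
  show thesis
    using that[of "z [^] l \<odot>\<^bsub>M\<^esub> x" "z [^] l \<odot>\<^bsub>M\<^esub> y" "z [^] k \<odot>\<^bsub>M\<^esub> w" "k + l"] h w \<tau>_expand[OF h(1), of l k]
      \<tau>_expand[OF h(2), of l k] \<tau>_expand[OF w(1), of k l] smult_closed[OF z_pow_closed] by (simp add: add_ac)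
qed

lemma abelian_group_TM: "abelian_group TM"
proof (rule abelian_groupI)
  show "\<zero>\<^bsub>TM\<^esub> \<in> carrier TM" using \<tau>_closed[of "\<zero>\<^bsub>M\<^esub>" 0] by (simp add: \<tau>_zero)
  fix s t assume st: "s \<in> carrier TM" "t \<in> carrier TM"
  obtain x y k where xy: "x \<in> carrier M" "y \<in> carrier M" "s = \<tau> x k" "t = \<tau> y k"
    by (rule \<tau>_common2[OF st])
  show "s \<oplus>\<^bsub>TM\<^esub> t \<in> carrier TM" "s \<oplus>\<^bsub>TM\<^esub> t = t \<oplus>\<^bsub>TM\<^esub> s"
    using xy by (simp_all add: \<tau>_add \<tau>_closed M.a_comm)
  show "\<zero>\<^bsub>TM\<^esub> \<oplus>\<^bsub>TM\<^esub> s = s"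
    using xy \<tau>_add[of "\<zero>\<^bsub>M\<^esub>" x k] by (simp add: \<tau>_zero)
  show "\<exists>t\<in>carrier TM. t \<oplus>\<^bsub>TM\<^esub> s = \<zero>\<^bsub>TM\<^esub>"
    using xy \<tau>_add[of "\<ominus>\<^bsub>M\<^esub> x" x k] by (intro bexI[of _ "\<tau> (\<ominus>\<^bsub>M\<^esub> x) k"]) (simp_all add: \<tau>_zero \<tau>_closed M.l_neg)
next
  fix s t u assume stu: "s \<in> carrier TM" "t \<in> carrier TM" "u \<in> carrier TM"
  show "s \<oplus>\<^bsub>TM\<^esub> t \<oplus>\<^bsub>TM\<^esub> u = s \<oplus>\<^bsub>TM\<^esub> (t \<oplus>\<^bsub>TM\<^esub> u)"
    by (rule \<tau>_common3[OF stu]) (simp add: \<tau>_add M.a_assoc)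
qed

lemma left_module_TM: "left_module S TM"
proof (intro left_module.intro left_module_axioms.intro ring_S abelian_group_TM)
  fix s t assume s: "s \<in> carrier S" and t: "t \<in> carrier TM"
  obtain a l where a: "a \<in> carrier R" "s = fr a l" using s by (auto simp: fraction_ring_simps(1))
  obtain x k where x: "x \<in> carrier M" "t = \<tau> x k" by (rule \<tau>_exists[OF t])
  show "s \<odot>\<^bsub>TM\<^esub> t \<in> carrier TM" using a x by (simp add: smult_\<tau> \<tau>_closed smult_closed)
  fix s' assume s': "s' \<in> carrier S"
  obtain b c m where b: "b \<in> carrier R" "c \<in> carrier R" "s = fr b m" "s' = fr c m"
    by (rule common_denominator2[OF s s'])
  show "(s \<oplus>\<^bsub>S\<^esub> s') \<odot>\<^bsub>TM\<^esub> t = s \<odot>\<^bsub>TM\<^esub> t \<oplus>\<^bsub>TM\<^esub> s' \<odot>\<^bsub>TM\<^esub> t"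
    using b x by (simp add: fr_add smult_\<tau> \<tau>_add smult_closed smult_l_distr)
  show "(s \<otimes>\<^bsub>S\<^esub> s') \<odot>\<^bsub>TM\<^esub> t = s \<odot>\<^bsub>TM\<^esub> (s' \<odot>\<^bsub>TM\<^esub> t)"
    using b x by (simp add: fr_mult smult_\<tau> smult_closed smult_assoc add_ac)
next
  fix t assume t: "t \<in> carrier TM"
  obtain x k where x: "x \<in> carrier M" "t = \<tau> x k" by (rule \<tau>_exists[OF t])
  then show "\<one>\<^bsub>S\<^esub> \<odot>\<^bsub>TM\<^esub> t = t" by (simp add: smult_\<tau> smult_one)
next
  fix s t u assume s: "s \<in> carrier S" and tu: "t \<in> carrier TM" "u \<in> carrier TM"
  obtain a l where a: "a \<in> carrier R" "s = fr a l" using s by (auto simp: fraction_ring_simps(1))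
  obtain x y k where "x \<in> carrier M" "y \<in> carrier M" "t = \<tau> x k" "u = \<tau> y k" by (rule \<tau>_common2[OF tu])
  then show "s \<odot>\<^bsub>TM\<^esub> (t \<oplus>\<^bsub>TM\<^esub> u) = s \<odot>\<^bsub>TM\<^esub> t \<oplus>\<^bsub>TM\<^esub> s \<odot>\<^bsub>TM\<^esub> u"
    using a by (simp add: \<tau>_add smult_\<tau> smult_closed smult_r_distr)
qed

interpretation T: left_module S TM by (rule left_module_TM)

lemma \<tau>_finsum:
  assumes "\<And>i. i \<in> A \<Longrightarrow> g i \<in> carrier M"
  shows "(\<Oplus>\<^bsub>TM\<^esub>i\<in>A. \<tau> (g i) k) = \<tau> (\<Oplus>\<^bsub>M\<^esub>i\<in>A. g i) k"
  using assms
proof (induction A rule: infinite_finite_induct)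
  case (insert i A)
  then have "(\<lambda>i. \<tau> (g i) k) \<in> A \<rightarrow> carrier TM" "g \<in> A \<rightarrow> carrier M" using \<tau>_closed by auto
  then show ?case using insert \<tau>_closed by (simp add: \<tau>_add)
qed (simp_all add: \<tau>_zero)

lemma shifted_independent:
  assumes "finite A" "\<And>i. w i \<in> mcomp M (i + c)" "(\<Oplus>\<^bsub>M\<^esub>i\<in>A. w i) = \<zero>\<^bsub>M\<^esub>" "i \<in> A"
  shows "w i = \<zero>\<^bsub>M\<^esub>"
proof -
  have "(\<Oplus>\<^bsub>M\<^esub>d\<in>(\<lambda>i. i + c) ` A. w (d - c)) = (\<Oplus>\<^bsub>M\<^esub>i\<in>A. w ((i + c) - c))"
    by (rule M.finsum_reindex) (use assms(2) mcomp_carrier in \<open>auto simp: inj_on_def\<close>)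
  then have z: "\<zero>\<^bsub>M\<^esub> = (\<Oplus>\<^bsub>M\<^esub>d\<in>(\<lambda>i. i + c) ` A. w (d - c))" using assms(3) by simp
  have "w (d - c) \<in> mcomp M d" for d using assms(2)[of "d - c"] by simp
  from homogeneous_part_unique[OF _ this z] assms(1,4)
  have "homogeneous_part M \<zero>\<^bsub>M\<^esub> (i + c) = w i" by auto
  then show ?thesis by simp
qed

lemma mcomp_TM_common:
  assumes "s \<in> mcomp TM d" "t \<in> mcomp TM d"
  obtains x y k where "x \<in> mcomp M (d + int k)" "y \<in> mcomp M (d + int k)" "s = \<tau> x k" "t = \<tau> y k"
proof -
  obtain x k where x: "x \<in> mcomp M (d + int k)" "s = \<tau> x k" using assms(1) by (auto simp: mcomp_TM)
  obtain y l where y: "y \<in> mcomp M (d + int l)" "t = \<tau> y l" using assms(2) by (auto simp: mcomp_TM)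
  show thesis
    using that[of "z [^] l \<odot>\<^bsub>M\<^esub> x" "k + l" "z [^] k \<odot>\<^bsub>M\<^esub> y"] x y z_pow_degree[OF x(1), of l] z_pow_degree[OF y(1), of k]
      \<tau>_expand[OF mcomp_carrier[OF x(1)], of l k] \<tau>_expand[OF mcomp_carrier[OF y(1)], of k l]
    by (simp add: add_ac)
qed

lemma graded_TM: "graded_left_module S TM"
proof (rule graded_left_moduleI[OF left_module_TM])
  fix d
  show "subgroup (mcomp TM d) (add_monoid TM)"
  proof (rule subgroup.intro)
    show "mcomp TM d \<subseteq> carrier (add_monoid TM)" using \<tau>_closed mcomp_carrier by (auto simp: mcomp_TM)
    show "\<one>\<^bsub>add_monoid TM\<^esub> \<in> mcomp TM d"
      using \<tau>_zero[of 0] mcomp_zero by (auto simp: mcomp_TM intro!: exI[of _ "\<zero>\<^bsub>M\<^esub>"] exI[of _ 0])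
    fix s assume s: "s \<in> mcomp TM d"
    then obtain x k where x: "x \<in> mcomp M (d + int k)" "s = \<tau> x k" by (auto simp: mcomp_TM)
    have "inv\<^bsub>add_monoid TM\<^esub> s = \<tau> (\<ominus>\<^bsub>M\<^esub> x) k"
      unfolding a_inv_def[of TM, symmetric] x(2)
      by (rule T.M.minus_equality) (use mcomp_carrier[OF x(1)] in \<open>simp_all add: \<tau>_add \<tau>_closed \<tau>_zero M.l_neg\<close>)
    then show "inv\<^bsub>add_monoid TM\<^esub> s \<in> mcomp TM d" using mcomp_minus[OF x(1)] by (auto simp: mcomp_TM)
    fix t assume t: "t \<in> mcomp TM d"
    obtain x y k where xy: "x \<in> mcomp M (d + int k)" "y \<in> mcomp M (d + int k)" "s = \<tau> x k" "t = \<tau> y k"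
      by (rule mcomp_TM_common[OF s t])
    then have "s \<otimes>\<^bsub>add_monoid TM\<^esub> t = \<tau> (x \<oplus>\<^bsub>M\<^esub> y) k" using mcomp_carrier by (simp add: \<tau>_add)
    then show "s \<otimes>\<^bsub>add_monoid TM\<^esub> t \<in> mcomp TM d"
      using mcomp_add[OF xy(1,2)] unfolding mcomp_TM by blast
  qed
next
  fix i j s t assume s: "s \<in> rcomp S i" and t: "t \<in> mcomp TM j"
  obtain a l where a: "s = fr a l" "a \<in> rcomp R (i + int l)" using s by auto
  obtain x k where x: "t = \<tau> x k" "x \<in> mcomp M (j + int k)" using t by (auto simp: mcomp_TM)
  have "a \<odot>\<^bsub>M\<^esub> x \<in> mcomp M (i + j + int (l + k))" using mcomp_smult[OF a(2) x(2)] by (simp add: add_ac)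
  moreover have "s \<odot>\<^bsub>TM\<^esub> t = \<tau> (a \<odot>\<^bsub>M\<^esub> x) (l + k)"
    unfolding a(1) x(1) by (rule smult_\<tau>) (use a(2) x(2) rcomp_carrier mcomp_carrier in auto)
  ultimately show "s \<odot>\<^bsub>TM\<^esub> t \<in> mcomp TM (i + j)" unfolding mcomp_TM by blast
next
  fix t assume "t \<in> carrier TM"
  then obtain x k where x: "x \<in> carrier M" "t = \<tau> x k" by (rule \<tau>_exists)
  let ?A = "{i. homogeneous_part M x i \<noteq> \<zero>\<^bsub>M\<^esub>}"
  let ?B = "(\<lambda>i. i - int k) ` ?A"
  have A: "(\<lambda>d. d + int k) ` ?B = ?A" by (auto simp: image_image)
  have "x = (\<Oplus>\<^bsub>M\<^esub>i\<in>(\<lambda>d. d + int k) ` ?B. homogeneous_part M x i)"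
    unfolding A by (rule homogeneous_part(3)[OF x(1)])
  also have "\<dots> = (\<Oplus>\<^bsub>M\<^esub>d\<in>?B. homogeneous_part M x (d + int k))"
    by (rule M.finsum_reindex) (use part_carrier[OF x(1)] in \<open>auto simp: inj_on_def\<close>)
  finally have "t = \<tau> (\<Oplus>\<^bsub>M\<^esub>d\<in>?B. homogeneous_part M x (d + int k)) k"
    unfolding x(2) by (rule arg_cong[where f = "\<lambda>y. \<tau> y k"])
  also have "\<dots> = (\<Oplus>\<^bsub>TM\<^esub>d\<in>?B. \<tau> (homogeneous_part M x (d + int k)) k)"
    by (rule \<tau>_finsum[symmetric]) (rule part_carrier[OF x(1)])
  finally show "\<exists>A g. finite A \<and> (\<forall>i. g i \<in> mcomp TM i) \<and> t = (\<Oplus>\<^bsub>TM\<^esub>i\<in>A. g i)"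
    using homogeneous_part(1,2)[OF x(1)]
    by (intro exI[of _ ?B] exI[of _ "\<lambda>d. \<tau> (homogeneous_part M x (d + int k)) k"]) (auto simp: mcomp_TM)
next
  fix A g i assume A: "finite A" and g: "\<forall>i. g i \<in> mcomp TM i" and sum: "(\<Oplus>\<^bsub>TM\<^esub>i\<in>A. g i) = \<zero>\<^bsub>TM\<^esub>" and i: "i \<in> A"
  have "\<forall>i. \<exists>y k. y \<in> mcomp M (i + int k) \<and> g i = \<tau> y k" using g unfolding mcomp_TM by blast
  then obtain y k where y: "\<And>i. y i \<in> mcomp M (i + int (k i))" "\<And>i. g i = \<tau> (y i) (k i)" by metis
  define K where "K = (\<Sum>i\<in>A. k i)"
  have kK: "k i \<le> K" if "i \<in> A" for i unfolding K_def using A that by (simp add: member_le_sum)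
  define u where "u i = (if i \<in> A then z [^] (K - k i) \<odot>\<^bsub>M\<^esub> y i else \<zero>\<^bsub>M\<^esub>)" for i
  have u: "u i \<in> mcomp M (i + int K)" for i
  proof (cases "i \<in> A")
    case True
    then show ?thesis using z_pow_degree[OF y(1), of "K - k i" i] kK[OF True] by (simp add: u_def of_nat_diff)
  qed (simp add: u_def mcomp_zero)
  have uc: "u i \<in> carrier M" for i using u mcomp_carrier by blast
  have gu: "g i = \<tau> (u i) K" if "i \<in> A" for i
    using \<tau>_expand[OF mcomp_carrier[OF y(1)], of "K - k i" i "k i"] kK[OF that] that y(2) by (simp add: u_def)
  have "(\<Oplus>\<^bsub>TM\<^esub>i\<in>A. g i) = (\<Oplus>\<^bsub>TM\<^esub>i\<in>A. \<tau> (u i) K)"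
    by (rule T.M.finsum_cong') (use gu uc \<tau>_closed in auto)
  then have "\<tau> (\<Oplus>\<^bsub>M\<^esub>i\<in>A. u i) K = \<zero>\<^bsub>TM\<^esub>" using sum \<tau>_finsum[of A u K] uc by simp
  then obtain j :: nat where "z [^] j \<odot>\<^bsub>M\<^esub> (\<Oplus>\<^bsub>M\<^esub>i\<in>A. u i) = \<zero>\<^bsub>M\<^esub>"
    using \<tau>_eq_zero_iff[of "\<Oplus>\<^bsub>M\<^esub>i\<in>A. u i" K] uc by (auto simp: torsion_def)
  then have "(\<Oplus>\<^bsub>M\<^esub>i\<in>A. z [^] j \<odot>\<^bsub>M\<^esub> u i) = \<zero>\<^bsub>M\<^esub>" using finsum_smult[OF z_pow_closed, of u A j] uc by auto
  moreover have "z [^] j \<odot>\<^bsub>M\<^esub> u i \<in> mcomp M (i + (int K + int j))" for i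
    using z_pow_degree[OF u, of j i] by (simp add: add_ac)
  ultimately have "z [^] j \<odot>\<^bsub>M\<^esub> u i = \<zero>\<^bsub>M\<^esub>" using shifted_independent[OF A _ _ i, of "\<lambda>i. z [^] j \<odot>\<^bsub>M\<^esub> u i"] by blast
  then have "torsion (u i)" unfolding torsion_def by blast
  then show "g i = \<zero>\<^bsub>TM\<^esub>" using \<tau>_eq_zero_iff[OF uc] gu[OF i] by simp
qed

lemma finitely_generated_TM:
  assumes "finitely_generated R M"
  shows "finitely_generated S TM"
proof -
  obtain G where G: "finite G" "G \<subseteq> carrier M" "carrier M \<subseteq> lin_span M (carrier R) G"
    using assms unfolding finitely_generated_iff by (elim exE conjE)
  let ?G = "(\<lambda>g. \<tau> g 0) ` G"
  have span: "\<tau> x k \<in> lin_span TM (carrier S) ?G" if "x \<in> lin_span M (carrier R) G" for x k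
    using that
  proof induction
    case zero
    then show ?case using lin_span.zero[of TM] by (simp add: \<tau>_zero)
  next
    case (step a s y)
    then have h: "s \<in> carrier M" "y \<in> carrier M" using G(2) lin_span_carrier[OF subset_refl G(2)] by auto
    have "\<tau> (a \<odot>\<^bsub>M\<^esub> s \<oplus>\<^bsub>M\<^esub> y) k = fr a k \<odot>\<^bsub>TM\<^esub> \<tau> s 0 \<oplus>\<^bsub>TM\<^esub> \<tau> y k"
      using h step(1) smult_closed by (simp add: smult_\<tau> \<tau>_add)
    then show ?case using lin_span.step[OF fr_closed[OF step(1)] imageI[OF step(2), of "\<lambda>g. \<tau> g 0"] step(4)] by simp
  qed
  have "t \<in> lin_span TM (carrier S) ?G" if t: "t \<in> carrier TM" for t
  proof -
    obtain x k where "x \<in> carrier M" "t = \<tau> x k" by (rule \<tau>_exists[OF t])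
    then show ?thesis using span G(3) by auto
  qed
  moreover have "?G \<subseteq> carrier TM" using G(2) \<tau>_closed by auto
  ultimately show ?thesis
    unfolding T.finitely_generated_iff using G(1) by (intro exI[of _ ?G]) auto
qed

end

locale central_hom = central_element R z + graded_hom R M N f
  for R :: "'a graded_ring" (structure) and z and M N :: "('a, 'b) graded_module" and f
begin

sublocale M: central_module R z M by unfold_locales
sublocale N: central_module R z N by unfold_locales

definition Tf where
  "Tf = (\<lambda>t \<in> carrier M.TM. \<Union>c \<in> t. tensor_class S to_S R N (frag_extend (\<lambda>(s, x). frag_of (s, f x)) c))"

lemma tensor_arr_eq: "tensor_arr S to_S R (M, N, f) = (M.TM, N.TM, Tf)"
  by (simp add: tensor_arr_def Tf_def)

lemma Tf_\<tau>: "x \<in> carrier M \<Longrightarrow> Tf (M.\<tau> x k) = N.\<tau> (f x) k"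
proof -
  assume x: "x \<in> carrier M"
  let ?h = "frag_extend (\<lambda>(s, x). frag_of (s, f x))"
  have "(\<Union>c \<in> M.cl (frag_of (fr \<one> k, x)). N.cl (?h c)) = N.cl (?h (frag_of (fr \<one> k, x)))"
  proof (rule M.cl_map[OF N.central_module_axioms frag_extend_add])
    fix c assume "c \<in> tensor_rels S to_S R M"
    then have "?h c \<in> tensor_rels S to_S R N"
      unfolding tensor_rels_def
    proof (elim UnE CollectE exE conjE, goal_cases)
      case (1 s1 s2 x)
      then show ?case
        by (intro UnI1 CollectI exI[of _ s1] exI[of _ s2] exI[of _ "f x"]) (simp add: frag_extend_diff closed)
    next
      case (2 s1 x x')
      then show ?case
        by (intro UnI1 UnI2 CollectI exI[of _ s1] exI[of _ "f x"] exI[of _ "f x'"])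
          (simp add: frag_extend_diff closed add)
    next
      case (3 s1 a x)
      then show ?case
        by (intro UnI2 CollectI exI[of _ s1] exI[of _ a] exI[of _ "f x"]) (simp add: frag_extend_diff closed smult)
    qed
    then show "?h c \<in> N.tsub" by (rule N.tsub_rel)
  qed
  then show ?thesis using M.\<tau>_closed[OF x, of k] by (simp add: Tf_def M.\<tau>_def N.\<tau>_def)
qed

lemma graded_hom_Tf: "graded_hom S M.TM N.TM Tf"
proof -
  interpret TM: graded_left_module S M.TM by (rule M.graded_TM)
  interpret TN: graded_left_module S N.TM by (rule N.graded_TM)
  show ?thesis
  proof (intro graded_hom.intro graded_hom_axioms.intro M.graded_TM N.graded_TM)
    fix t assume t: "t \<in> carrier M.TM"
    obtain x k where x: "x \<in> carrier M" "t = M.\<tau> x k" by (rule M.\<tau>_exists[OF t])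
    show "Tf t \<in> carrier N.TM" using x by (simp add: Tf_\<tau> N.\<tau>_closed closed)
    fix s assume "s \<in> carrier S"
    then obtain a l where a: "a \<in> carrier R" "s = fr a l" by (auto simp: fraction_ring_simps(1))
    show "Tf (s \<odot>\<^bsub>M.TM\<^esub> t) = s \<odot>\<^bsub>N.TM\<^esub> Tf t"
      using x a by (simp add: M.smult_\<tau> N.smult_\<tau> Tf_\<tau> closed smult M.smult_closed)
  next
    fix s t assume st: "s \<in> carrier M.TM" "t \<in> carrier M.TM"
    obtain x y k where "x \<in> carrier M" "y \<in> carrier M" "s = M.\<tau> x k" "t = M.\<tau> y k"
      by (rule M.\<tau>_common2[OF st])
    then show "Tf (s \<oplus>\<^bsub>M.TM\<^esub> t) = Tf s \<oplus>\<^bsub>N.TM\<^esub> Tf t"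
      by (simp add: M.\<tau>_add N.\<tau>_add Tf_\<tau> closed add)
  next
    fix t i assume "t \<in> mcomp M.TM i"
    then obtain x k where x: "x \<in> mcomp M (i + int k)" "t = M.\<tau> x k" by (auto simp: M.mcomp_TM)
    then show "Tf t \<in> mcomp N.TM i" using degree[OF x(1)] M.mcomp_carrier[OF x(1)] by (auto simp: Tf_\<tau> N.mcomp_TM)
  qed
qed

lemma Tf_extensional: "Tf \<in> extensional (carrier M.TM)"
  by (simp add: Tf_def)

lemma Tf_zero_iff:
  assumes "x \<in> carrier M"
  shows "Tf (M.\<tau> x k) = \<zero>\<^bsub>N.TM\<^esub> \<longleftrightarrow> (\<exists>j::nat. f (z [^] j \<odot>\<^bsub>M\<^esub> x) = \<zero>\<^bsub>N\<^esub>)"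
  using N.\<tau>_eq_zero_iff[of "f x" k] assms closed smult[OF z_pow_closed] by (simp add: Tf_\<tau> N.torsion_def)

end

subsection \<open>Exactness of the localization functor\<close>

context central_module
begin

lemma torsion_finsum: 
  assumes "\<And>i. i \<in> A \<Longrightarrow> g i \<in> carrier M" "\<And>i. i \<in> A \<Longrightarrow> torsion (g i)"
  shows "torsion (\<Oplus>\<^bsub>M\<^esub>i\<in>A. g i)"
  using assms
proof (induction A rule: infinite_finite_induct)
  case (insert i A)
  then have "g \<in> A \<rightarrow> carrier M" by auto
  then show ?case using insert by (simp add: torsion_add)
qed (simp_all add: torsion_zero)

text \<open>
  Every element of the localization is a fraction \<open>x / z\<^sup>k\<close>, and this is zero when a power of \<open>z\<close>
  kills \<open>x\<close>.
\<close>

lemma zero_TM_iff: "carrier TM = {\<zero>\<^bsub>TM\<^esub>} \<longleftrightarrow> torsion_module R z M"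
proof -
  have "carrier TM = {\<zero>\<^bsub>TM\<^esub>} \<longleftrightarrow> (\<forall>x \<in> carrier M. \<tau> x 0 = \<zero>\<^bsub>TM\<^esub>)"
  proof
    assume *: "\<forall>x \<in> carrier M. \<tau> x 0 = \<zero>\<^bsub>TM\<^esub>"
    have "t = \<zero>\<^bsub>TM\<^esub>" if t: "t \<in> carrier TM" for t
    proof -
      obtain x k where x: "x \<in> carrier M" "t = \<tau> x k" by (rule \<tau>_exists[OF t])
      then show ?thesis using * \<tau>_eq_zero_iff[OF x(1), of 0] \<tau>_eq_zero_iff[OF x(1), of k] by simp
    qed
    moreover have "\<zero>\<^bsub>TM\<^esub> \<in> carrier TM" using \<tau>_closed[of "\<zero>\<^bsub>M\<^esub>" 0] by (simp add: \<tau>_zero)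
    ultimately show "carrier TM = {\<zero>\<^bsub>TM\<^esub>}" by blast
  qed (use \<tau>_closed in blast)
  also have "\<dots> \<longleftrightarrow> torsion_module R z M"
    using \<tau>_eq_zero_iff by (simp add: torsion_def torsion_module_def)
  finally show ?thesis .
qed

lemma TM_fg: "finitely_generated R M \<Longrightarrow> TM \<in> fg_graded_modules S"
  using graded_TM finitely_generated_TM by (simp add: fg_graded_modules_def)

end

definition eventually_bij :: "('a, 'b) gr_arrow \<Rightarrow> bool" where
  "eventually_bij = (\<lambda>(M, N, f). \<exists>n. \<forall>i \<ge> n. inj_on f (mcomp M i) \<and> f ` mcomp M i = mcomp N i)"

context central_element
begin

abbreviation "Q \<equiv> tensor_functor S to_S R"

lemma central_homI: "graded_hom R M N f \<Longrightarrow> central_hom R z M N f"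
  by (intro central_hom.intro central_element_axioms)

lemma central_moduleI: "graded_left_module R M \<Longrightarrow> central_module R z M"
  by (intro central_module.intro central_element_axioms)

lemma fob_Q: "fob Q M = tensor_obj S to_S R M"
  by (simp add: tensor_functor_def)

lemma fob_Q_fg:
  assumes "M \<in> fg_graded_modules R"
  shows "fob Q M \<in> fg_graded_modules S"
  using central_module.TM_fg[OF central_moduleI[OF fg_graded_modulesD(1)[OF assms]] fg_graded_modulesD(2)[OF assms]]
  by (simp add: fob_Q)

lemma far_Q:
  assumes "graded_hom R M N f"
  shows "far Q (M, N, f) = (fob Q M, fob Q N, central_hom.Tf R z M N f)"
  using central_hom.tensor_arr_eq[OF central_homI[OF assms]] by (simp add: tensor_functor_def)

lemma far_Q_hom:
  assumes "(M, N, f) \<in> hom_set (gr R) M N"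
  shows "(fob Q M, fob Q N, central_hom.Tf R z M N f) \<in> hom_set (gr S) (fob Q M) (fob Q N)"
proof -
  have f: "graded_hom R M N f" "M \<in> fg_graded_modules R" "N \<in> fg_graded_modules R"
    using assms by (auto simp: hom_gr_iff)
  interpret central_hom R z M N f by (rule central_homI[OF f(1)])
  show ?thesis using graded_hom_Tf Tf_extensional fob_Q_fg f by (auto simp: hom_gr_iff fob_Q)
qed

lemma is_functor_Q: "is_functor (gr R) (gr S) Q"
  unfolding is_functor_def
proof (intro conjI ballI impI)
  fix M assume "M \<in> objs (gr R)"
  then have M: "M \<in> fg_graded_modules R" by simp
  then show "fob Q M \<in> objs (gr S)" using fob_Q_fg by simp
  let ?i = "\<lambda>x \<in> carrier M. x"
  have i: "graded_hom R M M ?i" by (rule graded_hom_id[OF fg_graded_modulesD(1)[OF M]])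
  interpret central_hom R z M M ?i by (rule central_homI[OF i])
  have "Tf t = t" if t: "t \<in> carrier M.TM" for t
  proof -
    obtain x k where "x \<in> carrier M" "t = M.\<tau> x k" by (rule M.\<tau>_exists[OF t])
    then show ?thesis by (simp add: Tf_\<tau>)
  qed
  then have "Tf = (\<lambda>t \<in> carrier M.TM. t)" using Tf_extensional by (auto simp: fun_eq_iff extensional_def)
  then show "far Q (idm (gr R) M) = idm (gr S) (fob Q M)" by (simp add: idm_gr far_Q[OF i] fob_Q)
next
  fix F assume "F \<in> arrs (gr R)"
  then have "F \<in> hom_set (gr R) (src (gr R) F) (tgt (gr R) F)" by (rule arr_hom_set)
  then obtain f where f: "F = (src (gr R) F, tgt (gr R) F, f)" "graded_hom R (src (gr R) F) (tgt (gr R) F) f"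
    "F \<in> hom_set (gr R) (src (gr R) F) (tgt (gr R) F)"
    by (metis hom_grE)
  then show "far Q F \<in> hom_set (gr S) (fob Q (src (gr R) F)) (fob Q (tgt (gr R) F))"
    using far_Q[OF f(2)] far_Q_hom by metis
next
  fix F G assume F: "F \<in> arrs (gr R)" and G: "G \<in> arrs (gr R)" and FG: "src (gr R) G = tgt (gr R) F"
  obtain M N f where f: "F = (M, N, f)" "F \<in> hom_set (gr R) M N" "graded_hom R M N f"
    using arr_hom_set[OF F] by (metis hom_grE)
  obtain P g where g: "G = (N, P, g)" "G \<in> hom_set (gr R) N P" "graded_hom R N P g"
    using arr_hom_set[OF G] FG hom_setD(3)[OF f(2)] by (metis hom_grE)
  interpret f: central_hom R z M N f by (rule central_homI[OF f(3)])
  interpret g: central_hom R z N P g by (rule central_homI[OF g(3)])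
  let ?c = "compose (carrier M) g f"
  have c: "graded_hom R M P ?c" by (rule graded_hom_compose[OF f(3) g(3)])
  interpret c: central_hom R z M P ?c by (rule central_homI[OF c])
  have "c.Tf t = g.Tf (f.Tf t)" if t: "t \<in> carrier f.M.TM" for t
  proof -
    obtain x k where "x \<in> carrier M" "t = f.M.\<tau> x k" by (rule f.M.\<tau>_exists[OF t])
    then show ?thesis by (simp add: f.Tf_\<tau> g.Tf_\<tau> c.Tf_\<tau> f.closed compose_eq)
  qed
  then have "c.Tf = compose (carrier f.M.TM) g.Tf f.Tf"
    using c.Tf_extensional by (auto simp: fun_eq_iff extensional_def compose_def[of "carrier f.M.TM"])
  then show "far Q (cmp (gr R) G F) = cmp (gr S) (far Q G) (far Q F)"
    using f(1) g(1) by (simp add: cmp_gr far_Q[OF f(3)] far_Q[OF g(3)] far_Q[OF c] fob_Q)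
qed

text \<open>
  If \<open>f x / z\<^sup>k\<close> is zero, a power of \<open>z\<close> moves \<open>x\<close> into the kernel of \<open>f\<close>, and the fraction
  \<open>x / z\<^sup>k\<close> does not change when its numerator and its denominator are multiplied by this power.
\<close>

lemma is_kernel_Q:
  assumes f: "(M, N, f) \<in> hom_set (gr R) M N" and k: "(K, M, k) \<in> hom_set (gr R) K M"
    and inj: "inj_on k (carrier K)" and img: "k ` carrier K = {x \<in> carrier M. f x = \<zero>\<^bsub>N\<^esub>}"
  shows "is_kernel (gr S) (far Q (M, N, f)) (far Q (K, M, k))"
proof -
  have f': "graded_hom R M N f" and k': "graded_hom R K M k" using f k by (auto simp: hom_gr_iff)
  interpret f: central_hom R z M N f by (rule central_homI[OF f'])
  interpret k: central_hom R z K M k by (rule central_homI[OF k'])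
  interpret Tk: graded_hom S k.M.TM f.M.TM k.Tf by (rule k.graded_hom_Tf)
  have "inj_on k.Tf (carrier k.M.TM)"
  proof (rule Tk.inj_onI)
    fix t assume t: "t \<in> carrier k.M.TM" "k.Tf t = \<zero>\<^bsub>f.M.TM\<^esub>"
    obtain x l where x: "x \<in> carrier K" "t = k.M.\<tau> x l" by (rule k.M.\<tau>_exists[OF t(1)])
    obtain j :: nat where j: "k (z [^] j \<odot>\<^bsub>K\<^esub> x) = \<zero>\<^bsub>M\<^esub>" using k.Tf_zero_iff[OF x(1)] t(2) x(2) by blast
    then have "z [^] j \<odot>\<^bsub>K\<^esub> x = \<zero>\<^bsub>K\<^esub>"
      using inj_onD[OF inj, of "z [^] j \<odot>\<^bsub>K\<^esub> x" "\<zero>\<^bsub>K\<^esub>"] k.hom_zero k.M.smult_closed[OF z_pow_closed x(1)] by simp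
    then show "t = \<zero>\<^bsub>k.M.TM\<^esub>" using k.M.\<tau>_eq_zero_iff[OF x(1)] x(2) by (auto simp: k.M.torsion_def)
  qed
  moreover have "k.Tf ` carrier k.M.TM = {t \<in> carrier f.M.TM. f.Tf t = \<zero>\<^bsub>f.N.TM\<^esub>}"
  proof (intro equalityI subsetI)
    fix t assume "t \<in> k.Tf ` carrier k.M.TM"
    then obtain s where s: "s \<in> carrier k.M.TM" "t = k.Tf s" by blast
    obtain x l where x: "x \<in> carrier K" "s = k.M.\<tau> x l" by (rule k.M.\<tau>_exists[OF s(1)])
    have "f (k x) = \<zero>\<^bsub>N\<^esub>" using img x(1) by blast
    then show "t \<in> {t \<in> carrier f.M.TM. f.Tf t = \<zero>\<^bsub>f.N.TM\<^esub>}"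
      using s x k.closed[OF x(1)] by (simp add: k.Tf_\<tau> f.Tf_\<tau> f.M.\<tau>_closed f.N.\<tau>_zero)
  next
    fix t assume "t \<in> {t \<in> carrier f.M.TM. f.Tf t = \<zero>\<^bsub>f.N.TM\<^esub>}"
    then have t: "t \<in> carrier f.M.TM" "f.Tf t = \<zero>\<^bsub>f.N.TM\<^esub>" by auto
    obtain x l where x: "x \<in> carrier M" "t = f.M.\<tau> x l" by (rule f.M.\<tau>_exists[OF t(1)])
    obtain j :: nat where j: "f (z [^] j \<odot>\<^bsub>M\<^esub> x) = \<zero>\<^bsub>N\<^esub>" using f.Tf_zero_iff[OF x(1)] t(2) x(2) by blast
    then have "z [^] j \<odot>\<^bsub>M\<^esub> x \<in> k ` carrier K" using img f.M.smult_closed[OF z_pow_closed x(1)] by simp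
    then obtain y where y: "y \<in> carrier K" "k y = z [^] j \<odot>\<^bsub>M\<^esub> x" by (metis imageE)
    have "t = k.Tf (k.M.\<tau> y (j + l))" using y x f.M.\<tau>_expand[OF x(1)] by (simp add: k.Tf_\<tau>)
    then show "t \<in> k.Tf ` carrier k.M.TM" using k.M.\<tau>_closed[OF y(1)] by blast
  qed
  ultimately show ?thesis
    using is_kernel_grI[OF ring_S far_Q_hom[OF f] far_Q_hom[OF k]] far_Q[OF f'] far_Q[OF k'] by (simp add: fob_Q)
qed

text \<open>
  If \<open>q y / z\<^sup>k\<close> is zero, a power of \<open>z\<close> moves \<open>y\<close> into the kernel of \<open>q\<close>, which is the image of \<open>f\<close>.
\<close>

lemma is_cokernel_Q:
  assumes f: "(M, N, f) \<in> hom_set (gr R) M N" and q: "(N, C, q) \<in> hom_set (gr R) N C"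
    and surj: "q ` carrier N = carrier C" and ker: "f ` carrier M = {y \<in> carrier N. q y = \<zero>\<^bsub>C\<^esub>}"
  shows "is_cokernel (gr S) (far Q (M, N, f)) (far Q (N, C, q))"
proof -
  have f': "graded_hom R M N f" and q': "graded_hom R N C q" using f q by (auto simp: hom_gr_iff)
  interpret f: central_hom R z M N f by (rule central_homI[OF f'])
  interpret q: central_hom R z N C q by (rule central_homI[OF q'])
  interpret Tq: graded_hom S f.N.TM q.N.TM q.Tf by (rule q.graded_hom_Tf)
  interpret Tf: graded_hom S f.M.TM f.N.TM f.Tf by (rule f.graded_hom_Tf)
  have "q.Tf ` carrier f.N.TM = carrier q.N.TM"
  proof (intro equalityI subsetI)
    fix t assume t: "t \<in> carrier q.N.TM"
    obtain x l where x: "x \<in> carrier C" "t = q.N.\<tau> x l" by (rule q.N.\<tau>_exists[OF t])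
    then obtain y where "y \<in> carrier N" "x = q y" using surj by (metis imageE)
    then show "t \<in> q.Tf ` carrier f.N.TM" using x q.Tf_\<tau>[of y l] f.N.\<tau>_closed[of y l] by auto
  qed (use Tq.closed in auto)
  moreover have "f.Tf ` carrier f.M.TM = {t \<in> carrier f.N.TM. q.Tf t = \<zero>\<^bsub>q.N.TM\<^esub>}"
  proof (intro equalityI subsetI)
    fix t assume "t \<in> f.Tf ` carrier f.M.TM"
    then obtain s where s: "s \<in> carrier f.M.TM" "t = f.Tf s" by blast
    obtain x l where x: "x \<in> carrier M" "s = f.M.\<tau> x l" by (rule f.M.\<tau>_exists[OF s(1)])
    have "q (f x) = \<zero>\<^bsub>C\<^esub>" using ker x(1) by blast
    then show "t \<in> {t \<in> carrier f.N.TM. q.Tf t = \<zero>\<^bsub>q.N.TM\<^esub>}"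
      using s x f.closed[OF x(1)] by (simp add: q.Tf_\<tau> f.Tf_\<tau> f.N.\<tau>_closed q.N.\<tau>_zero)
  next
    fix t assume "t \<in> {t \<in> carrier f.N.TM. q.Tf t = \<zero>\<^bsub>q.N.TM\<^esub>}"
    then have t: "t \<in> carrier f.N.TM" "q.Tf t = \<zero>\<^bsub>q.N.TM\<^esub>" by auto
    obtain x l where x: "x \<in> carrier N" "t = f.N.\<tau> x l" by (rule f.N.\<tau>_exists[OF t(1)])
    obtain j :: nat where j: "q (z [^] j \<odot>\<^bsub>N\<^esub> x) = \<zero>\<^bsub>C\<^esub>" using q.Tf_zero_iff[OF x(1)] t(2) x(2) by blast
    then have "z [^] j \<odot>\<^bsub>N\<^esub> x \<in> f ` carrier M" using ker f.N.smult_closed[OF z_pow_closed x(1)] by simp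
    then obtain y where y: "y \<in> carrier M" "f y = z [^] j \<odot>\<^bsub>N\<^esub> x" by (metis imageE)
    have "t = f.Tf (f.M.\<tau> y (j + l))" using y x f.N.\<tau>_expand[OF x(1)] by (simp add: f.Tf_\<tau>)
    then show "t \<in> f.Tf ` carrier f.M.TM" using f.M.\<tau>_closed[OF y(1)] by blast
  qed
  ultimately show ?thesis
    using is_cokernel_grI[OF ring_S far_Q_hom[OF f] far_Q_hom[OF q]] far_Q[OF f'] far_Q[OF q'] by (simp add: fob_Q)
qed

text \<open>
  Multiplication by powers of \<open>z\<close> moves every element into large degrees, so the localization
  does not see what happens in small degrees.
\<close>

lemma eventually_bij_Q:
  assumes f: "(M, N, f) \<in> hom_set (gr R) M N" and bij: "eventually_bij (M, N, f)"
  shows "is_iso (gr S) (far Q (M, N, f))"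
proof -
  have f': "graded_hom R M N f" using f by (auto simp: hom_gr_iff)
  interpret central_hom R z M N f by (rule central_homI[OF f'])
  interpret Tf: graded_hom S M.TM N.TM Tf by (rule graded_hom_Tf)
  obtain n where n: "\<And>i. i \<ge> n \<Longrightarrow> inj_on f (mcomp M i)" "\<And>i. i \<ge> n \<Longrightarrow> f ` mcomp M i = mcomp N i"
    using bij by (auto simp: eventually_bij_def)
  have tors: "M.torsion x" if x: "x \<in> mcomp M i" "f x = \<zero>\<^bsub>N\<^esub>" for x i
  proof -
    define m where "m = nat (n - i)"
    have d: "z [^] m \<odot>\<^bsub>M\<^esub> x \<in> mcomp M (i + int m)" "i + int m \<ge> n"
      using M.z_pow_degree[OF x(1), of m] by (auto simp: m_def)
    have "f (z [^] m \<odot>\<^bsub>M\<^esub> x) = f \<zero>\<^bsub>M\<^esub>"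
      using smult[OF z_pow_closed M.mcomp_carrier[OF x(1)]] x(2) N.smult_zero_right[OF z_pow_closed] hom_zero by simp
    then have "z [^] m \<odot>\<^bsub>M\<^esub> x = \<zero>\<^bsub>M\<^esub>" using inj_onD[OF n(1)[OF d(2)]] d(1) M.mcomp_zero by blast
    then show ?thesis unfolding M.torsion_def by blast
  qed
  have "inj_on Tf (carrier M.TM)"
  proof (rule Tf.inj_onI)
    fix t assume t: "t \<in> carrier M.TM" "Tf t = \<zero>\<^bsub>N.TM\<^esub>"
    obtain x l where x: "x \<in> carrier M" "t = M.\<tau> x l" by (rule M.\<tau>_exists[OF t(1)])
    obtain j :: nat where j: "f (z [^] j \<odot>\<^bsub>M\<^esub> x) = \<zero>\<^bsub>N\<^esub>" using Tf_zero_iff[OF x(1)] t(2) x(2) by blast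
    let ?y = "z [^] j \<odot>\<^bsub>M\<^esub> x"
    have y: "?y \<in> carrier M" using M.smult_closed[OF z_pow_closed x(1)] .
    have "M.torsion (homogeneous_part M ?y i)" for i
      using tors[OF M.homogeneous_part(1)[OF y]] homogeneous_part_image[OF y, of i] j by simp
    then have "M.torsion (\<Oplus>\<^bsub>M\<^esub>i\<in>{i. homogeneous_part M ?y i \<noteq> \<zero>\<^bsub>M\<^esub>}. homogeneous_part M ?y i)"
      by (intro M.torsion_finsum M.part_carrier[OF y])
    then have "M.torsion ?y" by (subst M.homogeneous_part(3)[OF y])
    then show "t = \<zero>\<^bsub>M.TM\<^esub>" using M.\<tau>_eq_zero_iff[OF x(1)] M.torsion_z_pow[OF x(1)] x(2) by simp
  qed
  moreover have "Tf ` carrier M.TM = carrier N.TM"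
  proof (intro equalityI subsetI)
    fix t assume t: "t \<in> carrier N.TM"
    obtain y l where y: "y \<in> carrier N" "t = N.\<tau> y l" by (rule N.\<tau>_exists[OF t])
    have "\<forall>l. N.\<tau> y l \<in> Tf ` carrier M.TM"
      using y(1)
    proof (rule N.homogeneous_induct)
      show "\<forall>l. N.\<tau> \<zero>\<^bsub>N\<^esub> l \<in> Tf ` carrier M.TM"
        unfolding N.\<tau>_zero using imageI[OF Tf.M.mcomp_carrier[OF Tf.M.mcomp_zero], of Tf] Tf.hom_zero by simp
    next
      fix i y assume y: "y \<in> mcomp N i"
      define m where "m = nat (n - i)"
      have d: "z [^] m \<odot>\<^bsub>N\<^esub> y \<in> mcomp N (i + int m)" "i + int m \<ge> n"
        using N.z_pow_degree[OF y, of m] by (auto simp: m_def)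
      then obtain x where x: "x \<in> mcomp M (i + int m)" "z [^] m \<odot>\<^bsub>N\<^esub> y = f x" using n(2)[OF d(2)] by blast
      have "N.\<tau> y l = Tf (M.\<tau> x (m + l))" for l
        using N.\<tau>_expand[OF N.mcomp_carrier[OF y], of m l] x(2) Tf_\<tau>[OF M.mcomp_carrier[OF x(1)]] by simp
      then show "\<forall>l. N.\<tau> y l \<in> Tf ` carrier M.TM" using M.\<tau>_closed[OF M.mcomp_carrier[OF x(1)]] by auto
    next
      fix x y assume xy: "x \<in> carrier N" "y \<in> carrier N" "\<forall>l. N.\<tau> x l \<in> Tf ` carrier M.TM"
        "\<forall>l. N.\<tau> y l \<in> Tf ` carrier M.TM"
      show "\<forall>l. N.\<tau> (x \<oplus>\<^bsub>N\<^esub> y) l \<in> Tf ` carrier M.TM"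
      proof
        fix l
        obtain s t where st: "s \<in> carrier M.TM" "t \<in> carrier M.TM" "N.\<tau> x l = Tf s" "N.\<tau> y l = Tf t"
          using xy(3,4)[rule_format, of l] by (elim imageE)
        then have "N.\<tau> (x \<oplus>\<^bsub>N\<^esub> y) l = Tf (s \<oplus>\<^bsub>M.TM\<^esub> t)"
          using N.\<tau>_add[OF xy(1,2), of l] Tf.add[OF st(1,2)] by simp
        then show "N.\<tau> (x \<oplus>\<^bsub>N\<^esub> y) l \<in> Tf ` carrier M.TM" using Tf.M.M.a_closed[OF st(1,2)] by blast
      qed
    qed
    then show "t \<in> Tf ` carrier M.TM" using y(2) by simp
  qed (use Tf.closed in auto)
  ultimately show ?thesis
    using gr_bijective_iso[OF far_Q_hom[OF f]] is_iso_hom[OF far_Q_hom[OF f]] far_Q[OF f'] by (simp add: fob_Q)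
qed

end

section \<open>Noetherianity\<close>

subsection \<open>Dickson's lemma\<close>

lemma nat_mono_subsequence:
  fixes g :: "nat \<Rightarrow> nat"
  shows "\<exists>r :: nat \<Rightarrow> nat. strict_mono r \<and> mono (\<lambda>n. g (r n))"
proof -
  obtain r :: "nat \<Rightarrow> nat" where r: "strict_mono r" "monoseq (\<lambda>n. g (r n))" using seq_monosub[of g] by blast
  show ?thesis
  proof (cases "\<forall>m n. m \<le> n \<longrightarrow> g (r m) \<le> g (r n)")
    case True
    then show ?thesis using r(1) by (auto simp: mono_def)
  next
    case False
    then have dec: "g (r n) \<le> g (r m)" if "m \<le> n" for m n using r(2) that by (auto simp: monoseq_def)
    obtain N where N: "\<And>n. g (r N) \<le> g (r n)" using ex_has_least_nat[of "\<lambda>_. True" _ "\<lambda>n. g (r n)"] by blast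
    have "g (r (N + n)) = g (r N)" for n using dec[of N "N + n"] N[of "N + n"] by simp
    then show ?thesis
      using r(1) by (intro exI[of _ "\<lambda>n. r (N + n)"]) (auto simp: mono_def strict_mono_def)
  qed
qed

text \<open>
  Passing to subsequences for one letter after another makes all the multiplicities monotone.
\<close>

lemma multiset_mono_subsequence:
  fixes f :: "nat \<Rightarrow> 'x multiset"
  assumes "finite Y"
  shows "\<exists>r :: nat \<Rightarrow> nat. strict_mono r \<and> (\<forall>x \<in> Y. mono (\<lambda>n. count (f (r n)) x))"
  using assms
proof induction
  case empty
  show ?case by (intro exI[of _ "\<lambda>n. n"]) (simp add: strict_mono_def)
next
  case (insert x Y)
  then obtain r :: "nat \<Rightarrow> nat" where r: "strict_mono r" "\<forall>x \<in> Y. mono (\<lambda>n. count (f (r n)) x)" by blast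
  obtain t :: "nat \<Rightarrow> nat" where t: "strict_mono t" "mono (\<lambda>n. count (f (r (t n))) x)"
    using nat_mono_subsequence[of "\<lambda>n. count (f (r n)) x"] by blast
  have "mono t" using t(1) by (rule strict_mono_mono)
  then have "strict_mono (\<lambda>n. r (t n)) \<and> (\<forall>x \<in> insert x Y. mono (\<lambda>n. count (f (r (t n))) x))"
    using r t by (auto simp: strict_mono_def mono_def)
  then show ?case by (rule exI[of _ "\<lambda>n. r (t n)"])
qed

text \<open>
  A sequence in \<open>A\<close> in which no member is contained in a later one cannot exist, since it has a
  subsequence along which all the multiplicities grow.
\<close>

lemma Dickson:
  fixes A :: "'x::finite multiset set"
  shows "\<exists>B. finite B \<and> B \<subseteq> A \<and> (\<forall>m \<in> A. \<exists>m0 \<in> B. m0 \<subseteq># m)"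
proof -
  let ?B = "{m \<in> A. \<forall>m' \<in> A. m' \<subseteq># m \<longrightarrow> m' = m}"
  have "finite ?B"
  proof (rule ccontr)
    assume "infinite ?B"
    then obtain f :: "nat \<Rightarrow> 'x multiset" where f: "inj f" "range f \<subseteq> ?B"
      using infinite_countable_subset by blast
    obtain r :: "nat \<Rightarrow> nat" where r: "strict_mono r" "\<And>x. mono (\<lambda>n. count (f (r n)) x)"
      using multiset_mono_subsequence[of UNIV f] by auto
    have "f (r 0) \<subseteq># f (r 1)" using r(2) by (auto simp: subseteq_mset_def mono_def)
    moreover have "f (r 0) \<in> ?B" "f (r 1) \<in> ?B" using f(2) by blast+
    ultimately have "f (r 0) = f (r 1)" by blast
    then have "r 0 = r 1" using f(1) by (simp add: inj_eq)
    then show False using r(1) by (simp add: strict_mono_eq)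
  qed
  moreover have "\<exists>m0 \<in> ?B. m0 \<subseteq># m" if "m \<in> A" for m
    using that
  proof (induction "size m" arbitrary: m rule: less_induct)
    case less
    show ?case
    proof (cases "m \<in> ?B")
      case False
      then obtain m' where m': "m' \<in> A" "m' \<subseteq># m" "m' \<noteq> m" using less.prems by blast
      then have "m' \<subset># m" by (simp add: subset_mset_def)
      then have "\<exists>m0 \<in> ?B. m0 \<subseteq># m'" using less.hyps m'(1) mset_subset_size by blast
      then show ?thesis using m'(2) subset_mset.order_trans by blast
    qed auto
  qed
  ultimately show ?thesis by (intro exI[of _ ?B]) blast
qed

subsection \<open>The lexicographic order on keys\<close>

abbreviation "key_ord \<equiv> lex (less_than :: (nat \<times> nat) set)"

lemma key_ord_total: "length k = length k' \<Longrightarrow> k = k' \<or> (k, k') \<in> key_ord \<or> (k', k) \<in> key_ord"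
proof (induction k k' rule: list_induct2)
  case (Cons x xs y ys)
  then show ?case by (cases x y rule: linorder_cases) auto
qed simp

lemma key_ord_add:
  assumes "length a = length k" "length k = length k'" "(k, k') \<in> key_ord"
  shows "(map2 (+) a k, map2 (+) a k') \<in> key_ord"
  using assms by (induction a k k' rule: list_induct3) auto

lemma key_ord_trans: "(k, k') \<in> key_ord \<Longrightarrow> (k', k'') \<in> key_ord \<Longrightarrow> (k, k'') \<in> key_ord"
  using lex_transI[OF trans_less_than] by (rule transD)

subsection \<open>Operators that commute up to scalars and terms of lower degree\<close>

abbreviation field_ring :: "'k::field ring" where
  "field_ring \<equiv> ring_of_type_algebra"

lemma field_ring_simps [simp]:
  "carrier (field_ring :: 'k::field ring) = UNIV" "x \<oplus>\<^bsub>field_ring\<^esub> y = x + (y :: 'k)"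
  "x \<otimes>\<^bsub>field_ring\<^esub> y = x * (y :: 'k)" "\<zero>\<^bsub>field_ring\<^esub> = (0 :: 'k)" "\<one>\<^bsub>field_ring\<^esub> = (1 :: 'k)"
  by (simp_all add: ring_of_type_algebra_def)

text \<open>
  A vector space with operators \<open>\<xi> x\<close>, one for each generator of the homogeneous algebra: \<open>\<xi> None\<close>
  is central, and two others commute up to a nonzero factor and up to terms in which one of
  them is replaced by \<open>\<xi> None\<close>.  These relations need not be all the relations.
\<close>

locale skew_operators = left_module field_ring V
  for V :: "('k::field, 'v, 'm) module_scheme" (structure) +
  fixes \<xi> :: "'n::{finite, linorder} option \<Rightarrow> 'v \<Rightarrow> 'v"
  assumes \<xi>_closed: "v \<in> carrier V \<Longrightarrow> \<xi> x v \<in> carrier V"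
    and \<xi>_add: "v \<in> carrier V \<Longrightarrow> w \<in> carrier V \<Longrightarrow> \<xi> x (v \<oplus> w) = \<xi> x v \<oplus> \<xi> x w"
    and \<xi>_smult: "v \<in> carrier V \<Longrightarrow> \<xi> x (a \<odot> v) = a \<odot> \<xi> x v"
    and \<xi>_None: "v \<in> carrier V \<Longrightarrow> \<xi> x (\<xi> None v) = \<xi> None (\<xi> x v)"
    and \<xi>_commute: "i > j \<Longrightarrow> v \<in> carrier V \<Longrightarrow>
      \<exists>a. a \<noteq> 0 \<and> \<xi> (Some i) (\<xi> (Some j) v) \<ominus> a \<odot> \<xi> (Some j) (\<xi> (Some i) v)
        \<in> lin_span V UNIV (range (\<lambda>x. \<xi> None (\<xi> x v)))"
begin

definition word :: "'n option list \<Rightarrow> 'v \<Rightarrow> 'v" where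
  "word l v = foldr \<xi> l v"

lemma word_simps [simp]: "word [] v = v" "word (x # l) v = \<xi> x (word l v)" "word (l @ l') v = word l (word l' v)"
  by (simp_all add: word_def)

lemma word_closed: "v \<in> carrier V \<Longrightarrow> word l v \<in> carrier V"
  by (induction l) (simp_all add: \<xi>_closed)

lemma word_add: "v \<in> carrier V \<Longrightarrow> w \<in> carrier V \<Longrightarrow> word l (v \<oplus> w) = word l v \<oplus> word l w"
  by (induction l) (simp_all add: \<xi>_add word_closed)

lemma word_smult: "v \<in> carrier V \<Longrightarrow> word l (a \<odot> v) = a \<odot> word l v"
  by (induction l) (simp_all add: \<xi>_smult word_closed)

lemma word_zero: "word l \<zero> = \<zero>"
  using word_smult[of "\<zero>" l 0] word_closed[of "\<zero>" l] smult_zero_left by simp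

lemma neg_one_smult: "v \<in> carrier V \<Longrightarrow> (- 1) \<odot> v = \<ominus> v"
  using smult_l_distr[of "- 1" 1 v] smult_one[of v] smult_closed[of "- 1" v] smult_zero_left[of v]
    M.minus_equality[of "(- 1) \<odot> v" v] by simp

lemma one_smult: "v \<in> carrier V \<Longrightarrow> 1 \<odot> v = v"
  using smult_one[of v] by simp

lemma word_diff:
  "v \<in> carrier V \<Longrightarrow> w \<in> carrier V \<Longrightarrow> word l (v \<ominus> w) = word l v \<ominus> word l w"
  using word_add[of v "(- 1) \<odot> w" l] word_smult[of w l "- 1"] smult_closed[of "- 1" w]
  by (simp add: neg_one_smult word_closed M.minus_eq)

end

locale skew_generated = skew_operators V \<xi>
  for V :: "('k::field, 'v, 'm) module_scheme" (structure) and \<xi> :: "'n::{finite, linorder} option \<Rightarrow> 'v \<Rightarrow> 'v" +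
  fixes G :: "'v set" and idx :: "'v \<Rightarrow> nat" and ls :: "'n option list"
  assumes G: "finite G" "G \<subseteq> carrier V" and idx: "inj_on idx G" and ls: "set ls = UNIV"
    and generated: "carrier V \<subseteq> lin_span V UNIV {word l g | l g. g \<in> G}"
begin

text \<open>
  The leading entry of a key is the number of letters other than \<open>None\<close>: this makes the
  correction terms of the commutation relations smaller.  The other entries refine the order to a
  total one that is compatible with multiplication by words.
\<close>

definition key :: "'n option multiset \<Rightarrow> 'v \<Rightarrow> nat list" where
  "key m g = size (filter_mset (\<lambda>x. x \<noteq> None) m) # map (count m) ls @ [idx g]"

lemma length_key: "length (key m g) = length ls + 2"
  by (simp add: key_def)

lemma key_eq_iff:
  assumes "g \<in> G" "h \<in> G"
  shows "key m g = key m' h \<longleftrightarrow> m = m' \<and> g = h"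
proof
  assume *: "key m g = key m' h"
  then have "count m x = count m' x" for x using ls by (auto simp: key_def)
  then show "m = m' \<and> g = h" using * idx assms by (auto simp: key_def multiset_eq_iff inj_on_def)
qed auto

lemma key_add_mono:
  assumes "(key m g, key m' h) \<in> key_ord"
  shows "(key (u + m) g, key (u + m') h) \<in> key_ord"
proof -
  have *: "key (u + m) g = map2 (+) (size (filter_mset (\<lambda>x. x \<noteq> None) u) # map (count u) ls @ [0]) (key m g)" for m g
    by (simp add: key_def map2_map_map zip_append)
  show ?thesis unfolding * by (rule key_ord_add[OF _ _ assms]) (simp_all add: key_def)
qed

definition below :: "(nat list \<Rightarrow> bool) \<Rightarrow> 'v set" where
  "below P = lin_span V UNIV {word l g | l g. g \<in> G \<and> P (key (mset l) g)}"

definition lower :: "nat list \<Rightarrow> 'v set" where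
  "lower k = below (\<lambda>k'. (k', k) \<in> key_ord)"

lemma below_gens: "{word l g | l g. g \<in> G \<and> P (key (mset l) g)} \<subseteq> carrier V"
  using G word_closed by auto

lemma below_carrier: "x \<in> below P \<Longrightarrow> x \<in> carrier V"
  using lin_span_carrier[of UNIV "{word l g | l g. g \<in> G \<and> P (key (mset l) g)}"] below_gens[of P]
  by (auto simp: below_def)

lemma below_zero: "\<zero> \<in> below P"
  by (simp add: below_def lin_span.zero)

lemma below_add: "x \<in> below P \<Longrightarrow> y \<in> below P \<Longrightarrow> x \<oplus> y \<in> below P"
  using lin_span_add[of UNIV "{word l g | l g. g \<in> G \<and> P (key (mset l) g)}" x y] below_gens[of P]
  by (simp add: below_def)

lemma below_smult: "x \<in> below P \<Longrightarrow> a \<odot> x \<in> below P"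
  using lin_span_smult[of UNIV "{word l g | l g. g \<in> G \<and> P (key (mset l) g)}" a x] below_gens[of P]
  by (simp add: below_def)

lemma below_diff: "x \<in> below P \<Longrightarrow> y \<in> below P \<Longrightarrow> x \<ominus> y \<in> below P"
  using below_add[of x P "(- 1) \<odot> y"] below_smult[of y P "- 1"] below_carrier[of y P]
  by (simp add: neg_one_smult M.minus_eq)

lemma below_word: "g \<in> G \<Longrightarrow> P (key (mset l) g) \<Longrightarrow> word l g \<in> below P"
  using lin_span_single[of UNIV "{word l g | l g. g \<in> G \<and> P (key (mset l) g)}" 1 "word l g"] below_gens[of P]
    one_smult[OF word_closed[of g l]] subsetD[OF G(2), of g] by (auto simp: below_def)

lemma below_mono:
  assumes "\<And>k. P k \<Longrightarrow> P' k" "x \<in> below P"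
  shows "x \<in> below P'"
proof -
  have "{word l g | l g. g \<in> G \<and> P (key (mset l) g)} \<subseteq> {word l g | l g. g \<in> G \<and> P' (key (mset l) g)}"
    using assms(1) by auto
  then show ?thesis using lin_span_mono[OF subset_refl] assms(2) unfolding below_def by blast
qed

lemma lower_mono: "(k, k') \<in> key_ord \<Longrightarrow> x \<in> lower k \<Longrightarrow> x \<in> lower k'"
  unfolding lower_def by (rule below_mono[of "\<lambda>k''. (k'', k) \<in> key_ord"]) (auto intro: key_ord_trans)

lemma below_word_mult:
  assumes "x \<in> below P" "\<And>m g. g \<in> G \<Longrightarrow> P (key m g) \<Longrightarrow> P' (key (mset u + m) g)"
  shows "word u x \<in> below P'"
  using assms(1) unfolding below_def[of P]
proof induction
  case zero
  then show ?case by (simp add: word_zero below_zero)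
next
  case (step a s y)
  then obtain l g where s: "s = word l g" "g \<in> G" "P (key (mset l) g)" by blast
  have y: "y \<in> carrier V" using below_carrier[of y P] step by (simp add: below_def)
  have sc: "s \<in> carrier V" using s G word_closed by auto
  have "word u (a \<odot> s \<oplus> y) = a \<odot> word (u @ l) g \<oplus> word u y"
    using y sc smult_closed[of a s] s(1) by (simp add: word_add word_smult)
  moreover have "word (u @ l) g \<in> below P'"
    by (rule below_word[OF s(2)]) (use assms(2)[OF s(2,3)] in simp)
  ultimately show ?case using step(4) by (simp add: below_add below_smult)
qed

lemma lower_word_mult: "x \<in> lower (key m g) \<Longrightarrow> word u x \<in> lower (key (mset u + m) g)"
  unfolding lower_def by (erule below_word_mult) (rule key_add_mono)

text \<open>Words with the same letters have proportional leading terms.\<close>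

definition proportional :: "'v \<Rightarrow> 'n option list \<Rightarrow> 'n option list \<Rightarrow> bool" where
  "proportional g l l' \<longleftrightarrow> mset l = mset l' \<and>
     (\<exists>a. a \<noteq> 0 \<and> word l g \<ominus> a \<odot> word l' g \<in> lower (key (mset l) g))"

lemma smult_diff: "x \<in> carrier V \<Longrightarrow> y \<in> carrier V \<Longrightarrow> a \<odot> (x \<ominus> y) = a \<odot> x \<ominus> a \<odot> y"
  using smult_minus_right[of a y] by (simp add: M.minus_eq smult_r_distr)

lemma diff_diff_cancel:
  assumes "x \<in> carrier V" "y \<in> carrier V" "w \<in> carrier V"
  shows "(x \<ominus> y) \<oplus> (y \<ominus> w) = x \<ominus> w"
proof -
  have "(x \<ominus> y) \<oplus> (y \<ominus> w) = (x \<oplus> (\<ominus> y \<oplus> y)) \<oplus> \<ominus> w"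
    using assms by (simp only: M.minus_eq M.a_assoc M.a_inv_closed M.a_closed)
  then show ?thesis using assms by (simp add: M.l_neg M.minus_eq)
qed

lemma minus_diff: "x \<in> carrier V \<Longrightarrow> y \<in> carrier V \<Longrightarrow> \<ominus> (x \<ominus> y) = y \<ominus> x"
  by (simp add: M.minus_eq M.minus_add M.a_comm)

lemma proportional_trans:
  assumes "g \<in> G" "proportional g l l'" "proportional g l' l''"
  shows "proportional g l l''"
proof -
  obtain a b where m: "mset l = mset l'" "mset l' = mset l''" and a: "a \<noteq> 0" "b \<noteq> 0"
    and 1: "word l g \<ominus> a \<odot> word l' g \<in> lower (key (mset l) g)"
    and 2: "word l' g \<ominus> b \<odot> word l'' g \<in> lower (key (mset l) g)"
    using assms(2,3) by (auto simp: proportional_def)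
  have c: "word l g \<in> carrier V" "word l' g \<in> carrier V" "word l'' g \<in> carrier V"
    using assms(1) G word_closed by auto
  have "a \<odot> (word l' g \<ominus> b \<odot> word l'' g) \<in> lower (key (mset l) g)"
    using below_smult 2 by (simp add: lower_def)
  then have "(word l g \<ominus> a \<odot> word l' g) \<oplus> a \<odot> (word l' g \<ominus> b \<odot> word l'' g) \<in> lower (key (mset l) g)"
    using below_add 1 by (simp add: lower_def)
  moreover have "a \<odot> (word l' g \<ominus> b \<odot> word l'' g) = a \<odot> word l' g \<ominus> (a * b) \<odot> word l'' g"
    using c smult_closed smult_assoc[of a b "word l'' g"] by (simp add: smult_diff)
  ultimately have "word l g \<ominus> (a * b) \<odot> word l'' g \<in> lower (key (mset l) g)"
    using diff_diff_cancel[of "word l g" "a \<odot> word l' g" "(a * b) \<odot> word l'' g"] c smult_closed by simp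
  then show ?thesis using m a by (auto simp: proportional_def intro!: exI[of _ "a * b"])
qed

lemma proportional_sym:
  assumes "g \<in> G" "proportional g l l'"
  shows "proportional g l' l"
proof -
  obtain a where m: "mset l = mset l'" and a: "a \<noteq> 0"
    and 1: "word l g \<ominus> a \<odot> word l' g \<in> lower (key (mset l) g)"
    using assms(2) by (auto simp: proportional_def)
  have c: "word l g \<in> carrier V" "word l' g \<in> carrier V" using assms(1) G word_closed by auto
  have "(- inverse a) \<odot> (word l g \<ominus> a \<odot> word l' g) \<in> lower (key (mset l) g)"
    using below_smult 1 by (simp add: lower_def)
  moreover have "(- inverse a) \<odot> (word l g \<ominus> a \<odot> word l' g) =
      (- 1) \<odot> (inverse a \<odot> word l g \<ominus> (inverse a * a) \<odot> word l' g)"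
    using smult_assoc[of "- 1" "inverse a" "word l g \<ominus> a \<odot> word l' g"]
      smult_assoc[of "inverse a" a "word l' g"] c smult_closed by (simp add: smult_diff)
  also have "\<dots> = word l' g \<ominus> inverse a \<odot> word l g"
    using a c smult_closed by (simp add: neg_one_smult one_smult minus_diff)
  ultimately show ?thesis using m a by (auto simp: proportional_def intro!: exI[of _ "inverse a"])
qed

lemma proportional_refl: "g \<in> G \<Longrightarrow> proportional g l l"
  unfolding proportional_def lower_def using below_zero one_smult[OF word_closed[of g l]] word_closed[of g l] G
  by (auto simp: M.minus_eq M.r_neg intro!: exI[of _ 1])

lemma proportional_mult:
  assumes "g \<in> G" "proportional g l l'"
  shows "proportional g (u @ l) (u @ l')"
proof -
  obtain a where m: "mset l = mset l'" and a: "a \<noteq> 0"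
    and 1: "word l g \<ominus> a \<odot> word l' g \<in> lower (key (mset l) g)"
    using assms(2) by (auto simp: proportional_def)
  have c: "word l g \<in> carrier V" "word l' g \<in> carrier V" using assms(1) G word_closed by auto
  have "word u (word l g \<ominus> a \<odot> word l' g) \<in> lower (key (mset (u @ l)) g)"
    using lower_word_mult[OF 1, of u] by simp
  then have "word (u @ l) g \<ominus> a \<odot> word (u @ l') g \<in> lower (key (mset (u @ l)) g)"
    using c smult_closed by (simp add: word_diff word_smult)
  then show ?thesis using m a by (auto simp: proportional_def)
qed

text \<open>
  By the commutation relation, interchanging two letters costs a nonzero factor and words in which
  \<open>None\<close> has replaced a letter; the keys of those words are smaller.
\<close>

lemma proportional_swap_gt:
  assumes "g \<in> G" "i > j"
  shows "proportional g (Some i # Some j # q) (Some j # Some i # q)"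
proof -
  let ?v = "word q g"
  have v: "?v \<in> carrier V" using assms(1) G word_closed by auto
  obtain a where a: "a \<noteq> 0" and 1: "\<xi> (Some i) (\<xi> (Some j) ?v) \<ominus> a \<odot> \<xi> (Some j) (\<xi> (Some i) ?v)
        \<in> lin_span V UNIV (range (\<lambda>x. \<xi> None (\<xi> x ?v)))"
    using \<xi>_commute[OF assms(2) v] by blast
  have "range (\<lambda>x. \<xi> None (\<xi> x ?v)) \<subseteq>
      {word l h | l h. h \<in> G \<and> (key (mset l) h, key (mset (Some i # Some j # q)) g) \<in> key_ord}"
  proof (intro subsetI, elim rangeE)
    fix y x assume y: "y = \<xi> None (\<xi> x ?v)"
    have "(key (mset (None # x # q)) g, key (mset (Some i # Some j # q)) g) \<in> key_ord"
      by (cases x) (simp_all add: key_def)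
    then show "y \<in> {word l h | l h. h \<in> G \<and> (key (mset l) h, key (mset (Some i # Some j # q)) g) \<in> key_ord}"
      using y assms(1) by (intro CollectI exI[of _ "None # x # q"] exI[of _ g]) simp
  qed
  then have "\<xi> (Some i) (\<xi> (Some j) ?v) \<ominus> a \<odot> \<xi> (Some j) (\<xi> (Some i) ?v)
      \<in> lower (key (mset (Some i # Some j # q)) g)"
    using lin_span_mono[OF subset_refl] 1 unfolding lower_def below_def by blast
  then show ?thesis using a by (auto simp: proportional_def)
qed

lemma proportional_swap:
  assumes "g \<in> G"
  shows "proportional g (x # y # q) (y # x # q)"
proof -
  have eq: "proportional g (x # y # q) (y # x # q)" if "\<xi> x (\<xi> y (word q g)) = \<xi> y (\<xi> x (word q g))"
  proof -
    have "word (y # x # q) g \<in> carrier V" using word_closed assms G by blast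
    then show ?thesis
      using that below_zero[of "\<lambda>k'. (k', key (mset (x # y # q)) g) \<in> key_ord"]
      by (auto simp: proportional_def lower_def one_smult M.minus_eq M.r_neg intro!: exI[of _ 1])
  qed
  have v: "word q g \<in> carrier V" using assms G word_closed by auto
  show ?thesis
  proof (cases "x = None \<or> y = None")
    case True
    then show ?thesis using eq \<xi>_None[OF v] by metis
  next
    case False
    then obtain i j where ij: "x = Some i" "y = Some j" by (cases x; cases y) auto
    show ?thesis
      using eq proportional_swap_gt[OF assms, of j i q] proportional_swap_gt[OF assms, of i j q]
        proportional_sym[OF assms, of "Some j # Some i # q" "Some i # Some j # q"]
      unfolding ij by (cases i j rule: linorder_cases) auto
  qed
qed

lemma proportional_mset:
  assumes "g \<in> G" "mset l = mset l'"
  shows "proportional g l l'"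
  using assms(2)
proof (induction l arbitrary: l')
  case Nil
  then show ?case using proportional_refl[OF assms(1)] by simp
next
  case (Cons x l)
  have move: "proportional g (x # p @ q) (p @ x # q)" for p q
  proof (induction p)
    case Nil
    then show ?case using proportional_refl[OF assms(1)] by simp
  next
    case (Cons y p)
    show ?case
      using proportional_trans[OF assms(1) proportional_swap[OF assms(1), of x y "p @ q"]
          proportional_mult[OF assms(1) Cons.IH, of "[y]", simplified]] by simp
  qed
  have "x \<in> set l'" using Cons.prems by (metis list.set_intros(1) set_mset_mset)
  then obtain p q where l': "l' = p @ x # q" by (meson split_list)
  then have "mset l = mset (p @ q)" using Cons.prems by simp
  then have "proportional g (x # l) (x # p @ q)"
    using proportional_mult[OF assms(1) Cons.IH, of "p @ q" "[x]"] by simp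
  then show ?case unfolding l' using proportional_trans[OF assms(1) _ move] by blast
qed

text \<open>
  Terms with the same largest key belong to words with the same letters, applied to the same
  generator.  They are proportional up to lower terms, so they merge into one.
\<close>

lemma leading_term:
  assumes "x \<in> below P"
  shows "x = \<zero> \<or> (\<exists>l g a. g \<in> G \<and> P (key (mset l) g) \<and>
    x \<ominus> a \<odot> word l g \<in> lower (key (mset l) g))"
  using assms unfolding below_def
proof induction
  case (step a0 s y)
  then obtain l0 g0 where s: "s = word l0 g0" "g0 \<in> G" "P (key (mset l0) g0)" by blast
  have y: "y \<in> carrier V" using below_carrier[of y P] step by (simp add: below_def)
  have sc: "s \<in> carrier V" "a0 \<odot> s \<in> carrier V" using s G word_closed smult_closed[of a0 s] by auto
  let ?kk = "key (mset l0) g0"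
  have sub: "(a0 \<odot> s \<oplus> y) \<ominus> a0 \<odot> word l0 g0 = y"
    using sc y unfolding s(1)[symmetric] by (simp add: M.minus_eq M.a_ac M.r_neg)
  show ?case
    using step(4)
  proof
    assume "y = \<zero>"
    then have "(a0 \<odot> s \<oplus> y) \<ominus> a0 \<odot> word l0 g0 \<in> lower ?kk"
      unfolding sub lower_def using below_zero by simp
    then show ?thesis using s by blast
  next
    assume "\<exists>l g a. g \<in> G \<and> P (key (mset l) g) \<and> y \<ominus> a \<odot> word l g \<in> lower (key (mset l) g)"
    then obtain l g a where g: "g \<in> G" "P (key (mset l) g)"
      "y \<ominus> a \<odot> word l g \<in> lower (key (mset l) g)" by blast
    let ?k = "key (mset l) g"
    have w: "word l g \<in> carrier V" "a \<odot> word l g \<in> carrier V" using g(1) G word_closed smult_closed by auto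
    have ysplit: "y = (y \<ominus> a \<odot> word l g) \<oplus> a \<odot> word l g"
      using y w by (simp add: M.minus_eq M.a_assoc M.l_neg)
    consider "?kk = ?k" | "(?kk, ?k) \<in> key_ord" | "(?k, ?kk) \<in> key_ord"
      using key_ord_total[of ?kk ?k] length_key by auto
    then show ?thesis
    proof cases
      case 1
      then have m: "mset l0 = mset l" "g0 = g" using iffD1[OF key_eq_iff[OF s(2) g(1)] 1] by simp_all
      obtain b where b: "word l0 g \<ominus> b \<odot> word l g \<in> lower ?k"
        using proportional_mset[OF g(1) m(1)] m(1) by (auto simp: proportional_def)
      have w0: "word l0 g \<in> carrier V" using g(1) G word_closed by auto
      have "a0 \<odot> (word l0 g \<ominus> b \<odot> word l g) \<oplus> (y \<ominus> a \<odot> word l g) \<in> lower ?k"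
        using below_add below_smult b g(3) unfolding lower_def by blast
      moreover have "a0 \<odot> (word l0 g \<ominus> b \<odot> word l g) \<oplus> (y \<ominus> a \<odot> word l g) =
          (a0 \<odot> s \<oplus> y) \<ominus> (a0 * b + a) \<odot> word l g"
      proof -
        have 1: "a0 \<odot> (word l0 g \<ominus> b \<odot> word l g) = a0 \<odot> s \<ominus> (a0 * b) \<odot> word l g"
          using w0 w smult_closed s(1) m smult_assoc[of a0 b "word l g"] by (simp add: smult_diff)
        have 2: "(a0 * b + a) \<odot> word l g = (a0 * b) \<odot> word l g \<oplus> a \<odot> word l g"
          using smult_l_distr[of "a0 * b" a "word l g"] w by simp
        have c: "(a0 * b) \<odot> word l g \<in> carrier V" using w smult_closed by simp
        show ?thesis unfolding 1 2 using sc y w c by (simp add: M.minus_eq M.minus_add M.a_ac)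
      qed
      ultimately show ?thesis using g(1,2) by metis
    next
      case 2
      have "word l0 g0 \<in> lower ?k" unfolding lower_def by (rule below_word[OF s(2)]) (rule 2)
      then have "a0 \<odot> s \<oplus> (y \<ominus> a \<odot> word l g) \<in> lower ?k"
        using below_add below_smult g(3) unfolding lower_def s(1) by blast
      then have "(a0 \<odot> s \<oplus> y) \<ominus> a \<odot> word l g \<in> lower ?k"
        using sc y w by (simp add: M.minus_eq M.a_assoc)
      then show ?thesis using g by blast
    next
      case 3
      have "word l g \<in> lower ?kk" unfolding lower_def by (rule below_word[OF g(1)]) (rule 3)
      then have "(y \<ominus> a \<odot> word l g) \<oplus> a \<odot> word l g \<in> lower ?kk"
        using below_add below_smult lower_mono[OF 3 g(3)] unfolding lower_def by blast
      then have "(a0 \<odot> s \<oplus> y) \<ominus> a0 \<odot> word l0 g0 \<in> lower ?kk"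
        unfolding sub using ysplit by simp
      then show ?thesis using s by blast
    qed
  qed
qed simp

text \<open>
  A subspace stable under the operators is generated by finitely many of its elements: by Dickson's
  lemma finitely many of its leading terms divide all the others, and elements with
  these leading terms generate, by induction on the leading term.
\<close>

theorem stable_subspace_finitely_generated:
  assumes L: "L \<subseteq> carrier V" "\<zero> \<in> L" "\<And>x y. x \<in> L \<Longrightarrow> y \<in> L \<Longrightarrow> x \<oplus> y \<in> L"
    "\<And>a x. x \<in> L \<Longrightarrow> a \<odot> x \<in> L" "\<And>c x. x \<in> L \<Longrightarrow> \<xi> c x \<in> L"
  shows "\<exists>F. finite F \<and> F \<subseteq> L \<and> L \<subseteq> lin_span V UNIV {word l y | l y. y \<in> F}"
proof -
  have L_word: "word l x \<in> L" if "x \<in> L" for l x using that by (induction l) (simp_all add: L(5))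
  have L_diff: "x \<ominus> y \<in> L" if "x \<in> L" "y \<in> L" for x y
    using L(3)[OF that(1) L(4)[OF that(2), of "- 1"]] neg_one_smult[of y] that L(1) by (auto simp: M.minus_eq)
  \<comment> \<open>The letters of those words that occur in a leading term of the form \<open>word l g\<close>.\<close>
  define lead where "lead g = {mset l | l. \<exists>y \<in> L. y \<ominus> word l g \<in> lower (key (mset l) g)}" for g
  have "\<forall>g. \<exists>B. finite B \<and> B \<subseteq> lead g \<and> (\<forall>m \<in> lead g. \<exists>m0 \<in> B. m0 \<subseteq># m)" using Dickson by blast
  then obtain B where B: "\<And>g. finite (B g)" "\<And>g. B g \<subseteq> lead g" "\<And>g m. m \<in> lead g \<Longrightarrow> \<exists>m0 \<in> B g. m0 \<subseteq># m"
    by metis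
  have "\<forall>g m. \<exists>y. m \<in> B g \<longrightarrow> y \<in> L \<and> (\<exists>l. mset l = m \<and> y \<ominus> word l g \<in> lower (key m g))"
    using B(2) unfolding lead_def by blast
  then obtain w where w: "\<And>g m. m \<in> B g \<Longrightarrow> w g m \<in> L"
    "\<And>g m. m \<in> B g \<Longrightarrow> \<exists>l. mset l = m \<and> w g m \<ominus> word l g \<in> lower (key m g)"
    by metis
  define F where "F = (\<Union>g \<in> G. w g ` B g)"
  have F: "finite F" "F \<subseteq> L" using G(1) B(1) w(1) by (auto simp: F_def)
  define L0 where "L0 = lin_span V UNIV {word l y | l y. y \<in> F}"
  have gens: "{word l y | l y. y \<in> F} \<subseteq> carrier V" using F(2) L(1) word_closed by auto
  have L0_add: "x \<oplus> y \<in> L0" if "x \<in> L0" "y \<in> L0" for x y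
    using lin_span_add[of UNIV _ x y] gens that by (simp add: L0_def)
  have L0_smult: "a \<odot> word l y \<in> L0" if "y \<in> F" for a l y
    using lin_span_single[of UNIV "{word l y | l y. y \<in> F}" a "word l y"] gens that by (auto simp: L0_def)
  \<comment> \<open>Subtracting a multiple of a word applied to an element of \<open>F\<close> removes the leading term.\<close>
  have reduce: "\<exists>y \<in> L0. x \<ominus> y \<in> L \<inter> lower (key (mset l) g) \<and> y \<in> carrier V"
    if x: "x \<in> L" and g: "g \<in> G" and xl: "x \<ominus> a \<odot> word l g \<in> lower (key (mset l) g)" for x g a l
  proof (cases "a = 0")
    case True
    have "\<zero> \<in> L0" by (simp add: L0_def lin_span.zero)
    moreover have "0 \<odot> word l g = \<zero>" using smult_zero_left[OF word_closed[of g l]] g G by auto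
    ultimately show ?thesis using True xl x L_diff[OF x L(2)] by (intro bexI[of _ "\<zero>"]) auto
  next
    case False
    let ?k = "key (mset l) g"
    have wc: "word l' g \<in> carrier V" for l' using g G word_closed by auto
    have xc: "x \<in> carrier V" using x L(1) by auto
    have "inverse a \<odot> (x \<ominus> a \<odot> word l g) \<in> lower ?k"
      using below_smult xl unfolding lower_def by blast
    moreover have "inverse a \<odot> (x \<ominus> a \<odot> word l g) = inverse a \<odot> x \<ominus> word l g"
      using False xc wc smult_closed smult_assoc[of "inverse a" a "word l g"] one_smult[OF wc] by (simp add: smult_diff)
    ultimately have "mset l \<in> lead g" unfolding lead_def using L(4)[OF x, of "inverse a"] by auto
    then obtain m0 where m0: "m0 \<in> B g" "m0 \<subseteq># mset l" using B(3) by blast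
    obtain l0 where l0: "mset l0 = m0" "w g m0 \<ominus> word l0 g \<in> lower (key m0 g)" using w(2)[OF m0(1)] by blast
    obtain u where u: "mset u = mset l - m0" using ex_mset by blast
    have um: "mset l = mset (u @ l0)" using u l0(1) m0(2) by simp
    let ?y = "w g m0"
    have yL: "?y \<in> L" "?y \<in> F" using w(1)[OF m0(1)] m0(1) g by (auto simp: F_def)
    have yc: "?y \<in> carrier V" "word u ?y \<in> carrier V" using yL(1) L(1) word_closed by auto
    obtain b where b: "word l g \<ominus> b \<odot> word (u @ l0) g \<in> lower ?k"
      using proportional_mset[OF g um] by (auto simp: proportional_def)
    have "word u (?y \<ominus> word l0 g) \<in> lower ?k" using lower_word_mult[OF l0(2), of u] um l0(1) by simp
    then have "word u ?y \<ominus> word (u @ l0) g \<in> lower ?k" using word_diff[OF yc(1) wc] by simp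
    then have e: "(x \<ominus> a \<odot> word l g) \<oplus> a \<odot> (word l g \<ominus> b \<odot> word (u @ l0) g) \<ominus>
        (a * b) \<odot> (word u ?y \<ominus> word (u @ l0) g) \<in> lower ?k"
      using xl b below_add below_diff below_smult unfolding lower_def by blast
    have c: "a \<odot> word l g \<in> carrier V" "(a * b) \<odot> word (u @ l0) g \<in> carrier V"
      "(a * b) \<odot> word u ?y \<in> carrier V" "b \<odot> word (u @ l0) g \<in> carrier V"
      using wc[of l] wc[of "u @ l0"] yc smult_closed by auto
    have e1: "a \<odot> (word l g \<ominus> b \<odot> word (u @ l0) g) = a \<odot> word l g \<ominus> (a * b) \<odot> word (u @ l0) g"
      using smult_assoc[of a b "word (u @ l0) g"] wc[of l] wc[of "u @ l0"] c by (simp add: smult_diff del: word_simps)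
    have e2: "(a * b) \<odot> (word u ?y \<ominus> word (u @ l0) g) =
        (a * b) \<odot> word u ?y \<ominus> (a * b) \<odot> word (u @ l0) g"
      using yc wc[of "u @ l0"] by (simp add: smult_diff del: word_simps)
    have cancel: "(p \<ominus> r) \<ominus> (q \<ominus> r) = p \<ominus> q" if "p \<in> carrier V" "q \<in> carrier V" "r \<in> carrier V" for p q r
      using diff_diff_cancel[OF that(1,3,2)] minus_diff[OF that(2,3)] that by (simp add: M.minus_eq[of "p \<ominus> r"])
    have "x \<ominus> (a * b) \<odot> word u ?y \<in> lower ?k"
      using e unfolding e1 e2 diff_diff_cancel[OF xc c(1,2)] cancel[OF xc c(3,2)] .
    moreover have "x \<ominus> (a * b) \<odot> word u ?y \<in> L" by (rule L_diff[OF x L(4)[OF L_word[OF yL(1)]]])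
    ultimately show ?thesis using L0_smult[OF yL(2)] c(3) by blast
  qed
  have recover: "x \<in> L0" if "y \<in> L0" "x \<ominus> y \<in> L0" "x \<in> carrier V" "y \<in> carrier V" for x y
    using L0_add[OF that(2,1)] that(3,4) by (simp add: M.minus_eq M.a_assoc M.l_neg)
  have low: "x \<in> L0" if "x \<in> L" "x \<in> lower k" for x k
    using that
  proof (induction k arbitrary: x rule: wf_induct_rule[OF wf_lex[OF wf_less_than]])
    case (1 k)
    from leading_term[OF 1(3)[unfolded lower_def]] show ?case
    proof
      assume "x = \<zero>"
      then show ?thesis by (simp add: L0_def lin_span.zero)
    next
      assume "\<exists>l g a. g \<in> G \<and> (key (mset l) g, k) \<in> key_ord \<and> x \<ominus> a \<odot> word l g \<in> lower (key (mset l) g)"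
      then obtain l g a where g: "g \<in> G" "(key (mset l) g, k) \<in> key_ord"
        "x \<ominus> a \<odot> word l g \<in> lower (key (mset l) g)" by blast
      obtain y where y: "y \<in> L0" "x \<ominus> y \<in> L \<inter> lower (key (mset l) g)" "y \<in> carrier V"
        using reduce[OF 1(2) g(1,3)] by blast
      have "x \<ominus> y \<in> L0" using 1(1)[OF g(2)] y(2) by blast
      then show ?thesis using recover[OF y(1) _ _ y(3)] 1(2) L(1) by blast
    qed
  qed
  have "x \<in> L0" if x: "x \<in> L" for x
  proof -
    have "x \<in> below (\<lambda>_. True)" using x L(1) generated by (auto simp: below_def)
    from leading_term[OF this] show ?thesis
    proof
      assume "x = \<zero>"
      then show ?thesis by (simp add: L0_def lin_span.zero)
    next
      assume "\<exists>l g a. g \<in> G \<and> True \<and> x \<ominus> a \<odot> word l g \<in> lower (key (mset l) g)"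
      then obtain l g a where g: "g \<in> G" "x \<ominus> a \<odot> word l g \<in> lower (key (mset l) g)" by blast
      obtain y where y: "y \<in> L0" "x \<ominus> y \<in> L \<inter> lower (key (mset l) g)" "y \<in> carrier V"
        using reduce[OF x g] by blast
      have "x \<ominus> y \<in> L0" using low y(2) by blast
      then show ?thesis using recover[OF y(1) _ _ y(3)] x L(1) by blast
    qed
  qed
  then show ?thesis using F unfolding L0_def by blast
qed

end

subsection \<open>The homogeneous G-algebra\<close>

lemma ring_of_type_ring: "ring (ring_of_type_algebra :: 'a::ring_1 ring)"
proof -
  have "\<exists>y. x + y = 0" for x :: 'a using add.right_inverse by blast
  then show ?thesis
    unfolding ring_of_type_algebra_def using add.right_inverse
    by unfold_locales (auto simp: algebra_simps Units_def)
qed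

lemma type_ring_simps [simp]:
  "carrier (ring_of_type_algebra :: 'a::ring_1 ring) = UNIV" "x \<oplus>\<^bsub>ring_of_type_algebra\<^esub> y = x + (y :: 'a)"
  "x \<otimes>\<^bsub>ring_of_type_algebra\<^esub> y = x * (y :: 'a)" "\<zero>\<^bsub>ring_of_type_algebra\<^esub> = (0 :: 'a)"
  "\<one>\<^bsub>ring_of_type_algebra\<^esub> = (1 :: 'a)"
  by (simp_all add: ring_of_type_algebra_def)

lemma scalar_mult_single: "scalar a * Poly_Mapping.single w e = Poly_Mapping.single w (a * e)"
  by (simp add: scalar_def mult_single)

lemma single_mult_scalar: "Poly_Mapping.single w e * scalar a = Poly_Mapping.single w (e * a)"
  by (simp add: scalar_def mult_single)

lemma scalar_ring_hom:
  "scalar (a + e) = scalar a + scalar e" "scalar (a * e) = scalar a * scalar e" "scalar 1 = 1"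
  "scalar 0 = 0"
  by (simp_all add: scalar_def single_add mult_single)

lemma gen_mult_single: "gen x * Poly_Mapping.single (FMon l) a = Poly_Mapping.single (FMon (x # l)) a"
  by (simp add: gen_def mult_single plus_fmon_def)

lemma free_alg_induct:
  fixes p :: "('x, 'k::field) free_alg"
  assumes "P 0" "\<And>a w p. P p \<Longrightarrow> P (Poly_Mapping.single (FMon w) a + p)"
  shows "P p"
proof -
  have *: "p = (\<Sum>w \<in> Poly_Mapping.keys p. Poly_Mapping.single w (Poly_Mapping.lookup p w))"
    by (rule poly_mapping_eqI) (simp add: lookup_sum lookup_single when_def in_keys_iff)
  have "P (\<Sum>w \<in> A. Poly_Mapping.single w (Poly_Mapping.lookup p w))" if "finite A" for A
    using that
  proof induction
    case (insert w A)
    then show ?case using assms(2)[of _ "letters w" "Poly_Mapping.lookup p w"] by simp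
  qed (simp add: assms(1))
  from this[OF finite_keys[of p]] show ?thesis using * by simp
qed

locale homogeneous_G_algebra =
  fixes b :: "'n::{finite, linorder} \<Rightarrow> 'n \<Rightarrow> 'k::field" and c :: "'n \<Rightarrow> 'n \<Rightarrow> 'n \<Rightarrow> 'k" and d :: "'n \<Rightarrow> 'n \<Rightarrow> 'k"
  assumes b_nonzero: "i > j \<Longrightarrow> b i j \<noteq> 0"
begin

abbreviation "A \<equiv> homog_G_algebra b c d"
abbreviation "I \<equiv> homog_ideal b c d"
abbreviation "hc \<equiv> homog_class b c d"
abbreviation "Z \<equiv> Zel b c d"

interpretation F: ring "free_ring :: ('n option, 'k) free_alg ring" by (rule ring_of_type_ring)

lemma ideal_I: "ideal I free_ring"
  unfolding homog_ideal_def by (rule F.genideal_ideal) simp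

interpretation I: ideal I "free_ring :: ('n option, 'k) free_alg ring" by (rule ideal_I)

lemma I_closed: "0 \<in> I" "p \<in> I \<Longrightarrow> q \<in> I \<Longrightarrow> p + q \<in> I" "p \<in> I \<Longrightarrow> q * p \<in> I" "p \<in> I \<Longrightarrow> p * q \<in> I"
  "p \<in> I \<Longrightarrow> - p \<in> I"
proof -
  show "0 \<in> I" using I.zero_closed by simp
  show "p \<in> I \<Longrightarrow> q \<in> I \<Longrightarrow> p + q \<in> I" using I.a_closed[of p q] by simp
  show l: "p \<in> I \<Longrightarrow> q * p \<in> I" for p q using I.I_l_closed[of p q] by simp
  show "p \<in> I \<Longrightarrow> p * q \<in> I" using I.I_r_closed[of p q] by simp
  show "p \<in> I \<Longrightarrow> - p \<in> I" using l[of p "- 1"] by simp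
qed

lemma rel_in_I:
  "i > j \<Longrightarrow> gen (Some i) * gen (Some j) - scalar (b i j) * gen (Some j) * gen (Some i)
     + (\<Sum>k \<in> UNIV. scalar (c i j k) * gen None * gen (Some k)) + scalar (d i j) * gen None * gen None \<in> I"
  "gen (Some i) * gen None - gen None * gen (Some i) \<in> I"
  unfolding homog_ideal_def by (rule subsetD[OF F.genideal_self]; force)+

lemma hc_def': "hc p = (\<lambda>h. h + p) ` I"
  by (auto simp: homog_class_def a_r_coset_def r_coset_def)

lemma hc_eq_iff: "hc p = hc q \<longleftrightarrow> p - q \<in> I"
proof
  assume "hc p = hc q"
  moreover have "p \<in> hc p" using I_closed(1) by (force simp: hc_def')
  ultimately show "p - q \<in> I" by (auto simp: hc_def')
next
  assume *: "p - q \<in> I"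
  have "h + p \<in> hc q" if "h \<in> I" for h
    using I_closed(2)[OF that *] by (auto simp: hc_def' image_iff intro!: bexI[of _ "h + (p - q)"])
  moreover have "h + q \<in> hc p" if "h \<in> I" for h
    using I_closed(2)[OF that I_closed(5)[OF *]] by (auto simp: hc_def' image_iff intro!: bexI[of _ "h + - (p - q)"])
  ultimately show "hc p = hc q" by (auto simp: hc_def'[of p] hc_def'[of q])
qed

lemma A_simps [simp]:
  "carrier A = range hc" "hc p \<oplus>\<^bsub>A\<^esub> hc q = hc (p + q)" "hc p \<otimes>\<^bsub>A\<^esub> hc q = hc (p * q)"
  "\<one>\<^bsub>A\<^esub> = hc 1" "\<zero>\<^bsub>A\<^esub> = hc 0"
  "rcomp A m = hc ` {p. \<forall>w\<in>Poly_Mapping.keys p. int (length (letters w)) = m}"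
proof -
  note defs = homog_G_algebra_def ring.defs FactRing_def
  show "carrier A = range hc"
    by (auto simp: defs A_RCOSETS_def RCOSETS_def homog_class_def a_r_coset_def)
  show "hc p \<oplus>\<^bsub>A\<^esub> hc q = hc (p + q)"
    using I.a_rcos_sum[of p q] by (simp add: defs homog_class_def)
  show "hc p \<otimes>\<^bsub>A\<^esub> hc q = hc (p * q)"
    using I.rcoset_mult_add[of p q] by (simp add: defs homog_class_def)
  show "\<one>\<^bsub>A\<^esub> = hc 1" by (simp add: defs homog_class_def)
  show "\<zero>\<^bsub>A\<^esub> = hc 0" by (simp add: defs hc_def')
  show "rcomp A m = hc ` {p. \<forall>w\<in>Poly_Mapping.keys p. int (length (letters w)) = m}"
    by (simp add: defs)
qed

lemma ring_A: "ring A"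
proof (rule ringI)
  show "abelian_group A"
  proof (rule abelian_groupI)
    fix x assume "x \<in> carrier A"
    then obtain p where p: "x = hc p" by auto
    show "\<exists>y\<in>carrier A. y \<oplus>\<^bsub>A\<^esub> x = \<zero>\<^bsub>A\<^esub>" by (rule bexI[of _ "hc (- p)"]) (simp_all add: p)
  qed (auto simp: add_ac)
  show "Group.monoid A" by (rule monoidI) (auto simp: mult.assoc)
qed (auto simp: algebra_simps)

text \<open>
  It is enough to treat words, where the letters can be passed one by one.
\<close>

lemma gen_central: "p * gen None - gen None * p \<in> I" for p :: "('n option, 'k) free_alg"
proof (induction p rule: free_alg_induct)
  case (2 a w p)
  have w: "Poly_Mapping.single (FMon w) 1 * gen None - gen None * Poly_Mapping.single (FMon w) 1 \<in> I"
  proof (induction w)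
    case Nil
    have "Poly_Mapping.single (FMon []) 1 = (1 :: ('n option, 'k) free_alg)"
      by (simp add: zero_fmon_def[symmetric])
    then show ?case using I_closed(1) by simp
  next
    case (Cons x w)
    let ?w = "Poly_Mapping.single (FMon w) 1 :: ('n option, 'k) free_alg"
    have x: "gen x * gen None - gen None * gen x \<in> I"
      using rel_in_I(2) I_closed(1) by (cases x) simp_all
    have "gen x * (?w * gen None - gen None * ?w) + (gen x * gen None - gen None * gen x) * ?w \<in> I"
      by (rule I_closed(2)[OF I_closed(3)[OF Cons] I_closed(4)[OF x]])
    then show ?case by (simp add: gen_mult_single[symmetric] algebra_simps)
  qed
  have "scalar a * (Poly_Mapping.single (FMon w) 1 * gen None - gen None * Poly_Mapping.single (FMon w) 1)
      + (p * gen None - gen None * p) \<in> I"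
    by (rule I_closed(2)[OF I_closed(3)[OF w] 2])
  moreover have "scalar a * (gen None * Poly_Mapping.single (FMon w) 1) =
      gen None * Poly_Mapping.single (FMon w) (a :: 'k)"
    by (simp add: gen_mult_single scalar_mult_single)
  moreover have "scalar a * (Poly_Mapping.single (FMon w) 1 * gen None) =
      Poly_Mapping.single (FMon w) a * (gen None :: ('n option, 'k) free_alg)"
    by (simp add: mult.assoc[symmetric] scalar_mult_single)
  ultimately show ?case by (simp add: algebra_simps)
qed (simp add: I_closed)

lemma central_element_Z: "central_element A Z"
proof (intro central_element.intro central_element_axioms.intro ring_A)
  show "Z \<in> carrier A" by (simp add: Zel_def)
  show "x \<otimes>\<^bsub>A\<^esub> Z = Z \<otimes>\<^bsub>A\<^esub> x" if x: "x \<in> carrier A" for x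
  proof -
    obtain p where "x = hc p" using x by auto
    then show ?thesis using hc_eq_iff[of "p * gen None" "gen None * p"] gen_central[of p] by (simp add: Zel_def)
  qed
  show "rcomp A i \<subseteq> carrier A" for i by auto
  show "Z \<in> rcomp A 1" by (auto simp: Zel_def gen_def intro!: imageI)
  show "\<one>\<^bsub>A\<^esub> \<in> rcomp A 0" by (auto simp: zero_fmon_def intro!: imageI)
qed

end

subsection \<open>Modules over the homogeneous G-algebra\<close>

locale homogeneous_module = homogeneous_G_algebra b c d + M: graded_left_module "homog_G_algebra b c d" M
  for b :: "'n::{finite, linorder} \<Rightarrow> 'n \<Rightarrow> 'k::field" and c d
    and M :: "(('n, 'k) homog_elt, 'm) graded_module" (structure)
begin

definition act :: "('n option, 'k) free_alg \<Rightarrow> 'm \<Rightarrow> 'm" where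
  "act p v = hc p \<odot> v"

lemma act_closed: "v \<in> carrier M \<Longrightarrow> act p v \<in> carrier M"
  using M.smult_closed by (simp add: act_def)

lemma act_add: "v \<in> carrier M \<Longrightarrow> act (p + q) v = act p v \<oplus> act q v"
  using M.smult_l_distr[of "hc p" "hc q" v] by (simp add: act_def)

lemma act_mult: "v \<in> carrier M \<Longrightarrow> act (p * q) v = act p (act q v)"
  using M.smult_assoc[of "hc p" "hc q" v] by (simp add: act_def)

lemma act_add_right: "v \<in> carrier M \<Longrightarrow> w \<in> carrier M \<Longrightarrow> act p (v \<oplus> w) = act p v \<oplus> act p w"
  using M.smult_r_distr[of "hc p" v w] by (simp add: act_def)

lemma act_one: "v \<in> carrier M \<Longrightarrow> act 1 v = v"
  using M.smult_one by (simp add: act_def)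

lemma act_zero: "v \<in> carrier M \<Longrightarrow> act 0 v = \<zero>"
  using M.smult_zero_left by (simp add: act_def)

lemma act_cong: "p - q \<in> I \<Longrightarrow> act p v = act q v"
  unfolding act_def by (rule arg_cong[where f = "\<lambda>a. a \<odot> v"]) (rule iffD2[OF hc_eq_iff])

text \<open>
  The module as a vector space, on which the generators of the algebra act as operators.
\<close>

definition V :: "('k, 'm) module" where
  "V = \<lparr>carrier = carrier M, monoid.mult = undefined, monoid.one = undefined, ring.zero = \<zero>,
     ring.add = add M, module.smult = (\<lambda>a. act (scalar a))\<rparr>"

lemma V_simps [simp]:
  "carrier V = carrier M" "\<zero>\<^bsub>V\<^esub> = \<zero>" "x \<oplus>\<^bsub>V\<^esub> y = x \<oplus> y" "a \<odot>\<^bsub>V\<^esub> x = act (scalar a) x"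
  by (simp_all add: V_def)

lemma left_module_V: "left_module field_ring V"
proof (intro left_module.intro left_module_axioms.intro)
  show "ring (field_ring :: 'k ring)" by (rule ring_of_type_ring)
  show "abelian_group V"
  proof (rule abelian_groupI)
    show "\<exists>y\<in>carrier V. y \<oplus>\<^bsub>V\<^esub> x = \<zero>\<^bsub>V\<^esub>" if "x \<in> carrier V" for x
      using that by (intro bexI[of _ "\<ominus> x"]) (simp_all add: M.M.l_neg)
  qed (simp_all add: M.M.a_ac)
qed (simp_all add: act_closed act_add act_mult act_add_right act_one scalar_ring_hom)

abbreviation \<xi> :: "'n option \<Rightarrow> 'm \<Rightarrow> 'm" where
  "\<xi> x \<equiv> act (gen x)"

interpretation V: left_module field_ring V by (rule left_module_V)

lemma act_sum_span:
  assumes "v \<in> carrier M" "S \<subseteq> carrier M" "\<And>k. k \<in> K \<Longrightarrow> act (f k) v \<in> lin_span V UNIV S"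
  shows "act (sum f K) v \<in> lin_span V UNIV S"
  using assms(3)
proof (induction K rule: infinite_finite_induct)
  case (insert k K)
  then show ?case
    using V.lin_span_add[of UNIV S "act (f k) v" "act (sum f K) v"] assms(1,2) by (simp add: act_add)
qed (use lin_span.zero[of V UNIV S] assms(1) in \<open>simp_all add: act_zero\<close>)

text \<open>
  The terms that the defining relations add to the commutation of two generators contain \<open>Z\<close>.
\<close>

lemma skew_operators_V: "skew_operators V \<xi>"
proof (intro skew_operators.intro skew_operators_axioms.intro left_module_V)
  fix i j :: 'n and v assume ij: "i > j" and "v \<in> carrier V"
  then have v: "v \<in> carrier M" by simp
  let ?S = "range (\<lambda>x. \<xi> None (\<xi> x v))"
  have S: "?S \<subseteq> carrier M" using v act_closed by auto
  have gen: "act (scalar e * gen None * gen x) v \<in> lin_span V UNIV ?S" for e x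
    using V.lin_span_single[of UNIV ?S e "\<xi> None (\<xi> x v)"] S v
    by (simp add: mult.assoc act_mult act_closed)
  let ?E = "(\<Sum>k \<in> UNIV. scalar (- c i j k) * gen None * gen (Some k)) + scalar (- d i j) * gen None * gen None
     :: ('n option, 'k) free_alg"
  have E: "act ?E v \<in> lin_span V UNIV ?S"
    using V.lin_span_add[OF _ _ act_sum_span[OF v S gen[of "- c i j _" "Some _"]] gen[of "- d i j" None]] S v
    by (simp add: act_add)
  have neg: "scalar (- e) = - scalar e" for e :: 'k
    using scalar_ring_hom(1)[of "- e" e] by (simp add: scalar_ring_hom(4) eq_neg_iff_add_eq_0)
  have cancel: "x \<oplus>\<^bsub>V\<^esub> y \<ominus>\<^bsub>V\<^esub> x = y" if "x \<in> carrier V" "y \<in> carrier V" for x y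
    using that by (simp add: V.M.minus_eq V.M.a_comm[of x y] V.M.a_assoc V.M.r_neg del: V_simps)
  have "act (gen (Some i) * gen (Some j)) v = act (scalar (b i j) * gen (Some j) * gen (Some i) + ?E) v"
    using rel_in_I(1)[OF ij] by (intro act_cong) (simp add: neg sum_negf algebra_simps)
  then have "\<xi> (Some i) (\<xi> (Some j) v) = b i j \<odot>\<^bsub>V\<^esub> \<xi> (Some j) (\<xi> (Some i) v) \<oplus> act ?E v"
    using v by (simp add: act_add act_mult mult.assoc act_closed)
  then have "\<xi> (Some i) (\<xi> (Some j) v) \<ominus>\<^bsub>V\<^esub> b i j \<odot>\<^bsub>V\<^esub> \<xi> (Some j) (\<xi> (Some i) v) = act ?E v"
    using v cancel[of "b i j \<odot>\<^bsub>V\<^esub> \<xi> (Some j) (\<xi> (Some i) v)" "act ?E v"] act_closed by (simp del: act_add)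
  then show "\<exists>a. a \<noteq> 0 \<and> \<xi> (Some i) (\<xi> (Some j) v) \<ominus>\<^bsub>V\<^esub> a \<odot>\<^bsub>V\<^esub> \<xi> (Some j) (\<xi> (Some i) v) \<in> lin_span V UNIV ?S"
    using E b_nonzero[OF ij] by (intro exI[of _ "b i j"]) simp
next
  fix v x a assume v: "v \<in> carrier V"
  show "\<xi> x (a \<odot>\<^bsub>V\<^esub> v) = a \<odot>\<^bsub>V\<^esub> \<xi> x v"
    using v by (simp add: act_mult[symmetric] gen_def single_mult_scalar scalar_mult_single)
  show "\<xi> x (\<xi> None v) = \<xi> None (\<xi> x v)"
    using v act_cong[OF gen_central[of "gen x"]] by (simp add: act_mult[symmetric])
qed (simp_all add: act_closed act_add_right)

interpretation V: skew_operators V \<xi> by (rule skew_operators_V)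

lemma act_single: "v \<in> carrier M \<Longrightarrow> act (Poly_Mapping.single (FMon l) a) v = a \<odot>\<^bsub>V\<^esub> V.word l v"
proof -
  assume v: "v \<in> carrier M"
  have "act (Poly_Mapping.single (FMon l) 1) v = V.word l v"
  proof (induction l)
    case Nil
    show ?case using act_one[OF v] by (simp add: zero_fmon_def[symmetric])
  next
    case (Cons x l)
    then show ?case using v by (simp add: gen_mult_single[symmetric] act_mult)
  qed
  then show ?thesis using act_mult[OF v, of "scalar a" "Poly_Mapping.single (FMon l) 1"]
    by (simp add: scalar_mult_single)
qed

lemma spanned_by_words:
  assumes G: "G \<subseteq> carrier M"
  shows "lin_span M (carrier A) G \<subseteq> lin_span V UNIV {V.word l g | l g. g \<in> G}"
proof
  let ?S = "{V.word l g | l g. g \<in> G}"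
  have S: "?S \<subseteq> carrier V" using G V.word_closed by auto
  fix x assume "x \<in> lin_span M (carrier A) G"
  then show "x \<in> lin_span V UNIV ?S"
  proof induction
    case zero
    show ?case using lin_span.zero[of V] by simp
  next
    case (step a g y)
    obtain p where p: "a = hc p" using step(1) by auto
    have g: "g \<in> carrier M" using step(2) G by auto
    have "act p g \<in> lin_span V UNIV ?S"
    proof (induction p rule: free_alg_induct)
      case 1
      show ?case using lin_span.zero[of V] act_zero[OF g] by simp
    next
      case (2 a w p)
      have "a \<odot>\<^bsub>V\<^esub> V.word w g \<in> lin_span V UNIV ?S"
        by (rule V.lin_span_single) (use S step(2) in auto)
      then show ?case using V.lin_span_add[OF _ S _ 2] by (simp add: act_add[OF g] act_single[OF g])
    qed
    then show ?case using V.lin_span_add[OF _ S _ step(4)] p by (simp add: act_def[symmetric])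
  qed
qed

lemma words_spanned:
  assumes "G \<subseteq> carrier M"
  shows "lin_span V UNIV {V.word l g | l g. g \<in> G} \<subseteq> lin_span M (carrier A) G"
proof
  fix x assume "x \<in> lin_span V UNIV {V.word l g | l g. g \<in> G}"
  then show "x \<in> lin_span M (carrier A) G"
  proof induction
    case zero
    show ?case using lin_span.zero[of M] by simp
  next
    case (step a s y)
    then obtain l g where s: "s = V.word l g" "g \<in> G" by blast
    have "a \<odot>\<^bsub>V\<^esub> s = hc (Poly_Mapping.single (FMon l) a) \<odot> g"
      using act_single[of g l a] s assms by (auto simp: act_def)
    then show ?case using lin_span.step[OF _ s(2) step(4), of "hc (Poly_Mapping.single (FMon l) a)"] by simp
  qed
qed

text \<open>
  A submodule is a subspace that is stable under the operators given by the generators.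
\<close>

lemma submodule_finitely_generated:
  assumes fg: "finitely_generated A M" and L: "graded_submodule A M L"
  shows "finitely_generated A (submodule_obj M L)"
proof -
  obtain G where G: "finite G" "G \<subseteq> carrier M" "carrier M \<subseteq> lin_span M (carrier A) G"
    using fg unfolding M.finitely_generated_iff by (elim exE conjE)
  obtain idx :: "'m \<Rightarrow> nat" where idx: "inj_on idx G" using finite_imp_inj_to_nat_seg[OF G(1)] by blast
  obtain ls :: "'n option list" where ls: "set ls = UNIV" using finite_list[OF finite] by blast
  interpret skew_generated V \<xi> G idx ls
    by unfold_locales (use G idx ls spanned_by_words[OF G(2)] in auto)
  note LD = graded_submoduleD[OF L]
  have "L \<subseteq> carrier V" "\<And>x y. x \<in> L \<Longrightarrow> y \<in> L \<Longrightarrow> x \<oplus>\<^bsub>V\<^esub> y \<in> L" "\<And>a x. x \<in> L \<Longrightarrow> a \<odot>\<^bsub>V\<^esub> x \<in> L"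
    "\<And>e x. x \<in> L \<Longrightarrow> \<xi> e x \<in> L" "\<zero>\<^bsub>V\<^esub> \<in> L"
    using LD by (auto simp: act_def)
  from stable_subspace_finitely_generated[OF this(1,5,2,3,4)]
  obtain F where F: "finite F" "F \<subseteq> L" "L \<subseteq> lin_span V UNIV {V.word l y | l y. y \<in> F}" by blast
  have "F \<subseteq> carrier M" using F(2) LD(1) by blast
  then have "L \<subseteq> lin_span M (carrier A) F" using F(3) words_spanned by blast
  moreover have "left_module A (submodule_obj M L)"
    using submodule_obj_graded(1)[OF M.graded_left_module_axioms central_element.rcomp_carrier[OF central_element_Z] L]
    by (simp add: graded_left_module_def)
  ultimately show ?thesis
    using F(1,2) unfolding left_module.finitely_generated_iff[OF \<open>left_module A (submodule_obj M L)\<close>]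
    by (intro exI[of _ F]) simp
qed

lemma word_degree: "v \<in> mcomp M i \<Longrightarrow> V.word l v \<in> mcomp M (i + int (length l))"
proof (induction l)
  case (Cons x l)
  have "hc (gen x) \<in> rcomp A 1" by (auto simp: gen_def intro!: imageI)
  then show ?case using M.mcomp_smult[of "hc (gen x)" 1 "V.word l v" "i + int (length l)"] Cons
    by (simp add: act_def[symmetric] add_ac del: A_simps)
qed simp

lemma part_finsum:
  assumes "\<And>s. s \<in> S \<Longrightarrow> g s \<in> carrier M"
  shows "M.part (\<Oplus>s\<in>S. g s) i = (\<Oplus>s\<in>S. M.part (g s) i)"
  using assms
proof (induction S rule: infinite_finite_induct)
  case (insert s S)
  then have "g \<in> S \<rightarrow> carrier M" "(\<lambda>s. M.part (g s) i) \<in> S \<rightarrow> carrier M" using M.part_carrier by auto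
  then show ?case using insert by (simp add: M.part_add M.part_carrier)
qed simp_all

text \<open>
  Finitely many vectors have components in finitely many degrees only.  Conversely, if large degrees
  vanish, then long words kill the homogeneous generators, and the finitely many short words applied to
  these generators span the module.
\<close>

lemma finite_dimensional_iff:
  assumes fg: "finitely_generated A M"
  shows "M \<in> finite_dimensional_objs b c d \<longleftrightarrow> (\<exists>n. \<forall>i \<ge> n. mcomp M i = {\<zero>})"
proof
  assume "M \<in> finite_dimensional_objs b c d"
  then obtain S where S: "finite S" "S \<subseteq> carrier M"
    "\<And>x. x \<in> carrier M \<Longrightarrow> \<exists>f :: 'm \<Rightarrow> 'k. x = (\<Oplus>s\<in>S. hc (scalar (f s)) \<odot> s)"
    by (auto simp: finite_dimensional_objs_def)
  let ?D = "\<Union>s \<in> S. {i. M.part s i \<noteq> \<zero>}"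
  have "finite ?D" using S M.homogeneous_part(2) by blast
  then have "\<forall>i \<in> ?D. i < Max ?D + 1" using Max_ge[of ?D] by (simp add: zle_add1_eq_le)
  then obtain n where n: "\<And>i. i \<in> ?D \<Longrightarrow> i < n" by blast
  have "x = \<zero>" if i: "n \<le> i" and x: "x \<in> mcomp M i" for i x
  proof -
    obtain f :: "'m \<Rightarrow> 'k" where f: "x = (\<Oplus>s\<in>S. hc (scalar (f s)) \<odot> s)"
      using S(3)[OF M.mcomp_carrier[OF x]] by blast
    have sc: "hc (scalar (f s)) \<in> rcomp A 0" for s by (auto simp: scalar_def zero_fmon_def intro!: imageI)
    have "x = M.part x i" using M.part_homogeneous[OF x] by simp
    also have "\<dots> = (\<Oplus>s\<in>S. M.part (hc (scalar (f s)) \<odot> s) i)"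
      unfolding f by (rule part_finsum) (use S(2) M.smult_closed in auto)
    also have "\<dots> = (\<Oplus>s\<in>S. \<zero>)"
    proof (rule M.finsum_cong')
      fix s assume s: "s \<in> S"
      have "M.part s i = \<zero>" using n[of i] i s by force
      then show "M.part (hc (scalar (f s)) \<odot> s) i = \<zero>"
        using M.part_smult[OF sc, of s] S(2) s M.smult_zero_right by auto
    qed auto
    finally show ?thesis by simp
  qed
  then show "\<exists>n. \<forall>i \<ge> n. mcomp M i = {\<zero>}" using M.mcomp_zero by blast
next
  assume "\<exists>n. \<forall>i \<ge> n. mcomp M i = {\<zero>}"
  then obtain n where n: "\<And>i x. n \<le> i \<Longrightarrow> x \<in> mcomp M i \<Longrightarrow> x = \<zero>" by blast
  obtain G where G: "finite G" "G \<subseteq> carrier M" "carrier M \<subseteq> lin_span M (carrier A) G"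
    using fg unfolding M.finitely_generated_iff by (elim exE conjE)
  let ?supp = "\<lambda>g. {i. M.part g i \<noteq> \<zero>}"
  define H where "H = (\<Union>g \<in> G. M.part g ` ?supp g)"
  have finsupp: "finite (?supp g)" if "g \<in> G" for g using M.homogeneous_part(2) that G(2) by blast
  obtain m where m: "\<And>g i. g \<in> G \<Longrightarrow> i \<in> ?supp g \<Longrightarrow> m < i"
  proof -
    have "finite (\<Union>g \<in> G. ?supp g)" using G(1) finsupp by blast
    then have "\<forall>i \<in> (\<Union>g \<in> G. ?supp g). Min (\<Union>g \<in> G. ?supp g) - 1 < i"
      using Min_le[of "\<Union>g \<in> G. ?supp g"] by fastforce
    then obtain m where "\<And>i. i \<in> (\<Union>g \<in> G. ?supp g) \<Longrightarrow> m < i" by blast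
    then show thesis using that by blast
  qed
  define N where "N = nat (n - m)"
  have H: "finite H" "H \<subseteq> carrier M" "\<And>h. h \<in> H \<Longrightarrow> \<exists>i > m. h \<in> mcomp M i"
  proof -
    have Gc: "g \<in> carrier M" if "g \<in> G" for g using that G(2) by auto
    show "finite H" using G(1) finsupp by (simp add: H_def)
    show "H \<subseteq> carrier M" using M.part_carrier[OF Gc] by (auto simp: H_def)
    show "\<exists>i > m. h \<in> mcomp M i" if h: "h \<in> H" for h
    proof -
      obtain g i where "g \<in> G" "i \<in> ?supp g" "h = M.part g i" using h unfolding H_def by blast
      then show ?thesis using m[of g i] M.homogeneous_part(1)[OF Gc[of g]] by blast
    qed
  qed
  let ?W = "{V.word l h | l h. h \<in> H}" and ?W' = "{V.word l h | l h. h \<in> H \<and> length l \<le> N}"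
  have W: "?W' \<subseteq> carrier V" using H(2) V.word_closed by auto
  have "finite {l :: 'n option list. set l \<subseteq> UNIV \<and> length l \<le> N}" by (rule finite_lists_length_le) simp
  then have "finite ((\<lambda>(l, h). V.word l h) ` ({l. set l \<subseteq> UNIV \<and> length l \<le> N} \<times> H))" using H(1) by blast
  moreover have "?W' \<subseteq> (\<lambda>(l, h). V.word l h) ` ({l. set l \<subseteq> UNIV \<and> length l \<le> N} \<times> H)" by auto
  ultimately have finW: "finite ?W'" by (rule finite_subset[rotated])
  have "g \<in> lin_span M (carrier A) H" if "g \<in> G" for g
  proof -
    have g: "g \<in> carrier M" using that G(2) by auto
    have "M.part g i \<in> lin_span M (carrier A) H" if "i \<in> ?supp g" for i
      using M.lin_span_single[OF subset_refl H(2), of "hc 1" "M.part g i"] that \<open>g \<in> G\<close>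
        M.smult_one[OF M.part_carrier[OF g]] by (auto simp: H_def)
    then have "(\<Oplus>i\<in>?supp g. M.part g i) \<in> lin_span M (carrier A) H"
      by (rule M.lin_span_finsum[OF subset_refl H(2)])
    then show ?thesis by (subst M.homogeneous_part(3)[OF g])
  qed
  then have GH: "G \<subseteq> lin_span M (carrier A) H" by blast
  have "x \<in> lin_span M (carrier A) H" if "x \<in> lin_span M (carrier A) G" for x
    using that
  proof induction
    case (step a s y)
    have "a \<odot> s \<in> lin_span M (carrier A) H"
      by (rule M.lin_span_smult[OF subset_refl H(2) step(1)]) (use step GH M.R.m_closed in blast)+
    then show ?case using M.lin_span_add[OF subset_refl H(2)] step by blast
  qed (rule lin_span.zero)
  then have cM: "carrier M \<subseteq> lin_span V UNIV ?W" using G(3) spanned_by_words[OF H(2)] by blast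
  have WW': "x \<in> lin_span V UNIV ?W'" if "x \<in> lin_span V UNIV ?W" for x
    using that
  proof induction
    case (step a s y)
    then obtain l h where s: "s = V.word l h" "h \<in> H" by blast
    obtain i where i: "i > m" "h \<in> mcomp M i" using H(3)[OF s(2)] by blast
    show ?case
    proof (cases "length l \<le> N")
      case True
      then show ?thesis using lin_span.step[OF step(1) _ step(4), of s] s by blast
    next
      case False
      then have "s = \<zero>" unfolding s(1) using n[OF _ word_degree[OF i(2)], of l] i(1) by (auto simp: N_def)
      then show ?thesis
        using step(4) subsetD[OF V.lin_span_carrier[OF _ W] step(4)] V.smult_zero_right[of a] by simp
    qed
  qed (rule lin_span.zero)
  have fs: "finsum V g S = finsum M g S" if "\<And>s. s \<in> S \<Longrightarrow> g s \<in> carrier M" for g and S :: "'m set"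
    using that
  proof (induction S rule: infinite_finite_induct)
    case (insert s S)
    then have "g \<in> S \<rightarrow> carrier M" "g \<in> S \<rightarrow> carrier V" by auto
    then show ?case using insert V.M.finsum_insert[of S s g] by simp
  qed simp_all
  have "\<exists>f :: 'm \<Rightarrow> 'k. x = (\<Oplus>s\<in>?W'. hc (scalar (f s)) \<odot> s)" if "x \<in> carrier M" for x
  proof -
    have "x \<in> lin_span V UNIV ?W'" using WW' cM that by blast
    then obtain f where "x = (\<Oplus>\<^bsub>V\<^esub>s\<in>?W'. act (scalar (f s)) s)"
      unfolding V.lin_span_finite[OF finW W, of UNIV, simplified] by blast
    also have "\<dots> = (\<Oplus>s\<in>?W'. act (scalar (f s)) s)" by (rule fs) (use W act_closed in auto)
    finally show ?thesis by (intro exI[of _ f]) (simp add: act_def)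
  qed
  then show "M \<in> finite_dimensional_objs b c d"
    using finW W fg M.graded_left_module_axioms
    unfolding finite_dimensional_objs_def fg_graded_modules_def by (intro CollectI conjI exI[of _ ?W']) auto
qed

end

context homogeneous_G_algebra
begin

lemma homogeneous_moduleI: "graded_left_module A M \<Longrightarrow> homogeneous_module b c d M"
  by (intro homogeneous_module.intro homogeneous_G_algebra_axioms)

lemma gr_noetherian_A: "gr_noetherian TYPE('m) A"
  by (intro gr_noetherian.intro gr_noetherian_axioms.intro ring_A
      central_element.rcomp_carrier[OF central_element_Z]
      homogeneous_module.submodule_finitely_generated[OF homogeneous_moduleI])
    (auto dest: fg_graded_modulesD)

end

section \<open>Localization of a category with truncations\<close>

lemma (in cat) functor_zero_arrow:
  assumes "is_functor C D F" "\<And>z. zero_object C z \<Longrightarrow> zero_object D (fob F z)" "cat D"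
    and "zero_arrow C f" "f \<in> hom_set C x y"
  shows "zero_arrow D (far F f)"
proof -
  interpret D: cat D by fact
  obtain z p q where z: "zero_object C z" "p \<in> hom_set C x z" "q \<in> hom_set C z y" "f = cmp C q p"
    using assms(4,5) by (auto simp: zero_arrow_def hom_set_def)
  show ?thesis
    unfolding z(4) is_functor_cmp[OF assms(1) z(2,3)]
    by (rule D.zero_arrowI[OF assms(2)[OF z(1)] is_functor_hom[OF assms(1) z(2)] is_functor_hom[OF assms(1) z(3)]])
qed

text \<open>
  The functors \<open>T n\<close> stand for the truncations of graded modules to the degrees at least \<open>n\<close>.  The
  inclusion \<open>\<iota> n x\<close> of a truncation belongs to \<open>W\<close>, and every arrow of \<open>W\<close> becomes invertible after a
  deep truncation.  Therefore an arrow of the localization is a germ in large degrees of arrows of \<open>C\<close>.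
\<close>

locale truncated_category = cat_with_weq C W for C :: "('o, 'a) category" and W +
  fixes T :: "int \<Rightarrow> ('o, 'a, 'o, 'a) func" and \<iota> :: "int \<Rightarrow> 'o \<Rightarrow> 'a"
  assumes functor_T: "is_functor C C (T n)"
    and \<iota>_hom: "x \<in> objs C \<Longrightarrow> \<iota> n x \<in> hom_set C (fob (T n) x) x"
    and \<iota>_W: "x \<in> objs C \<Longrightarrow> \<iota> n x \<in> W"
    and \<iota>_natural: "f \<in> hom_set C x y \<Longrightarrow> cmp C f (\<iota> n x) = cmp C (\<iota> n y) (far (T n) f)"
    and \<iota>_idem: "x \<in> objs C \<Longrightarrow> is_iso C (\<iota> n (fob (T n) x))"
    and eventually_iso: "s \<in> W \<Longrightarrow> \<forall>\<^sub>F n in at_top. is_iso C (far (T n) s)"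
    and T_zero: "zero_object C z \<Longrightarrow> zero_object C (fob (T n) z)"
    and T_cokernels: "preserves_cokernels C C (T n)"
    and has_zero: "\<exists>z. zero_object C z"
begin

sublocale CW: cat CW by (rule cat_localization)

lemma T_hom: "f \<in> hom_set C x y \<Longrightarrow> far (T n) f \<in> hom_set C (fob (T n) x) (fob (T n) y)"
  by (rule is_functor_hom[OF functor_T])

lemma T_obj: "x \<in> objs C \<Longrightarrow> fob (T n) x \<in> objs C"
  by (rule is_functor_obj[OF functor_T])

lemma L_cmp: "f \<in> hom_set C x y \<Longrightarrow> g \<in> hom_set C y z \<Longrightarrow> cmp CW (far L g) (far L f) = far L (cmp C g f)"
  by (rule is_functor_cmp[OF is_functor_L, symmetric])

lemma L_\<iota>_inverse: "x \<in> objs C \<Longrightarrow> \<exists>j. inverse_arrows CW (fob (T n) x) x (far L (\<iota> n x)) j"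
  using L_inverse[OF \<iota>_W, of x n] hom_setD(2,3)[OF \<iota>_hom, of x n] by (simp only:) blast

lemma L_\<iota>_natural:
  assumes f: "f \<in> hom_set C x y"
  shows "cmp CW (far L f) (far L (\<iota> n x)) = cmp CW (far L (\<iota> n y)) (far L (far (T n) f))"
  using L_cmp[OF \<iota>_hom[OF hom_objs(1)[OF f]] f] L_cmp[OF T_hom[OF f] \<iota>_hom[OF hom_objs(2)[OF f]]]
    \<iota>_natural[OF f] by simp

lemma L_\<iota>_hom: "x \<in> objs C \<Longrightarrow> far L (\<iota> n x) \<in> hom_set CW (fob (T n) x) x"
  by (rule L_hom[OF \<iota>_hom])

text \<open>
  An arrow of the localization is an arrow of \<open>C\<close> after restriction to a deep enough truncation:
  a formal inverse of \<open>s\<close> is, on such a truncation, the inverse of the truncation of \<open>s\<close>.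
\<close>

lemma represent:
  assumes "u \<in> hom_set CW x y"
  shows "\<forall>\<^sub>F n in at_top. \<exists>f \<in> hom_set C (fob (T n) x) y. cmp CW u (far L (\<iota> n x)) = far L f"
  using assms
proof (induction rule: localization_induct
    [where P = "\<lambda>x y u. \<forall>\<^sub>F n in at_top. \<exists>f \<in> hom_set C (fob (T n) x) y. cmp CW u (far L (\<iota> n x)) = far L f", consumes 1])
  case (1 x)
  show ?case
    using \<iota>_hom[OF 1] CW.cmp_idm_left[OF L_\<iota>_hom[OF 1]] by (intro always_eventually allI) blast
next
  case (2 x y z f u)
  from 2(3) show ?case
  proof eventually_elim
    case (elim n)
    then obtain g where g: "g \<in> hom_set C (fob (T n) y) z" "cmp CW u (far L (\<iota> n y)) = far L g" by blast
    note o = hom_objs[OF 2(1)]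
    have "cmp CW (cmp CW u (far L f)) (far L (\<iota> n x)) = cmp CW u (cmp CW (far L (\<iota> n y)) (far L (far (T n) f)))"
      using CW.cmp_assoc[OF L_\<iota>_hom[OF o(1), of n] L_hom[OF 2(1)] 2(2)] L_\<iota>_natural[OF 2(1), of n] by simp
    also have "\<dots> = far L (cmp C g (far (T n) f))"
      using CW.cmp_assoc[OF L_hom[OF T_hom[OF 2(1), of n]] L_\<iota>_hom[OF o(2)] 2(2)] g(2) L_cmp[OF T_hom[OF 2(1)] g(1)] by simp
    finally show ?case using cmp_hom[OF T_hom[OF 2(1)] g(1)] by blast
  qed
next
  case (3 x y z s t u)
  from 3(5) eventually_iso[OF 3(1)] show ?case
  proof eventually_elim
    case (elim n)
    then obtain g where g: "g \<in> hom_set C (fob (T n) y) z" "cmp CW u (far L (\<iota> n y)) = far L g" by blast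
    note o = hom_objs[OF 3(3)]
    obtain r where r: "inverse_arrows C (fob (T n) y) (fob (T n) x) (far (T n) s) r"
      using elim(2) is_iso_hom[OF T_hom[OF 3(3)]] by blast
    note rD = inverse_arrowsD[OF r]
    note h = L_hom[OF rD(2)] L_hom[OF rD(1)] L_\<iota>_hom[OF o(2), of n] L_\<iota>_hom[OF o(1), of n] L_hom[OF 3(3)]
      inverse_arrowsD(2)[OF 3(2)]
    have "cmp CW (far L (far (T n) s)) (far L r) = far L (idm C (fob (T n) x))"
      using L_cmp[OF rD(2,1)] rD(4) by simp
    also have "\<dots> = idm CW (fob (T n) x)" using is_functor_idm[OF is_functor_L T_obj[OF o(2)]] by simp
    finally have "far L (\<iota> n x) = cmp CW (far L (\<iota> n x)) (cmp CW (far L (far (T n) s)) (far L r))"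
      using CW.cmp_idm_right[OF h(3)] by simp
    also have "\<dots> = cmp CW (cmp CW (far L s) (far L (\<iota> n y))) (far L r)"
      using CW.cmp_assoc[OF h(1,2,3)] L_\<iota>_natural[OF 3(3), of n] by simp
    also have "\<dots> = cmp CW (far L s) (cmp CW (far L (\<iota> n y)) (far L r))"
      by (rule CW.cmp_assoc[OF h(1,4,5)])
    finally have "cmp CW t (far L (\<iota> n x)) = cmp CW (far L (\<iota> n y)) (far L r)"
      using CW.inverse_arrows_cancel(1)[OF 3(2), of "cmp CW (far L (\<iota> n y)) (far L r)"]
        hom_setD[OF CW.cmp_hom[OF h(1,4)]] by simp
    then have "cmp CW (cmp CW u t) (far L (\<iota> n x)) = cmp CW u (cmp CW (far L (\<iota> n y)) (far L r))"
      using CW.cmp_assoc[OF h(3,6) 3(4)] by simp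
    also have "\<dots> = far L (cmp C g r)"
      using CW.cmp_assoc[OF h(1,4) 3(4)] g(2) L_cmp[OF rD(2) g(1)] by simp
    finally show ?case using cmp_hom[OF rD(2) g(1)] by blast
  qed
qed

lemma represent2:
  assumes "u \<in> hom_set CW x y" "v \<in> hom_set CW x z"
  obtains n f g where "f \<in> hom_set C (fob (T n) x) y" "cmp CW u (far L (\<iota> n x)) = far L f"
    "g \<in> hom_set C (fob (T n) x) z" "cmp CW v (far L (\<iota> n x)) = far L g"
proof -
  have "\<forall>\<^sub>F n in at_top. (\<exists>f \<in> hom_set C (fob (T n) x) y. cmp CW u (far L (\<iota> n x)) = far L f) \<and>
      (\<exists>f \<in> hom_set C (fob (T n) x) z. cmp CW v (far L (\<iota> n x)) = far L f)"
    by (rule eventually_conj[OF represent[OF assms(1)] represent[OF assms(2)]])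
  from eventually_happens'[OF trivial_limit_at_top_linorder this] that show thesis by blast
qed

text \<open>
  A chain of elementary steps between two zigzags involves finitely many arrows of \<open>W\<close>.  Therefore
  it is already a chain over the arrows inverted by some truncation functor.
\<close>

lemma eventually_equal:
  assumes f: "f \<in> hom_set C x y" and g: "g \<in> hom_set C x y" and fg: "far L f = far L g"
  shows "\<forall>\<^sub>F n in at_top. far (T n) f = far (T n) g"
proof -
  \<comment> \<open>The arrows of \<open>W\<close> that the truncation functor \<open>T n\<close> already inverts.\<close>
  let ?V = "\<lambda>n. {s \<in> W. is_iso C (far (T n) s)}"
  have zz: "\<forall>\<^sub>F n in at_top. zigzag C (?V n) x p y" if "zigzag C W x p y" for x p y
    using that
  proof (induction p arbitrary: x)
    case (Cons s p)
    show ?case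
    proof (cases s)
      case (Fwd h)
      then show ?thesis using Cons by simp
    next
      case (Bwd t)
      then have t: "t \<in> W" "tgt C t = x" and p: "zigzag C W (src C t) p y" using Cons.prems by simp_all
      show ?thesis
        using eventually_conj[OF eventually_iso[OF t(1)] Cons.IH[OF p]] t by (rule_tac eventually_mono) (auto simp: Bwd)
    qed
  qed simp
  have zs: "\<forall>\<^sub>F n in at_top. zstep C (?V n) r s" if "zstep C W r s" for r s
    using that
  proof cases
    case (3 t p q)
    show ?thesis using eventually_iso[OF 3(3)] by (rule eventually_mono) (use 3 zstep.intros(3)[of t _ C p q] in auto)
  next
    case (4 t p q)
    show ?thesis using eventually_iso[OF 4(3)] by (rule eventually_mono) (use 4 zstep.intros(4)[of t _ C p q] in auto)
  qed (use zstep.intros(1,2)[of C] in \<open>auto intro!: always_eventually\<close>)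
  have ze: "\<forall>\<^sub>F n in at_top. zigzag_equiv C (?V n) x y p q" if "zigzag_equiv C W x y p q" for p q
    using that unfolding zigzag_equiv_def
  proof (induction rule: equivclp_induct)
    case (step r s)
    have *: "\<forall>\<^sub>F n in at_top. zigzag C (?V n) x r y \<and> zigzag C (?V n) x s y \<and> zstep C (?V n) r s"
      if "zigzag C W x r y \<and> zigzag C W x s y \<and> zstep C W r s" for r s
      using that zz zs by (intro eventually_conj) auto
    have "\<forall>\<^sub>F n in at_top. equivclp (\<lambda>r s. zigzag C (?V n) x r y \<and> zigzag C (?V n) x s y \<and> zstep C (?V n) r s) r s"
      using step(2)
    proof
      assume "zigzag C W x r y \<and> zigzag C W x s y \<and> zstep C W r s"
      from *[OF this] show ?thesis by (rule eventually_mono) (rule r_into_equivclp)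
    next
      assume "zigzag C W x s y \<and> zigzag C W x r y \<and> zstep C W s r"
      from *[OF this] show ?thesis by (rule eventually_mono) (rule equivclp_sym[OF r_into_equivclp])
    qed
    with step(3) show ?case by eventually_elim (rule equivclp_trans)
  qed simp
  have "zigzag_equiv C W x y [Fwd f] [Fwd g]"
    using fg hom_setD[OF f] hom_setD[OF g] by (simp add: far_localization_functor zigzag_arrow_eq)
  from ze[OF this] show ?thesis
  proof eventually_elim
    case (elim n)
    interpret V: cat_with_weq C "?V n" by unfold_locales (use W_arrs in auto)
    obtain G where G: "is_functor V.CW C G" "\<forall>f \<in> arrs C. far G (far (localization_functor C (?V n)) f) = far (T n) f"
      using V.localization_universal[OF cat_axioms functor_T[of n]] by auto
    have "far (localization_functor C (?V n)) f = far (localization_functor C (?V n)) g"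
      using elim hom_setD[OF f] hom_setD[OF g] by (simp add: far_localization_functor zigzag_arrow_eq)
    then show ?case using bspec[OF G(2) hom_setD(1)[OF f]] bspec[OF G(2) hom_setD(1)[OF g]] by simp
  qed
qed

lemma equalized:
  assumes f: "f \<in> hom_set C x y" and g: "g \<in> hom_set C x y" and fg: "far L f = far L g"
  obtains m where "cmp C f (\<iota> m x) = cmp C g (\<iota> m x)"
proof -
  obtain m where "far (T m) f = far (T m) g"
    using eventually_happens'[OF trivial_limit_at_top_linorder eventually_equal[OF assms]] by blast
  then show thesis using that \<iota>_natural[OF f] \<iota>_natural[OF g] by metis
qed

text \<open>
  An arrow of the localization between \<open>z\<close> and another object is represented by an arrow of \<open>C\<close> with
  a zero object at one end.
\<close>

lemma zero_object_L:
  assumes z: "zero_object C z"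
  shows "zero_object CW z"
proof -
  have zo: "z \<in> objs C" using z by (simp add: zero_object_def)
  have "\<exists>!h. h \<in> hom_set CW x z" "\<exists>!h. h \<in> hom_set CW z x" if x: "x \<in> objs C" for x
  proof -
    obtain p q where p: "p \<in> hom_set C x z" and q: "q \<in> hom_set C z x" by (rule zero_object_homs[OF z x])
    have "u = v" if u: "u \<in> hom_set CW x z" and v: "v \<in> hom_set CW x z" for u v
    proof -
      obtain n f g where n: "f \<in> hom_set C (fob (T n) x) z" "cmp CW u (far L (\<iota> n x)) = far L f"
        "g \<in> hom_set C (fob (T n) x) z" "cmp CW v (far L (\<iota> n x)) = far L g" by (rule represent2[OF u v])
      obtain j where j: "inverse_arrows CW (fob (T n) x) x (far L (\<iota> n x)) j" using L_\<iota>_inverse[OF x] by blast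
      show ?thesis using CW.cancel_iso_right[OF j u v] n zero_object_hom_unique(1)[OF z n(1,3)] by simp
    qed
    then show "\<exists>!h. h \<in> hom_set CW x z" using L_hom[OF p] by blast
    have "u = v" if u: "u \<in> hom_set CW z x" and v: "v \<in> hom_set CW z x" for u v
    proof -
      obtain n f g where n: "f \<in> hom_set C (fob (T n) z) x" "cmp CW u (far L (\<iota> n z)) = far L f"
        "g \<in> hom_set C (fob (T n) z) x" "cmp CW v (far L (\<iota> n z)) = far L g" by (rule represent2[OF u v])
      obtain j where j: "inverse_arrows CW (fob (T n) z) z (far L (\<iota> n z)) j" using L_\<iota>_inverse[OF zo] by blast
      show ?thesis using CW.cancel_iso_right[OF j u v] n zero_object_hom_unique(2)[OF T_zero[OF z] n(1,3)] by simp
    qed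
    then show "\<exists>!h. h \<in> hom_set CW z x" using L_hom[OF q] by blast
  qed
  then show ?thesis using zo by (simp add: zero_object_def)
qed

lemma zero_arrow_L: "zero_arrow C f \<Longrightarrow> f \<in> hom_set C x y \<Longrightarrow> zero_arrow CW (far L f)"
  by (rule functor_zero_arrow[OF is_functor_L _ cat_localization]) (simp_all add: zero_object_L)

lemma zero_arrow_T: "zero_arrow C f \<Longrightarrow> f \<in> hom_set C x y \<Longrightarrow> zero_arrow C (far (T n) f)"
  by (rule functor_zero_arrow[OF functor_T T_zero cat_axioms])

lemma eventually_zero:
  assumes f: "f \<in> hom_set C x y" and z: "zero_arrow CW (far L f)"
  shows "\<forall>\<^sub>F n in at_top. zero_arrow C (far (T n) f)"
proof -
  obtain w where "zero_object C w" using has_zero by blast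
  from zero_arrow_exists[OF this hom_objs[OF f]]
  obtain o' where o: "o' \<in> hom_set C x y" "zero_arrow C o'" by blast
  have "far L f = far L o'" by (rule CW.zero_arrow_unique[OF z zero_arrow_L[OF o(2,1)] L_hom[OF f] L_hom[OF o(1)]])
  from eventually_equal[OF f o(1) this] show ?thesis
    by (rule eventually_mono) (use zero_arrow_T[OF o(2,1)] in simp)
qed

lemma equalized_zero:
  assumes f: "f \<in> hom_set C x y" and z: "zero_arrow CW (far L f)"
  obtains m where "zero_arrow C (cmp C f (\<iota> m x))" "zero_arrow C (far (T m) f)"
proof -
  obtain m where "zero_arrow C (far (T m) f)"
    using eventually_happens'[OF trivial_limit_at_top_linorder eventually_zero[OF assms]] by blast
  then show thesis using that \<iota>_natural[OF f] zero_arrow_cmp_left[OF _ T_hom[OF f] \<iota>_hom[OF hom_objs(2)[OF f]]] by simp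
qed

text \<open>
  After one truncation an arrow of the localization comes from \<open>C\<close>.  An equation between two such
  arrows holds in \<open>C\<close> only after a second truncation.
\<close>

abbreviation "TTo m n x \<equiv> fob (T m) (fob (T n) x)"
abbreviation "TTa m n f \<equiv> far (T m) (far (T n) f)"
abbreviation "\<sigma> m n x \<equiv> cmp C (\<iota> n x) (\<iota> m (fob (T n) x))"

lemma \<sigma>_hom: "x \<in> objs C \<Longrightarrow> \<sigma> m n x \<in> hom_set C (TTo m n x) x"
  by (rule cmp_hom[OF \<iota>_hom[OF T_obj] \<iota>_hom])

lemma L_\<sigma>: "x \<in> objs C \<Longrightarrow> far L (\<sigma> m n x) = cmp CW (far L (\<iota> n x)) (far L (\<iota> m (fob (T n) x)))"
  by (rule L_cmp[OF \<iota>_hom[OF T_obj] \<iota>_hom, symmetric])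

lemma L_\<sigma>_inverse: "x \<in> objs C \<Longrightarrow> \<exists>j. inverse_arrows CW (TTo m n x) x (far L (\<sigma> m n x)) j"
  using L_\<iota>_inverse[of x n] L_\<iota>_inverse[OF T_obj, of x m n] CW.inverse_arrows_cmp L_\<sigma> by metis

lemma \<sigma>_natural:
  assumes f: "f \<in> hom_set C x y"
  shows "cmp C f (\<sigma> m n x) = cmp C (\<sigma> m n y) (TTa m n f)"
proof -
  note o = hom_objs[OF f]
  have "cmp C f (\<sigma> m n x) = cmp C (cmp C (\<iota> n y) (far (T n) f)) (\<iota> m (fob (T n) x))"
    using cmp_assoc[OF \<iota>_hom[OF T_obj[OF o(1)]] \<iota>_hom[OF o(1)] f] \<iota>_natural[OF f] by simp
  also have "\<dots> = cmp C (\<iota> n y) (cmp C (\<iota> m (fob (T n) y)) (TTa m n f))"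
    using cmp_assoc[OF \<iota>_hom[OF T_obj[OF o(1)]] T_hom[OF f] \<iota>_hom[OF o(2)]] \<iota>_natural[OF T_hom[OF f]] by simp
  also have "\<dots> = cmp C (\<sigma> m n y) (TTa m n f)"
    by (rule cmp_assoc[OF T_hom[OF T_hom[OF f]] \<iota>_hom[OF T_obj[OF o(2)]] \<iota>_hom[OF o(2)], symmetric])
  finally show ?thesis .
qed

lemma L_\<sigma>_natural:
  assumes f: "f \<in> hom_set C x y"
  shows "cmp CW (far L f) (far L (\<sigma> m n x)) = cmp CW (far L (\<sigma> m n y)) (far L (TTa m n f))"
  using L_cmp[OF \<sigma>_hom[OF hom_objs(1)[OF f]] f] L_cmp[OF T_hom[OF T_hom[OF f]] \<sigma>_hom[OF hom_objs(2)[OF f]]]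
    \<sigma>_natural[OF f] by simp

lemma cmp_\<sigma>:
  assumes u: "u \<in> hom_set CW x y" and x: "x \<in> objs C"
    and f: "f \<in> hom_set C (fob (T n) x) y" "cmp CW u (far L (\<iota> n x)) = far L f"
  shows "cmp CW u (far L (\<sigma> m n x)) = far L (cmp C f (\<iota> m (fob (T n) x)))"
  using CW.cmp_assoc[OF L_\<iota>_hom[OF T_obj[OF x], of m n] L_\<iota>_hom[OF x] u] L_\<sigma>[OF x, of n m] f(2)
    L_cmp[OF \<iota>_hom[OF T_obj[OF x], of m n] f(1)] by simp

lemma equal_if_equal_\<sigma>:
  assumes "x \<in> objs C" "u \<in> hom_set CW x y" "v \<in> hom_set CW x y"
    "cmp CW u (far L (\<sigma> m n x)) = cmp CW v (far L (\<sigma> m n x))"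
  shows "u = v"
  using L_\<sigma>_inverse[OF assms(1)] CW.cancel_iso_right[OF _ assms(2-4)] by blast

text \<open>
  An arrow that \<open>f\<close> kills in the localization is, after two truncations, an arrow of \<open>C\<close> that \<open>f\<close> kills
  and that factors through the kernel.
\<close>

lemma kernels_L: "preserves_kernels C CW L"
  unfolding preserves_kernels_def
proof (intro allI impI)
  fix f k assume k: "is_kernel C f k"
  obtain x y w where xyw: "x = src C f" "y = tgt C f" "w = src C k" by blast
  note kD = is_kernelD[OF k, folded xyw]
  show "is_kernel CW (far L f) (far L k)"
  proof (rule CW.is_kernelI)
    show "far L f \<in> hom_set CW x y" "far L k \<in> hom_set CW w x" using L_hom kD by blast+
    show "zero_arrow CW (cmp CW (far L f) (far L k))"
      using zero_arrow_L[OF kD(3) cmp_hom[OF kD(2,1)]] L_cmp[OF kD(2,1)] by simp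
  next
    fix v u assume u: "u \<in> hom_set CW v x" and z: "zero_arrow CW (cmp CW (far L f) u)"
    have v: "v \<in> objs C" using CW.hom_objs(1)[OF u] by simp
    obtain n g where g: "g \<in> hom_set C (fob (T n) v) x" "cmp CW u (far L (\<iota> n v)) = far L g"
      by (rule represent2[OF u u])
    have fu: "cmp CW (far L f) u \<in> hom_set CW v y" by (rule CW.cmp_hom[OF u L_hom[OF kD(1)]])
    have "far L (cmp C f g) = cmp CW (cmp CW (far L f) u) (far L (\<iota> n v))"
      using CW.cmp_assoc[OF L_\<iota>_hom[OF v] u L_hom[OF kD(1)]] g(2) L_cmp[OF g(1) kD(1)] by simp
    then have "zero_arrow CW (far L (cmp C f g))" using CW.zero_arrow_cmp_right[OF z fu L_\<iota>_hom[OF v]] by simp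
    from equalized_zero[OF cmp_hom[OF g(1) kD(1)] this]
    obtain m where m: "zero_arrow C (cmp C (cmp C f g) (\<iota> m (fob (T n) v)))" by blast
    note i = \<iota>_hom[OF T_obj[OF v, of n], of m]
    note gi = cmp_hom[OF i g(1)]
    have "zero_arrow C (cmp C f (cmp C g (\<iota> m (fob (T n) v))))" using m cmp_assoc[OF i g(1) kD(1)] by simp
    from kD(4)[OF gi this]
    obtain h where h: "h \<in> hom_set C (TTo m n v) w" "cmp C k h = cmp C g (\<iota> m (fob (T n) v))" by blast
    obtain j where j: "inverse_arrows CW (TTo m n v) v (far L (\<sigma> m n v)) j" using L_\<sigma>_inverse[OF v] by blast
    note jD = inverse_arrowsD[OF j]
    have "cmp CW (far L k) (far L h) = cmp CW u (far L (\<sigma> m n v))"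
      using L_cmp[OF h(1) kD(2)] h(2) cmp_\<sigma>[OF u v g] by simp
    then have "cmp CW (far L k) (cmp CW (far L h) j) = cmp CW (cmp CW u (far L (\<sigma> m n v))) j"
      using CW.cmp_assoc[OF jD(2) L_hom[OF h(1)] L_hom[OF kD(2)]] by simp
    also have "\<dots> = u" using CW.inverse_arrows_cancel(4)[OF j] hom_setD[OF u] by blast
    finally show "\<exists>h. h \<in> hom_set CW v w \<and> cmp CW (far L k) h = u"
      using CW.cmp_hom[OF jD(2) L_hom[OF h(1)]] by blast
  next
    fix v u u' assume u: "u \<in> hom_set CW v w" "u' \<in> hom_set CW v w" and eq: "cmp CW (far L k) u = cmp CW (far L k) u'"
    have v: "v \<in> objs C" using CW.hom_objs(1)[OF u(1)] by simp
    obtain n g g' where g: "g \<in> hom_set C (fob (T n) v) w" "cmp CW u (far L (\<iota> n v)) = far L g"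
      and g': "g' \<in> hom_set C (fob (T n) v) w" "cmp CW u' (far L (\<iota> n v)) = far L g'"
      by (rule represent2[OF u])
    have "far L (cmp C k g) = far L (cmp C k g')"
      using CW.cmp_assoc[OF L_\<iota>_hom[OF v] u(1) L_hom[OF kD(2)]] CW.cmp_assoc[OF L_\<iota>_hom[OF v] u(2) L_hom[OF kD(2)]]
        eq g(2) g'(2) L_cmp[OF g(1) kD(2)] L_cmp[OF g'(1) kD(2)] by metis
    from equalized[OF cmp_hom[OF g(1) kD(2)] cmp_hom[OF g'(1) kD(2)] this]
    obtain m where m: "cmp C (cmp C k g) (\<iota> m (fob (T n) v)) = cmp C (cmp C k g') (\<iota> m (fob (T n) v))" by blast
    note i = \<iota>_hom[OF T_obj[OF v, of n], of m]
    have "cmp C g (\<iota> m (fob (T n) v)) = cmp C g' (\<iota> m (fob (T n) v))"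
      using kernel_mono[OF k, folded xyw, OF cmp_hom[OF i g(1)] cmp_hom[OF i g'(1)]] m
        cmp_assoc[OF i g(1) kD(2)] cmp_assoc[OF i g'(1) kD(2)] by simp
    then show "u = u'"
      by (intro equal_if_equal_\<sigma>[OF v u, where m = m and n = n]) (simp add: cmp_\<sigma>[OF u(1) v g] cmp_\<sigma>[OF u(2) v g'])
  qed
qed

text \<open>
  This is not dual to the case of kernels, as only the domain of an arrow is truncated to represent it.
  An arrow that vanishes on the image of \<open>f\<close> is represented by one that vanishes on the image of a
  truncation of \<open>f\<close>, and this factors through the truncation of \<open>q\<close> because truncation preserves cokernels.
\<close>

lemma cokernels_L: "preserves_cokernels C CW L"
  unfolding preserves_cokernels_def
proof (intro allI impI)
  fix f q assume q: "is_cokernel C f q"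
  obtain x y w where xyw: "x = src C f" "y = tgt C f" "w = tgt C q" by blast
  note qD = is_cokernelD[OF q, folded xyw]
  note o = hom_objs[OF qD(1)] hom_objs[OF qD(2)]
  interpret op: cat "opposite CW" by (rule cat_opposite) (rule cat_localization)
  have TTq: "is_cokernel C (TTa m n f) (TTa m n q)" for m n
    using T_cokernels q unfolding preserves_cokernels_def by blast
  note Th = T_hom[OF T_hom]
  have "is_kernel (opposite CW) (far L f) (far L q)"
  proof (rule op.is_kernelI)
    show "far L f \<in> hom_set (opposite CW) y x" "far L q \<in> hom_set (opposite CW) w y"
      using L_hom qD by simp_all
    show "zero_arrow (opposite CW) (cmp (opposite CW) (far L f) (far L q))"
      using zero_arrow_L[OF qD(3) cmp_hom[OF qD(1,2)]] L_cmp[OF qD(1,2)] by simp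
  next
    fix v u assume "u \<in> hom_set (opposite CW) v y" and "zero_arrow (opposite CW) (cmp (opposite CW) (far L f) u)"
    then have u: "u \<in> hom_set CW y v" and z: "zero_arrow CW (cmp CW u (far L f))" by simp_all
    obtain n g where g: "g \<in> hom_set C (fob (T n) y) v" "cmp CW u (far L (\<iota> n y)) = far L g"
      by (rule represent2[OF u u])
    note uf = CW.cmp_hom[OF L_hom[OF qD(1)] u]
    note gf = cmp_hom[OF T_hom[OF qD(1)] g(1)]
    have "far L (cmp C g (far (T n) f)) = cmp CW (cmp CW u (far L f)) (far L (\<iota> n x))"
      using CW.cmp_assoc[OF L_\<iota>_hom[OF o(1), of n] L_hom[OF qD(1)] u] g(2) L_cmp[OF T_hom[OF qD(1)] g(1)]
        L_\<iota>_natural[OF qD(1), of n] CW.cmp_assoc[OF L_hom[OF T_hom[OF qD(1), of n]] L_\<iota>_hom[OF o(2)] u] by simp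
    then have "zero_arrow CW (far L (cmp C g (far (T n) f)))"
      using CW.zero_arrow_cmp_right[OF z uf L_\<iota>_hom[OF o(1)]] by simp
    from equalized_zero[OF gf this]
    obtain m where m: "zero_arrow C (cmp C (cmp C g (far (T n) f)) (\<iota> m (fob (T n) x)))" by blast
    note i = \<iota>_hom[OF T_obj[OF o(1), of n], of m] and i' = \<iota>_hom[OF T_obj[OF o(2), of n], of m]
    note gi = cmp_hom[OF i' g(1)]
    have "zero_arrow C (cmp C (cmp C g (\<iota> m (fob (T n) y))) (TTa m n f))"
      using m cmp_assoc[OF i T_hom[OF qD(1)] g(1)] \<iota>_natural[OF T_hom[OF qD(1)], of n m]
        cmp_assoc[OF Th[OF qD(1)] i' g(1)] by simp
    with gi obtain h where h: "h \<in> hom_set C (TTo m n w) v" "cmp C h (TTa m n q) = cmp C g (\<iota> m (fob (T n) y))"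
      using is_cokernelD(4)[OF TTq, of "cmp C g (\<iota> m (fob (T n) y))" m n v]
        hom_setD(3)[OF Th[OF qD(1)]] hom_setD(3)[OF Th[OF qD(2)]] by auto
    obtain j where j: "inverse_arrows CW (TTo m n w) w (far L (\<sigma> m n w)) j" using L_\<sigma>_inverse[OF o(4)] by blast
    note jD = inverse_arrowsD[OF j]
    let ?h = "cmp CW (far L h) j"
    have hh: "?h \<in> hom_set CW w v" by (rule CW.cmp_hom[OF jD(2) L_hom[OF h(1)]])
    have hj: "cmp CW ?h (far L (\<sigma> m n w)) = far L h"
      using CW.inverse_arrows_cancel(3)[OF j] hom_setD[OF L_hom[OF h(1)]] by blast
    have "cmp CW (cmp CW ?h (far L q)) (far L (\<sigma> m n y)) = cmp CW (cmp CW ?h (far L (\<sigma> m n w))) (far L (TTa m n q))"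
      using CW.cmp_assoc[OF L_hom[OF \<sigma>_hom[OF o(2), of n m]] L_hom[OF qD(2)] hh] L_\<sigma>_natural[OF qD(2), of n m]
        CW.cmp_assoc[OF L_hom[OF Th[OF qD(2), of m n]] L_hom[OF \<sigma>_hom[OF o(4)]] hh] by simp
    also have "\<dots> = cmp CW u (far L (\<sigma> m n y))"
      unfolding hj using L_cmp[OF Th[OF qD(2)] h(1)] h(2) cmp_\<sigma>[OF u o(2) g] by simp
    finally have "cmp CW ?h (far L q) = u"
      by (rule equal_if_equal_\<sigma>[OF o(2) CW.cmp_hom[OF L_hom[OF qD(2)] hh] u])
    then show "\<exists>h. h \<in> hom_set (opposite CW) v w \<and> cmp (opposite CW) (far L q) h = u"
      using hh by (intro exI[of _ ?h]) simp
  next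
    fix v u u' assume "u \<in> hom_set (opposite CW) v w" "u' \<in> hom_set (opposite CW) v w"
      "cmp (opposite CW) (far L q) u = cmp (opposite CW) (far L q) u'"
    then have u: "u \<in> hom_set CW w v" "u' \<in> hom_set CW w v" and eq: "cmp CW u (far L q) = cmp CW u' (far L q)"
      by simp_all
    obtain n g g' where g: "g \<in> hom_set C (fob (T n) w) v" "cmp CW u (far L (\<iota> n w)) = far L g"
      and g': "g' \<in> hom_set C (fob (T n) w) v" "cmp CW u' (far L (\<iota> n w)) = far L g'"
      by (rule represent2[OF u])
    have *: "far L (cmp C g (far (T n) q)) = cmp CW (cmp CW u (far L q)) (far L (\<iota> n y))"
      if "u \<in> hom_set CW w v" "g \<in> hom_set C (fob (T n) w) v" "cmp CW u (far L (\<iota> n w)) = far L g" for u g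
      using CW.cmp_assoc[OF L_\<iota>_hom[OF o(2), of n] L_hom[OF qD(2)] that(1)] that(3) L_cmp[OF T_hom[OF qD(2)] that(2)]
        L_\<iota>_natural[OF qD(2), of n] CW.cmp_assoc[OF L_hom[OF T_hom[OF qD(2), of n]] L_\<iota>_hom[OF o(4)] that(1)] by simp
    have "far L (cmp C g (far (T n) q)) = far L (cmp C g' (far (T n) q))"
      unfolding *[OF u(1) g] *[OF u(2) g'] eq ..
    from equalized[OF cmp_hom[OF T_hom[OF qD(2)] g(1)] cmp_hom[OF T_hom[OF qD(2)] g'(1)] this]
    obtain m where m: "cmp C (cmp C g (far (T n) q)) (\<iota> m (fob (T n) y)) = cmp C (cmp C g' (far (T n) q)) (\<iota> m (fob (T n) y))"
      by blast
    note i = \<iota>_hom[OF T_obj[OF o(2), of n], of m] and i' = \<iota>_hom[OF T_obj[OF o(4), of n], of m]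
    have **: "cmp C (cmp C g (\<iota> m (fob (T n) w))) (TTa m n q) = cmp C (cmp C g (far (T n) q)) (\<iota> m (fob (T n) y))"
      if "g \<in> hom_set C (fob (T n) w) v" for g
      using cmp_assoc[OF i T_hom[OF qD(2)] that] \<iota>_natural[OF T_hom[OF qD(2)], of n m]
        cmp_assoc[OF Th[OF qD(2)] i' that] by simp
    have "cmp C g (\<iota> m (fob (T n) w)) = cmp C g' (\<iota> m (fob (T n) w))"
    proof (rule cokernel_epi[OF TTq[of m n]])
      show "cmp C g (\<iota> m (fob (T n) w)) \<in> hom_set C (tgt C (TTa m n q)) v"
        "cmp C g' (\<iota> m (fob (T n) w)) \<in> hom_set C (tgt C (TTa m n q)) v"
        using cmp_hom[OF i' g(1)] cmp_hom[OF i' g'(1)] hom_setD(3)[OF Th[OF qD(2)]] by simp_all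
    qed (simp add: **[OF g(1)] **[OF g'(1)] m)
    then show "u = u'"
      by (intro equal_if_equal_\<sigma>[OF o(4) u, where m = m and n = n]) (simp add: cmp_\<sigma>[OF u(1) o(4) g] cmp_\<sigma>[OF u(2) o(4) g'])
  qed
  then show "is_cokernel CW (far L f) (far L q)" by simp
qed

text \<open>
  By this lemma, exactness of functors and the existence of kernels and cokernels pass from \<open>C\<close> to
  the localization.
\<close>

lemma dense:
  assumes g: "g \<in> arrs CW"
  shows "\<exists>f \<in> arrs C. \<exists>a a' c c'. inverse_arrows CW (fob L (src C f)) (src CW g) a a' \<and>
      inverse_arrows CW (tgt CW g) (fob L (tgt C f)) c c' \<and> far L f = cmp CW c (cmp CW g a)"
proof -
  note gh = arr_hom_set[OF g]
  have o: "src CW g \<in> objs C" "tgt CW g \<in> objs C" using CW.hom_objs[OF gh] by simp_all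
  obtain n f where f: "f \<in> hom_set C (fob (T n) (src CW g)) (tgt CW g)" "cmp CW g (far L (\<iota> n (src CW g))) = far L f"
    by (rule represent2[OF gh gh])
  obtain j where j: "inverse_arrows CW (fob (T n) (src CW g)) (src CW g) (far L (\<iota> n (src CW g))) j"
    using L_\<iota>_inverse[OF o(1)] by blast
  note fD = hom_setD[OF f(1)]
  have "far L f = cmp CW (idm CW (tgt CW g)) (cmp CW g (far L (\<iota> n (src CW g))))"
    using CW.cmp_idm_left[OF L_hom[OF f(1)]] f(2) by simp
  moreover have "inverse_arrows CW (tgt CW g) (fob L (tgt C f)) (idm CW (tgt CW g)) (idm CW (tgt CW g))"
    using CW.inverse_arrows_idm[of "tgt CW g"] o(2) fD(3) by simp
  moreover have "inverse_arrows CW (fob L (src C f)) (src CW g) (far L (\<iota> n (src CW g))) j"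
    using j fD(2) by simp
  ultimately show ?thesis using fD(1) by blast
qed

text \<open>
  A bounded complex in the localization is isomorphic to the image of one in \<open>C\<close>: after a deep
  truncation its differentials come from \<open>C\<close>, and after a deeper one their composites vanish.
  Outside the range where the complex lives, a zero object of \<open>C\<close> takes the place of its terms.
\<close>

lemma bounded_complex_lifts:
  assumes K: "bounded_complex CW K"
  obtains M a b where "bounded_complex C M"
    "\<And>i. inverse_arrows CW (cob M i) (cob K i) (a i) (b i)"
    "\<And>i. cmp CW (a (i + 1)) (far L (cdiff M i)) = cmp CW (cdiff K i) (a i)"
proof -
  note KD = bounded_complexD[OF K]
  have ko: "cob K i \<in> objs C" for i using KD(1)[of i] by simp
  obtain B where B: "\<And>i. \<bar>i\<bar> > B \<Longrightarrow> zero_object CW (cob K i)"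
    using K by (auto simp: bounded_complex_def)
  obtain z where z: "zero_object C z" using has_zero by blast
  let ?R = "{-B..B}"
  have "\<forall>\<^sub>F n in at_top. \<forall>i\<in>?R. \<exists>f \<in> hom_set C (fob (T n) (cob K i)) (cob K (i + 1)).
      cmp CW (cdiff K i) (far L (\<iota> n (cob K i))) = far L f"
    by (rule eventually_ball_finite) (use represent[OF KD(2)] in auto)
  from eventually_happens'[OF trivial_limit_at_top_linorder this]
  obtain n f where f: "\<And>i. i \<in> ?R \<Longrightarrow> f i \<in> hom_set C (fob (T n) (cob K i)) (cob K (i + 1))"
    "\<And>i. i \<in> ?R \<Longrightarrow> cmp CW (cdiff K i) (far L (\<iota> n (cob K i))) = far L (f i)"
    by metis
  let ?T = "\<lambda>i. fob (T n) (cob K i)"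
  have "\<exists>d. d \<in> hom_set C (?T i) (?T (i + 1)) \<and> cmp C (\<iota> n (cob K (i + 1))) d = f i" if i: "i \<in> ?R" for i
  proof -
    obtain r where r: "inverse_arrows C (fob (T n) (?T i)) (?T i) (\<iota> n (?T i)) r"
      using \<iota>_idem[OF ko[of i], of n] is_iso_hom[OF \<iota>_hom[OF T_obj[OF ko[of i]]]] by blast
    note rD = inverse_arrowsD[OF r]
    have "cmp C (\<iota> n (cob K (i + 1))) (cmp C (far (T n) (f i)) r) = cmp C (cmp C (f i) (\<iota> n (?T i))) r"
      using cmp_assoc[OF rD(2) T_hom[OF f(1)[OF i]] \<iota>_hom[OF ko]] \<iota>_natural[OF f(1)[OF i]] by simp
    also have "\<dots> = f i" using inverse_arrows_cancel(4)[OF r] hom_setD[OF f(1)[OF i]] by blast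
    finally show ?thesis using cmp_hom[OF rD(2) T_hom[OF f(1)[OF i]]] by blast
  qed
  then obtain d where d: "\<And>i. i \<in> ?R \<Longrightarrow> d i \<in> hom_set C (?T i) (?T (i + 1))"
    "\<And>i. i \<in> ?R \<Longrightarrow> cmp C (\<iota> n (cob K (i + 1))) (d i) = f i" by metis
  have Ld: "cmp CW (far L (\<iota> n (cob K (i + 1)))) (far L (d i)) = cmp CW (cdiff K i) (far L (\<iota> n (cob K i)))"
    if i: "i \<in> ?R" for i
    using L_cmp[OF d(1)[OF i] \<iota>_hom[OF ko]] d(2)[OF i] f(2)[OF i] by simp
  \<comment> \<open>The composites vanish in the localization, so they vanish in \<open>C\<close> after a truncation.\<close>
  have dd: "\<forall>\<^sub>F m in at_top. zero_arrow C (far (T m) (cmp C (d (i + 1)) (d i)))" if i: "i \<in> {-B..B - 1}" for i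
  proof -
    have i': "i \<in> ?R" "i + 1 \<in> ?R" using i by auto
    note h = cmp_hom[OF d(1)[OF i'(1)] d(1)[OF i'(2)]]
    note h3 = L_hom[OF d(1)[OF i'(1)]] L_hom[OF d(1)[OF i'(2)]] L_\<iota>_hom[OF ko, of n]
    have "cmp CW (far L (\<iota> n (cob K (i + 1 + 1)))) (far L (cmp C (d (i + 1)) (d i))) =
        cmp CW (cmp CW (cdiff K (i + 1)) (far L (\<iota> n (cob K (i + 1))))) (far L (d i))"
      using CW.cmp_assoc[OF h3(1,2) h3(3)] L_cmp[OF d(1)[OF i'(1)] d(1)[OF i'(2)]] Ld[OF i'(2)] by simp
    also have "\<dots> = cmp CW (cmp CW (cdiff K (i + 1)) (cdiff K i)) (far L (\<iota> n (cob K i)))"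
      using CW.cmp_assoc[OF h3(1) h3(3) KD(2)] CW.cmp_assoc[OF h3(3) KD(2) KD(2)] Ld[OF i'(1)] by simp
    finally have "zero_arrow CW (cmp CW (far L (\<iota> n (cob K (i + 1 + 1)))) (far L (cmp C (d (i + 1)) (d i))))"
      using CW.zero_arrow_cmp_right[OF KD(3) CW.cmp_hom[OF KD(2) KD(2)] h3(3)] by simp
    moreover obtain j where "inverse_arrows CW (?T (i + 1 + 1)) (cob K (i + 1 + 1)) (far L (\<iota> n (cob K (i + 1 + 1)))) j"
      using L_\<iota>_inverse[OF ko] by blast
    ultimately have "zero_arrow CW (far L (cmp C (d (i + 1)) (d i)))"
      using CW.zero_arrow_iso_left[OF _ L_hom[OF h]] by blast
    then show ?thesis by (rule eventually_zero[OF h])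
  qed
  have "\<forall>\<^sub>F m in at_top. \<forall>i\<in>{-B..B - 1}. zero_arrow C (far (T m) (cmp C (d (i + 1)) (d i)))"
    by (rule eventually_ball_finite) (use dd in auto)
  from eventually_happens'[OF trivial_limit_at_top_linorder this]
  obtain m where m: "\<And>i. i \<in> {-B..B - 1} \<Longrightarrow> zero_arrow C (far (T m) (cmp C (d (i + 1)) (d i)))" by blast
  define Y where "Y i = (if i \<in> ?R then TTo m n (cob K i) else z)" for i
  have zo: "z \<in> objs C" using z by (simp add: zero_object_def)
  have Y: "Y i \<in> objs C" for i using T_obj[OF T_obj[OF ko]] zo by (simp add: Y_def)
  have "\<exists>g. g \<in> hom_set C (Y i) (Y (i + 1)) \<and> (if i \<in> {-B..B - 1} then g = far (T m) (d i) else zero_arrow C g)" for i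
  proof (cases "i \<in> {-B..B - 1}")
    case True
    then show ?thesis using T_hom[OF d(1), of i m] by (auto simp: Y_def)
  next
    case False
    then show ?thesis using zero_arrow_exists[OF z Y Y, of i "i + 1"] by auto
  qed
  then obtain D where D: "\<And>i. D i \<in> hom_set C (Y i) (Y (i + 1))"
    "\<And>i. if i \<in> {-B..B - 1} then D i = far (T m) (d i) else zero_arrow C (D i)" by metis
  let ?M = "\<lparr>cob = Y, cdiff = D\<rparr>"
  have "zero_arrow C (cmp C (D (i + 1)) (D i))" for i
  proof (cases "i \<in> {-B..B - 1} \<and> i + 1 \<in> {-B..B - 1}")
    case True
    have "d i \<in> hom_set C (?T i) (?T (i + 1))" "d (i + 1) \<in> hom_set C (?T (i + 1)) (?T (i + 1 + 1))"
      using d(1)[of i] d(1)[of "i + 1"] True by auto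
    from is_functor_cmp[OF functor_T this, of m] show ?thesis using D(2)[of i] D(2)[of "i + 1"] True m[of i] by simp
  next
    case False
    then have "zero_arrow C (D i) \<or> zero_arrow C (D (i + 1))" using D(2)[of i] D(2)[of "i + 1"] by metis
    then show ?thesis
      using zero_arrow_cmp_left[OF _ D(1) D(1)] zero_arrow_cmp_right[OF _ D(1) D(1)] by blast
  qed
  moreover have "zero_object C (Y i)" if "\<bar>i\<bar> > B" for i using that z by (auto simp: Y_def)
  ultimately have M: "bounded_complex C ?M" using Y D(1) by (auto simp: bounded_complex_def)
  \<comment> \<open>Outside the range, zero objects stand on both sides, and all squares commute.\<close>
  have zR: "zero_object CW (cob K i) \<and> zero_object CW (Y i)" if "i \<notin> ?R" for i
    using B[of i] zero_object_L[OF z] that by (auto simp: Y_def)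
  have "\<exists>a b. inverse_arrows CW (Y i) (cob K i) a b \<and> (i \<in> ?R \<longrightarrow> a = far L (\<sigma> m n (cob K i)))" for i
  proof (cases "i \<in> ?R")
    case True
    obtain j where "inverse_arrows CW (TTo m n (cob K i)) (cob K i) (far L (\<sigma> m n (cob K i))) j"
      using L_\<sigma>_inverse[OF ko[of i], of m n] by blast
    then show ?thesis using True by (intro exI[of _ "far L (\<sigma> m n (cob K i))"] exI[of _ j]) (simp add: Y_def)
  next
    case False
    then have "isomorphic CW (Y i) (cob K i)" using zR[of i] CW.zero_object_unique[of "Y i" "cob K i"] by blast
    then obtain a b where "inverse_arrows CW (Y i) (cob K i) a b" unfolding isomorphic_iff by blast
    then show ?thesis using False by blast
  qed
  then obtain a b where ab: "\<And>i. inverse_arrows CW (Y i) (cob K i) (a i) (b i)"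
    "\<And>i. i \<in> ?R \<Longrightarrow> a i = far L (\<sigma> m n (cob K i))" by metis
  have "cmp CW (a (i + 1)) (far L (D i)) = cmp CW (cdiff K i) (a i)" for i
  proof -
    note h = CW.cmp_hom[OF L_hom[OF D(1)[of i]] inverse_arrowsD(1)[OF ab(1)[of "i + 1"]]]
      CW.cmp_hom[OF inverse_arrowsD(1)[OF ab(1)[of i]] KD(2)[of i]]
    consider "i \<notin> ?R" | "i + 1 \<notin> ?R" | "i \<in> {-B..B - 1}" "i \<in> ?R" "i + 1 \<in> ?R" by force
    then show ?thesis
    proof cases
      case 1
      then show ?thesis using CW.zero_object_hom_unique(2)[OF _ h] zR by blast
    next
      case 2
      then show ?thesis using CW.zero_object_hom_unique(1)[OF _ h] zR by blast
    next
      case 3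
      note i = \<iota>_hom[OF T_obj[OF ko], of m n]
      note di = d(1)[OF 3(2)]
      have Di: "D i = far (T m) (d i)" using D(2)[of i] 3(1) by simp
      have "cmp CW (far L (\<sigma> m n (cob K (i + 1)))) (far L (far (T m) (d i))) =
          cmp CW (far L (\<iota> n (cob K (i + 1)))) (cmp CW (far L (d i)) (far L (\<iota> m (?T i))))"
        using CW.cmp_assoc[OF L_hom[OF T_hom[OF di]] L_hom[OF i] L_\<iota>_hom[OF ko]] L_\<sigma>[OF ko] L_\<iota>_natural[OF di, of m]
        by simp
      also have "\<dots> = cmp CW (cmp CW (cdiff K i) (far L (\<iota> n (cob K i)))) (far L (\<iota> m (?T i)))"
        using CW.cmp_assoc[OF L_hom[OF i] L_hom[OF di] L_\<iota>_hom[OF ko]] Ld[OF 3(2)] by simp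
      also have "\<dots> = cmp CW (cdiff K i) (far L (\<sigma> m n (cob K i)))"
        using CW.cmp_assoc[OF L_hom[OF i] L_\<iota>_hom[OF ko] KD(2)] L_\<sigma>[OF ko] by simp
      finally show ?thesis using Di ab(2)[OF 3(2)] ab(2)[OF 3(3)] by simp
    qed
  qed
  with M ab(1) that[of ?M a b] show thesis by simp
qed

end

text \<open>
  The functor \<open>P\<close> takes a kernel to a kernel of an arrow that is isomorphic to \<open>g\<close>.
\<close>

lemma kernel_exists_descends:
  assumes C: "cat C" and E: "cat E" and P: "is_functor C E P" "preserves_kernels C E P"
    and ker: "\<And>f. f \<in> arrs C \<Longrightarrow> \<exists>k. is_kernel C f k"
    and dense: "\<And>g. g \<in> arrs E \<Longrightarrow> \<exists>f \<in> arrs C. \<exists>a a' c c'.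
      inverse_arrows E (fob P (src C f)) (src E g) a a' \<and>
      inverse_arrows E (tgt E g) (fob P (tgt C f)) c c' \<and> far P f = cmp E c (cmp E g a)"
    and g: "g \<in> arrs E"
  shows "\<exists>k. is_kernel E g k"
proof -
  interpret C: cat C by fact
  interpret E: cat E by fact
  obtain f a a' c c' where f: "f \<in> arrs C" and a: "inverse_arrows E (fob P (src C f)) (src E g) a a'"
    and c: "inverse_arrows E (tgt E g) (fob P (tgt C f)) c c'" and eq: "far P f = cmp E c (cmp E g a)"
    using dense[OF g] by blast
  obtain k where k: "is_kernel C f k" using ker[OF f] by blast
  have Pk: "is_kernel E (cmp E c (cmp E g a)) (far P k)"
    using P(2) k eq unfolding preserves_kernels_def by metis
  have "src E (far P k) \<in> objs E" using E.hom_objs(1)[OF E.is_kernelD(2)[OF Pk]] .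
  from E.kernel_conjugate[OF Pk arr_hom_set[OF g] a c E.inverse_arrows_idm[OF this]] show ?thesis by blast
qed

lemma cokernel_exists_descends:
  assumes C: "cat C" and E: "cat E" and P: "is_functor C E P" "preserves_cokernels C E P"
    and coker: "\<And>f. f \<in> arrs C \<Longrightarrow> \<exists>q. is_cokernel C f q"
    and dense: "\<And>g. g \<in> arrs E \<Longrightarrow> \<exists>f \<in> arrs C. \<exists>a a' c c'.
      inverse_arrows E (fob P (src C f)) (src E g) a a' \<and>
      inverse_arrows E (tgt E g) (fob P (tgt C f)) c c' \<and> far P f = cmp E c (cmp E g a)"
    and g: "g \<in> arrs E"
  shows "\<exists>q. is_cokernel E g q"
proof -
  interpret E: cat E by fact
  have "\<exists>k. is_kernel (opposite E) g k"
  proof (rule kernel_exists_descends[OF cat_opposite[OF C] cat_opposite[OF E] is_functor_opposite[OF P(1)]])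
    show "preserves_kernels (opposite C) (opposite E) P"
      using P(2) by (simp add: preserves_kernels_def preserves_cokernels_def)
    show "\<exists>k. is_kernel (opposite C) f k" if "f \<in> arrs (opposite C)" for f
      using coker that by simp
    fix g assume "g \<in> arrs (opposite E)"
    then have g: "g \<in> arrs E" by simp
    obtain f a a' c c' where f: "f \<in> arrs C" and a: "inverse_arrows E (fob P (src C f)) (src E g) a a'"
      and c: "inverse_arrows E (tgt E g) (fob P (tgt C f)) c c'" and eq: "far P f = cmp E c (cmp E g a)"
      using dense[OF g] by blast
    have "far P f = cmp E (cmp E c g) a"
      using eq E.cmp_assoc[OF inverse_arrowsD(1)[OF a] arr_hom_set[OF g] inverse_arrowsD(1)[OF c]] by simp
    then show "\<exists>f\<in>arrs (opposite C). \<exists>a a' c c'.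
      inverse_arrows (opposite E) (fob P (src (opposite C) f)) (src (opposite E) g) a a' \<and>
      inverse_arrows (opposite E) (tgt (opposite E) g) (fob P (tgt (opposite C) f)) c c' \<and>
      far P f = cmp (opposite E) c (cmp (opposite E) g a)"
      using f inverse_arrows_sym[OF a] inverse_arrows_sym[OF c]
      by (intro bexI[of _ f] exI[of _ c] exI[of _ c'] exI[of _ a] exI[of _ a']) simp_all
  qed (use g in simp_all)
  then show ?thesis by simp
qed

section \<open>Truncations of graded modules\<close>

context graded_left_module
begin

lemma part_ext:
  assumes x: "x \<in> carrier M" and y: "y \<in> carrier M" and eq: "\<And>i. part x i = part y i"
  shows "x = y"
proof -
  have *: "part x = part y" using eq by blast
  show ?thesis by (rule trans[OF homogeneous_part(3)[OF x]]) (unfold *, rule homogeneous_part(3)[OF y, symmetric])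
qed

lemma tail_exists:
  assumes x: "x \<in> carrier M"
  obtains y where "y \<in> carrier M" "\<And>i. part y i = (if i < n then \<zero>\<^bsub>M\<^esub> else part x i)"
proof -
  let ?A = "{i. part x i \<noteq> \<zero>\<^bsub>M\<^esub> \<and> \<not> i < n}"
  let ?y = "\<Oplus>\<^bsub>M\<^esub>i\<in>?A. part x i"
  have fin: "finite ?A" by (rule finite_subset[OF _ homogeneous_part(2)[OF x]]) auto
  have "part ?y = (\<lambda>i. if i \<in> ?A then part x i else \<zero>\<^bsub>M\<^esub>)"
    by (rule homogeneous_part_unique[OF fin homogeneous_part(1)[OF x] refl])
  moreover have "?y \<in> carrier M" using part_carrier[OF x] by (intro M.finsum_closed) auto
  ultimately show thesis using that[of ?y] by auto
qed

end

definition tail_set :: "int \<Rightarrow> ('a, 'b) graded_module \<Rightarrow> 'b set" where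
  "tail_set n M = {x \<in> carrier M. \<forall>i < n. homogeneous_part M x i = \<zero>\<^bsub>M\<^esub>}"

definition truncation :: "int \<Rightarrow> ('a, 'b) graded_module \<Rightarrow> ('a, 'b) graded_module" where
  "truncation n M = submodule_obj M (tail_set n M)"

definition truncation_functor ::
  "int \<Rightarrow> (('a, 'b) graded_module, ('a, 'b) gr_arrow, ('a, 'b) graded_module, ('a, 'b) gr_arrow) func" where
  "truncation_functor n = \<lparr>fob = truncation n,
     far = (\<lambda>(M, N, f). (truncation n M, truncation n N, restrict f (tail_set n M)))\<rparr>"

definition tail_inclusion :: "int \<Rightarrow> ('a, 'b) graded_module \<Rightarrow> ('a, 'b) gr_arrow" where
  "tail_inclusion n M = (truncation n M, M, restrict (\<lambda>x. x) (tail_set n M))"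

lemma truncation_simps [simp]:
  "carrier (truncation n M) = tail_set n M" "\<zero>\<^bsub>truncation n M\<^esub> = \<zero>\<^bsub>M\<^esub>"
  "x \<oplus>\<^bsub>truncation n M\<^esub> y = x \<oplus>\<^bsub>M\<^esub> y" "a \<odot>\<^bsub>truncation n M\<^esub> x = a \<odot>\<^bsub>M\<^esub> x"
  "mcomp (truncation n M) i = mcomp M i \<inter> tail_set n M"
  by (simp_all add: truncation_def)

lemma truncation_functor_simps [simp]:
  "fob (truncation_functor n) M = truncation n M"
  "far (truncation_functor n) (M, N, f) = (truncation n M, truncation n N, restrict f (tail_set n M))"
  by (simp_all add: truncation_functor_def)

lemma mcomp_tail:
  assumes "graded_left_module R M" "x \<in> mcomp M i" "n \<le> i"
  shows "x \<in> tail_set n M"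
  using graded_left_module.mcomp_carrier[OF assms(1,2)] graded_left_module.part_homogeneous[OF assms(1,2)] assms(3)
  by (auto simp: tail_set_def)

lemma graded_hom_tail:
  assumes "graded_hom R M N f" "x \<in> tail_set n M"
  shows "f x \<in> tail_set n N"
proof -
  interpret graded_hom R M N f by fact
  show ?thesis using assms(2) closed hom_zero by (auto simp: tail_set_def homogeneous_part_image)
qed

text \<open>
  The components of degree at least \<open>n\<close> of a preimage form a preimage, since \<open>f\<close> preserves degrees.
\<close>

lemma graded_hom_lifts_tail:
  assumes "graded_hom R M N f" "y \<in> tail_set n N" "y \<in> f ` carrier M"
  shows "y \<in> f ` tail_set n M"
proof -
  interpret graded_hom R M N f by fact
  obtain x where x: "x \<in> carrier M" "y = f x" using assms(3) by auto
  obtain x' where x': "x' \<in> carrier M" "\<And>i. homogeneous_part M x' i = (if i < n then \<zero>\<^bsub>M\<^esub> else homogeneous_part M x i)"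
    using M.tail_exists[OF x(1), of n] by blast
  have y: "homogeneous_part N (f x) i = \<zero>\<^bsub>N\<^esub>" if "i < n" for i using assms(2) x(2) that by (simp add: tail_set_def)
  have "f x' = f x"
    by (rule N.part_ext) (use x' x(1) y closed hom_zero in \<open>auto simp: homogeneous_part_image\<close>)
  moreover have "x' \<in> tail_set n M" using x' by (simp add: tail_set_def)
  ultimately show ?thesis using x(2) by (intro image_eqI[of _ _ x']) simp_all
qed

context homogeneous_G_algebra
begin

text \<open>
  The algebra has no elements of negative degree, so its elements do not lower degrees.
\<close>

lemma tail_graded_submodule:
  assumes M: "graded_left_module A M"
  shows "graded_submodule A M (tail_set n M)"
proof -
  interpret homogeneous_module b c d M by (rule homogeneous_moduleI[OF M])
  have smult: "M.part (act p x) i = \<zero>\<^bsub>M\<^esub>" if x: "x \<in> tail_set n M" and i: "i < n" for p x i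
  proof -
    have xc: "x \<in> carrier M" and x0: "\<And>i. i < n \<Longrightarrow> M.part x i = \<zero>\<^bsub>M\<^esub>" using x by (auto simp: tail_set_def)
    show ?thesis
    proof (induction p rule: free_alg_induct)
      case 1
      then show ?case using act_zero[OF xc] by simp
    next
      case (2 a w p)
      let ?w = "Poly_Mapping.single (FMon w) a :: ('n option, 'k) free_alg"
      have w: "hc ?w \<in> rcomp A (int (length w))" by (auto intro!: imageI)
      have "M.part (act ?w x) i = hc ?w \<odot>\<^bsub>M\<^esub> M.part x (i - int (length w))"
        unfolding act_def by (rule M.part_smult[OF w _ xc]) simp
      then have "M.part (act ?w x) i = \<zero>\<^bsub>M\<^esub>" using x0[of "i - int (length w)"] i M.smult_zero_right[of "hc ?w"] by simp
      then show ?case using 2 M.part_add[OF act_closed[OF xc] act_closed[OF xc]] by (simp add: act_add[OF xc])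
    qed
  qed
  show ?thesis
    unfolding graded_submodule_def
  proof (intro conjI ballI allI)
    fix x assume x: "x \<in> tail_set n M"
    then have xc: "x \<in> carrier M" by (simp add: tail_set_def)
    show "x \<oplus>\<^bsub>M\<^esub> y \<in> tail_set n M" if "y \<in> tail_set n M" for y
      using x that by (auto simp: tail_set_def M.part_add)
    show "M.part x i \<in> tail_set n M" for i
      using x M.part_carrier[OF xc] M.part_homogeneous[OF M.homogeneous_part(1)[OF xc]] by (auto simp: tail_set_def)
    show "a \<odot>\<^bsub>M\<^esub> x \<in> tail_set n M" if a: "a \<in> carrier A" for a
    proof -
      obtain p where "a = hc p" using a by auto
      then have "a \<odot>\<^bsub>M\<^esub> x = act p x" by (simp only: act_def)
      then show ?thesis using smult[OF x] act_closed[OF xc] by (simp add: tail_set_def)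
    qed
  qed (auto simp: tail_set_def)
qed

lemma rcomp_A: "rcomp A i \<subseteq> carrier A"
  by (rule central_element.rcomp_carrier[OF central_element_Z])

lemma truncation_fg: "M \<in> fg_graded_modules A \<Longrightarrow> truncation n M \<in> fg_graded_modules A"
  unfolding fg_graded_modules_def truncation_def
  using submodule_obj_graded(1)[OF _ rcomp_A tail_graded_submodule]
    gr_noetherian.fg_submodule[OF gr_noetherian_A _ tail_graded_submodule]
  by (auto simp: fg_graded_modules_def)

lemma truncation_hom:
  assumes "(M, N, f) \<in> hom_set (gr A) M N"
  shows "(truncation n M, truncation n N, restrict f (tail_set n M)) \<in> hom_set (gr A) (truncation n M) (truncation n N)"
proof -
  have M: "M \<in> fg_graded_modules A" and N: "N \<in> fg_graded_modules A" and f: "graded_hom A M N f"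
    using assms by (auto simp: hom_gr_iff)
  interpret graded_hom A M N f by fact
  have gl: "graded_left_module A (truncation n M)" "graded_left_module A (truncation n N)"
    using truncation_fg[OF M] truncation_fg[OF N] fg_graded_modulesD(1) by blast+
  have "graded_hom A (truncation n M) (truncation n N) f"
    by (intro graded_hom.intro graded_hom_axioms.intro gl)
      (use graded_hom_tail[OF f] add smult degree in \<open>auto simp: tail_set_def\<close>)
  from hom_gr_restrict[OF this truncation_fg[OF M] truncation_fg[OF N]] show ?thesis by simp
qed

lemma is_functor_truncation: "is_functor (gr A) (gr A) (truncation_functor n)"
  unfolding is_functor_def
proof (intro conjI ballI impI)
  fix M assume "M \<in> objs (gr A)"
  then have M: "M \<in> fg_graded_modules A" by simp
  show "fob (truncation_functor n) M \<in> objs (gr A)" using truncation_fg[OF M] by simp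
  show "far (truncation_functor n) (idm (gr A) M) = idm (gr A) (fob (truncation_functor n) M)"
    by (auto simp: idm_gr tail_set_def restrict_def fun_eq_iff)
next
  fix F assume "F \<in> arrs (gr A)"
  then obtain M N f where F: "F = (M, N, f)" "F \<in> hom_set (gr A) M N"
    using arr_hom_set hom_grE by metis
  show "far (truncation_functor n) F \<in> hom_set (gr A) (fob (truncation_functor n) (src (gr A) F)) (fob (truncation_functor n) (tgt (gr A) F))"
    using truncation_hom[of M N f n] F hom_setD(2,3)[OF F(2)] by simp
  fix G assume G: "G \<in> arrs (gr A)" "src (gr A) G = tgt (gr A) F"
  then obtain P g where g: "G = (N, P, g)" "G \<in> hom_set (gr A) N P"
    using arr_hom_set[OF G(1)] hom_grE hom_setD(3)[OF F(2)] by metis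
  have "graded_hom A M N f" using F by (auto simp: hom_gr_iff)
  from graded_hom_tail[OF this]
  have "f x \<in> tail_set n N" "x \<in> carrier M" if "x \<in> tail_set n M" for x using that by (auto simp: tail_set_def)
  then show "far (truncation_functor n) (cmp (gr A) G F) = cmp (gr A) (far (truncation_functor n) G) (far (truncation_functor n) F)"
    by (simp add: F(1) g(1) cmp_gr compose_def restrict_def fun_eq_iff)
qed

lemma tail_inclusion_hom:
  assumes M: "M \<in> fg_graded_modules A"
  shows "tail_inclusion n M \<in> hom_set (gr A) (truncation n M) M"
  using hom_gr_restrict[OF submodule_obj_graded(2)[OF fg_graded_modulesD(1)[OF M] rcomp_A
      tail_graded_submodule[OF fg_graded_modulesD(1)[OF M]]], folded truncation_def, OF truncation_fg[OF M] M]
  by (simp add: tail_inclusion_def)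

lemma tail_inclusion_natural:
  assumes "F \<in> hom_set (gr A) M N"
  shows "cmp (gr A) F (tail_inclusion n M) = cmp (gr A) (tail_inclusion n N) (far (truncation_functor n) F)"
proof -
  obtain f where f: "F = (M, N, f)" "graded_hom A M N f" by (rule hom_grE[OF assms])
  have "f x \<in> tail_set n N" if "x \<in> tail_set n M" for x by (rule graded_hom_tail[OF f(2) that])
  then show ?thesis by (simp add: f(1) tail_inclusion_def cmp_gr compose_def restrict_def fun_eq_iff)
qed

lemma tail_inclusion_idem:
  assumes M: "M \<in> fg_graded_modules A"
  shows "is_iso (gr A) (tail_inclusion n (truncation n M))"
proof -
  note i = tail_inclusion_hom[OF M, of n]
  have "graded_hom A (truncation n M) M (restrict (\<lambda>x. x) (tail_set n M))"
    using i by (auto simp: tail_inclusion_def hom_gr_iff)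
  from graded_hom.homogeneous_part_image[OF this]
  have "homogeneous_part (truncation n M) x i = homogeneous_part M x i" if "x \<in> tail_set n M" for x i
  proof -
    have "homogeneous_part (truncation n M) x i \<in> tail_set n M"
      using graded_left_module.part_carrier[OF fg_graded_modulesD(1)[OF truncation_fg[OF M]], of x n i] that by simp
    then show ?thesis using graded_hom.homogeneous_part_image[OF \<open>graded_hom A (truncation n M) M _\<close>, of x i] that by simp
  qed
  then have "tail_set n (truncation n M) = tail_set n M" by (auto simp: tail_set_def[of n "truncation n M"] tail_set_def[of n M])
  then show ?thesis
    using gr_bijective_iso[OF tail_inclusion_hom[OF truncation_fg[OF M, of n], of n, unfolded tail_inclusion_def]]
      is_iso_hom[OF tail_inclusion_hom[OF truncation_fg[OF M, of n], of n]] by (simp add: tail_inclusion_def)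
qed

lemma finite_dimensional_iff_bounded:
  assumes "M \<in> fg_graded_modules A"
  shows "M \<in> finite_dimensional_objs b c d \<longleftrightarrow> (\<exists>n. \<forall>i \<ge> n. mcomp M i = {\<zero>\<^bsub>M\<^esub>})"
  using homogeneous_module.finite_dimensional_iff[OF homogeneous_moduleI] fg_graded_modulesD[OF assms] by blast

text \<open>
  The inclusion has zero kernel, and its cokernel vanishes in degrees at least \<open>n\<close>.
\<close>

lemma tail_inclusion_W:
  fixes M :: "(('n, 'k) homog_elt, 'm) graded_module"
  assumes M: "M \<in> fg_graded_modules A"
  shows "tail_inclusion n M \<in> Qgr_arrows b c d"
proof -
  note gl = fg_graded_modulesD(1)[OF M]
  interpret M: graded_left_module A M by fact
  let ?i = "restrict (\<lambda>x. x) (tail_set n M)"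
  note i = tail_inclusion_hom[OF M, of n, unfolded tail_inclusion_def]
  note k = gr_noetherian.kernel_gr_exists[OF gr_noetherian_A i] and q = gr_noetherian.cokernel_gr_exists[OF gr_noetherian_A i]
  have z: "\<zero>\<^bsub>M\<^esub> \<in> tail_set n M" by (simp add: tail_set_def)
  have "submodule_obj (truncation n M) {x \<in> carrier (truncation n M). ?i x = \<zero>\<^bsub>M\<^esub>} \<in> finite_dimensional_objs b c d"
    unfolding finite_dimensional_iff_bounded[OF k(2)] using z M.mcomp_zero by auto
  moreover have "quotient_obj M (?i ` carrier (truncation n M)) \<in> finite_dimensional_objs b c d"
    unfolding finite_dimensional_iff_bounded[OF q(2)]
  proof (intro exI[of _ n] allI impI)
    fix j assume j: "n \<le> j"
    have im: "?i ` carrier (truncation n M) = tail_set n M" by simp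
    have "coset_rep M (tail_set n M) x = coset_rep M (tail_set n M) \<zero>\<^bsub>M\<^esub>" if "x \<in> mcomp M j" for x
      using iffD2[OF quotient_obj_graded(3)[OF gl rcomp_A tail_graded_submodule[OF gl] M.mcomp_carrier[OF that]]
        mcomp_tail[OF gl that j]] by (simp only: quotient_obj_simps(2))
    then show "mcomp (quotient_obj M (?i ` carrier (truncation n M))) j = {\<zero>\<^bsub>quotient_obj M (?i ` carrier (truncation n M))\<^esub>}"
      unfolding im quotient_obj_simps using M.mcomp_zero[of j] by blast
  qed
  ultimately have "\<exists>k. is_kernel (gr A) (truncation n M, M, ?i) k \<and> src (gr A) k \<in> finite_dimensional_objs b c d"
    "\<exists>q. is_cokernel (gr A) (truncation n M, M, ?i) q \<and> tgt (gr A) q \<in> finite_dimensional_objs b c d"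
    by - (rule exI, rule conjI, rule k(1), simp add: gr_def, rule exI, rule conjI, rule q(1), simp add: gr_def)
  then show ?thesis
    unfolding Qgr_arrows_def serre_arrows_def tail_inclusion_def using hom_setD(1)[OF i] by simp
qed

lemma kernels_truncation: "preserves_kernels (gr A) (gr A) (truncation_functor n)"
  unfolding preserves_kernels_def
proof (intro allI impI)
  interpret cat "gr A" by (rule cat_gr)
  fix F G assume k: "is_kernel (gr A) F G"
  obtain M N f where f: "F = (M, N, f)" "(M, N, f) \<in> hom_set (gr A) M N" "graded_hom A M N f"
    using is_kernelD(1)[OF k] hom_grE by metis
  have s: "src (gr A) F = M" by (simp add: f(1) gr_def)
  obtain K k' where k': "G = (K, M, k')" "(K, M, k') \<in> hom_set (gr A) K M" "graded_hom A K M k'"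
    using is_kernelD(2)[OF k, unfolded s] hom_grE by metis
  note kD = gr_noetherian.kernel_grD[OF gr_noetherian_A k[unfolded f(1) k'(1)]]
  interpret k: graded_hom A K M k' by (rule k'(3))
  have "is_kernel (gr A) (truncation n M, truncation n N, restrict f (tail_set n M)) (truncation n K, truncation n M, restrict k' (tail_set n K))"
  proof (rule is_kernel_grI[OF ring_A truncation_hom[OF f(2)] truncation_hom[OF k'(2)]])
    have sub: "tail_set n K \<subseteq> carrier K" by (auto simp: tail_set_def)
    then show "inj_on (restrict k' (tail_set n K)) (carrier (truncation n K))"
      using inj_on_subset[OF kD(1) sub] by (simp add: inj_on_def)
    have "x \<in> k' ` tail_set n K" if "x \<in> tail_set n M" "f x = \<zero>\<^bsub>N\<^esub>" for x
      by (rule graded_hom_lifts_tail[OF k'(3) that(1)]) (use that kD(2) in \<open>auto simp: tail_set_def\<close>)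
    moreover have "f (k' x) = \<zero>\<^bsub>N\<^esub>" if "x \<in> tail_set n K" for x
      using that kD(2) sub by blast
    ultimately show "restrict k' (tail_set n K) ` carrier (truncation n K) =
        {x \<in> carrier (truncation n M). restrict f (tail_set n M) x = \<zero>\<^bsub>truncation n N\<^esub>}"
      using graded_hom_tail[OF k'(3)] by auto
  qed
  then show "is_kernel (gr A) (far (truncation_functor n) F) (far (truncation_functor n) G)" by (simp add: f(1) k'(1))
qed

lemma cokernels_truncation: "preserves_cokernels (gr A) (gr A) (truncation_functor n)"
  unfolding preserves_cokernels_def
proof (intro allI impI)
  interpret cat "gr A" by (rule cat_gr)
  fix F G assume q: "is_cokernel (gr A) F G"
  obtain M N f where f: "F = (M, N, f)" "(M, N, f) \<in> hom_set (gr A) M N" "graded_hom A M N f"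
    using is_cokernelD(1)[OF q] hom_grE by metis
  have s: "tgt (gr A) F = N" by (simp add: f(1) gr_def)
  obtain C q' where q': "G = (N, C, q')" "(N, C, q') \<in> hom_set (gr A) N C" "graded_hom A N C q'"
    using is_cokernelD(2)[OF q, unfolded s] hom_grE by metis
  note qD = gr_noetherian.cokernel_grD[OF gr_noetherian_A q[unfolded f(1) q'(1)]]
  have "is_cokernel (gr A) (truncation n M, truncation n N, restrict f (tail_set n M)) (truncation n N, truncation n C, restrict q' (tail_set n N))"
  proof (rule is_cokernel_grI[OF ring_A truncation_hom[OF f(2)] truncation_hom[OF q'(2)]])
    have sub: "tail_set n M \<subseteq> carrier M" by (auto simp: tail_set_def)
    have "x \<in> q' ` tail_set n N" if "x \<in> tail_set n C" for x
      by (rule graded_hom_lifts_tail[OF q'(3) that]) (use that qD(1) in \<open>auto simp: tail_set_def\<close>)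
    then show "restrict q' (tail_set n N) ` carrier (truncation n N) = carrier (truncation n C)"
      using graded_hom_tail[OF q'(3)] by auto
    have "x \<in> f ` tail_set n M" if "x \<in> tail_set n N" "q' x = \<zero>\<^bsub>C\<^esub>" for x
      by (rule graded_hom_lifts_tail[OF f(3) that(1)]) (use that qD(2) in \<open>auto simp: tail_set_def\<close>)
    moreover have "q' (f x) = \<zero>\<^bsub>C\<^esub>" if "x \<in> tail_set n M" for x
      using that qD(2) sub by blast
    ultimately show "restrict f (tail_set n M) ` carrier (truncation n M) =
        {x \<in> carrier (truncation n N). restrict q' (tail_set n N) x = \<zero>\<^bsub>truncation n C\<^esub>}"
      using graded_hom_tail[OF f(3)] by auto
  qed
  then show "is_cokernel (gr A) (far (truncation_functor n) F) (far (truncation_functor n) G)" by (simp add: f(1) q'(1))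
qed

lemma truncation_zero_if_bounded:
  assumes M: "graded_left_module A M" and "\<And>i. n \<le> i \<Longrightarrow> mcomp M i = {\<zero>\<^bsub>M\<^esub>}"
  shows "tail_set n M = {\<zero>\<^bsub>M\<^esub>}"
proof -
  interpret graded_left_module A M by fact
  have "x = \<zero>\<^bsub>M\<^esub>" if x: "x \<in> tail_set n M" for x
  proof (rule part_ext)
    show "x \<in> carrier M" using x by (simp add: tail_set_def)
    fix i
    show "part x i = part \<zero>\<^bsub>M\<^esub> i"
      using x homogeneous_part(1)[of x i] assms(2)[of i] by (cases "i < n") (auto simp: tail_set_def)
  qed simp
  then show ?thesis by (auto simp: tail_set_def)
qed

text \<open>
  The kernel and the cokernel are finite-dimensional, so a deep truncation leaves nothing of them.
\<close>

lemma W_eventually_iso: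
  assumes s: "s \<in> Qgr_arrows b c d"
  shows "\<forall>\<^sub>F n in at_top. is_iso (gr A) (far (truncation_functor n) s)"
proof -
  interpret cat "gr A" by (rule cat_gr)
  obtain G H where kq: "is_kernel (gr A) s G" "is_cokernel (gr A) s H"
    and fd: "src (gr A) G \<in> finite_dimensional_objs b c d" "tgt (gr A) H \<in> finite_dimensional_objs b c d"
    using s by (auto simp: Qgr_arrows_def serre_arrows_def)
  obtain M N f where f: "s = (M, N, f)" "(M, N, f) \<in> hom_set (gr A) M N" "graded_hom A M N f"
    using is_kernelD(1)[OF kq(1)] hom_grE by metis
  have st: "src (gr A) s = M" "tgt (gr A) s = N" by (simp_all add: f(1) gr_def)
  obtain K k where k: "G = (K, M, k)" "K \<in> fg_graded_modules A" using is_kernelD(2)[OF kq(1), unfolded st] hom_grE by metis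
  obtain C q where q: "H = (N, C, q)" "C \<in> fg_graded_modules A" using is_cokernelD(2)[OF kq(2), unfolded st] hom_grE by metis
  have "K \<in> finite_dimensional_objs b c d" "C \<in> finite_dimensional_objs b c d"
    using fd by (simp_all add: k(1) q(1) gr_def)
  then obtain n1 n2 where n12: "\<And>i. n1 \<le> i \<Longrightarrow> mcomp K i = {\<zero>\<^bsub>K\<^esub>}" "\<And>i. n2 \<le> i \<Longrightarrow> mcomp C i = {\<zero>\<^bsub>C\<^esub>}"
    unfolding finite_dimensional_iff_bounded[OF k(2)] finite_dimensional_iff_bounded[OF q(2)] by blast
  have "is_iso (gr A) (far (truncation_functor n) s)" if n: "max n1 n2 \<le> n" for n
  proof -
    have K0: "tail_set n K = {\<zero>\<^bsub>K\<^esub>}" by (rule truncation_zero_if_bounded[OF fg_graded_modulesD(1)[OF k(2)]]) (use n12 n in auto)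
    have C0: "tail_set n C = {\<zero>\<^bsub>C\<^esub>}" by (rule truncation_zero_if_bounded[OF fg_graded_modulesD(1)[OF q(2)]]) (use n12 n in auto)
    let ?f = "restrict f (tail_set n M)"
    have "is_kernel (gr A) (truncation n M, truncation n N, ?f) (truncation n K, truncation n M, restrict k (tail_set n K))"
      using kernels_truncation[of n] kq(1) unfolding preserves_kernels_def f(1) k(1) by fastforce
    note kD = gr_noetherian.kernel_grD(2)[OF gr_noetherian_A this]
    have "is_cokernel (gr A) (truncation n M, truncation n N, ?f) (truncation n N, truncation n C, restrict q (tail_set n N))"
      using cokernels_truncation[of n] kq(2) unfolding preserves_cokernels_def f(1) q(1) by fastforce
    note qD = gr_noetherian.cokernel_grD[OF gr_noetherian_A this]
    note fh = truncation_hom[OF f(2), of n]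
    then have fg: "graded_hom A (truncation n M) (truncation n N) ?f" by (auto simp: hom_gr_iff)
    have "{x \<in> tail_set n M. ?f x = \<zero>\<^bsub>N\<^esub>} = {restrict k (tail_set n K) \<zero>\<^bsub>K\<^esub>}" using kD K0 by simp
    moreover have "\<zero>\<^bsub>M\<^esub> \<in> tail_set n M" "?f \<zero>\<^bsub>M\<^esub> = \<zero>\<^bsub>N\<^esub>"
      using graded_hom.hom_zero[OF fg] graded_hom.hom_zero[OF f(3)] graded_submoduleD(2)[OF tail_graded_submodule[OF graded_hom.axioms(1)[OF f(3)]]]
      by simp_all
    ultimately have 0: "\<zero>\<^bsub>M\<^esub> \<in> {restrict k (tail_set n K) \<zero>\<^bsub>K\<^esub>}" and
      eq: "{x \<in> tail_set n M. ?f x = \<zero>\<^bsub>N\<^esub>} = {restrict k (tail_set n K) \<zero>\<^bsub>K\<^esub>}" by blast+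
    have "x = \<zero>\<^bsub>M\<^esub>" if "x \<in> tail_set n M" "?f x = \<zero>\<^bsub>N\<^esub>" for x
    proof -
      have "x \<in> {x \<in> tail_set n M. ?f x = \<zero>\<^bsub>N\<^esub>}" using that by simp
      then show ?thesis using 0 unfolding eq by simp
    qed
    then have "inj_on ?f (carrier (truncation n M))"
      by (intro graded_hom.inj_onI[OF fg]) simp
    moreover have "?f ` carrier (truncation n M) = carrier (truncation n N)"
      using qD C0 by auto
    ultimately show ?thesis
      using gr_bijective_iso[OF fh] is_iso_hom[OF fh] by (simp add: f(1))
  qed
  then show ?thesis unfolding eventually_at_top_linorder by blast
qed

lemma truncated_category_gr:
  "truncated_category (gr A) (Qgr_arrows b c d) truncation_functor tail_inclusion"
proof (intro truncated_category.intro cat_with_weq.intro cat_with_weq_axioms.intro truncated_category_axioms.intro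
    cat_gr is_functor_truncation cokernels_truncation W_eventually_iso)
  show "Qgr_arrows b c d \<subseteq> arrs (gr A)" by (auto simp: Qgr_arrows_def serre_arrows_def)
  show "\<exists>z. zero_object (gr A) z"
    by (rule exI[of _ "zero_module undefined"]) (simp add: zero_object_gr[OF ring_A zero_module_fg[OF ring_A]])
  fix z n assume z: "zero_object (gr A) z"
  then have zf: "z \<in> fg_graded_modules A" by (simp add: zero_object_def)
  have "carrier z = {\<zero>\<^bsub>z\<^esub>}" using z zero_object_gr[OF ring_A zf] by simp
  moreover have "\<zero>\<^bsub>z\<^esub> \<in> tail_set n z"
    using graded_submoduleD(2)[OF tail_graded_submodule[OF fg_graded_modulesD(1)[OF zf]]] .
  ultimately have "tail_set n z = {\<zero>\<^bsub>z\<^esub>}" by (auto simp: tail_set_def)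
  then show "zero_object (gr A) (fob (truncation_functor n) z)"
    using zero_object_gr[OF ring_A truncation_fg[OF zf]] by simp
qed (simp_all add: tail_inclusion_hom tail_inclusion_W tail_inclusion_natural tail_inclusion_idem)

lemma W_eventually_bij:
  assumes s: "(M, N, f) \<in> Qgr_arrows b c d"
  shows "eventually_bij (M, N, f)" "(M, N, f) \<in> hom_set (gr A) M N"
proof -
  show fh: "(M, N, f) \<in> hom_set (gr A) M N"
    using s arr_hom_set[of "(M, N, f)" "gr A"] by (simp add: Qgr_arrows_def serre_arrows_def) (simp add: gr_def)
  then have f: "graded_hom A M N f" by (auto simp: hom_gr_iff)
  interpret graded_hom A M N f by fact
  obtain n where n: "\<And>m. n \<le> m \<Longrightarrow> is_iso (gr A) (far (truncation_functor m) (M, N, f))"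
    using W_eventually_iso[OF s] unfolding eventually_at_top_linorder by blast
  obtain g where "inverse_arrows (gr A) (truncation n M) (truncation n N) (truncation n M, truncation n N, restrict f (tail_set n M)) g"
    using n[OF order_refl] is_iso_hom[OF truncation_hom[OF fh]] by auto
  note bij = gr_iso_bijective[OF this]
  have "inj_on f (mcomp M i) \<and> f ` mcomp M i = mcomp N i" if i: "n \<le> i" for i
  proof
    have sub: "mcomp M i \<subseteq> tail_set n M"
      using mcomp_tail[OF M.graded_left_module_axioms _ i] by blast
    have "inj_on f (tail_set n M)" using bij(1) by (simp add: inj_on_def)
    then show "inj_on f (mcomp M i)" by (rule inj_on_subset[OF _ sub])
    have "y \<in> f ` mcomp M i" if y: "y \<in> mcomp N i" for y
    proof -
      have "y \<in> restrict f (tail_set n M) ` tail_set n M"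
        using mcomp_tail[OF N.graded_left_module_axioms y i] bij(2) by simp
      then have "y \<in> f ` carrier M" by (auto simp: tail_set_def)
      then show ?thesis by (rule lifts_degree[OF y])
    qed
    then show "f ` mcomp M i = mcomp N i" using degree by blast
  qed
  then show "eventually_bij (M, N, f)" unfolding eventually_bij_def by blast
qed

end

section \<open>The kernel of the localization functor on derived categories\<close>

context cat
begin

lemma bounded_complex_map:
  assumes F: "is_functor C D F" and zero: "\<And>z. zero_object C z \<Longrightarrow> zero_object D (fob F z)" and D: "cat D"
    and K: "bounded_complex C K"
  shows "bounded_complex D (map_cochain F K)"
proof -
  note KD = bounded_complexD[OF K]
  obtain N where "\<And>i. \<bar>i\<bar> > N \<Longrightarrow> zero_object C (cob K i)" using K by (auto simp: bounded_complex_def)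
  then have "\<exists>N. \<forall>i. \<bar>i\<bar> > N \<longrightarrow> zero_object D (fob F (cob K i))" using zero by blast
  moreover have "zero_arrow D (cmp D (far F (cdiff K (i + 1))) (far F (cdiff K i)))" for i
    using functor_zero_arrow[OF F zero D KD(3) cmp_hom[OF KD(2) KD(2)]] is_functor_cmp[OF F KD(2) KD(2)] by simp
  ultimately show ?thesis
    using is_functor_obj[OF F KD(1)] is_functor_hom[OF F KD(2)]
    by (simp add: bounded_complex_def map_cochain_def)
qed

lemma cohomology_preserved:
  assumes F: "is_functor C D F" "preserves_kernels C D F" "preserves_cokernels C D F" and D: "cat D"
    and K: "bounded_complex C K" and H: "is_cohomology C K i H"
  shows "is_cohomology D (map_cochain F K) i (fob F H)"
proof -
  obtain k q where kq: "cohomology_data C K i k q" "tgt C q = H" using H by (auto simp: is_cohomology_def)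
  then have "q \<in> arrs C" by (auto simp: cohomology_data_def is_cokernel_def)
  from is_functor_hom[OF F(1) arr_hom_set[OF this]] have "tgt D (far F q) = fob F H"
    using kq(2) by (simp add: hom_set_def)
  then show ?thesis
    using cohomology_data_preserved[OF F cat_axioms K kq(1)] unfolding is_cohomology_def by blast
qed

end

lemma objs_derived_category [simp]: "objs (derived_category C) = {K. bounded_complex C K}"
  by (simp add: derived_category_def complex_category_def)

context homogeneous_G_algebra
begin

text \<open>
  The functor \<open>Q\<close> inverts the arrows that are bijective in large degrees.  By the universal property of
  the localization it factors through \<open>\<pi>\<close>, so the choice in the definition of \<open>\<psi>\<close> is a choice of
  such a factorization.
\<close>

lemma psi_functor:
  fixes \<psi> :: "((('n, 'k) homog_elt, 'm) graded_module, _, _, _) func"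
  assumes "\<psi> = psi_functor b c d"
  shows "is_functor (Qgr b c d) (gr (homog_localized b c d)) \<psi>"
    "M \<in> objs (gr A) \<Longrightarrow> fob \<psi> M = fob (Q_functor b c d) M"
    "f \<in> arrs (gr A) \<Longrightarrow> far \<psi> (far (pi_functor b c d) f) = far (Q_functor b c d) f"
proof -
  interpret Z: central_element A Z by (rule central_element_Z)
  interpret truncated_category "gr A :: ((('n, 'k) homog_elt, 'm) graded_module, _) category"
    "Qgr_arrows b c d" truncation_functor tail_inclusion
    by (rule truncated_category_gr)
  have Q: "Q_functor b c d = Z.Q" by (simp add: Q_functor_def homog_localized_def)
  have "is_iso (gr Z.S) (far Z.Q s)" if s: "s \<in> Qgr_arrows b c d" for s
  proof -
    obtain M N f where "s = (M, N, f)" by (metis prod_cases3)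
    then show ?thesis using Z.eventually_bij_Q[OF W_eventually_bij(2,1)] s by blast
  qed
  from localization_universal[OF cat_gr Z.is_functor_Q this]
  have "\<exists>F :: ((('n, 'k) homog_elt, 'm) graded_module, _, _, _) func.
     is_functor (Qgr b c d) (gr (homog_localized b c d)) F \<and>
     (\<forall>M \<in> objs (gr A). fob F (fob (pi_functor b c d) M) = fob (Q_functor b c d) M) \<and>
     (\<forall>f \<in> arrs (gr A). far F (far (pi_functor b c d) f) = far (Q_functor b c d) f)"
    unfolding Q Qgr_def pi_functor_def homog_localized_def by auto
  from someI_ex[OF this, folded psi_functor_def]
  show "is_functor (Qgr b c d) (gr (homog_localized b c d)) \<psi>"
    "M \<in> objs (gr A) \<Longrightarrow> fob \<psi> M = fob (Q_functor b c d) M"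
    "f \<in> arrs (gr A) \<Longrightarrow> far \<psi> (far (pi_functor b c d) f) = far (Q_functor b c d) f"
    unfolding assms by (auto simp: pi_functor_def)
qed

lemma gr_kernel_exists:
  assumes "F \<in> arrs (gr A)"
  shows "\<exists>k. is_kernel (gr A) F k" "\<exists>q. is_cokernel (gr A) F q"
proof -
  obtain M N f where F: "F = (M, N, f)" "(M, N, f) \<in> hom_set (gr A) M N"
    using arr_hom_set[OF assms] hom_grE by metis
  show "\<exists>k. is_kernel (gr A) F k" unfolding F(1) by (rule exI) (rule gr_noetherian.kernel_gr_exists(1)[OF gr_noetherian_A F(2)])
  show "\<exists>q. is_cokernel (gr A) F q" unfolding F(1) by (rule exI) (rule gr_noetherian.cokernel_gr_exists(1)[OF gr_noetherian_A F(2)])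
qed

text \<open>
  Exactness of \<open>\<psi>\<close> follows from that of \<open>Q = \<psi>\<pi>\<close>, since every arrow of the quotient category is
  isomorphic to the image of an arrow of graded modules and \<open>\<pi>\<close> is exact.
\<close>

lemma psi_exact:
  fixes \<psi> :: "((('n, 'k) homog_elt, 'm) graded_module, _, _, _) func"
  assumes \<psi>: "\<psi> = psi_functor b c d"
  shows "preserves_kernels (Qgr b c d) (gr (homog_localized b c d)) \<psi>"
    "preserves_cokernels (Qgr b c d) (gr (homog_localized b c d)) \<psi>"
proof -
  interpret Z: central_element A Z by (rule central_element_Z)
  interpret truncated_category "gr A :: ((('n, 'k) homog_elt, 'm) graded_module, _) category"
    "Qgr_arrows b c d" truncation_functor tail_inclusion
    by (rule truncated_category_gr)
  note psi = psi_functor[OF \<psi>]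
  have Q: "Q_functor b c d = Z.Q" by (simp add: Q_functor_def homog_localized_def)
  have far: "far \<psi> (far L f) = far Z.Q f" if "f \<in> arrs (gr A)" for f
    using psi(3)[OF that] by (simp add: Q pi_functor_def)
  have ker: "is_kernel (gr Z.S) (far \<psi> (far L F)) (far \<psi> (far L G))" if k: "is_kernel (gr A) F G" for F G
  proof -
    obtain M N f where f: "F = (M, N, f)" "(M, N, f) \<in> hom_set (gr A) M N"
      using is_kernelD(1)[OF k] hom_grE by metis
    have s: "src (gr A) F = M" by (simp add: f(1) gr_def)
    obtain K k' where k': "G = (K, M, k')" "(K, M, k') \<in> hom_set (gr A) K M"
      using is_kernelD(2)[OF k, unfolded s] hom_grE by metis
    note kD = gr_noetherian.kernel_grD[OF gr_noetherian_A k[unfolded f(1) k'(1)]]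
    show ?thesis
      using Z.is_kernel_Q[OF f(2) k'(2) kD] far[OF hom_setD(1)[OF f(2)]] far[OF hom_setD(1)[OF k'(2)]]
      by (simp add: f(1) k'(1))
  qed
  have coker: "is_cokernel (gr Z.S) (far \<psi> (far L F)) (far \<psi> (far L G))" if q: "is_cokernel (gr A) F G" for F G
  proof -
    obtain M N f where f: "F = (M, N, f)" "(M, N, f) \<in> hom_set (gr A) M N"
      using is_cokernelD(1)[OF q] hom_grE by metis
    have s: "tgt (gr A) F = N" by (simp add: f(1) gr_def)
    obtain C q' where q': "G = (N, C, q')" "(N, C, q') \<in> hom_set (gr A) N C"
      using is_cokernelD(2)[OF q, unfolded s] hom_grE by metis
    note qD = gr_noetherian.cokernel_grD[OF gr_noetherian_A q[unfolded f(1) q'(1)]]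
    show ?thesis
      using Z.is_cokernel_Q[OF f(2) q'(2) qD] far[OF hom_setD(1)[OF f(2)]] far[OF hom_setD(1)[OF q'(2)]]
      by (simp add: f(1) q'(1))
  qed
  note \<psi>F = psi(1)[unfolded Qgr_def homog_localized_def]
  show "preserves_kernels (Qgr b c d) (gr (homog_localized b c d)) \<psi>"
    unfolding Qgr_def homog_localized_def
    by (rule kernel_preservation_descends[OF cat_axioms cat_localization cat_gr is_functor_L kernels_L \<psi>F ker
          gr_kernel_exists(1) dense])
  show "preserves_cokernels (Qgr b c d) (gr (homog_localized b c d)) \<psi>"
    unfolding Qgr_def homog_localized_def
    by (rule cokernel_preservation_descends[OF cat_axioms cat_localization cat_gr is_functor_L cokernels_L \<psi>F coker
          gr_kernel_exists(2) dense])
qed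

lemma zero_Q_iff:
  assumes M: "M \<in> fg_graded_modules A"
  shows "zero_object (gr (homog_localized b c d)) (fob (Q_functor b c d) M) \<longleftrightarrow> torsion_module A Z M"
proof -
  interpret Z: central_element A Z by (rule central_element_Z)
  have Q: "Q_functor b c d = Z.Q" by (simp add: Q_functor_def homog_localized_def)
  interpret M: central_module A Z M by (rule Z.central_moduleI[OF fg_graded_modulesD(1)[OF M]])
  show ?thesis
    using zero_object_gr[OF Z.ring_S Z.fob_Q_fg[OF M]] M.zero_TM_iff by (simp add: Q homog_localized_def Z.fob_Q)
qed

text \<open>
  As \<open>\<pi>\<close> and \<open>\<psi>\<close> are exact, the cohomology of \<open>\<psi> K\<close> is \<open>Q\<close> of the cohomology of \<open>M\<close>; and \<open>Q\<close>
  kills precisely the torsion modules.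
\<close>

lemma acyclic_iff_torsion:
  fixes \<psi> :: "((('n, 'k) homog_elt, 'm) graded_module, _, _, _) func"
  assumes \<psi>: "\<psi> = psi_functor b c d" and K: "bounded_complex (Qgr b c d) K" and M: "bounded_complex (gr A) M"
    and iso: "isomorphic (derived_category (Qgr b c d)) K (map_cochain (pi_functor b c d) M)"
  shows "acyclic_complex (gr (homog_localized b c d)) (map_cochain \<psi> K) \<longleftrightarrow>
    (\<forall>i. \<exists>H. is_cohomology (gr A) M i H \<and> torsion_module A Z H)"
proof -
  interpret truncated_category "gr A :: ((('n, 'k) homog_elt, 'm) graded_module, _) category"
    "Qgr_arrows b c d" truncation_functor tail_inclusion
    by (rule truncated_category_gr)
  let ?S = "gr (homog_localized b c d)"
  interpret S: cat ?S by (rule cat_gr)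
  note psi = psi_functor[OF \<psi>, unfolded Qgr_def] and exact = psi_exact[OF \<psi>, unfolded Qgr_def]
  note K = K[unfolded Qgr_def] and iso = iso[unfolded Qgr_def pi_functor_def]
  have zero: "zero_object ?S (fob \<psi> z)" if z: "zero_object CW z" for z
  proof -
    obtain w :: "(('n, 'k) homog_elt, 'm) graded_module" where w: "zero_object (gr A) w" using has_zero by blast
    then have wf: "w \<in> fg_graded_modules A" by (simp add: zero_object_def)
    have c: "carrier w = {\<zero>\<^bsub>w\<^esub>}" using w zero_object_gr[OF ring_A wf] by simp
    have "(Z [^]\<^bsub>A\<^esub> (0::nat)) \<odot>\<^bsub>w\<^esub> \<zero>\<^bsub>w\<^esub> = \<zero>\<^bsub>w\<^esub>"
    proof -
      interpret w: graded_left_module A w by (rule fg_graded_modulesD(1)[OF wf])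
      show ?thesis
        unfolding w.R.nat_pow_0 by (rule w.smult_one[OF w.mcomp_carrier[OF w.mcomp_zero]])
    qed
    then have "torsion_module A Z w" unfolding torsion_module_def c by (intro ballI exI[of _ 0]) (simp only: singleton_iff)
    then have "zero_object ?S (fob \<psi> w)" unfolding psi(2)[of w, unfolded objs_gr, OF wf] by (rule iffD2[OF zero_Q_iff[OF wf]])
    moreover have "isomorphic ?S (fob \<psi> w) (fob \<psi> z)"
      by (rule functor_isomorphic[OF cat_localization psi(1) CW.zero_object_unique[OF zero_object_L[OF w] z]])
    ultimately show ?thesis by (rule S.zero_object_isomorphic)
  qed
  have \<psi>K: "bounded_complex ?S (map_cochain \<psi> K)" by (rule CW.bounded_complex_map[OF psi(1) zero S.cat_axioms K])
  have kerL: "\<exists>k. is_kernel CW f k" if "f \<in> arrs CW" for f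
    by (rule kernel_exists_descends[OF cat_axioms cat_localization is_functor_L kernels_L gr_kernel_exists(1) dense that])
  have cokerL: "\<exists>k. is_cokernel CW f k" if "f \<in> arrs CW" for f
    by (rule cokernel_exists_descends[OF cat_axioms cat_localization is_functor_L cokernels_L gr_kernel_exists(2) dense that])
  have H: "zero_object ?S H' \<longleftrightarrow> torsion_module A Z H"
    if H: "is_cohomology (gr A) M i H" and H': "is_cohomology ?S (map_cochain \<psi> K) i H'" for i H H'
  proof -
    have Hf: "H \<in> fg_graded_modules A"
      using H tgt_objs by (auto simp: is_cohomology_def cohomology_data_def is_cokernel_def)
    have LM: "is_cohomology CW (map_cochain L M) i H"
      using cohomology_preserved[OF is_functor_L kernels_L cokernels_L cat_localization M H] by simp
    obtain k q where "cohomology_data CW K i k q" using CW.cohomology_data_exists[OF kerL cokerL K] by blast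
    then have HK: "is_cohomology CW K i (tgt CW q)" unfolding is_cohomology_def by blast
    have "isomorphic CW (tgt CW q) H" by (rule CW.derived_isomorphic_cohomology[OF kerL cokerL iso HK LM])
    from functor_isomorphic[OF cat_localization psi(1) this]
    have "isomorphic ?S (fob \<psi> (tgt CW q)) (fob \<psi> H)" .
    moreover have "isomorphic ?S H' (fob \<psi> (tgt CW q))"
      by (rule S.is_cohomology_unique[OF \<psi>K H' CW.cohomology_preserved[OF psi(1) exact S.cat_axioms K HK]])
    ultimately have iso': "isomorphic ?S H' (fob \<psi> H)" by (rule S.isomorphic_trans[rotated])
    have "zero_object ?S H' \<longleftrightarrow> zero_object ?S (fob \<psi> H)"
      by (rule iffI) (erule S.zero_object_isomorphic, rule iso', erule S.zero_object_isomorphic, rule isomorphic_sym[OF iso'])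
    then show ?thesis unfolding psi(2)[of H, unfolded objs_gr, OF Hf] by (rule trans) (rule zero_Q_iff[OF Hf])
  qed
  have exM: "\<exists>H. is_cohomology (gr A) M i H" for i
    using cohomology_data_exists[OF gr_kernel_exists M, of i] by (auto simp: is_cohomology_def)
  have exK: "\<exists>H. is_cohomology ?S (map_cochain \<psi> K) i H" for i
  proof -
    obtain k q where "cohomology_data CW K i k q" using CW.cohomology_data_exists[OF kerL cokerL K] by blast
    then have "is_cohomology CW K i (tgt CW q)" unfolding is_cohomology_def by blast
    from CW.cohomology_preserved[OF psi(1) exact S.cat_axioms K this] show ?thesis by blast
  qed
  have "(\<exists>H. is_cohomology ?S (map_cochain \<psi> K) i H \<and> zero_object ?S H) \<longleftrightarrow>
      (\<exists>H. is_cohomology (gr A) M i H \<and> torsion_module A Z H)" for i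
    using H[of i] exM[of i] exK[of i] by blast
  then show ?thesis by (simp add: acyclic_complex_def)
qed

text \<open>
  A complex in the kernel is isomorphic to the image under \<open>\<pi>\<close> of a complex of graded modules, as every
  bounded complex in the quotient category is.
\<close>

lemma kernel_Db_psi_eq:
  "kernel_Db_psi b c d =
    {K \<in> objs (derived_category (Qgr b c d)).
       \<exists>M :: ((('n, 'k) homog_elt, 'm) graded_module, (('n, 'k) homog_elt, 'm) gr_arrow) cochain.
         M \<in> objs (derived_category (gr A)) \<and>
         (\<forall>i. \<exists>H. is_cohomology (gr A) M i H \<and> torsion_module A Z H) \<and>
         isomorphic (derived_category (Qgr b c d)) K (map_cochain (pi_functor b c d) M)}"
    (is "?L = ?R")
proof (intro Set.set_eqI iffI)
  interpret truncated_category "gr A :: ((('n, 'k) homog_elt, 'm) graded_module, _) category"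
    "Qgr_arrows b c d" truncation_functor tail_inclusion
    by (rule truncated_category_gr)
  fix K assume "K \<in> ?L"
  then have K: "bounded_complex (Qgr b c d) K"
    and ac: "acyclic_complex (gr (homog_localized b c d)) (map_cochain (psi_functor b c d) K)"
    by (simp_all add: kernel_Db_psi_def)
  obtain M a a' where M: "bounded_complex (gr A) M"
    and a: "\<And>i. inverse_arrows CW (cob M i) (cob K i) (a i) (a' i)"
    and chain: "\<And>i. cmp CW (a (i + 1)) (far L (cdiff M i)) = cmp CW (cdiff K i) (a i)"
    using bounded_complex_lifts[OF K[unfolded Qgr_def]] by metis
  have LM: "bounded_complex CW (map_cochain L M)"
    by (rule bounded_complex_map[OF is_functor_L _ cat_localization M]) (simp add: zero_object_L)
  have "isomorphic (derived_category CW) (map_cochain L M) K"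
    using CW.complex_isomorphic_derived[OF LM K[unfolded Qgr_def], of a a'] a chain by (simp add: map_cochain_def)
  then have iso: "isomorphic (derived_category (Qgr b c d)) K (map_cochain (pi_functor b c d) M)"
    unfolding Qgr_def pi_functor_def by (rule isomorphic_sym)
  show "K \<in> ?R"
    using acyclic_iff_torsion[OF refl K M iso] ac K M iso by auto
next
  fix K assume "K \<in> ?R"
  then obtain M :: "((('n, 'k) homog_elt, 'm) graded_module, (('n, 'k) homog_elt, 'm) gr_arrow) cochain"
    where K: "bounded_complex (Qgr b c d) K" and M: "bounded_complex (gr A) M"
    and t: "\<forall>i. \<exists>H. is_cohomology (gr A) M i H \<and> torsion_module A Z H"
    and iso: "isomorphic (derived_category (Qgr b c d)) K (map_cochain (pi_functor b c d) M)"
    by auto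
  show "K \<in> kernel_Db_psi b c d"
    using acyclic_iff_torsion[OF refl K M iso] t K by (simp add: kernel_Db_psi_def)
qed

end

theorem proposition3:
  fixes b :: "'n::{finite, linorder} \<Rightarrow> 'n \<Rightarrow> 'k::field_char_0"
    and c :: "'n \<Rightarrow> 'n \<Rightarrow> 'n \<Rightarrow> 'k"
    and d :: "'n \<Rightarrow> 'n \<Rightarrow> 'k"
    and \<iota> :: "'k \<Rightarrow> 'm"
  assumes "G_algebra b c d"
    and universe: "inj \<iota>"
  shows "kernel_Db_psi b c d =
    {K \<in> objs (derived_category (Qgr b c d)).
       \<exists>M :: ((('n, 'k) homog_elt, 'm) graded_module, (('n, 'k) homog_elt, 'm) gr_arrow) cochain.
         M \<in> objs (derived_category (gr (homog_G_algebra b c d))) \<and>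
         (\<forall>i. \<exists>H. is_cohomology (gr (homog_G_algebra b c d)) M i H \<and>
                  torsion_module (homog_G_algebra b c d) (Zel b c d) H) \<and>
         isomorphic (derived_category (Qgr b c d)) K (map_cochain (pi_functor b c d) M)}"
proof -
  interpret homogeneous_G_algebra b c d
    using assms(1) by unfold_locales (simp add: G_algebra_def)
  show ?thesis by (rule kernel_Db_psi_eq)
qed

end
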